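(* The following are equivalent over $\mathsf{RCA}_0$: (a) $\mathsf{WKL}_0$; (b) the $\mathrm{CFP}$ for continuous $V$ and compact $\mathcal X$ (that is: every Caristi system $(\mathcal X,f,V)$ with $\mathcal X$ compact and $V$ continuous has a fixed point); (c) the $\mathrm{CFP}$ for continuous $f,V$ on the Cantor space (that is: every Caristi system $(2^{\mathbb N},f,V)$ with $f$ and $V$ both continuous has a fixed point).
   Context: $\mathsf{RCA}_0$ and $\mathsf{WKL}_0$ are the usual subsystems of second-order arithmetic. Metric spaces. A (code for a) complete separable metric space $\mathcal X=\widehat X$ is a nonempty set $X\subseteq\mathbb N$ with a sequence of reals $d\colon X\times X\to\mathbb R$ such that $d(a,a)=0$, $d(a,b)=d(b,a)\ge 0$ and $d(a,b)+d(b,c)\ge d(a,c)$. A point of $\mathcal X$ is a sequence $x=\langle x_i\rangle_{i\in\mathbb N}$ in $X$ with $d(x_i,x_j)\le 2^{-i}$ for $i\le j$; $d(x,y)=\lim_n d(x_n,y_n)$, and $x=y$ means $d(x,y)=0$. For $a\in X$, $r\in\mathbb Q^{>0}$, $B_r(a)$ is the rational open ball coded by $\langle a,r\rangle$. $\mathcal X$ is compact if there is a sequence of (finite sequences of) points witnessing total boundedness (Simpson, Definition III.2.3). The Cantor space is $2^{\mathbb N}=\{0,1\}^{\mathbb N}$ with $d(\Lambda,\Lambda')=2^{-n}$ for the least $n$ with $\Lambda(n)\ne\Lambda'(n)$ (and $0$ if there is no such $n$). Borel functions. A Borel code for a subset of $\mathcal X$ is a tree $S\subseteq\mathbb N^{<\mathbb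 N}$ with no infinite path, with exactly one $n$ such that $\langle n\rangle\in S$, and all of whose leaves have the form $\tau^\frown\langle B_r(a)\rangle$ with $a\in X$, $r\in\mathbb Q^{>0}$. Put $U_S(\sigma)=B_r(a)$ if $\sigma=\upsilon^\frown\langle B_r(a)\rangle$ is a leaf; for non-leaves $\sigma=\upsilon^\frown\langle n\rangle$, $U_S(\sigma)$ is $\bigcup\{U_S(\sigma^\frown\langle k\rangle):\sigma^\frown\langle k\rangle\in S\}$ if $n$ is odd and $\bigcap\{U_S(\sigma^\frown\langle k\rangle):\sigma^\frown\langle k\rangle\in S\}$ if $n$ is even; $U_S(\langle\rangle)=U_S(\langle n\rangle)$ for the unique $\langle n\rangle\in S$. $S$ codes the set $U_S(\langle\rangle)$; membership is formalized through evaluation maps satisfying these clauses (Simpson, Section V.3), and open sets are represented as unions of open balls. A code for a Borel function $\mathcal X\to\mathcal Y=\widehat Y$ is a sequence $\Upsilon$ of Borel codes $\Upsilon_{\langle a,r\rangle}$, $\langle a,r\rangle\in Y\times\mathbb Q^{>0}$, such that, writing $\Upsilon(B_r(a))=U_{\Upsilon_{\langle a,r\rangle}}(\langle\rangle)$, for all rational open balls $B,B'$ of $\mathcal Y$: (i) $B\subseteq B'$ implies $\Upsilon(B)\subseteq\Upsilon(B')$; (ii) $B\cap B'=\varnothing$ implies $\Upsilon(B)\cap\Upsilon(B')=\varnothing$. It codes the (partial) function $f$ with $f(x)=y$ iff $y$ is the unique point such that $x\in\Upsilon(B)$ for every rational ball $B\ni y$. Continuous functions are those coded as Borel functions in which the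 preimage of every open ball is open (equivalently over $\mathsf{RCA}_0$, by the standard codes of Simpson, Definition II.6.1). Baire functions. A code for a partial Baire function is a well-founded tree $\Xi$ in which each leaf is labelled by a code for a partial continuous function and each non-leaf $\sigma$ has $\sigma^\frown\langle i\rangle\in\Xi$ for all $i\in\mathbb N$. Define $f_{\Xi,\sigma}(x)=f(x)$ if $\sigma$ is a leaf labelled by $f$; otherwise $f_{\Xi,\sigma}(x)=\lim_{n}f_{\Xi,\sigma^\frown\langle n\rangle}(x)$ if all $f_{\Xi,\sigma^\frown\langle n\rangle}(x)$ and the limit exist, and undefined otherwise. The coded function is $f_\Xi=f_{\Xi,\langle\rangle}$; it is a Baire function if $f_\Xi(x)$ exists for all $x$. Potentials. A potential on $\mathcal X$ is a (coded) function $V\colon\mathcal X\to[0,\infty)$ that is the pointwise limit of a sequence of continuous functions $V_n$ with $V_n(x)\le V_m(x)$ for all $x$ and $n\le m$. Caristi. A Caristi system is $(\mathcal X,f,V)$ with $\mathcal X$ a coded complete separable metric space, $f\colon\mathcal X\to\mathcal X$ a coded (total) Baire or Borel function, $V\colon\mathcal X\to[0,\infty)$ a coded potential, and $d(x,f(x))\le V(x)-V(f(x))$ for all $x\in\mathcal X$. The $\mathrm{CFP}$ (Caristi fixed point theorem) for given classes of $\mathcal X,f,V$ states: every Caristi system with components in these classes has a fixed point $x_*=f(x_* )$. Classes not mentioned are unrestricted (all coded complete separable metric spaces, all Baire or Borel $f$, all coded potentials). *)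

theory Defs
  imports Main
begin

text \<open>
  Second-order arithmetic is interpreted in arbitrary Henkin structures for its two-sorted
  language: a type \<^typ>\<open>'m\<close> of (possibly nonstandard) numbers with the arithmetical operations,
  and a collection of subsets of it over which the set quantifiers range. A sentence is provable
  in a theory iff it holds in all models of the theory (completeness theorem), so ``over \<open>RCA\<^sub>0\<close>'' is read as
  ``in every model of \<open>RCA\<^sub>0\<close>''. Only the schemes of \<open>RCA\<^sub>0\<close> mention formulas, and these
  are represented syntactically; every other notion is an interpreted formula of
  second-order arithmetic, whose quantifiers range over numbers of the structure, over members
  of its set part, and over objects (functions, reals, points, ...) coded by such members.
\<close>

record 'm l2_structure =
  num_zero :: 'm
  num_one :: 'm
  num_add :: "'m \<Rightarrow> 'm \<Rightarrow> 'm"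
  num_mult :: "'m \<Rightarrow> 'm \<Rightarrow> 'm"
  num_less :: "'m \<Rightarrow> 'm \<Rightarrow> bool"
  set_part :: "'m set set"

datatype l2_term = TVar nat | TZero | TOne | TAdd l2_term l2_term | TMult l2_term l2_term

text \<open>Formulas all of whose quantifiers are bounded number quantifiers. The second argument of
  \<open>FMem\<close> is a set variable; \<open>FEx v t \<phi>\<close> is \<open>\<exists>v < t. \<phi>\<close>.\<close>

datatype bounded_formula =
    FEq l2_term l2_term
  | FLess l2_term l2_term
  | FMem l2_term nat
  | FNot bounded_formula
  | FAnd bounded_formula bounded_formula
  | FEx nat l2_term bounded_formula

text \<open>A coded space is a pair of the set of codes \<open>A\<close> and the function that maps \<open>a, b \<in> A\<close> to
  the real number \<open>d(a, b)\<close>; the values of the latter outside \<open>A\<close> are irrelevant.\<close>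

type_synonym 'a space = "'a set \<times> ('a \<Rightarrow> 'a \<Rightarrow> 'a \<Rightarrow> 'a)"

locale l2 =
  fixes M :: "'m l2_structure"
begin

abbreviation Zero ("\<zero>") where "\<zero> \<equiv> num_zero M"
abbreviation One ("\<one>") where "\<one> \<equiv> num_one M"
abbreviation Add (infixl "\<oplus>" 65) where "x \<oplus> y \<equiv> num_add M x y"
abbreviation Mult (infixl "\<otimes>" 70) where "x \<otimes> y \<equiv> num_mult M x y"
abbreviation Less (infix "\<prec>" 50) where "x \<prec> y \<equiv> num_less M x y"
abbreviation Leq (infix "\<preceq>" 50) where "x \<preceq> y \<equiv> x \<prec> y \<or> x = y"
abbreviation Sets where "Sets \<equiv> set_part M"


subsection \<open>\<open>RCA\<^sub>0\<close>\<close>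

primrec eval :: "l2_term \<Rightarrow> (nat \<Rightarrow> 'm) \<Rightarrow> 'm" where
  "eval (TVar v) e = e v"
| "eval TZero e = \<zero>"
| "eval TOne e = \<one>"
| "eval (TAdd s t) e = eval s e \<oplus> eval t e"
| "eval (TMult s t) e = eval s e \<otimes> eval t e"

primrec sat :: "bounded_formula \<Rightarrow> (nat \<Rightarrow> 'm) \<Rightarrow> (nat \<Rightarrow> 'm set) \<Rightarrow> bool" where
  "sat (FEq s t) e E \<longleftrightarrow> eval s e = eval t e"
| "sat (FLess s t) e E \<longleftrightarrow> eval s e \<prec> eval t e"
| "sat (FMem t V) e E \<longleftrightarrow> eval t e \<in> E V"
| "sat (FNot \<phi>) e E \<longleftrightarrow> \<not> sat \<phi> e E"
| "sat (FAnd \<phi> \<psi>) e E \<longleftrightarrow> sat \<phi> e E \<and> sat \<psi> e E"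
| "sat (FEx v t \<phi>) e E \<longleftrightarrow> (\<exists>x. x \<prec> eval t e \<and> sat \<phi> (e(v := x)) E)"

definition basic_axioms :: bool where
  "basic_axioms \<longleftrightarrow>
     (\<forall>n. n \<oplus> \<one> \<noteq> \<zero>) \<and>
     (\<forall>m n. m \<oplus> \<one> = n \<oplus> \<one> \<longrightarrow> m = n) \<and>
     (\<forall>m. m \<oplus> \<zero> = m) \<and>
     (\<forall>m n. m \<oplus> (n \<oplus> \<one>) = (m \<oplus> n) \<oplus> \<one>) \<and>
     (\<forall>m. m \<otimes> \<zero> = \<zero>) \<and>
     (\<forall>m n. m \<otimes> (n \<oplus> \<one>) = (m \<otimes> n) \<oplus> m) \<and>
     (\<forall>m. \<not> m \<prec> \<zero>) \<and>
     (\<forall>m n. m \<prec> n \<oplus> \<one> \<longleftrightarrow> m \<prec> n \<or> m = n)"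

text \<open>In both schemes number variable 0 is the main variable and number variable 1 the unbounded
  quantified one; the other variables are parameters, given by \<open>e\<close> and \<open>E\<close>.\<close>

definition Sigma01_induction :: bool where
  "Sigma01_induction \<longleftrightarrow>
     (\<forall>\<theta> e E. (\<forall>V. E V \<in> Sets) \<longrightarrow>
        (let \<phi> = (\<lambda>n. \<exists>m. sat \<theta> (e(0 := n, 1 := m)) E)
         in \<phi> \<zero> \<and> (\<forall>n. \<phi> n \<longrightarrow> \<phi> (n \<oplus> \<one>)) \<longrightarrow> (\<forall>n. \<phi> n)))"

definition Delta01_comprehension :: bool where
  "Delta01_comprehension \<longleftrightarrow>
     (\<forall>\<theta> \<psi> e E. (\<forall>V. E V \<in> Sets) \<longrightarrow>
        (\<forall>n. (\<exists>m. sat \<theta> (e(0 := n, 1 := m)) E) \<longleftrightarrow> (\<forall>m. sat \<psi> (e(0 := n, 1 := m)) E)) \<longrightarrow>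
        {n. \<exists>m. sat \<theta> (e(0 := n, 1 := m)) E} \<in> Sets)"

text \<open>Nonemptiness of the set sort is part of the semantics of two-sorted logic; without it the
  two schemes would be vacuous in structures without sets.\<close>

definition RCA0 :: bool where
  "RCA0 \<longleftrightarrow> Sets \<noteq> {} \<and> basic_axioms \<and> Sigma01_induction \<and> Delta01_comprehension"


subsection \<open>Pairs, functions, finite sequences, trees\<close>

definition pair :: "'m \<Rightarrow> 'm \<Rightarrow> 'm" ("\<langle>_,/ _\<rangle>") where
  "\<langle>i, j\<rangle> = (i \<oplus> j) \<otimes> (i \<oplus> j) \<oplus> i"

definition p1 :: "'m \<Rightarrow> 'm" where "p1 z = (THE i. \<exists>j. z = \<langle>i, j\<rangle>)"
definition p2 :: "'m \<Rightarrow> 'm" where "p2 z = (THE j. \<exists>i. z = \<langle>i, j\<rangle>)"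

text \<open>\<open>f\<close> restricted to \<open>A\<close> is a function of the structure.\<close>

definition fn_on :: "'m set \<Rightarrow> ('m \<Rightarrow> 'm) \<Rightarrow> bool" where
  "fn_on A f \<longleftrightarrow> {\<langle>n, f n\<rangle> | n. n \<in> A} \<in> Sets"

text \<open>The \<open>i\<close>-th member of the sequence of sets coded by \<open>Z\<close>.\<close>

definition sect :: "'m set \<Rightarrow> 'm \<Rightarrow> 'm set" where
  "sect Z i = {z. \<langle>i, z\<rangle> \<in> Z}"

text \<open>Finite sets and sequences are coded by numbers as in Simpson, Section II.2: for
  \<open>c = \<langle>k, \<langle>m, n\<rangle>\<rangle>\<close>, the elements of \<open>c\<close> are the \<open>i < k\<close> such that \<open>m(i+1)+1\<close> divides \<open>n\<close>,
  and the code of a finite set is the least number with the given elements. A finite sequence is a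
  finite set of pairs that is a function on an initial segment \<open>{i. i < l}\<close>.\<close>

definition elt :: "'m \<Rightarrow> 'm \<Rightarrow> bool" where
  "elt i c \<longleftrightarrow>
     (\<exists>k m n. c = \<langle>k, \<langle>m, n\<rangle>\<rangle> \<and> i \<prec> k \<and> (\<exists>q. n = q \<otimes> (m \<otimes> (i \<oplus> \<one>) \<oplus> \<one>)))"

definition fin_code :: "'m \<Rightarrow> bool" where
  "fin_code c \<longleftrightarrow> (\<forall>c'. c' \<prec> c \<longrightarrow> \<not> (\<forall>i. elt i c' \<longleftrightarrow> elt i c))"

definition has_length :: "'m \<Rightarrow> 'm \<Rightarrow> bool" where
  "has_length s l \<longleftrightarrow> (\<forall>i. i \<prec> l \<longleftrightarrow> (\<exists>j. elt \<langle>i, j\<rangle> s))"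

definition fin_seq :: "'m \<Rightarrow> bool" where
  "fin_seq s \<longleftrightarrow>
     fin_code s \<and> (\<forall>z. elt z s \<longrightarrow> (\<exists>i j. z = \<langle>i, j\<rangle>)) \<and>
     (\<forall>i j k. elt \<langle>i, j\<rangle> s \<and> elt \<langle>i, k\<rangle> s \<longrightarrow> j = k) \<and> (\<exists>l. has_length s l)"

definition lh :: "'m \<Rightarrow> 'm" where "lh s = (THE l. has_length s l)"
definition entry :: "'m \<Rightarrow> 'm \<Rightarrow> 'm" where "entry s i = (THE j. elt \<langle>i, j\<rangle> s)"

definition nil :: 'm where "nil = (THE s. fin_seq s \<and> lh s = \<zero>)"

definition snoc :: "'m \<Rightarrow> 'm \<Rightarrow> 'm" where
  "snoc s n = (THE t. fin_seq t \<and> lh t = lh s \<oplus> \<one> \<and>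
                      (\<forall>i. i \<prec> lh s \<longrightarrow> entry t i = entry s i) \<and> entry t (lh s) = n)"

definition initial_segment :: "'m \<Rightarrow> 'm \<Rightarrow> bool" where
  "initial_segment t s \<longleftrightarrow> lh t \<preceq> lh s \<and> (\<forall>i. i \<prec> lh t \<longrightarrow> entry t i = entry s i)"

definition restr :: "('m \<Rightarrow> 'm) \<Rightarrow> 'm \<Rightarrow> 'm" where
  "restr g n = (THE s. fin_seq s \<and> lh s = n \<and> (\<forall>i. i \<prec> n \<longrightarrow> entry s i = g i))"

definition tree :: "'m set \<Rightarrow> bool" where
  "tree T \<longleftrightarrow> T \<in> Sets \<and> (\<forall>s\<in>T. fin_seq s) \<and>
     (\<forall>s t. s \<in> T \<and> fin_seq t \<and> initial_segment t s \<longrightarrow> t \<in> T)"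

definition has_path :: "'m set \<Rightarrow> bool" where
  "has_path T \<longleftrightarrow> (\<exists>g. fn_on UNIV g \<and> (\<forall>n. restr g n \<in> T))"

definition leaf :: "'m set \<Rightarrow> 'm \<Rightarrow> bool" where
  "leaf T s \<longleftrightarrow> s \<in> T \<and> (\<forall>k. snoc s k \<notin> T)"

definition binary_seq :: "'m \<Rightarrow> bool" where
  "binary_seq s \<longleftrightarrow> fin_seq s \<and> (\<forall>i. i \<prec> lh s \<longrightarrow> entry s i = \<zero> \<or> entry s i = \<one>)"

definition WKL :: bool where
  "WKL \<longleftrightarrow> (\<forall>T. tree T \<and> (\<forall>s\<in>T. binary_seq s) \<and> \<not> (\<exists>k. \<forall>s\<in>T. s \<prec> k) \<longrightarrow> has_path T)"

definition WKL0 :: bool where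
  "WKL0 \<longleftrightarrow> RCA0 \<and> WKL"


subsection \<open>Rational and real numbers\<close>

text \<open>\<open>\<langle>\<langle>a, b\<rangle>, c\<rangle>\<close> with \<open>c \<noteq> 0\<close> codes the rational number \<open>(a - b) / c\<close>. No least
  representatives are chosen, so equality of rational numbers is \<open>rat_le\<close> in both directions.\<close>

definition rat :: "'m \<Rightarrow> bool" where
  "rat q \<longleftrightarrow> (\<exists>a b c. c \<noteq> \<zero> \<and> q = \<langle>\<langle>a, b\<rangle>, c\<rangle>)"

abbreviation rat_pos where "rat_pos q \<equiv> p1 (p1 q)"
abbreviation rat_neg where "rat_neg q \<equiv> p2 (p1 q)"
abbreviation rat_den where "rat_den q \<equiv> p2 q"

definition rat_le :: "'m \<Rightarrow> 'm \<Rightarrow> bool" where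
  "rat_le p q \<longleftrightarrow>
     rat_pos p \<otimes> rat_den q \<oplus> rat_neg q \<otimes> rat_den p \<preceq> rat_pos q \<otimes> rat_den p \<oplus> rat_neg p \<otimes> rat_den q"

definition rat_add :: "'m \<Rightarrow> 'm \<Rightarrow> 'm" where
  "rat_add p q =
     \<langle>\<langle>rat_pos p \<otimes> rat_den q \<oplus> rat_pos q \<otimes> rat_den p,
       rat_neg p \<otimes> rat_den q \<oplus> rat_neg q \<otimes> rat_den p\<rangle>, rat_den p \<otimes> rat_den q\<rangle>"

definition rat_minus :: "'m \<Rightarrow> 'm" where
  "rat_minus q = \<langle>\<langle>rat_neg q, rat_pos q\<rangle>, rat_den q\<rangle>"

definition rat_zero :: 'm where
  "rat_zero = \<langle>\<langle>\<zero>, \<zero>\<rangle>, \<one>\<rangle>"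

definition rat_dist :: "'m \<Rightarrow> 'm \<Rightarrow> 'm" where
  "rat_dist p q = (if rat_le q p then rat_add p (rat_minus q) else rat_add q (rat_minus p))"

definition pos_rat :: "'m \<Rightarrow> bool" where
  "pos_rat r \<longleftrightarrow> rat r \<and> \<not> rat_le r rat_zero"

definition pow2 :: "'m \<Rightarrow> 'm" where
  "pow2 = (THE f. fn_on UNIV f \<and> f \<zero> = \<one> \<and> (\<forall>n. f (n \<oplus> \<one>) = f n \<oplus> f n))"

text \<open>The rational number \<open>2\<^sup>-\<^sup>n\<close>.\<close>

definition half_pow :: "'m \<Rightarrow> 'm" where
  "half_pow n = \<langle>\<langle>\<one>, \<zero>\<rangle>, pow2 n\<rangle>"

text \<open>Reals are sequences \<open>x\<close> of rationals with \<open>\<bar>x\<^sub>k - x\<^sub>k\<^sub>+\<^sub>i\<bar> \<le> 2\<^sup>-\<^sup>k\<close>, and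
  \<open>x \<le> y\<close> means \<open>x\<^sub>k \<le> y\<^sub>k + 2\<^sup>-\<^sup>k\<^sup>+\<^sup>1\<close> for all \<open>k\<close> (Simpson, Section II.4).\<close>

definition real_num :: "('m \<Rightarrow> 'm) \<Rightarrow> bool" where
  "real_num x \<longleftrightarrow> fn_on UNIV x \<and> (\<forall>k. rat (x k)) \<and>
     (\<forall>k i. rat_le (rat_dist (x k) (x (k \<oplus> i))) (half_pow k))"

definition real_le :: "('m \<Rightarrow> 'm) \<Rightarrow> ('m \<Rightarrow> 'm) \<Rightarrow> bool" where
  "real_le x y \<longleftrightarrow> (\<forall>k. rat_le (x k) (rat_add (y k) (rat_add (half_pow k) (half_pow k))))"

definition real_eq :: "('m \<Rightarrow> 'm) \<Rightarrow> ('m \<Rightarrow> 'm) \<Rightarrow> bool" where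
  "real_eq x y \<longleftrightarrow> real_le x y \<and> real_le y x"

definition real_less :: "('m \<Rightarrow> 'm) \<Rightarrow> ('m \<Rightarrow> 'm) \<Rightarrow> bool" where
  "real_less x y \<longleftrightarrow> \<not> real_le y x"

definition real_of :: "'m \<Rightarrow> 'm \<Rightarrow> 'm" where
  "real_of q = (\<lambda>k. q)"

definition real_add :: "('m \<Rightarrow> 'm) \<Rightarrow> ('m \<Rightarrow> 'm) \<Rightarrow> 'm \<Rightarrow> 'm" where
  "real_add x y = (\<lambda>k. rat_add (x (k \<oplus> \<one>)) (y (k \<oplus> \<one>)))"

definition real_minus :: "('m \<Rightarrow> 'm) \<Rightarrow> ('m \<Rightarrow> 'm) \<Rightarrow> 'm \<Rightarrow> 'm" where
  "real_minus x y = (\<lambda>k. rat_add (x (k \<oplus> \<one>)) (rat_minus (y (k \<oplus> \<one>))))"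


subsection \<open>Complete separable metric spaces\<close>

definition metric_code :: "'m space \<Rightarrow> bool" where
  "metric_code X \<longleftrightarrow> (case X of (A, d) \<Rightarrow>
     A \<in> Sets \<and> A \<noteq> {} \<and>
     {\<langle>\<langle>\<langle>a, b\<rangle>, k\<rangle>, d a b k\<rangle> | a b k. a \<in> A \<and> b \<in> A} \<in> Sets \<and>
     (\<forall>a\<in>A. \<forall>b\<in>A. real_num (d a b)) \<and>
     (\<forall>a\<in>A. real_eq (d a a) (real_of rat_zero)) \<and>
     (\<forall>a\<in>A. \<forall>b\<in>A. real_eq (d a b) (d b a) \<and> real_le (real_of rat_zero) (d a b)) \<and>
     (\<forall>a\<in>A. \<forall>b\<in>A. \<forall>c\<in>A. real_le (d a c) (real_add (d a b) (d b c))))"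

definition point :: "'m space \<Rightarrow> ('m \<Rightarrow> 'm) \<Rightarrow> bool" where
  "point X x \<longleftrightarrow> fn_on UNIV x \<and> (\<forall>i. x i \<in> fst X) \<and>
     (\<forall>i j. i \<preceq> j \<longrightarrow> real_le (snd X (x i) (x j)) (real_of (half_pow i)))"

text \<open>For points \<open>x\<close> and \<open>y\<close>, this is the real number \<open>lim\<^sub>n d(x\<^sub>n, y\<^sub>n)\<close>:
  \<open>d(x\<^sub>n, y\<^sub>n)\<close> changes by at most \<open>2 \<sqdot> 2\<^sup>-\<^sup>n\<close> from \<open>n\<close> on, and its \<open>n\<close>-th rational
  approximation has error at most \<open>2\<^sup>-\<^sup>n\<close>, so that with \<open>n = k + 2\<close> the
  \<open>2\<^sup>-\<^sup>k\<close> modulus required of a real is met.\<close>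

definition distance :: "'m space \<Rightarrow> ('m \<Rightarrow> 'm) \<Rightarrow> ('m \<Rightarrow> 'm) \<Rightarrow> 'm \<Rightarrow> 'm" where
  "distance X x y = (\<lambda>k. let n = k \<oplus> \<one> \<oplus> \<one> in snd X (x n) (y n) n)"

definition same_point :: "'m space \<Rightarrow> ('m \<Rightarrow> 'm) \<Rightarrow> ('m \<Rightarrow> 'm) \<Rightarrow> bool" where
  "same_point X x y \<longleftrightarrow> real_eq (distance X x y) (real_of rat_zero)"

definition ball :: "'m space \<Rightarrow> 'm \<Rightarrow> 'm \<Rightarrow> ('m \<Rightarrow> 'm) set" where
  "ball X a r = {x. point X x \<and> real_less (distance X x (\<lambda>_. a)) (real_of r)}"

definition converges :: "'m space \<Rightarrow> ('m \<Rightarrow> 'm \<Rightarrow> 'm) \<Rightarrow> ('m \<Rightarrow> 'm) \<Rightarrow> bool" where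
  "converges X s x \<longleftrightarrow>
     (\<forall>k. \<exists>N. \<forall>n. N \<preceq> n \<longrightarrow> real_less (distance X (s n) x) (real_of (half_pow k)))"

text \<open>Simpson, Definition III.2.3: points \<open>x\<^sub>i\<^sub>j\<close>, \<open>i \<le> n\<^sub>j\<close>, such that every point is at distance
  less than \<open>2\<^sup>-\<^sup>j\<close> from some \<open>x\<^sub>i\<^sub>j\<close>.\<close>

definition compact_space :: "'m space \<Rightarrow> bool" where
  "compact_space X \<longleftrightarrow> metric_code X \<and>
     (\<exists>n x. fn_on UNIV n \<and> {\<langle>\<langle>\<langle>i, j\<rangle>, k\<rangle>, x i j k\<rangle> | i j k. i \<preceq> n j} \<in> Sets \<and>
        (\<forall>i j. i \<preceq> n j \<longrightarrow> point X (x i j)) \<and>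
        (\<forall>z j. point X z \<longrightarrow>
           (\<exists>i. i \<preceq> n j \<and> real_less (distance X (x i j) z) (real_of (half_pow j)))))"

text \<open>The interval \<open>[0, \<infinity>)\<close>.\<close>

definition nonneg_reals :: "'m space" where
  "nonneg_reals = ({q. rat q \<and> rat_le rat_zero q}, \<lambda>p q. real_of (rat_dist p q))"

text \<open>The dense subset of \<open>2\<^sup>\<nat>\<close> consists of the eventually zero sequences; a finite binary
  sequence \<open>s\<close> stands for \<open>s\<^sup>\<frown>000\<dots>\<close>.\<close>

definition pad :: "'m \<Rightarrow> 'm \<Rightarrow> 'm" where
  "pad s i = (if i \<prec> lh s then entry s i else \<zero>)"

definition cantor_space :: "'m space" where
  "cantor_space = ({s. binary_seq s},
     \<lambda>s t. real_of (if \<forall>i. pad s i = pad t i then rat_zero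
             else half_pow (THE n. pad s n \<noteq> pad t n \<and> (\<forall>i. i \<prec> n \<longrightarrow> pad s i = pad t i))))"


subsection \<open>Coded functions\<close>

text \<open>Partial functions are given by their graphs on points. Codes of Borel and of continuous
  functions assign to each rational ball \<open>B\<^sub>r(a)\<close> of \<open>Y\<close> a code for a subset of \<open>X\<close>. Below,
  \<open>P a r\<close> is the set of points coded by it.\<close>

definition preimage_conditions :: "'m space \<Rightarrow> 'm space \<Rightarrow> ('m \<Rightarrow> 'm \<Rightarrow> ('m \<Rightarrow> 'm) set) \<Rightarrow> bool" where
  "preimage_conditions X Y P \<longleftrightarrow>
     (\<forall>a r b s. a \<in> fst Y \<and> pos_rat r \<and> b \<in> fst Y \<and> pos_rat s \<longrightarrow>
        (ball Y a r \<subseteq> ball Y b s \<longrightarrow> P a r \<subseteq> P b s) \<and>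
        (ball Y a r \<inter> ball Y b s = {} \<longrightarrow> P a r \<inter> P b s = {}))"

definition value_at ::
  "'m space \<Rightarrow> 'm space \<Rightarrow> ('m \<Rightarrow> 'm \<Rightarrow> ('m \<Rightarrow> 'm) set) \<Rightarrow> ('m \<Rightarrow> 'm) \<Rightarrow> ('m \<Rightarrow> 'm) \<Rightarrow> bool" where
  "value_at X Y P x y \<longleftrightarrow>
     (let V = (\<lambda>y. point Y y \<and> (\<forall>a r. a \<in> fst Y \<and> pos_rat r \<and> y \<in> ball Y a r \<longrightarrow> x \<in> P a r))
      in point X x \<and> V y \<and> (\<forall>z. V z \<longrightarrow> same_point Y y z))"

definition total :: "'m space \<Rightarrow> (('m \<Rightarrow> 'm) \<Rightarrow> ('m \<Rightarrow> 'm) \<Rightarrow> bool) \<Rightarrow> bool" where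
  "total X f \<longleftrightarrow> (\<forall>x. point X x \<longrightarrow> (\<exists>y. f x y))"

text \<open>Borel functions. The ball \<open>B\<^sub>r(a)\<close> is coded by the number \<open>\<langle>a, r\<rangle>\<close>.\<close>

definition borel_code :: "'m space \<Rightarrow> 'm set \<Rightarrow> bool" where
  "borel_code X S \<longleftrightarrow> tree S \<and> \<not> has_path S \<and> (\<exists>!n. snoc nil n \<in> S) \<and>
     (\<forall>s. leaf S s \<longrightarrow> (\<exists>t a r. fin_seq t \<and> s = snoc t \<langle>a, r\<rangle> \<and> a \<in> fst X \<and> pos_rat r))"

definition borel_evaluation :: "'m space \<Rightarrow> 'm set \<Rightarrow> ('m \<Rightarrow> 'm) \<Rightarrow> ('m \<Rightarrow> 'm) \<Rightarrow> bool" where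
  "borel_evaluation X S x E \<longleftrightarrow> fn_on S E \<and> (\<forall>s\<in>S. E s = \<zero> \<or> E s = \<one>) \<and>
     (\<forall>t a r. leaf S (snoc t \<langle>a, r\<rangle>) \<and> fin_seq t \<longrightarrow> (E (snoc t \<langle>a, r\<rangle>) = \<one> \<longleftrightarrow> x \<in> ball X a r)) \<and>
     (\<forall>t n. fin_seq t \<and> snoc t n \<in> S \<and> \<not> leaf S (snoc t n) \<longrightarrow>
        (E (snoc t n) = \<one> \<longleftrightarrow>
           (if \<exists>m. n = m \<oplus> m \<oplus> \<one>
            then \<exists>k. snoc (snoc t n) k \<in> S \<and> E (snoc (snoc t n) k) = \<one>
            else \<forall>k. snoc (snoc t n) k \<in> S \<longrightarrow> E (snoc (snoc t n) k) = \<one>))) \<and>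
     (\<forall>n. snoc nil n \<in> S \<longrightarrow> E nil = E (snoc nil n))"

definition borel_set :: "'m space \<Rightarrow> 'm set \<Rightarrow> ('m \<Rightarrow> 'm) set" where
  "borel_set X S = {x. point X x \<and> (\<exists>E. borel_evaluation X S x E \<and> E nil = \<one>)}"

definition borel_function_code :: "'m space \<Rightarrow> 'm space \<Rightarrow> 'm set \<Rightarrow> bool" where
  "borel_function_code X Y \<Upsilon> \<longleftrightarrow> \<Upsilon> \<in> Sets \<and>
     (\<forall>a r. a \<in> fst Y \<and> pos_rat r \<longrightarrow> borel_code X (sect \<Upsilon> \<langle>a, r\<rangle>)) \<and>
     preimage_conditions X Y (\<lambda>a r. borel_set X (sect \<Upsilon> \<langle>a, r\<rangle>))"

definition borel_function :: "'m space \<Rightarrow> 'm space \<Rightarrow> (('m \<Rightarrow> 'm) \<Rightarrow> ('m \<Rightarrow> 'm) \<Rightarrow> bool) \<Rightarrow> bool" where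
  "borel_function X Y f \<longleftrightarrow> total X f \<and>
     (\<exists>\<Upsilon>. borel_function_code X Y \<Upsilon> \<and> f = value_at X Y (\<lambda>a r. borel_set X (sect \<Upsilon> \<langle>a, r\<rangle>)))"

text \<open>Continuous functions: each preimage is given by an open code, i.e. a set \<open>U\<close> of
  triples \<open>\<langle>n, \<langle>b, s\<rangle>\<rangle>\<close>, which codes the union of the balls \<open>B\<^sub>s(b)\<close>. As usual, the
  component \<open>n\<close> makes it possible to code any enumerable set of balls, and \<open>U\<close> may be empty.\<close>

definition open_code :: "'m space \<Rightarrow> 'm set \<Rightarrow> bool" where
  "open_code X U \<longleftrightarrow> (\<forall>z\<in>U. \<exists>n b s. z = \<langle>n, \<langle>b, s\<rangle>\<rangle> \<and> b \<in> fst X \<and> pos_rat s)"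

definition open_set :: "'m space \<Rightarrow> 'm set \<Rightarrow> ('m \<Rightarrow> 'm) set" where
  "open_set X U = {x. \<exists>n b s. \<langle>n, \<langle>b, s\<rangle>\<rangle> \<in> U \<and> x \<in> ball X b s}"

definition continuous_code :: "'m space \<Rightarrow> 'm space \<Rightarrow> 'm set \<Rightarrow> bool" where
  "continuous_code X Y \<Phi> \<longleftrightarrow> \<Phi> \<in> Sets \<and>
     (\<forall>a r. a \<in> fst Y \<and> pos_rat r \<longrightarrow> open_code X (sect \<Phi> \<langle>a, r\<rangle>)) \<and>
     preimage_conditions X Y (\<lambda>a r. open_set X (sect \<Phi> \<langle>a, r\<rangle>))"

definition continuous_value ::
  "'m space \<Rightarrow> 'm space \<Rightarrow> 'm set \<Rightarrow> ('m \<Rightarrow> 'm) \<Rightarrow> ('m \<Rightarrow> 'm) \<Rightarrow> bool" where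
  "continuous_value X Y \<Phi> = value_at X Y (\<lambda>a r. open_set X (sect \<Phi> \<langle>a, r\<rangle>))"

definition continuous_function ::
  "'m space \<Rightarrow> 'm space \<Rightarrow> (('m \<Rightarrow> 'm) \<Rightarrow> ('m \<Rightarrow> 'm) \<Rightarrow> bool) \<Rightarrow> bool" where
  "continuous_function X Y f \<longleftrightarrow> total X f \<and>
     (\<exists>\<Phi>. continuous_code X Y \<Phi> \<and> f = continuous_value X Y \<Phi>)"

text \<open>Baire functions are coded by a tree \<open>T\<close> and a sequence \<open>L\<close> of continuous codes labelling
  its leaves. Existence of \<open>f\<^bsub>\<Xi>\<^esub>(x)\<close> requires \<open>f\<^bsub>\<Xi>,\<sigma>\<^esub>(x)\<close> to exist for all \<open>\<sigma> \<in> T\<close>; as for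
  Borel sets, the recursion is expressed by a map \<open>\<sigma> \<mapsto> v\<^sub>\<sigma>\<close> of the structure which satisfies its
  clauses.\<close>

definition baire_code :: "'m space \<Rightarrow> 'm space \<Rightarrow> 'm set \<Rightarrow> 'm set \<Rightarrow> bool" where
  "baire_code X Y T L \<longleftrightarrow> tree T \<and> nil \<in> T \<and> \<not> has_path T \<and> L \<in> Sets \<and>
     (\<forall>s\<in>T. if leaf T s then continuous_code X Y (sect L s) else \<forall>i. snoc s i \<in> T)"

definition baire_evaluation ::
  "'m space \<Rightarrow> 'm space \<Rightarrow> 'm set \<Rightarrow> 'm set \<Rightarrow> ('m \<Rightarrow> 'm) \<Rightarrow> ('m \<Rightarrow> 'm \<Rightarrow> 'm) \<Rightarrow> bool" where
  "baire_evaluation X Y T L x v \<longleftrightarrow>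
     {\<langle>\<langle>s, k\<rangle>, v s k\<rangle> | s k. s \<in> T} \<in> Sets \<and>
     (\<forall>s\<in>T. point Y (v s) \<and>
        (if leaf T s then continuous_value X Y (sect L s) x (v s)
         else converges Y (\<lambda>n. v (snoc s n)) (v s)))"

definition baire_value ::
  "'m space \<Rightarrow> 'm space \<Rightarrow> 'm set \<Rightarrow> 'm set \<Rightarrow> ('m \<Rightarrow> 'm) \<Rightarrow> ('m \<Rightarrow> 'm) \<Rightarrow> bool" where
  "baire_value X Y T L x y \<longleftrightarrow> point X x \<and> point Y y \<and>
     (\<exists>v. baire_evaluation X Y T L x v \<and> same_point Y (v nil) y)"

definition baire_function :: "'m space \<Rightarrow> 'm space \<Rightarrow> (('m \<Rightarrow> 'm) \<Rightarrow> ('m \<Rightarrow> 'm) \<Rightarrow> bool) \<Rightarrow> bool" where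
  "baire_function X Y f \<longleftrightarrow> total X f \<and> (\<exists>T L. baire_code X Y T L \<and> f = baire_value X Y T L)"


subsection \<open>Caristi systems\<close>

definition potential :: "'m space \<Rightarrow> (('m \<Rightarrow> 'm) \<Rightarrow> ('m \<Rightarrow> 'm) \<Rightarrow> bool) \<Rightarrow> bool" where
  "potential X V \<longleftrightarrow> total X V \<and>
     (\<exists>W\<in>Sets. let Vn = (\<lambda>n. continuous_value X nonneg_reals (sect W n)) in
        (\<forall>n. continuous_code X nonneg_reals (sect W n) \<and> total X (Vn n)) \<and>
        (\<forall>n m x u w. n \<preceq> m \<and> Vn n x u \<and> Vn m x w \<longrightarrow> real_le u w) \<and>
        (\<forall>x v. V x v \<longleftrightarrow> point X x \<and> point nonneg_reals v \<and>
           (\<forall>k. \<exists>N. \<forall>n u. N \<preceq> n \<and> Vn n x u \<longrightarrow>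
              real_less (distance nonneg_reals u v) (real_of (half_pow k)))))"

definition caristi_system ::
  "'m space \<Rightarrow> (('m \<Rightarrow> 'm) \<Rightarrow> ('m \<Rightarrow> 'm) \<Rightarrow> bool) \<Rightarrow> (('m \<Rightarrow> 'm) \<Rightarrow> ('m \<Rightarrow> 'm) \<Rightarrow> bool) \<Rightarrow> bool" where
  "caristi_system X f V \<longleftrightarrow>
     metric_code X \<and> (baire_function X X f \<or> borel_function X X f) \<and> potential X V \<and>
     (\<forall>x y v w. f x y \<and> V x v \<and> V y w \<longrightarrow> real_le (distance X x y) (real_minus v w))"

text \<open>The Caristi fixed point theorem for the class \<open>K\<close> of triples \<open>(X, f, V)\<close>.\<close>

definition CFP ::
  "('m space \<Rightarrow> (('m \<Rightarrow> 'm) \<Rightarrow> ('m \<Rightarrow> 'm) \<Rightarrow> bool) \<Rightarrow> (('m \<Rightarrow> 'm) \<Rightarrow> ('m \<Rightarrow> 'm) \<Rightarrow> bool) \<Rightarrow> bool) \<Rightarrow> bool" where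
  "CFP K \<longleftrightarrow> (\<forall>X f V. caristi_system X f V \<and> K X f V \<longrightarrow> (\<exists>x. f x x))"

definition CFP_continuous_V_compact :: bool where
  "CFP_continuous_V_compact \<longleftrightarrow>
     CFP (\<lambda>X f V. compact_space X \<and> continuous_function X nonneg_reals V)"

definition CFP_continuous_f_V_cantor :: bool where
  "CFP_continuous_f_V_cantor \<longleftrightarrow>
     CFP (\<lambda>X f V. X = cantor_space \<and> continuous_function X X f \<and>
                  continuous_function X nonneg_reals V)"

end

end

theory Submission
  imports Defs
begin

text \<open>\<open>WKL\<^sub>0\<close> is equivalent to \<open>\<Sigma>\<^sup>0\<^sub>1\<close> separation, which allows to choose, uniformly in a parameter, among finitely
  many alternatives one that is not refuted, as long as there is one. So if no finite part of a
  \<open>\<Sigma>\<^sup>0\<^sub>1\<close> family of balls covers a compact space, then a sequence of such choices converges to a point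
  outside the family. Hence a continuous potential \<open>V\<close> attains its minimum at some \<open>z\<close>, and
  \<open>d(z, f(z)) \<le> V(z) - V(f(z)) \<le> 0\<close>.

  Conversely, if some disjoint \<open>\<Sigma>\<^sup>0\<^sub>1\<close> classes cannot be separated, then any \<open>x \<in> 2\<^sup>\<nat>\<close>, read as a set, is
  seen at a finite stage not to separate them. Let \<open>f(x)\<close> consist of the elements enumerated into the
  second class by this stage, unless \<open>x\<close> contains others below the stage, in which case
  \<open>f(x) = \<emptyset>\<close>. With \<open>V(x) = 2 - \<Sum>\<^sub>i x(i) 2\<^sup>-\<^sup>i\<close>, the sum extending up to the stage, in the first case and
  \<open>V(x) = 3\<close> in the second, \<open>V\<close> drops by at least \<open>2\<^sup>-\<^sup>d = d(x, f(x))\<close> for the first place \<open>d\<close> that \<open>f\<close> changes.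
  Both functions are locally constant, and \<open>f\<close> has no fixed point.\<close>

section \<open>Definable relations\<close>

text \<open>The sentences are interpreted in an arbitrary, possibly nonstandard model in which only
  \<Sigma>1 induction and \<Delta>1 comprehension are available. Every induction formula, recursion
  and set has to be shown definable; hence the calculus of definability, on which collection and
  coded sequences rest. In the compactness argument the obstacle is to express that no finite part
  of the family covers the neighbourhood of a net point by a \<Pi>1 property that is inherited by
  some nearby net point of the next level. Not lying in a single ball of the family is \<Pi>1 but
  need not be inherited; finite parts are therefore replaced by one finer net whose nearby points
  lie in single balls. In the reversal, \<open>V\<close> has to drop by the distance to
  \<open>f(x)\<close>, which is given by the first changed place. If an element is added there, the
  binary fraction grows by enough; if one is removed, it may shrink. Hence only those
  \<open>x\<close> are corrected whose elements are all confirmed; the others start anew from a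
  higher value. Disjointness keeps the corrected set free of errors up to the old stage, so that
  corrections never end although the potential is bounded.\<close>

primrec rename_term :: "(nat \<Rightarrow> nat) \<Rightarrow> l2_term \<Rightarrow> l2_term" where
  "rename_term f (TVar v) = TVar (f v)"
| "rename_term f TZero = TZero"
| "rename_term f TOne = TOne"
| "rename_term f (TAdd s t) = TAdd (rename_term f s) (rename_term f t)"
| "rename_term f (TMult s t) = TMult (rename_term f s) (rename_term f t)"

primrec rename :: "(nat \<Rightarrow> nat) \<Rightarrow> (nat \<Rightarrow> nat) \<Rightarrow> bounded_formula \<Rightarrow> bounded_formula" where
  "rename f g (FEq s t) = FEq (rename_term f s) (rename_term f t)"
| "rename f g (FLess s t) = FLess (rename_term f s) (rename_term f t)"
| "rename f g (FMem t V) = FMem (rename_term f t) (g V)"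
| "rename f g (FNot \<phi>) = FNot (rename f g \<phi>)"
| "rename f g (FAnd \<phi> \<psi>) = FAnd (rename f g \<phi>) (rename f g \<psi>)"
| "rename f g (FEx v t \<phi>) = FEx (f v) (rename_term f t) (rename f g \<phi>)"

definition interleave :: "(nat \<Rightarrow> 'a) \<Rightarrow> (nat \<Rightarrow> 'a) \<Rightarrow> nat \<Rightarrow> 'a" where
  "interleave e c i = (if even i then e (i div 2) else c (i div 2))"

context l2
begin

lemma eval_rename: "eval (rename_term f t) e = eval t (\<lambda>i. e (f i))"
  by (induction t) auto

text \<open>Injectivity rules out capture: in the quantifier case the update of the bound variable
  must not reach any other variable. Set variables are never bound and may be identified by
  \<open>g\<close>.\<close>

lemma sat_rename:
  assumes "inj f"
  shows "sat (rename f g \<phi>) e E \<longleftrightarrow> sat \<phi> (\<lambda>i. e (f i)) (\<lambda>i. E (g i))"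
proof (induction \<phi> arbitrary: e)
  case (FEx v t \<phi>)
  have "(\<lambda>i. (e(f v := x)) (f i)) = (\<lambda>i. e (f i))(v := x)" for x
    using assms by (auto simp: fun_eq_iff inj_eq)
  then show ?case
    by (simp add: FEx eval_rename del: fun_upd_apply)
qed (auto simp: eval_rename)

text \<open>Relations are represented as predicates on environments \<open>e\<close>, whose variables become the even
  variables of a formula; its odd variables are parameters. A quantifier binds variable 0 of the
  environment and shifts the others, so that the closure properties below can be applied
  backwards to the literal text of a definition.\<close>

definition Delta0 :: "((nat \<Rightarrow> 'm) \<Rightarrow> bool) \<Rightarrow> bool" where
  "Delta0 P \<longleftrightarrow> (\<exists>\<phi> c E. (\<forall>V. E V \<in> Sets) \<and> (\<forall>e. P e \<longleftrightarrow> sat \<phi> (interleave e c) E))"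

definition def_term :: "((nat \<Rightarrow> 'm) \<Rightarrow> 'm) \<Rightarrow> bool" where
  "def_term t \<longleftrightarrow> (\<exists>s c. \<forall>e. t e = eval s (interleave e c))"

definition Sigma1 :: "((nat \<Rightarrow> 'm) \<Rightarrow> bool) \<Rightarrow> bool" where
  "Sigma1 P \<longleftrightarrow> (\<exists>Q. Delta0 Q \<and> (\<forall>e. P e \<longleftrightarrow> (\<exists>m. Q (case_nat m e))))"

definition Delta1 :: "((nat \<Rightarrow> 'm) \<Rightarrow> bool) \<Rightarrow> bool" where
  "Delta1 P \<longleftrightarrow> Sigma1 P \<and> Sigma1 (\<lambda>e. \<not> P e)"

text \<open>A \<Sigma>1 graph suffices because the function is total: that \<open>y\<close> is not
  the value means that some number other than \<open>y\<close> is, which is \<Sigma>1 again.\<close>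

definition def_fun :: "((nat \<Rightarrow> 'm) \<Rightarrow> 'm) \<Rightarrow> bool" where
  "def_fun t \<longleftrightarrow> Sigma1 (\<lambda>e. e 0 = t (\<lambda>i. e (Suc i)))"

end

locale rca0 = l2 M for M :: "'m l2_structure" +
  assumes RCA0: RCA0
begin

lemma basic_axioms: basic_axioms
  using RCA0 by (simp add: RCA0_def)

lemma
  shows succ_neq_zero [simp]: "n \<oplus> \<one> \<noteq> \<zero>"
    and succ_inject: "m \<oplus> \<one> = n \<oplus> \<one> \<Longrightarrow> m = n"
    and add_zero: "m \<oplus> \<zero> = m"
    and add_succ: "m \<oplus> (n \<oplus> \<one>) = (m \<oplus> n) \<oplus> \<one>"
    and mult_zero: "m \<otimes> \<zero> = \<zero>"
    and mult_succ: "m \<otimes> (n \<oplus> \<one>) = (m \<otimes> n) \<oplus> m"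
    and not_less_zero [simp]: "\<not> m \<prec> \<zero>"
    and less_succ: "m \<prec> n \<oplus> \<one> \<longleftrightarrow> m \<prec> n \<or> m = n"
  using basic_axioms unfolding basic_axioms_def by blast+

lemma ex_set: "\<exists>A. A \<in> Sets"
  using RCA0 by (auto simp: RCA0_def)

subsection \<open>Bounded formulas\<close>

lemma def_term_var: "def_term (\<lambda>e. e n)"
  unfolding def_term_def by (intro exI[of _ "TVar (2 * n)"]) (simp add: interleave_def)

lemma def_term_const: "def_term (\<lambda>e. a)"
  unfolding def_term_def
  by (intro exI[of _ "TVar 1"] exI[of _ "\<lambda>_. a"]) (simp add: interleave_def)

text \<open>Two formulas come with parameter sequences \<open>c\<close> and \<open>c'\<close> of
  their own. The renamings fix the variables at even places and send the parameters to the two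
  halves of the common sequence \<open>interleave c c'\<close>.\<close>

definition merge0 :: "nat \<Rightarrow> nat" where "merge0 i = (if even i then i else 2 * i - 1)"
definition merge1 :: "nat \<Rightarrow> nat" where "merge1 i = (if even i then i else 2 * i + 1)"

lemma inj_merge0: "inj merge0"
  by (rule injI, simp add: merge0_def split: if_splits; presburger)

lemma inj_merge1: "inj merge1"
  by (rule injI, simp add: merge1_def split: if_splits; presburger)

lemma interleave_merge:
  "(\<lambda>i. interleave e (interleave c c') (merge0 i)) = interleave e c"
  "(\<lambda>i. interleave e (interleave c c') (merge1 i)) = interleave e c'"
proof -
  have "interleave e (interleave c c') (merge0 i) = interleave e c i \<and>
        interleave e (interleave c c') (merge1 i) = interleave e c' i" for i
  proof (cases "even i")
    case False
    then obtain j where "i = 2 * j + 1" by (rule oddE)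
    moreover have "(4 * j + 1) div 2 = 2 * j" "(4 * j + 3) div 2 = 2 * j + 1"
      by presburger+
    ultimately show ?thesis
      by (simp add: interleave_def merge0_def merge1_def)
  qed (simp add: interleave_def merge0_def merge1_def)
  then show
    "(\<lambda>i. interleave e (interleave c c') (merge0 i)) = interleave e c"
    "(\<lambda>i. interleave e (interleave c c') (merge1 i)) = interleave e c'"
    by auto
qed

lemma def_term_common:
  assumes "def_term s" "def_term t"
  obtains s' t' c where "\<And>e. s e = eval s' (interleave e c)" "\<And>e. t e = eval t' (interleave e c)"
proof -
  from assms obtain s' c t' c' where
    "\<And>e. s e = eval s' (interleave e c)" "\<And>e. t e = eval t' (interleave e c')"
    unfolding def_term_def by blast
  then show ?thesis
    by (intro that[of "rename_term merge0 s'" "interleave c c'" "rename_term merge1 t'"])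
       (simp_all add: eval_rename interleave_merge)
qed

lemma Delta0_common:
  assumes "Delta0 P" "Delta0 Q"
  obtains \<phi> \<psi> c E where "\<And>V. E V \<in> Sets" "\<And>e. P e \<longleftrightarrow> sat \<phi> (interleave e c) E"
    "\<And>e. Q e \<longleftrightarrow> sat \<psi> (interleave e c) E"
proof -
  from assms obtain \<phi> c E \<psi> c' E' where *: "\<And>V. E V \<in> Sets" "\<And>V. E' V \<in> Sets"
    "\<And>e. P e \<longleftrightarrow> sat \<phi> (interleave e c) E" "\<And>e. Q e \<longleftrightarrow> sat \<psi> (interleave e c') E'"
    unfolding Delta0_def by blast
  have "(\<lambda>i. interleave E E' (2 * i)) = E" "(\<lambda>i. interleave E E' (2 * i + 1)) = E'"
    by (auto simp: interleave_def)
  then show ?thesis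
    using * by (intro that[of "interleave E E'" "rename merge0 (\<lambda>i. 2 * i) \<phi>" "interleave c c'"
            "rename merge1 (\<lambda>i. 2 * i + 1) \<psi>"])
       (simp_all add: sat_rename interleave_merge inj_merge0 inj_merge1, simp add: interleave_def)
qed

lemma def_term_add: "def_term s \<Longrightarrow> def_term t \<Longrightarrow> def_term (\<lambda>e. s e \<oplus> t e)"
  by (erule (1) def_term_common, unfold def_term_def) (metis eval.simps(4))

lemma def_term_mult: "def_term s \<Longrightarrow> def_term t \<Longrightarrow> def_term (\<lambda>e. s e \<otimes> t e)"
  by (erule (1) def_term_common, unfold def_term_def) (metis eval.simps(5))

lemma Delta0_eq: "def_term s \<Longrightarrow> def_term t \<Longrightarrow> Delta0 (\<lambda>e. s e = t e)"
  by (insert ex_set, erule exE, erule (1) def_term_common, unfold Delta0_def)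
    (rule_tac x = "FEq s' t'" in exI, rule_tac x = c in exI, rule_tac x = "\<lambda>_. A" in exI, simp)

lemma Delta0_less: "def_term s \<Longrightarrow> def_term t \<Longrightarrow> Delta0 (\<lambda>e. s e \<prec> t e)"
  by (insert ex_set, erule exE, erule (1) def_term_common, unfold Delta0_def)
    (rule_tac x = "FLess s' t'" in exI, rule_tac x = c in exI, rule_tac x = "\<lambda>_. A" in exI, simp)

lemma Delta0_mem: "A \<in> Sets \<Longrightarrow> def_term t \<Longrightarrow> Delta0 (\<lambda>e. t e \<in> A)"
  unfolding Delta0_def def_term_def
  by (elim exE, rule_tac x = "FMem s 0" in exI, rule_tac x = c in exI, rule_tac x = "\<lambda>_. A" in exI) simp

lemma Delta0_not: "Delta0 P \<Longrightarrow> Delta0 (\<lambda>e. \<not> P e)"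
  unfolding Delta0_def by (metis sat.simps(4))

lemma Delta0_and: "Delta0 P \<Longrightarrow> Delta0 Q \<Longrightarrow> Delta0 (\<lambda>e. P e \<and> Q e)"
  by (erule (1) Delta0_common, unfold Delta0_def) (metis sat.simps(5))

lemma Delta0_ex:
  assumes "def_term t" and P: "Delta0 (\<lambda>e. P (\<lambda>i. e (Suc i)) (e 0))"
  shows "Delta0 (\<lambda>e. \<exists>x. x \<prec> t e \<and> P e x)"
proof -
  have "Delta0 (\<lambda>e. P (\<lambda>i. e (Suc i)) (e 0) \<and> t e = t e)"
    by (intro Delta0_and P Delta0_eq assms)
  from assms obtain s c where s: "\<And>e. t e = eval s (interleave e c)"
    unfolding def_term_def by blast
  from P obtain \<phi> c' E where E: "\<And>V. E V \<in> Sets"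
    and \<phi>: "\<And>e. P (\<lambda>i. e (Suc i)) (e 0) \<longleftrightarrow> sat \<phi> (interleave e c') E"
    unfolding Delta0_def by blast
  \<comment> \<open>The quantified variable takes number 1, the first parameter place, which is
    vacated by moving all parameters up by one place. The other variables of the environment move
    down by one place, undoing the shift under the quantifier.\<close>
  define c'' where "c'' = case_nat \<zero> (interleave c c')"
  define f where "f i = (if i = 0 then 1 else if even i then i - 2 else i + 2)" for i :: nat
  define g where "g i = (if even i then i else i + 2)" for i :: nat
  have injf: "inj f"
    unfolding inj_def f_def by (auto split: if_splits) presburger+
  have shift: "(\<lambda>i. (interleave e (case_nat b d)) (g i)) = interleave e d" for e b d
    by (auto simp: fun_eq_iff interleave_def g_def)
  have shift': "(\<lambda>i. ((interleave e (case_nat b d))(Suc 0 := x)) (f i)) = interleave (case_nat x e) d"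
    for e x b d
    by (auto simp: fun_eq_iff interleave_def f_def split: nat.split)
  have "P e x \<longleftrightarrow> sat (rename f id (rename merge1 id \<phi>)) ((interleave e c'')(Suc 0 := x)) E" for e x
    using \<phi>[of "case_nat x e"]
    by (simp add: sat_rename injf inj_merge1 shift' c''_def interleave_merge del: fun_upd_apply)
  moreover have "t e = eval (rename_term g (rename_term merge0 s)) (interleave e c'')" for e
  proof -
    have "(\<lambda>i. interleave e c'' (g (merge0 i))) = (\<lambda>i. interleave e (interleave c c') (merge0 i))"
      using shift[of e \<zero> "interleave c c'"] by (auto simp: fun_eq_iff c''_def)
    then show ?thesis
      by (simp add: eval_rename s interleave_merge)
  qed
  ultimately show ?thesis
    unfolding Delta0_def
    by (intro exI[of _ "FEx 1 (rename_term g (rename_term merge0 s)) (rename f id (rename merge1 id \<phi>))"]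
        exI[of _ c''] exI[of _ E]) (simp add: E)
qed

lemma Delta0_or: "Delta0 P \<Longrightarrow> Delta0 Q \<Longrightarrow> Delta0 (\<lambda>e. P e \<or> Q e)"
  using Delta0_not[OF Delta0_and[OF Delta0_not Delta0_not], of P Q] by simp

lemma Delta0_imp: "Delta0 P \<Longrightarrow> Delta0 Q \<Longrightarrow> Delta0 (\<lambda>e. P e \<longrightarrow> Q e)"
  unfolding imp_conv_disj by (intro Delta0_or Delta0_not)

lemma Delta0_all:
  assumes "def_term t" "Delta0 (\<lambda>e. P (\<lambda>i. e (Suc i)) (e 0))"
  shows "Delta0 (\<lambda>e. \<forall>x. x \<prec> t e \<longrightarrow> P e x)"
proof -
  have "Delta0 (\<lambda>e. \<not> (\<exists>x. x \<prec> t e \<and> \<not> P e x))"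
    by (rule Delta0_not, rule Delta0_ex, rule assms(1), rule Delta0_not, rule assms(2))
  then show ?thesis
    by (rule back_subst[of Delta0]) blast
qed

lemma Delta0_reindex:
  assumes "inj h" "Delta0 P"
  shows "Delta0 (\<lambda>e. P (\<lambda>i. e (h i)))"
proof -
  define f where "f i = (if even i then 2 * h (i div 2) else i)" for i
  have "inj f"
  proof (rule injI)
    fix i j assume *: "f i = f j"
    have "even (f i) \<longleftrightarrow> even i" for i
      by (simp add: f_def)
    then have "even i \<longleftrightarrow> even j"
      using * by metis
    then show "i = j"
      using * assms(1) dvd_div_eq_iff[of 2 i j] by (cases "even i") (auto simp: f_def inj_eq)
  qed
  moreover have "sat \<phi> (\<lambda>i. interleave e c (f i)) E = sat \<phi> (interleave (\<lambda>i. e (h i)) c) E" for \<phi> e c E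
    by (rule arg_cong[of _ _ "\<lambda>e. sat \<phi> e E"]) (auto simp: fun_eq_iff interleave_def f_def)
  moreover obtain \<phi> c E where "\<forall>V. E V \<in> Sets" "\<And>e. P e \<longleftrightarrow> sat \<phi> (interleave e c) E"
    using assms(2) unfolding Delta0_def by blast
  ultimately show ?thesis
    unfolding Delta0_def
    by (intro exI[of _ "rename f id \<phi>"] exI[of _ c] exI[of _ E])
      (simp add: sat_rename)
qed

lemmas Delta0_intros = def_term_var def_term_const def_term_add def_term_mult Delta0_eq Delta0_less
  Delta0_mem Delta0_not Delta0_and Delta0_or Delta0_imp Delta0_ex Delta0_all

text \<open>In the schemes of \<open>RCA\<^sub>0\<close>, the main variable is 0 and the unbounded one is 1.\<close>

lemma Delta0_scheme:
  assumes "Delta0 P" "Delta0 Q"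
  obtains \<phi> \<psi> e E where "\<And>V. E V \<in> Sets"
    "\<And>n m. sat \<phi> (e(0 := n, 1 := m)) E \<longleftrightarrow> P (case_nat m (case_nat n (\<lambda>_. \<zero>)))"
    "\<And>n m. sat \<psi> (e(0 := n, 1 := m)) E \<longleftrightarrow> Q (case_nat m (case_nat n (\<lambda>_. \<zero>)))"
proof -
  obtain \<phi> \<psi> c E where *: "\<And>V. E V \<in> Sets" "\<And>e. P e \<longleftrightarrow> sat \<phi> (interleave e c) E"
    "\<And>e. Q e \<longleftrightarrow> sat \<psi> (interleave e c) E"
    using assms by (rule Delta0_common) blast
  \<comment> \<open>The environment has its variables 0 and 1 at the formula numbers 0 and 2; the
    schemes want them at 1 and 0. Number 1 was the first parameter, so all parameters move up by two
    numbers.\<close>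
  define f where "f i = (if i = 0 then 1 else if i = 2 then 0 else if even i then i else i + 2)"
    for i :: nat
  define e where "e = interleave (\<lambda>_. \<zero>) (\<lambda>i. c (i - 1))"
  have "inj f"
    unfolding inj_def f_def by (auto split: if_splits)
  moreover have "(e(0 := n, Suc 0 := m)) (f i) = interleave (case_nat m (case_nat n (\<lambda>_. \<zero>))) c i" for n m i
  proof (cases "even i")
    case True
    then obtain j where "i = 2 * j" by blast
    then show ?thesis
      by (auto simp: f_def e_def interleave_def split: nat.split)
  qed (auto simp: f_def e_def interleave_def)
  ultimately show ?thesis
    using * by (intro that[of E "rename f id \<phi>" e "rename f id \<psi>"])
      (auto simp: sat_rename simp del: fun_upd_apply)
qed

lemma Sigma1_induct:
  assumes "Sigma1 (\<lambda>e. P (e 0))" "P \<zero>" "\<And>n. P n \<Longrightarrow> P (n \<oplus> \<one>)"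
  shows "P n"
proof -
  from assms(1) obtain Q where Q: "Delta0 Q" "\<And>e. P (e 0) \<longleftrightarrow> (\<exists>m. Q (case_nat m e))"
    unfolding Sigma1_def by blast
  from Q(1,1) obtain \<phi> \<psi> e E where E: "\<And>V. E V \<in> Sets"
    and \<phi>: "\<And>n m. sat \<phi> (e(0 := n, 1 := m)) E \<longleftrightarrow> Q (case_nat m (case_nat n (\<lambda>_. \<zero>)))"
    by (rule Delta0_scheme) blast
  have "P n \<longleftrightarrow> (\<exists>m. sat \<phi> (e(0 := n, 1 := m)) E)" for n
    using Q(2)[of "case_nat n (\<lambda>_. \<zero>)"] \<phi> by simp
  moreover have Sigma01_induction
    using RCA0 by (simp add: RCA0_def)
  ultimately show ?thesis
    using E assms(2,3) unfolding Sigma01_induction_def Let_def by metis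
qed

lemma Delta0_Sigma1: "Delta0 P \<Longrightarrow> Sigma1 P"
  unfolding Sigma1_def
  by (intro exI[of _ "\<lambda>e. P (\<lambda>i. e (Suc i))"]) (simp add: Delta0_reindex)

lemma Delta0_induct:
  assumes "Delta0 (\<lambda>e. P (e 0))" "P \<zero>" "\<And>n. P n \<Longrightarrow> P (n \<oplus> \<one>)"
  shows "P n"
  using Sigma1_induct[of P] assms Delta0_Sigma1 by blast

lemma comprehension:
  assumes "Delta1 (\<lambda>e. P (e 0))"
  shows "{n. P n} \<in> Sets"
proof -
  from assms obtain Q R where "Delta0 Q" "Delta0 R"
    and QR: "\<And>e. P (e 0) \<longleftrightarrow> (\<exists>m. Q (case_nat m e))" "\<And>e. \<not> P (e 0) \<longleftrightarrow> (\<exists>m. R (case_nat m e))"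
    unfolding Delta1_def Sigma1_def by blast
  then obtain \<phi> \<psi> e E where E: "\<And>V. E V \<in> Sets"
    and *: "\<And>n m. sat \<phi> (e(0 := n, 1 := m)) E \<longleftrightarrow> Q (case_nat m (case_nat n (\<lambda>_. \<zero>)))"
      "\<And>n m. sat \<psi> (e(0 := n, 1 := m)) E \<longleftrightarrow> R (case_nat m (case_nat n (\<lambda>_. \<zero>)))"
    by - (rule Delta0_scheme[of Q R], auto)
  have "(\<exists>m. sat \<phi> (e(0 := n, 1 := m)) E) \<longleftrightarrow> P n"
    "(\<forall>m. sat (FNot \<psi>) (e(0 := n, 1 := m)) E) \<longleftrightarrow> P n" for n
    using QR[of "case_nat n (\<lambda>_. \<zero>)"] by (simp_all add: *[simplified] del: fun_upd_apply) blast
  moreover have "Delta01_comprehension"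
    using RCA0 by (simp add: RCA0_def)
  ultimately show ?thesis
    using E unfolding Delta01_comprehension_def
    by (drule_tac x = \<phi> in spec, drule_tac x = "FNot \<psi>" in spec,
        drule_tac x = e in spec, drule_tac x = E in spec) simp
qed

section \<open>Arithmetic\<close>

lemma num_add_assoc: "a \<oplus> b \<oplus> c = a \<oplus> (b \<oplus> c)"
  by (rule Delta0_induct[where P = "\<lambda>c. a \<oplus> b \<oplus> c = a \<oplus> (b \<oplus> c)"])
    (intro Delta0_intros | simp add: add_zero add_succ)+

lemma zero_add: "\<zero> \<oplus> a = a"
  by (rule Delta0_induct[where P = "\<lambda>a. \<zero> \<oplus> a = a"])
    (intro Delta0_intros | simp add: add_zero flip: num_add_assoc)+

lemma succ_add: "a \<oplus> \<one> \<oplus> b = a \<oplus> b \<oplus> \<one>"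
  by (rule Delta0_induct[where P = "\<lambda>b. a \<oplus> \<one> \<oplus> b = a \<oplus> b \<oplus> \<one>"])
    (intro Delta0_intros | simp add: add_zero flip: num_add_assoc)+

lemma num_add_commute: "a \<oplus> b = b \<oplus> a"
  by (rule Delta0_induct[where P = "\<lambda>b. a \<oplus> b = b \<oplus> a"])
    (intro Delta0_intros | simp add: add_zero zero_add succ_add flip: num_add_assoc)+

lemma num_mult_one: "a \<otimes> \<one> = a"
  using mult_succ[of a \<zero>] by (simp add: zero_add mult_zero)

lemma zero_mult: "\<zero> \<otimes> a = \<zero>"
  by (rule Delta0_induct[where P = "\<lambda>a. \<zero> \<otimes> a = \<zero>"])
    (intro Delta0_intros | simp add: mult_zero mult_succ add_zero)+

lemma num_distrib: "a \<otimes> (b \<oplus> c) = a \<otimes> b \<oplus> a \<otimes> c"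
  by (rule Delta0_induct[where P = "\<lambda>c. a \<otimes> (b \<oplus> c) = a \<otimes> b \<oplus> a \<otimes> c"])
    (intro Delta0_intros | simp add: mult_zero mult_succ add_zero flip: num_add_assoc)+

lemma succ_mult: "(a \<oplus> \<one>) \<otimes> b = a \<otimes> b \<oplus> b"
proof (rule Delta0_induct[where P = "\<lambda>b. (a \<oplus> \<one>) \<otimes> b = a \<otimes> b \<oplus> b"])
  fix n assume "(a \<oplus> \<one>) \<otimes> n = a \<otimes> n \<oplus> n"
  then have "(a \<oplus> \<one>) \<otimes> (n \<oplus> \<one>) = a \<otimes> n \<oplus> n \<oplus> (a \<oplus> \<one>)"
    by (simp add: mult_succ)
  also have "\<dots> = a \<otimes> n \<oplus> a \<oplus> (n \<oplus> \<one>)"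
    by (metis num_add_assoc num_add_commute)
  finally show "(a \<oplus> \<one>) \<otimes> (n \<oplus> \<one>) = a \<otimes> (n \<oplus> \<one>) \<oplus> (n \<oplus> \<one>)"
    by (simp add: mult_succ)
qed (intro Delta0_intros | simp add: mult_zero add_zero)+

lemma num_mult_commute: "a \<otimes> b = b \<otimes> a"
  by (rule Delta0_induct[where P = "\<lambda>b. a \<otimes> b = b \<otimes> a"])
    (intro Delta0_intros | simp add: mult_zero zero_mult mult_succ succ_mult)+

lemma num_mult_assoc: "a \<otimes> b \<otimes> c = a \<otimes> (b \<otimes> c)"
  by (rule Delta0_induct[where P = "\<lambda>c. a \<otimes> b \<otimes> c = a \<otimes> (b \<otimes> c)"])
    (intro Delta0_intros | simp add: mult_zero mult_succ num_distrib num_mult_one)+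

lemma num_add_left_cancel: "a \<oplus> b = a \<oplus> c \<Longrightarrow> b = c"
proof -
  have "a \<oplus> b = a \<oplus> c \<longrightarrow> b = c"
    by (rule Delta0_induct[where P = "\<lambda>a. a \<oplus> b = a \<oplus> c \<longrightarrow> b = c"])
      (intro Delta0_intros | auto simp: zero_add succ_add dest: succ_inject)+
  then show "a \<oplus> b = a \<oplus> c \<Longrightarrow> b = c" by blast
qed

lemma zero_or_pos: "a = \<zero> \<or> \<zero> \<prec> a"
  by (rule Delta0_induct[where P = "\<lambda>a. a = \<zero> \<or> \<zero> \<prec> a"])
    (intro Delta0_intros | auto simp: less_succ)+

lemma num_less_trans: "a \<prec> b \<Longrightarrow> b \<prec> c \<Longrightarrow> a \<prec> c"
proof -
  have "a \<prec> b \<longrightarrow> b \<prec> c \<longrightarrow> a \<prec> c"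
    by (rule Delta0_induct[where P = "\<lambda>c. a \<prec> b \<longrightarrow> b \<prec> c \<longrightarrow> a \<prec> c"])
      (intro Delta0_intros | auto simp: less_succ)+
  then show "a \<prec> b \<Longrightarrow> b \<prec> c \<Longrightarrow> a \<prec> c" by blast
qed

lemma num_less_irrefl: "\<not> a \<prec> a"
proof (rule Delta0_induct[where P = "\<lambda>a. \<not> a \<prec> a"])
  show "\<not> n \<oplus> \<one> \<prec> n \<oplus> \<one>" if "\<not> n \<prec> n" for n
    using that less_succ num_less_trans by metis
qed (intro Delta0_intros | simp)+

lemma succ_less_succ: "a \<prec> b \<Longrightarrow> a \<oplus> \<one> \<prec> b \<oplus> \<one>"
proof -
  have "a \<prec> b \<longrightarrow> a \<oplus> \<one> \<prec> b \<oplus> \<one>"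
    by (rule Delta0_induct[where P = "\<lambda>b. a \<prec> b \<longrightarrow> a \<oplus> \<one> \<prec> b \<oplus> \<one>"])
      (intro Delta0_intros | auto simp: less_succ)+
  then show "a \<prec> b \<Longrightarrow> a \<oplus> \<one> \<prec> b \<oplus> \<one>" by blast
qed

lemma num_less_linear: "a \<prec> b \<or> a = b \<or> b \<prec> a"
proof (rule Delta0_induct[where P = "\<lambda>b. a \<prec> b \<or> a = b \<or> b \<prec> a"])
  show "a \<prec> n \<oplus> \<one> \<or> a = n \<oplus> \<one> \<or> n \<oplus> \<one> \<prec> a" if "a \<prec> n \<or> a = n \<or> n \<prec> a" for n
    using that succ_less_succ[of n a] by (auto simp: less_succ)
  show "a \<prec> \<zero> \<or> a = \<zero> \<or> \<zero> \<prec> a"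
    using zero_or_pos by simp
qed (intro Delta0_intros | simp)+

lemma num_add_less: "a \<prec> b \<Longrightarrow> a \<oplus> c \<prec> b \<oplus> c"
proof -
  have "a \<prec> b \<longrightarrow> a \<oplus> c \<prec> b \<oplus> c"
    by (rule Delta0_induct[where P = "\<lambda>c. a \<prec> b \<longrightarrow> a \<oplus> c \<prec> b \<oplus> c"])
      (intro Delta0_intros | auto simp: add_zero succ_less_succ simp flip: num_add_assoc)+
  then show "a \<prec> b \<Longrightarrow> a \<oplus> c \<prec> b \<oplus> c" by blast
qed

lemma less_imp_ex_add: "a \<prec> b \<Longrightarrow> \<exists>c. b = a \<oplus> c \<oplus> \<one>"
proof -
  \<comment> \<open>The bound on \<open>c\<close> is added to keep the induction formula
    bounded.\<close>
  have "a \<prec> b \<longrightarrow> (\<exists>c. c \<prec> b \<and> b = a \<oplus> c \<oplus> \<one>)"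
  proof (rule Delta0_induct[where P = "\<lambda>b. a \<prec> b \<longrightarrow> (\<exists>c. c \<prec> b \<and> b = a \<oplus> c \<oplus> \<one>)"])
    fix n assume IH: "a \<prec> n \<longrightarrow> (\<exists>c. c \<prec> n \<and> n = a \<oplus> c \<oplus> \<one>)"
    show "a \<prec> n \<oplus> \<one> \<longrightarrow> (\<exists>c. c \<prec> n \<oplus> \<one> \<and> n \<oplus> \<one> = a \<oplus> c \<oplus> \<one>)"
    proof
      assume "a \<prec> n \<oplus> \<one>"
      then consider "a \<prec> n" | "a = n" by (auto simp: less_succ)
      then show "\<exists>c. c \<prec> n \<oplus> \<one> \<and> n \<oplus> \<one> = a \<oplus> c \<oplus> \<one>"
      proof cases
        case 1
        then obtain c where "c \<prec> n" "n = a \<oplus> c \<oplus> \<one>" using IH by blast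
        then show ?thesis
          using succ_less_succ by (intro exI[of _ "c \<oplus> \<one>"]) (auto simp: add_succ)
      next
        case 2
        then show ?thesis
          using zero_or_pos[of "n \<oplus> \<one>"] by (intro exI[of _ \<zero>]) (auto simp: add_zero)
      qed
    qed
  qed (intro Delta0_intros | simp)+
  then show "a \<prec> b \<Longrightarrow> \<exists>c. b = a \<oplus> c \<oplus> \<one>" by blast
qed

text \<open>A constant of its own keeps \<open>\<preceq>\<close>, which abbreviates a disjunction, intact under simplification.\<close>

definition num_le :: "'m \<Rightarrow> 'm \<Rightarrow> bool" (infix "\<preceq>\<preceq>" 50) where "a \<preceq>\<preceq> b \<longleftrightarrow> a \<preceq> b"

text \<open>Truncated subtraction belongs to the signature of \<open>linordered_semidom\<close>.
  Interpreting that class makes the usual rules for ordered semirings available for the numbers of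
  the structure.\<close>

definition num_minus :: "'m \<Rightarrow> 'm \<Rightarrow> 'm" (infixl "\<ominus>" 65) where
  "a \<ominus> b = (if b \<preceq>\<preceq> a then THE c. b \<oplus> c = a else \<zero>)"

lemma le_imp_ex_add: "a \<preceq>\<preceq> b \<Longrightarrow> \<exists>c. b = a \<oplus> c"
  unfolding num_le_def by (metis less_imp_ex_add add_zero num_add_assoc)

lemma le_add: "a \<preceq>\<preceq> a \<oplus> c"
  unfolding num_le_def using num_add_less[of \<zero> c a] zero_or_pos[of c]
  by (auto simp: zero_add add_zero num_add_commute[of a])

lemma add_num_minus: "a \<oplus> c \<ominus> a = c"
  unfolding num_minus_def using num_add_left_cancel by (auto simp: le_add)

lemma num_minus_eq_zero: "\<not> b \<preceq>\<preceq> a \<Longrightarrow> a \<ominus> b = \<zero>"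
  unfolding num_minus_def by simp

lemma num_le_iff: "a \<preceq>\<preceq> b \<longleftrightarrow> (\<exists>c. b = a \<oplus> c)"
  using le_imp_ex_add le_add by auto

lemma num_le_trans: "a \<preceq>\<preceq> b \<Longrightarrow> b \<preceq>\<preceq> c \<Longrightarrow> a \<preceq>\<preceq> c"
  unfolding num_le_def using num_less_trans by blast

lemma num_mult_less: "a \<prec> b \<Longrightarrow> \<zero> \<prec> c \<Longrightarrow> c \<otimes> a \<prec> c \<otimes> b"
proof -
  assume "a \<prec> b" "\<zero> \<prec> c"
  from less_imp_ex_add[OF \<open>a \<prec> b\<close>] obtain d where "b = a \<oplus> d \<oplus> \<one>" by blast
  then have "c \<otimes> b = c \<otimes> a \<oplus> c \<otimes> d \<oplus> c"
    by (simp add: num_distrib num_mult_one)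
  moreover have "c \<otimes> a \<oplus> c \<otimes> d \<prec> c \<otimes> a \<oplus> c \<otimes> d \<oplus> c"
    using num_add_less[OF \<open>\<zero> \<prec> c\<close>, of "c \<otimes> a \<oplus> c \<otimes> d"] by (simp add: zero_add num_add_commute)
  moreover have "c \<otimes> a \<preceq>\<preceq> c \<otimes> a \<oplus> c \<otimes> d"
    by (rule le_add)
  ultimately show "c \<otimes> a \<prec> c \<otimes> b"
    unfolding num_le_def using num_less_trans by metis
qed

lemma num_le_minus: "b \<preceq>\<preceq> a \<Longrightarrow> b \<oplus> (a \<ominus> b) = a"
  using le_imp_ex_add add_num_minus by metis

lemma minus_minus: "a \<ominus> b \<ominus> c = a \<ominus> (b \<oplus> c)"
proof (cases "b \<oplus> c \<preceq>\<preceq> a")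
  case True
  then obtain d where "a = b \<oplus> (c \<oplus> d)"
    using le_imp_ex_add num_add_assoc by metis
  then show ?thesis
    using add_num_minus num_add_assoc by metis
next
  case False
  show ?thesis
  proof (cases "b \<preceq>\<preceq> a")
    case True
    then have "\<not> c \<preceq>\<preceq> a \<ominus> b"
      using False num_le_minus num_add_assoc num_le_iff by metis
    then show ?thesis
      using False by (simp add: num_minus_eq_zero)
  next
    case f: False
    have "\<zero> \<ominus> c = \<zero>"
      using add_num_minus[of \<zero> \<zero>] num_minus_eq_zero[of c \<zero>] zero_or_pos[of c]
      by (cases "c = \<zero>") (auto simp: num_le_def add_zero)
    then show ?thesis
      using False f by (simp add: num_minus_eq_zero)
  qed
qed

lemma mult_minus: "a \<otimes> (b \<ominus> c) = a \<otimes> b \<ominus> a \<otimes> c"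
proof (cases "c \<preceq>\<preceq> b")
  case True
  then have "a \<otimes> b = a \<otimes> c \<oplus> a \<otimes> (b \<ominus> c)"
    using num_distrib num_le_minus by metis
  then show ?thesis
    using add_num_minus by metis
next
  case False
  then have bc: "b \<prec> c"
    using num_less_linear by (auto simp: num_le_def)
  show ?thesis
  proof (cases "a = \<zero>")
    case True
    then show ?thesis
      using add_num_minus[of \<zero> \<zero>] by (simp add: zero_mult add_zero)
  next
    case a: False
    then have "a \<otimes> b \<prec> a \<otimes> c"
      using num_mult_less bc zero_or_pos by blast
    then have "\<not> a \<otimes> c \<preceq>\<preceq> a \<otimes> b"
      using num_less_trans num_less_irrefl by (auto simp: num_le_def)
    then show ?thesis
      using False by (simp add: num_minus_eq_zero mult_zero)
  qed
qed

sublocale nums: linordered_semidom "(\<oplus>)" "(\<ominus>)" "(\<preceq>\<preceq>)" "(\<prec>)" \<zero> "(\<otimes>)" \<one>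
proof unfold_locales
  show "a \<oplus> b \<oplus> c = a \<oplus> (b \<oplus> c)" for a b c by (rule num_add_assoc)
  show "a \<oplus> b = b \<oplus> a" for a b by (rule num_add_commute)
  show "\<zero> \<oplus> a = a" for a by (rule zero_add)
  show "a \<oplus> b \<ominus> a = b" for a b by (rule add_num_minus)
  show "a \<ominus> b \<ominus> c = a \<ominus> (b \<oplus> c)" for a b c by (rule minus_minus)
  show "(a \<oplus> b) \<otimes> c = a \<otimes> c \<oplus> b \<otimes> c" for a b c
    using num_distrib num_mult_commute by metis
  show "a \<otimes> b \<otimes> c = a \<otimes> (b \<otimes> c)" for a b c by (rule num_mult_assoc)
  show "a \<otimes> b = b \<otimes> a" for a b by (rule num_mult_commute)
  show "\<one> \<otimes> a = a" for a by (metis num_mult_one num_mult_commute)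
  show "\<zero> \<noteq> \<one>" by (metis succ_neq_zero zero_add)
  show "\<zero> \<prec> \<one>" by (metis less_succ zero_or_pos zero_add)
  show "a \<otimes> (b \<ominus> c) = a \<otimes> b \<ominus> a \<otimes> c" for a b c by (rule mult_minus)
  show "a \<ominus> b \<oplus> b = a" if "b \<preceq>\<preceq> a" for a b
    using num_le_minus[OF that] num_add_commute by metis
  show "(a \<prec> b) = (a \<preceq>\<preceq> b \<and> \<not> b \<preceq>\<preceq> a)" for a b
    using num_less_irrefl num_less_trans by (auto simp: num_le_def)
  show "a \<preceq>\<preceq> a" for a by (simp add: num_le_def)
  show "a \<preceq>\<preceq> c" if "a \<preceq>\<preceq> b" "b \<preceq>\<preceq> c" for a b c using that by (rule num_le_trans)
  show "a = b" if "a \<preceq>\<preceq> b" "b \<preceq>\<preceq> a" for a b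
    using that num_less_irrefl num_less_trans by (auto simp: num_le_def)
  show "a \<preceq>\<preceq> b \<or> b \<preceq>\<preceq> a" for a b
    using num_less_linear by (auto simp: num_le_def)
  show "c \<oplus> a \<preceq>\<preceq> c \<oplus> b" if "a \<preceq>\<preceq> b" for a b c
    using that num_add_less by (auto simp: num_le_def num_add_commute)
  show "c \<otimes> a \<prec> c \<otimes> b" if "a \<prec> b" "\<zero> \<prec> c" for a b c
    using that by (rule num_mult_less)
  show "a \<otimes> b \<noteq> \<zero>" if "a \<noteq> \<zero>" "b \<noteq> \<zero>" for a b
    using that num_mult_less[of \<zero> b a] zero_or_pos[of a] zero_or_pos[of b] num_less_irrefl
    by (auto simp: mult_zero)
qed (auto simp: zero_mult mult_zero num_distrib)

declare nums.one_add_one [simp del]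

lemmas num_ac = nums.add.assoc nums.add.commute nums.add.left_commute
  nums.mult.assoc nums.mult.commute nums.mult.left_commute nums.distrib_left nums.distrib_right

lemma less_succ_iff_le: "a \<prec> b \<oplus> \<one> \<longleftrightarrow> a \<preceq>\<preceq> b"
  by (simp add: less_succ num_le_def)

lemma succ_le_iff: "a \<oplus> \<one> \<preceq>\<preceq> b \<longleftrightarrow> a \<prec> b"
  by (metis less_succ_iff_le nums.add_less_cancel_right nums.not_less)

lemma zero_le [simp]: "\<zero> \<preceq>\<preceq> a"
  using zero_or_pos[of a] by (auto simp: num_le_def)

lemma num_neq_zero_iff: "a \<noteq> \<zero> \<longleftrightarrow> \<zero> \<prec> a"
  using zero_or_pos nums.less_irrefl by auto

lemma less_succ_self [simp]: "a \<prec> a \<oplus> \<one>"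
  by (simp add: less_succ)

lemma num_cases: obtains "n = \<zero>" | m where "n = m \<oplus> \<one>"
  using zero_or_pos[of n] less_imp_ex_add[of \<zero> n] by auto


subsection \<open>Pairs\<close>

lemma square_ge: "a \<preceq>\<preceq> a \<otimes> a"
proof (cases a rule: num_cases)
  case (2 m)
  then have "a \<otimes> a = a \<oplus> a \<otimes> m"
    by (simp add: num_ac)
  then show ?thesis
    using le_add by simp
qed simp

lemma le_pair: "i \<oplus> j \<preceq>\<preceq> \<langle>i, j\<rangle>"
  unfolding pair_def using square_ge nums.order_trans le_add by blast

lemma le_pair1: "i \<preceq>\<preceq> \<langle>i, j\<rangle>" and le_pair2: "j \<preceq>\<preceq> \<langle>i, j\<rangle>"
  using nums.order_trans[OF _ le_pair, of _ i j] le_add[of i j] le_add[of j i]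
  by (auto simp: nums.add.commute)

text \<open>The pairs with sum \<open>s\<close> have codes from \<open>s^2\<close> to
  \<open>s^2 + s\<close>, and \<open>s^2 + s < (s + 1)^2\<close>, so that different sums occupy
  disjoint intervals. Hence a code determines first the sum and then the pair.\<close>

lemma pair_sum_less:
  assumes "i \<oplus> j \<prec> k \<oplus> l"
  shows "\<langle>i, j\<rangle> \<prec> \<langle>k, l\<rangle>"
proof -
  define s where "s = i \<oplus> j"
  have "s \<oplus> \<one> \<preceq>\<preceq> k \<oplus> l"
    using assms by (simp add: s_def succ_le_iff)
  then have "(s \<oplus> \<one>) \<otimes> (s \<oplus> \<one>) \<preceq>\<preceq> (k \<oplus> l) \<otimes> (k \<oplus> l)"
    by (intro nums.mult_mono) auto
  moreover have "(s \<oplus> \<one>) \<otimes> (s \<oplus> \<one>) = s \<otimes> s \<oplus> s \<oplus> s \<oplus> \<one>"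
    by (simp add: num_ac)
  moreover have "s \<otimes> s \<oplus> i \<preceq>\<preceq> s \<otimes> s \<oplus> s \<oplus> s"
    using le_add[of i j] nums.order_trans[OF _ le_add, of "s \<otimes> s \<oplus> i" "s \<otimes> s \<oplus> s" s]
    by (auto simp: s_def)
  ultimately have "s \<otimes> s \<oplus> i \<prec> (k \<oplus> l) \<otimes> (k \<oplus> l)"
    by (metis less_succ_iff_le nums.less_le_trans)
  then show ?thesis
    unfolding pair_def s_def using le_add nums.less_le_trans by blast
qed

lemma pair_eq_iff [simp]: "\<langle>i, j\<rangle> = \<langle>k, l\<rangle> \<longleftrightarrow> i = k \<and> j = l"
proof
  assume eq: "\<langle>i, j\<rangle> = \<langle>k, l\<rangle>"
  then have "i \<oplus> j = k \<oplus> l"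
    using pair_sum_less[of i j k l] pair_sum_less[of k l i j] nums.less_irrefl num_less_linear
    by metis
  then show "i = k \<and> j = l"
    using eq unfolding pair_def by (metis nums.add_left_cancel)
qed simp

lemma p1_pair [simp]: "p1 \<langle>i, j\<rangle> = i" and p2_pair [simp]: "p2 \<langle>i, j\<rangle> = j"
  by (auto simp: p1_def p2_def)

section \<open>Closure properties of definable relations\<close>

lemma Delta0_subst_vars:
  assumes "Delta0 P" and inj: "inj_on h {i. b i}"
  shows "Delta0 (\<lambda>e. P (\<lambda>i. if b i then e (h i) else d i))"
proof -
  obtain \<phi> c E where E: "\<forall>V. E V \<in> Sets" and \<phi>: "\<And>e. P e \<longleftrightarrow> sat \<phi> (interleave e c) E"
    using assms(1) unfolding Delta0_def by blast
  define f where "f i = (if even i then if b (i div 2) then 2 * h (i div 2) else 2 * i + 1 else 2 * i + 1)" for i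
  have "inj f"
  proof (rule injI)
    fix i j assume *: "f i = f j"
    have odd: "even (f i) \<longleftrightarrow> even i \<and> b (i div 2)" for i
      by (simp add: f_def)
    show "i = j"
    proof (cases "even (f i)")
      case True
      then have "even i" "even j" "b (i div 2)" "b (j div 2)"
        using * odd[of i] odd[of j] by simp_all
      then have "2 * h (i div 2) = 2 * h (j div 2)" "b (i div 2)" "b (j div 2)"
        using * by (simp_all only: f_def if_True)
      then have "i div 2 = j div 2"
        using inj by (simp add: inj_on_def)
      then show ?thesis
        using \<open>even i\<close> \<open>even j\<close> by presburger
    next
      case False
      then have "\<not> (even i \<and> b (i div 2))" "\<not> (even j \<and> b (j div 2))"
        unfolding odd[symmetric] using False * by simp_all
      then have "f i = 2 * i + 1" "f j = 2 * j + 1"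
        unfolding f_def by (simp_all only: if_False split: if_split) blast+
      then have "2 * i + 1 = 2 * j + 1"
        using * by metis
      then show ?thesis by simp
    qed
  qed
  moreover have "sat \<phi> (\<lambda>i. interleave e (interleave d c) (f i)) E =
      sat \<phi> (interleave (\<lambda>i. if b i then e (h i) else d i) c) E" for e
  proof -
    have "interleave e (interleave d c) (f i) = interleave (\<lambda>i. if b i then e (h i) else d i) c i" for i
    proof -
      have "interleave e (interleave d c) (2 * i + 1) = interleave d c i"
        by (simp add: interleave_def)
      then show ?thesis
        by (simp add: interleave_def f_def)
    qed
    then show ?thesis by simp
  qed
  ultimately show ?thesis
    unfolding Delta0_def
    by (intro exI[of _ "rename f id \<phi>"] exI[of _ "interleave d c"] exI[of _ E])
      (simp add: sat_rename E \<phi>)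
qed

lemma Sigma1_subst_vars:
  assumes "Sigma1 P" "inj_on h {i. b i}"
  shows "Sigma1 (\<lambda>e. P (\<lambda>i. if b i then e (h i) else d i))"
proof -
  obtain Q where Q: "Delta0 Q" "\<And>e. P e \<longleftrightarrow> (\<exists>m. Q (case_nat m e))"
    using assms(1) unfolding Sigma1_def by blast
  have "Delta0 (\<lambda>e. Q (\<lambda>i. if case_nat True b i then e (case_nat 0 (\<lambda>i. Suc (h i)) i) else case_nat \<zero> d i))"
    using assms(2) by (intro Delta0_subst_vars Q) (auto simp: inj_on_def split: nat.splits)
  moreover have "(\<lambda>i. if case_nat True b i then (case_nat m e) (case_nat 0 (\<lambda>i. Suc (h i)) i) else case_nat \<zero> d i) =
      case_nat m (\<lambda>i. if b i then e (h i) else d i)" for m e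
    by (auto simp: fun_eq_iff split: nat.split)
  ultimately show ?thesis
    unfolding Sigma1_def by (intro exI conjI allI) (auto simp: Q)
qed

lemma Sigma1_reindex: "Sigma1 P \<Longrightarrow> inj h \<Longrightarrow> Sigma1 (\<lambda>e. P (\<lambda>i. e (h i)))"
  using Sigma1_subst_vars[of P h "\<lambda>_. True"] by (simp add: inj_on_def)

text \<open>Two unbounded quantifiers are contracted to a common bound \<open>z\<close>, below which
  both witnesses are sought; \<open>x \<oplus> m\<close> is such a bound. The matrix remains
  bounded.\<close>

lemma Sigma1_ex:
  assumes "Sigma1 (\<lambda>e. P (\<lambda>i. e (Suc i)) (e 0))"
  shows "Sigma1 (\<lambda>e. \<exists>x. P e x)"
proof -
  obtain Q where Q: "Delta0 Q" "\<And>e. P (\<lambda>i. e (Suc i)) (e 0) \<longleftrightarrow> (\<exists>m. Q (case_nat m e))"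
    using assms unfolding Sigma1_def by blast
  have P: "P e x \<longleftrightarrow> (\<exists>m. Q (case_nat m (case_nat x e)))" for e x
    using Q(2)[of "case_nat x e"] by simp
  define R where "R e m x \<longleftrightarrow> Q (case_nat m (case_nat x (\<lambda>i. e (Suc i))))" for e m x
  have "Delta0 (\<lambda>e. \<exists>x. x \<prec> e 0 \<oplus> \<one> \<and> (\<exists>m. m \<prec> e 0 \<oplus> \<one> \<and> R e m x))"
  proof (intro Delta0_intros)
    have "inj (\<lambda>i. case i of 0 \<Rightarrow> 0 | Suc 0 \<Rightarrow> Suc 0 | Suc (Suc j) \<Rightarrow> Suc (Suc (Suc j)))"
      by (auto simp: inj_def split: nat.splits)
    from Delta0_reindex[OF this Q(1)]
    show "Delta0 (\<lambda>e. R (\<lambda>i. e (Suc (Suc i))) (e 0) (e (Suc 0)))"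
      unfolding R_def by (rule back_subst[of Delta0])
        (auto intro!: ext arg_cong[of _ _ Q] split: nat.split)
  qed
  moreover have "(\<exists>x. P e x) \<longleftrightarrow> (\<exists>z x. x \<prec> z \<oplus> \<one> \<and> (\<exists>m. m \<prec> z \<oplus> \<one> \<and> R (case_nat z e) m x))" for e
  proof
    assume "\<exists>x. P e x"
    then obtain x m where "Q (case_nat m (case_nat x e))"
      using P by blast
    then show "\<exists>z x. x \<prec> z \<oplus> \<one> \<and> (\<exists>m. m \<prec> z \<oplus> \<one> \<and> R (case_nat z e) m x)"
      by (intro exI[of _ "x \<oplus> m"] exI[of _ x] exI[of _ m] conjI)
        (simp_all add: less_succ_iff_le R_def nums.add_increasing nums.add_increasing2)
  qed (auto simp: R_def P)
  ultimately show ?thesis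
    unfolding Sigma1_def
    by (intro exI[of _ "\<lambda>e. \<exists>x. x \<prec> e 0 \<oplus> \<one> \<and> (\<exists>m. m \<prec> e 0 \<oplus> \<one> \<and> R e m x)"]) simp
qed

lemma Sigma1_common:
  assumes "Sigma1 P" "Sigma1 Q"
  obtains P' Q' where "Delta0 P'" "Delta0 Q'"
    "\<And>e. P e \<longleftrightarrow> (\<exists>m. P' (case_nat m e))" "\<And>e. Q e \<longleftrightarrow> (\<exists>m. Q' (case_nat m e))"
  using assms unfolding Sigma1_def by blast

lemma Sigma1_or:
  assumes "Sigma1 P" "Sigma1 Q"
  shows "Sigma1 (\<lambda>e. P e \<or> Q e)"
proof -
  obtain P' Q' where "Delta0 P'" "Delta0 Q'"
    "\<And>e. P e \<longleftrightarrow> (\<exists>m. P' (case_nat m e))" "\<And>e. Q e \<longleftrightarrow> (\<exists>m. Q' (case_nat m e))"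
    using Sigma1_common[OF assms] by blast
  then show ?thesis
    unfolding Sigma1_def
    by (intro exI[of _ "\<lambda>e. P' e \<or> Q' e"] conjI Delta0_or) auto
qed

lemma Sigma1_and:
  assumes "Sigma1 P" "Sigma1 Q"
  shows "Sigma1 (\<lambda>e. P e \<and> Q e)"
proof -
  obtain P' Q' where PQ: "Delta0 P'" "Delta0 Q'"
    "\<And>e. P e \<longleftrightarrow> (\<exists>m. P' (case_nat m e))" "\<And>e. Q e \<longleftrightarrow> (\<exists>m. Q' (case_nat m e))"
    using Sigma1_common[OF assms] by blast
  have inj: "inj (case_nat 0 (\<lambda>j. Suc (Suc j)))" "inj Suc"
    by (auto simp: inj_def split: nat.splits)
  have *: "case_nat m (case_nat k e) (case_nat 0 (\<lambda>j. Suc (Suc j)) i) = case_nat m e i" for m k e i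
    by (simp split: nat.split)
  have "Delta0 (\<lambda>e. P' (\<lambda>i. e (case_nat 0 (\<lambda>j. Suc (Suc j)) i)) \<and> Q' (\<lambda>i. e (Suc i)))"
    by (intro Delta0_and Delta0_reindex[OF inj(1) PQ(1)] Delta0_reindex[OF inj(2) PQ(2)])
  then have "Sigma1 (\<lambda>e. \<exists>k m. P' (case_nat m (\<lambda>i. e i)) \<and> Q' (case_nat k e))"
    by (intro Sigma1_ex Delta0_Sigma1)
       (rule back_subst[of Delta0], assumption, auto intro!: ext arg_cong2[of _ _ _ _ "(\<and>)"]
         arg_cong[of _ _ P'] arg_cong[of _ _ Q'] split: nat.split)
  then show ?thesis
    by (rule back_subst[of Sigma1]) (auto simp: PQ)
qed

lemma Sigma1_subst:
  assumes "Sigma1 (\<lambda>e. P (\<lambda>i. e (Suc i)) (e 0))" "def_fun t"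
  shows "Sigma1 (\<lambda>e. P e (t e))"
proof -
  have "Sigma1 (\<lambda>e. \<exists>x. x = t e \<and> P e x)"
    using assms by (intro Sigma1_ex Sigma1_and) (simp_all add: def_fun_def)
  then show ?thesis by simp
qed

text \<open>Collection follows from \<Sigma>1 induction on the length \<open>n\<close> of the
  segment of \<open>x\<close> that is already bounded: in each step the bound is raised beyond one
  more witness. The disjunct \<open>a \<prec> n\<close> makes the claim void outside the range of
  the hypothesis.\<close>

lemma Delta0_bounding:
  assumes Q: "Delta0 Q" and ex: "\<And>x. x \<prec> a \<Longrightarrow> \<exists>m. Q (case_nat m (case_nat x e))"
  shows "\<exists>b. \<forall>x. x \<prec> a \<longrightarrow> (\<exists>m. m \<prec> b \<and> Q (case_nat m (case_nat x e)))"
proof -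
  define R where "R m x \<longleftrightarrow> Q (case_nat m (case_nat x e))" for m x
  have R: "Delta0 (\<lambda>e. R (e 0) (e (Suc 0)))"
  proof -
    have "Delta0 (\<lambda>e'. Q (\<lambda>i. if i < 2 then e' i else e (i - 2)))"
      by (rule Delta0_subst_vars) (auto simp: Q)
    then show ?thesis
      unfolding R_def by (rule back_subst[of Delta0])
        (auto intro!: ext arg_cong[of _ _ Q] split: nat.split)
  qed
  have "a \<prec> n \<or> (\<exists>b. \<forall>x. x \<prec> n \<longrightarrow> (\<exists>m. m \<prec> b \<and> R m x))" for n
  proof (rule Sigma1_induct[where P = "\<lambda>n. a \<prec> n \<or> (\<exists>b. \<forall>x. x \<prec> n \<longrightarrow> (\<exists>m. m \<prec> b \<and> R m x))"])
    show "Sigma1 (\<lambda>e. a \<prec> e 0 \<or> (\<exists>b. \<forall>x. x \<prec> e 0 \<longrightarrow> (\<exists>m. m \<prec> b \<and> R m x)))"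
      by (intro Sigma1_or Sigma1_ex Delta0_Sigma1; intro Delta0_intros R)
    fix n assume IH: "a \<prec> n \<or> (\<exists>b. \<forall>x. x \<prec> n \<longrightarrow> (\<exists>m. m \<prec> b \<and> R m x))"
    show "a \<prec> n \<oplus> \<one> \<or> (\<exists>b. \<forall>x. x \<prec> n \<oplus> \<one> \<longrightarrow> (\<exists>m. m \<prec> b \<and> R m x))"
    proof (cases "a \<prec> n \<oplus> \<one>")
      case False
      then have "n \<prec> a"
        by (metis less_succ num_less_linear)
      with IH obtain b where b: "\<forall>x. x \<prec> n \<longrightarrow> (\<exists>m. m \<prec> b \<and> R m x)"
        using nums.less_asym by blast
      obtain m where m: "R m n"
        using ex[OF \<open>n \<prec> a\<close>] by (auto simp: R_def)
      have "b \<preceq>\<preceq> b \<oplus> (m \<oplus> \<one>)" "m \<prec> b \<oplus> (m \<oplus> \<one>)"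
        by (auto simp: nums.add_increasing2 nums.add_strict_increasing2 intro: le_add)
      moreover have "\<exists>m'. m' \<prec> b \<oplus> (m \<oplus> \<one>) \<and> R m' x" if "x \<prec> n \<oplus> \<one>" for x
      proof (cases "x = n")
        case False
        then have "x \<prec> n"
          using that by (simp add: less_succ)
        then show ?thesis
          using b \<open>b \<preceq>\<preceq> _\<close> nums.less_le_trans by blast
      qed (use m \<open>m \<prec> _\<close> in blast)
      ultimately show ?thesis by blast
    qed simp
  qed simp
  from this[of a] show ?thesis
    by (simp add: R_def)
qed

text \<open>By collection, the witnesses for all \<open>x\<close> below \<open>t e\<close> have a
  common bound \<open>b\<close>; then the quantifier over \<open>b\<close> comes first and all
  others are bounded.\<close>

lemma Sigma1_ball:
  assumes P: "Sigma1 (\<lambda>e. P (\<lambda>i. e (Suc i)) (e 0))" and t: "def_fun t"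
  shows "Sigma1 (\<lambda>e. \<forall>x. x \<prec> t e \<longrightarrow> P e x)"
proof -
  obtain Q where Q: "Delta0 Q" "\<And>e. P (\<lambda>i. e (Suc i)) (e 0) \<longleftrightarrow> (\<exists>m. Q (case_nat m e))"
    using P unfolding Sigma1_def by blast
  have P: "P e x \<longleftrightarrow> (\<exists>m. Q (case_nat m (case_nat x e)))" for e x
    using Q(2)[of "case_nat x e"] by simp
  have *: "Delta0 (\<lambda>e. Q (case_nat (e 0) (case_nat (e (Suc 0)) (\<lambda>i. e (Suc (Suc (Suc (Suc i))))))))"
  proof -
    have "inj (\<lambda>i. case i of 0 \<Rightarrow> 0 | Suc 0 \<Rightarrow> Suc 0 | Suc (Suc j) \<Rightarrow> Suc (Suc (Suc (Suc j))))"
      by (auto simp: inj_def split: nat.splits)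
    from Delta0_reindex[OF this Q(1)] show ?thesis
      by (rule back_subst[of Delta0]) (auto intro!: ext arg_cong[of _ _ Q] split: nat.split)
  qed
  have "Sigma1 (\<lambda>e. \<exists>a. a = t e \<and> (\<exists>b. \<forall>x. x \<prec> a \<longrightarrow> (\<exists>m. m \<prec> b \<and> Q (case_nat m (case_nat x e)))))"
    by (intro Sigma1_ex Sigma1_and)
       (use t in \<open>simp add: def_fun_def\<close>, intro Sigma1_ex Delta0_Sigma1 Delta0_intros *)
  then show ?thesis
  proof (rule back_subst[of Sigma1], intro ext iffI)
    fix e assume "\<forall>x. x \<prec> t e \<longrightarrow> P e x"
    then show "\<exists>a. a = t e \<and> (\<exists>b. \<forall>x. x \<prec> a \<longrightarrow> (\<exists>m. m \<prec> b \<and> Q (case_nat m (case_nat x e))))"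
      using Delta0_bounding[OF Q(1), of "t e" e] P by simp
  qed (use P in blast)
qed

section \<open>Rules for \<Delta>1 relations and definable functions\<close>

lemma Delta1_Sigma1: "Delta1 P \<Longrightarrow> Sigma1 P"
  by (simp add: Delta1_def)

lemma Delta0_Delta1: "Delta0 P \<Longrightarrow> Delta1 P"
  by (simp add: Delta1_def Delta0_Sigma1 Delta0_not)

named_theorems definable

lemma Delta1_const [definable]: "Delta1 (\<lambda>e. P)"
proof (cases P)
  case True
  have "Delta1 (\<lambda>e. \<zero> = \<zero>)" by (intro Delta0_Delta1 Delta0_intros)
  then show ?thesis using True by simp
next
  case False
  have "Delta1 (\<lambda>e. \<zero> = \<one>)" by (intro Delta0_Delta1 Delta0_intros)
  then show ?thesis using False by simp
qed

lemma Delta1_not [definable]: "Delta1 P \<Longrightarrow> Delta1 (\<lambda>e. \<not> P e)"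
  by (simp add: Delta1_def)

lemma Delta1_and [definable]: "Delta1 P \<Longrightarrow> Delta1 Q \<Longrightarrow> Delta1 (\<lambda>e. P e \<and> Q e)"
  unfolding Delta1_def de_Morgan_conj by (intro conjI Sigma1_and Sigma1_or; simp)

lemma Delta1_or [definable]: "Delta1 P \<Longrightarrow> Delta1 Q \<Longrightarrow> Delta1 (\<lambda>e. P e \<or> Q e)"
  unfolding Delta1_def de_Morgan_disj by (intro conjI Sigma1_and Sigma1_or; simp)

lemma Delta1_imp [definable]: "Delta1 P \<Longrightarrow> Delta1 Q \<Longrightarrow> Delta1 (\<lambda>e. P e \<longrightarrow> Q e)"
  unfolding imp_conv_disj by (intro Delta1_or Delta1_not)

lemma Delta1_iff [definable]: "Delta1 P \<Longrightarrow> Delta1 Q \<Longrightarrow> Delta1 (\<lambda>e. P e \<longleftrightarrow> Q e)"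
  unfolding iff_conv_conj_imp by (intro definable)


lemma def_fun_var [definable]: "def_fun (\<lambda>e. e n)"
  unfolding def_fun_def by (intro Delta0_Sigma1 Delta0_intros)

lemma def_fun_const [definable]: "def_fun (\<lambda>e. a)"
  unfolding def_fun_def by (intro Delta0_Sigma1 Delta0_intros)

lemma def_fun_shift:
  assumes "def_fun t"
  shows "def_fun (\<lambda>e. t (\<lambda>i. e (Suc i)))"
proof -
  have "Sigma1 (\<lambda>e. e (case_nat 0 (\<lambda>i. Suc (Suc i)) 0) = t (\<lambda>i. e (case_nat 0 (\<lambda>i. Suc (Suc i)) (Suc i))))"
    by (rule Sigma1_reindex[OF assms[unfolded def_fun_def]]) (auto simp: inj_def split: nat.splits)
  then show ?thesis
    by (simp add: def_fun_def)
qed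

lemma Delta1_shift:
  assumes "Delta1 P"
  shows "Delta1 (\<lambda>e. P (\<lambda>i. e (Suc i)))"
  using assms Sigma1_reindex[of P Suc] Sigma1_reindex[of "\<lambda>e. \<not> P e" Suc] by (simp add: Delta1_def)

lemma Sigma1_subst2:
  assumes P: "Sigma1 (\<lambda>e. P (e 0) (e (Suc 0)))" and s: "def_fun s" and t: "def_fun t"
  shows "Sigma1 (\<lambda>e. P (s e) (t e))"
proof (rule Sigma1_subst[OF _ t])
  show "Sigma1 (\<lambda>e. P (s (\<lambda>i. e (Suc i))) (e 0))"
    by (rule Sigma1_subst[OF _ def_fun_shift[OF s]]) (rule P)
qed

lemma Delta1_subst2:
  assumes "Delta1 (\<lambda>e. P (e 0) (e (Suc 0)))" "def_fun s" "def_fun t"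
  shows "Delta1 (\<lambda>e. P (s e) (t e))"
  using assms Sigma1_subst2[of P] Sigma1_subst2[of "\<lambda>x y. \<not> P x y"] by (simp add: Delta1_def)

lemma Delta1_eq [definable]: "def_fun s \<Longrightarrow> def_fun t \<Longrightarrow> Delta1 (\<lambda>e. s e = t e)"
  by (rule Delta1_subst2) (intro Delta0_Delta1 Delta0_intros)

lemma Delta1_less [definable]: "def_fun s \<Longrightarrow> def_fun t \<Longrightarrow> Delta1 (\<lambda>e. s e \<prec> t e)"
  by (rule Delta1_subst2) (intro Delta0_Delta1 Delta0_intros)

lemma Delta1_le [definable]: "def_fun s \<Longrightarrow> def_fun t \<Longrightarrow> Delta1 (\<lambda>e. s e \<preceq>\<preceq> t e)"
  unfolding num_le_def by (intro definable)

lemma Delta1_mem [definable]: "A \<in> Sets \<Longrightarrow> def_fun t \<Longrightarrow> Delta1 (\<lambda>e. t e \<in> A)"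
  by (rule Delta1_subst2[where P = "\<lambda>x y. x \<in> A"]) (intro Delta0_Delta1 Delta0_intros)

lemma Delta1_bex [definable]:
  assumes "Delta1 (\<lambda>e. P (\<lambda>i. e (Suc i)) (e 0))" "def_fun t"
  shows "Delta1 (\<lambda>e. \<exists>x. x \<prec> t e \<and> P e x)"
proof -
  have "Sigma1 (\<lambda>e. \<exists>x. x \<prec> t e \<and> P e x)"
    by (intro Sigma1_ex Sigma1_and Delta1_Sigma1[OF Delta1_less] def_fun_var def_fun_shift
        Delta1_Sigma1 assms)
  moreover have "Sigma1 (\<lambda>e. \<forall>x. x \<prec> t e \<longrightarrow> \<not> P e x)"
    using assms by (intro Sigma1_ball) (auto simp: Delta1_def)
  ultimately show ?thesis
    by (simp add: Delta1_def)
qed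

lemma Delta1_ball [definable]:
  assumes "Delta1 (\<lambda>e. P (\<lambda>i. e (Suc i)) (e 0))" "def_fun t"
  shows "Delta1 (\<lambda>e. \<forall>x. x \<prec> t e \<longrightarrow> P e x)"
proof -
  have "Delta1 (\<lambda>e. \<not> (\<exists>x. x \<prec> t e \<and> \<not> P e x))"
    by (intro definable assms)
  then show ?thesis
    by (rule back_subst[of Delta1]) blast
qed

lemma def_fun_subst3:
  assumes f: "def_fun (\<lambda>e. f (e 0) (e (Suc 0)) (e (Suc (Suc 0))))"
    and r: "def_fun r" and s: "def_fun s" and t: "def_fun t"
  shows "def_fun (\<lambda>e. f (r e) (s e) (t e))"
proof -
  \<comment> \<open>The graph has the value at variable 0 and the arguments at 1, 2, 3. Substitution
    acts on variable 0, so the value is moved behind the arguments, which are then replaced one by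
    one.\<close>
  define h :: "nat \<Rightarrow> nat" where
    "h i = (case i of 0 \<Rightarrow> 3 | Suc 0 \<Rightarrow> 0 | Suc (Suc 0) \<Rightarrow> 1 | Suc (Suc (Suc 0)) \<Rightarrow> 2 | _ \<Rightarrow> i)" for i
  have "inj h"
    by (auto simp: inj_def h_def split: nat.splits)
  from Sigma1_reindex[OF f[unfolded def_fun_def] this]
  have "Sigma1 (\<lambda>e. e 3 = f (e 0) (e 1) (e 2))"
    by (simp add: h_def)
  then have *: "Sigma1 (\<lambda>e. e (Suc (Suc (Suc 0))) = f (e 0) (e (Suc 0)) (e (Suc (Suc 0))))"
    by (simp add: numeral_3_eq_3 numeral_2_eq_2)
  have "Sigma1 (\<lambda>e. e 0 = f (r (\<lambda>i. e (Suc i))) (s (\<lambda>i. e (Suc i))) (t (\<lambda>i. e (Suc i))))"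
    apply (rule Sigma1_subst[where P = "\<lambda>e. (=) (e 0) \<circ> f (r (\<lambda>i. e (Suc i))) (s (\<lambda>i. e (Suc i)))", unfolded o_def, OF _ def_fun_shift[OF t]])
    apply (rule Sigma1_subst[where P = "\<lambda>e x. e (Suc 0) = f (r (\<lambda>i. e (Suc (Suc i)))) x (e 0)", OF _ def_fun_shift[OF def_fun_shift[OF s]]])
    apply (rule Sigma1_subst[where P = "\<lambda>e x. e (Suc (Suc 0)) = f x (e 0) (e (Suc 0))", OF _ def_fun_shift[OF def_fun_shift[OF def_fun_shift[OF r]]]])
    by (rule *)
  then show ?thesis
    by (simp add: def_fun_def)
qed

lemma def_fun_subst2:
  assumes "def_fun (\<lambda>e. f (e 0) (e (Suc 0)))" "def_fun s" "def_fun t"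
  shows "def_fun (\<lambda>e. f (s e) (t e))"
  using def_fun_subst3[of "\<lambda>x y z. f x y" s t "\<lambda>_. \<zero>"] assms def_fun_const by simp

lemma def_fun_subst1:
  assumes "def_fun (\<lambda>e. f (e 0))" "def_fun t"
  shows "def_fun (\<lambda>e. f (t e))"
  using def_fun_subst3[of "\<lambda>x y z. f x" t "\<lambda>_. \<zero>" "\<lambda>_. \<zero>"] assms def_fun_const by simp

lemma def_fun_comp3:
  assumes "Delta1 (\<lambda>e. e 0 = f (e (Suc 0)) (e (Suc (Suc 0))) (e (Suc (Suc (Suc 0)))))"
    "def_fun r" "def_fun s" "def_fun t"
  shows "def_fun (\<lambda>e. f (r e) (s e) (t e))"
  by (rule def_fun_subst3[OF _ assms(2-4)]) (simp add: def_fun_def Delta1_Sigma1[OF assms(1)])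

lemma def_fun_comp2:
  assumes "Delta1 (\<lambda>e. e 0 = f (e (Suc 0)) (e (Suc (Suc 0))))" "def_fun s" "def_fun t"
  shows "def_fun (\<lambda>e. f (s e) (t e))"
  by (rule def_fun_subst2[OF _ assms(2,3)]) (simp add: def_fun_def Delta1_Sigma1[OF assms(1)])

lemma def_fun_comp1:
  assumes "Delta1 (\<lambda>e. e 0 = f (e (Suc 0)))" "def_fun t"
  shows "def_fun (\<lambda>e. f (t e))"
  by (rule def_fun_subst1[OF _ assms(2)]) (simp add: def_fun_def Delta1_Sigma1[OF assms(1)])

lemma def_fun_add [definable]: "def_fun s \<Longrightarrow> def_fun t \<Longrightarrow> def_fun (\<lambda>e. s e \<oplus> t e)"
  by (rule def_fun_comp2) (intro Delta0_Delta1 Delta0_intros)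

lemma def_fun_mult [definable]: "def_fun s \<Longrightarrow> def_fun t \<Longrightarrow> def_fun (\<lambda>e. s e \<otimes> t e)"
  by (rule def_fun_comp2) (intro Delta0_Delta1 Delta0_intros)

lemma def_fun_pair [definable]: "def_fun s \<Longrightarrow> def_fun t \<Longrightarrow> def_fun (\<lambda>e. \<langle>s e, t e\<rangle>)"
  unfolding pair_def by (intro definable)

lemma def_fun_if [definable]:
  assumes "Delta1 P" "def_fun s" "def_fun t"
  shows "def_fun (\<lambda>e. if P e then s e else t e)"
proof -
  have "Sigma1 (\<lambda>e. P (\<lambda>i. e (Suc i)) \<and> e 0 = s (\<lambda>i. e (Suc i)) \<or>
                  \<not> P (\<lambda>i. e (Suc i)) \<and> e 0 = t (\<lambda>i. e (Suc i)))"
    using assms by (intro Delta1_Sigma1 definable Delta1_shift def_fun_shift)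
  then show ?thesis
    unfolding def_fun_def by (rule back_subst[of Sigma1]) auto
qed

lemma Delta1_if [definable]:
  assumes "Delta1 P" "Delta1 Q" "Delta1 R"
  shows "Delta1 (\<lambda>e. if P e then Q e else R e)"
  unfolding if_bool_eq_conj by (intro definable assms)

text \<open>\<open>\<Sigma>\<^sup>0\<^sub>1\<close> induction gives \<open>\<Pi>\<^sup>0\<^sub>1\<close> induction: if \<open>P a\<close> fails, then so does \<open>P (a - m)\<close> for all \<open>m\<close>.\<close>

lemma Pi1_induct:
  assumes "Sigma1 (\<lambda>e. \<not> P (e 0))" "P \<zero>" "\<And>n. P n \<Longrightarrow> P (n \<oplus> \<one>)"
  shows "P a"
proof (rule ccontr)
  assume "\<not> P a"
  have "a \<prec> m \<or> (\<exists>n. n \<oplus> m = a \<and> \<not> P n)" for m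
  proof (rule Sigma1_induct[where P = "\<lambda>m. a \<prec> m \<or> (\<exists>n. n \<oplus> m = a \<and> \<not> P n)"])
    show "Sigma1 (\<lambda>e. a \<prec> e 0 \<or> (\<exists>n. n \<oplus> e 0 = a \<and> \<not> P n))"
      by (intro Sigma1_or Sigma1_ex Sigma1_and Delta1_Sigma1[OF Delta1_less]
          Delta1_Sigma1[OF Delta1_eq] definable assms)
    fix m assume IH: "a \<prec> m \<or> (\<exists>n. n \<oplus> m = a \<and> \<not> P n)"
    show "a \<prec> m \<oplus> \<one> \<or> (\<exists>n. n \<oplus> (m \<oplus> \<one>) = a \<and> \<not> P n)"
    proof (cases "a \<prec> m \<oplus> \<one>")
      case False
      then obtain n where n: "n \<oplus> m = a" "\<not> P n"
        using IH by (auto simp: less_succ)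
      moreover have "n \<noteq> \<zero>"
        using n False by auto
      ultimately obtain n' where "n = n' \<oplus> \<one>"
        using num_cases by blast
      then show ?thesis
        using n assms(3) by (auto simp: nums.add.assoc nums.add.commute[of \<one>])
    qed simp
  qed (use \<open>\<not> P a\<close> in auto)
  from this[of a] assms(2) show False
    using nums.less_irrefl by auto
qed

lemma Delta1_induct:
  assumes "Delta1 (\<lambda>e. P (e 0))" "P \<zero>" "\<And>n. P n \<Longrightarrow> P (n \<oplus> \<one>)"
  shows "P n"
  using Sigma1_induct[of P] assms Delta1_Sigma1 by blast

lemma ex_least:
  assumes "Delta1 (\<lambda>e. P (e 0))" "P n"
  shows "\<exists>m. P m \<and> (\<forall>k. k \<prec> m \<longrightarrow> \<not> P k)"
proof (rule ccontr)
  assume *: "\<not> ?thesis"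
  have "\<forall>k. k \<prec> m \<longrightarrow> \<not> P k" for m
    by (rule Delta1_induct[where P = "\<lambda>m. \<forall>k. k \<prec> m \<longrightarrow> \<not> P k"])
      (intro definable assms(1), simp, use * in \<open>auto simp: less_succ\<close>)
  then show False
    using assms(2) less_succ_self by blast
qed

definition least :: "('m \<Rightarrow> bool) \<Rightarrow> 'm" where
  "least P = (THE m. P m \<and> (\<forall>k. k \<prec> m \<longrightarrow> \<not> P k))"

lemma least_eqI: "P m \<Longrightarrow> (\<And>k. k \<prec> m \<Longrightarrow> \<not> P k) \<Longrightarrow> least P = m"
  unfolding least_def by (rule the_equality) (use num_less_linear in blast)+

lemma
  assumes "Delta1 (\<lambda>e. P (e 0))" "P n"
  shows leastI: "P (least P)" and least_le: "least P \<preceq>\<preceq> n" and not_less_least: "k \<prec> least P \<Longrightarrow> \<not> P k"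
proof -
  obtain m where "P m" "\<And>k. k \<prec> m \<Longrightarrow> \<not> P k"
    using ex_least[of P, OF assms] by blast
  then show "P (least P)" "least P \<preceq>\<preceq> n" "k \<prec> least P \<Longrightarrow> \<not> P k"
    using least_eqI[of P m] \<open>P n\<close> nums.not_less by auto
qed

lemma Delta1_fix:
  assumes "Delta1 (\<lambda>e. P (\<lambda>i. e (Suc i)) (e 0))"
  shows "Delta1 (\<lambda>e. P d (e 0))"
proof -
  have "Sigma1 (\<lambda>e. P d (e 0))" if "Sigma1 (\<lambda>e. P (\<lambda>i. e (Suc i)) (e 0))" for P :: "(nat \<Rightarrow> 'm) \<Rightarrow> 'm \<Rightarrow> bool"
    using Sigma1_subst_vars[OF that, of id "\<lambda>i. i = 0" "\<lambda>i. d (i - 1)"] by simp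
  from this[of P] this[of "\<lambda>e x. \<not> P e x"] show ?thesis
    using assms unfolding Delta1_def by simp
qed

text \<open>Minimality is a condition on the numbers below the candidate, so the graph is \<Delta>1.
  The least number principle is applied for each fixed environment, to the predicate obtained by
  \<open>Delta1_fix\<close>.\<close>

lemma def_fun_least [definable]:
  assumes "Delta1 (\<lambda>e. P (\<lambda>i. e (Suc i)) (e 0))" "\<And>e. \<exists>x. P e x"
  shows "def_fun (\<lambda>e. least (P e))"
proof -
  have D: "Delta1 (\<lambda>e. P (\<lambda>i. e (Suc (Suc i))) (e 0))"
  proof -
    have "inj (case_nat 0 (\<lambda>i. Suc (Suc i)))"
      by (auto simp: inj_def split: nat.splits)
    from Sigma1_reindex[OF _ this] assms(1) show ?thesis
      unfolding Delta1_def by fastforce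
  qed
  have "Delta1 (\<lambda>e. P (\<lambda>i. e (Suc i)) (e 0) \<and> (\<forall>k. k \<prec> e 0 \<longrightarrow> \<not> P (\<lambda>i. e (Suc i)) k))"
    by (intro definable assms(1) D)
  moreover have "e 0 = least (P (\<lambda>i. e (Suc i))) \<longleftrightarrow>
    P (\<lambda>i. e (Suc i)) (e 0) \<and> (\<forall>k. k \<prec> e 0 \<longrightarrow> \<not> P (\<lambda>i. e (Suc i)) k)" for e
  proof -
    define d where "d = (\<lambda>i. e (Suc i))"
    obtain x where "P d x" using assms(2) by blast
    have D: "Delta1 (\<lambda>e. P d (e 0))"
      using assms(1) by (rule Delta1_fix)
    have "e 0 = least (P d) \<longleftrightarrow> P d (e 0) \<and> (\<forall>k. k \<prec> e 0 \<longrightarrow> \<not> P d k)"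
      using leastI[of "P d", OF D \<open>P d x\<close>] not_less_least[of "P d", OF D \<open>P d x\<close>] least_eqI[of "P d" "e 0"]
      by metis
    then show ?thesis
      by (simp only: d_def)
  qed
  ultimately show ?thesis
    unfolding def_fun_def using Delta1_Sigma1 by simp
qed

subsection \<open>Functions of the structure\<close>

text \<open>A pair bounds its components. The search for the argument is therefore bounded, and
  graphs of definable functions become sets of the structure.\<close>

lemma mem_pairs_iff: "z \<in> {\<langle>n, f n\<rangle> |n. n \<in> A} \<longleftrightarrow> (\<exists>n. n \<prec> z \<oplus> \<one> \<and> n \<in> A \<and> z = \<langle>n, f n\<rangle>)"
  using le_pair1 by (auto simp: less_succ_iff_le)

lemma fn_onI:
  assumes "def_fun (\<lambda>e. f (e 0))" "A \<in> Sets"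
  shows "fn_on A f"
proof -
  have "{z. \<exists>n. n \<prec> z \<oplus> \<one> \<and> n \<in> A \<and> z = \<langle>n, f n\<rangle>} \<in> Sets"
    by (intro comprehension definable def_fun_subst1[OF assms(1)] assms(2))
  then show ?thesis
    unfolding fn_on_def mem_pairs_iff[symmetric] Collect_mem_eq .
qed

lemma UNIV_in_Sets [simp]: "UNIV \<in> Sets"
  using comprehension[of "\<lambda>_. True"] Delta1_const by simp

lemma def_fun_fn:
  assumes "fn_on UNIV f" "def_fun t"
  shows "def_fun (\<lambda>e. f (t e))"
proof (rule def_fun_comp1[OF _ assms(2)])
  have "Delta1 (\<lambda>e. \<langle>e (Suc 0), e 0\<rangle> \<in> {\<langle>n, f n\<rangle> | n. n \<in> UNIV})"
    using assms(1) unfolding fn_on_def by (intro definable)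
  then show "Delta1 (\<lambda>e. e 0 = f (e (Suc 0)))"
    by simp
qed

lemma def_fun_p1 [definable]: "def_fun t \<Longrightarrow> def_fun (\<lambda>e. p1 (t e))"
proof (erule def_fun_comp1[rotated])
  \<comment> \<open>On a number that is no pair, \<open>p1\<close> takes the unspecified value of an
    empty description. Treating this value as a parameter makes \<open>p1\<close> definable for all
    arguments.\<close>
  define junk :: 'm where "junk = (THE i. False)"
  have p: "y = p1 z \<longleftrightarrow> (\<exists>j. j \<prec> z \<oplus> \<one> \<and> z = \<langle>y, j\<rangle>) \<or>
     \<not> (\<exists>i. i \<prec> z \<oplus> \<one> \<and> (\<exists>j. j \<prec> z \<oplus> \<one> \<and> z = \<langle>i, j\<rangle>)) \<and> y = junk" for y z
  proof (cases "\<exists>i j. z = \<langle>i, j\<rangle>")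
    case True
    then show ?thesis
      using le_pair1 le_pair2 unfolding less_succ_iff_le by (metis p1_pair p2_pair)
  next
    case False
    then show ?thesis
      by (auto simp: p1_def junk_def)
  qed
  show "Delta1 (\<lambda>e. e 0 = p1 (e (Suc 0)))"
    unfolding p by (intro definable)
qed

lemma def_fun_p2 [definable]: "def_fun t \<Longrightarrow> def_fun (\<lambda>e. p2 (t e))"
proof (erule def_fun_comp1[rotated])
  define junk :: 'm where "junk = (THE i. False)"
  have p: "y = p2 z \<longleftrightarrow> (\<exists>j. j \<prec> z \<oplus> \<one> \<and> z = \<langle>j, y\<rangle>) \<or>
     \<not> (\<exists>i. i \<prec> z \<oplus> \<one> \<and> (\<exists>j. j \<prec> z \<oplus> \<one> \<and> z = \<langle>i, j\<rangle>)) \<and> y = junk" for y z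
  proof (cases "\<exists>i j. z = \<langle>i, j\<rangle>")
    case True
    then show ?thesis
      using le_pair1 le_pair2 unfolding less_succ_iff_le by (metis p1_pair p2_pair)
  next
    case False
    then show ?thesis
      by (auto simp: p2_def junk_def)
  qed
  show "Delta1 (\<lambda>e. e 0 = p2 (e (Suc 0)))"
    unfolding p by (intro definable)
qed

section \<open>Finite sets and sequences\<close>

abbreviation num_dvd (infix "divides" 50) where "num_dvd \<equiv> dvd.dvd (\<otimes>)"

lemma divides_def: "a divides b \<longleftrightarrow> (\<exists>q. b = a \<otimes> q)"
  by (rule nums.dvd_def)

lemma Delta1_divides [definable]: "def_fun s \<Longrightarrow> def_fun t \<Longrightarrow> Delta1 (\<lambda>e. s e divides t e)"
proof -
  have "a divides b \<longleftrightarrow> (\<exists>q. q \<prec> b \<oplus> \<one> \<and> b = a \<otimes> q)" for a b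
  proof
    assume "a divides b"
    then obtain q where q: "b = a \<otimes> q" by (auto simp: divides_def)
    show "\<exists>q. q \<prec> b \<oplus> \<one> \<and> b = a \<otimes> q"
    proof (cases a rule: num_cases)
      case 1
      then show ?thesis using q by (intro exI[of _ \<zero>]) (simp add: less_succ_iff_le)
    next
      case (2 a')
      then have "b = q \<oplus> a' \<otimes> q" using q by (simp add: num_ac)
      then show ?thesis using q le_add[of q "a' \<otimes> q"] unfolding less_succ_iff_le by metis
    qed
  qed (auto simp: divides_def)
  then have "Delta1 (\<lambda>e. e 0 divides e (Suc 0))"
    by (simp only:) (intro definable)
  then show "def_fun s \<Longrightarrow> def_fun t \<Longrightarrow> Delta1 (\<lambda>e. s e divides t e)"
    by (rule Delta1_subst2)
qed

definition modulus :: "'m \<Rightarrow> 'm \<Rightarrow> 'm" where "modulus m i = m \<otimes> (i \<oplus> \<one>) \<oplus> \<one>"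

lemma def_fun_modulus [definable]: "def_fun s \<Longrightarrow> def_fun t \<Longrightarrow> def_fun (\<lambda>e. modulus (s e) (t e))"
  unfolding modulus_def by (intro definable)

lemma elt_iff: "elt i \<langle>k, \<langle>m, n\<rangle>\<rangle> \<longleftrightarrow> i \<prec> k \<and> modulus m i divides n"
  unfolding elt_def divides_def modulus_def by (auto simp: nums.mult.commute)

lemma elt_iff_ex: "elt i c \<longleftrightarrow> (\<exists>k m n. c = \<langle>k, \<langle>m, n\<rangle>\<rangle> \<and> i \<prec> k \<and> modulus m i divides n)"
  unfolding elt_def divides_def modulus_def by (auto simp: nums.mult.commute)

lemma elt_less: "elt i c \<Longrightarrow> i \<prec> c"
  unfolding elt_def using le_pair1 nums.less_le_trans by blast

lemma Delta1_elt [definable]: "def_fun s \<Longrightarrow> def_fun t \<Longrightarrow> Delta1 (\<lambda>e. elt (s e) (t e))"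
proof -
  have "elt i c \<longleftrightarrow> (\<exists>k. k \<prec> c \<oplus> \<one> \<and> (\<exists>m. m \<prec> c \<oplus> \<one> \<and> (\<exists>n. n \<prec> c \<oplus> \<one> \<and>
      c = \<langle>k, \<langle>m, n\<rangle>\<rangle> \<and> i \<prec> k \<and> modulus m i divides n)))" for i c
  proof
    assume "elt i c"
    then obtain k m n where *: "c = \<langle>k, \<langle>m, n\<rangle>\<rangle>" "i \<prec> k \<and> modulus m i divides n"
      by (auto simp: elt_iff_ex)
    moreover have "k \<preceq>\<preceq> c" "m \<preceq>\<preceq> c" "n \<preceq>\<preceq> c"
      using * le_pair1 le_pair2 nums.order_trans by blast+
    ultimately show "\<exists>k. k \<prec> c \<oplus> \<one> \<and> (\<exists>m. m \<prec> c \<oplus> \<one> \<and> (\<exists>n. n \<prec> c \<oplus> \<one> \<and>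
      c = \<langle>k, \<langle>m, n\<rangle>\<rangle> \<and> i \<prec> k \<and> modulus m i divides n))"
      unfolding less_succ_iff_le by blast
  qed (auto simp: elt_iff_ex)
  then have "Delta1 (\<lambda>e. elt (e 0) (e (Suc 0)))"
    by (simp only:) (intro definable)
  then show "def_fun s \<Longrightarrow> def_fun t \<Longrightarrow> Delta1 (\<lambda>e. elt (s e) (t e))"
    by (rule Delta1_subst2)
qed

text \<open>Such an \<open>m\<close> replaces the factorial of \<open>k\<close>, which cannot be
  formed before recursion is available. Its existence is \<Sigma>1, so that induction
  applies.\<close>

lemma ex_common_multiple: "\<exists>m. m \<noteq> \<zero> \<and> (\<forall>i. i \<prec> k \<longrightarrow> i \<oplus> \<one> divides m)"
proof (rule Sigma1_induct[where P = "\<lambda>k. \<exists>m. m \<noteq> \<zero> \<and> (\<forall>i. i \<prec> k \<longrightarrow> i \<oplus> \<one> divides m)"])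
  show "Sigma1 (\<lambda>e. \<exists>m. m \<noteq> \<zero> \<and> (\<forall>i. i \<prec> e 0 \<longrightarrow> i \<oplus> \<one> divides m))"
    by (intro Sigma1_ex Delta1_Sigma1 definable)
  show "\<exists>m. m \<noteq> \<zero> \<and> (\<forall>i. i \<prec> \<zero> \<longrightarrow> i \<oplus> \<one> divides m)"
    by (rule exI[of _ \<one>]) simp
  fix k assume "\<exists>m. m \<noteq> \<zero> \<and> (\<forall>i. i \<prec> k \<longrightarrow> i \<oplus> \<one> divides m)"
  then obtain m where "m \<noteq> \<zero>" "\<forall>i. i \<prec> k \<longrightarrow> i \<oplus> \<one> divides m" by blast
  then show "\<exists>m. m \<noteq> \<zero> \<and> (\<forall>i. i \<prec> k \<oplus> \<one> \<longrightarrow> i \<oplus> \<one> divides m)"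
    by (intro exI[of _ "m \<otimes> (k \<oplus> \<one>)"]) (auto simp: less_succ intro: nums.dvd_mult nums.dvd_mult2)
qed

text \<open>The moduli are pairwise coprime. For \<open>p = modulus m i\<close> and \<open>q = modulus m l\<close>,
  \<open>(i + 1) q\<close> and \<open>(l + 1) p\<close> differ by \<open>\<bar>i - l\<bar>\<close>, which divides \<open>m\<close> and hence is invertible modulo \<open>p\<close>.\<close>

lemma modulus_coprime:
  assumes m: "\<forall>j. j \<prec> k \<longrightarrow> j \<oplus> \<one> divides m" and "i \<prec> k" "l \<prec> k" "i \<noteq> l"
    and dvd: "modulus m i divides n \<otimes> modulus m l"
  shows "modulus m i divides n"
proof -
  define p q where "p = modulus m i" and "q = modulus m l"
  have ex: "\<exists>m'. m = (e \<oplus> \<one>) \<otimes> m'" if "a = b \<oplus> e \<oplus> \<one>" "a \<prec> k" for a b e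
  proof -
    have "e \<preceq>\<preceq> a"
      using that(1) by (simp add: nums.add_increasing nums.add_increasing2)
    then have "e \<prec> k"
      using that(2) nums.le_less_trans by blast
    then show ?thesis
      using m by (auto simp: divides_def)
  qed
  consider e where "i = l \<oplus> e \<oplus> \<one>" | e where "l = i \<oplus> e \<oplus> \<one>"
    using \<open>i \<noteq> l\<close> num_less_linear less_imp_ex_add by metis
  then show ?thesis
  proof cases
    case 1
    obtain m' where m': "m = (e \<oplus> \<one>) \<otimes> m'"
      using ex[OF 1 \<open>i \<prec> k\<close>] by blast
    define x where "x = m' \<otimes> (i \<oplus> \<one>)"
    have p: "p = (e \<oplus> \<one>) \<otimes> x \<oplus> \<one>"
      by (simp add: p_def modulus_def m' x_def nums.mult.assoc)
    have "(i \<oplus> \<one>) \<otimes> q = (l \<oplus> \<one>) \<otimes> p \<oplus> (e \<oplus> \<one>)"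
      by (simp add: p_def q_def modulus_def 1 num_ac)
    then have "n \<otimes> q \<otimes> ((i \<oplus> \<one>) \<otimes> x) = n \<otimes> x \<otimes> ((l \<oplus> \<one>) \<otimes> p \<oplus> (e \<oplus> \<one>))"
      by (metis nums.mult.assoc nums.mult.commute)
    then have "n \<otimes> q \<otimes> ((i \<oplus> \<one>) \<otimes> x) \<oplus> n = p \<otimes> (n \<otimes> x \<otimes> (l \<oplus> \<one>)) \<oplus> n \<otimes> ((e \<oplus> \<one>) \<otimes> x \<oplus> \<one>)"
      by (simp add: num_ac)
    then have "n \<otimes> q \<otimes> ((i \<oplus> \<one>) \<otimes> x) \<oplus> n = p \<otimes> (n \<otimes> x \<otimes> (l \<oplus> \<one>)) \<oplus> n \<otimes> p"
      by (simp only: p)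
    then have "p divides n \<otimes> q \<otimes> ((i \<oplus> \<one>) \<otimes> x) \<oplus> n"
      by (simp add: nums.dvd_add)
    then show ?thesis
      using dvd unfolding p_def q_def by (metis nums.dvd_add_right_iff nums.dvd_mult2)
  next
    case 2
    obtain m' where m': "m = (e \<oplus> \<one>) \<otimes> m'"
      using ex[OF 2 \<open>l \<prec> k\<close>] by blast
    define x where "x = m' \<otimes> (i \<oplus> \<one>)"
    have p: "p = (e \<oplus> \<one>) \<otimes> x \<oplus> \<one>"
      by (simp add: p_def modulus_def m' x_def nums.mult.assoc)
    have "(l \<oplus> \<one>) \<otimes> p = (i \<oplus> \<one>) \<otimes> q \<oplus> (e \<oplus> \<one>)"
      by (simp add: p_def q_def modulus_def 2 num_ac)
    then have "n \<otimes> x \<otimes> ((l \<oplus> \<one>) \<otimes> p) = n \<otimes> x \<otimes> ((i \<oplus> \<one>) \<otimes> q \<oplus> (e \<oplus> \<one>))"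
      by simp
    then have "p \<otimes> (n \<otimes> x \<otimes> (l \<oplus> \<one>)) \<oplus> n = n \<otimes> q \<otimes> ((i \<oplus> \<one>) \<otimes> x) \<oplus> n \<otimes> ((e \<oplus> \<one>) \<otimes> x \<oplus> \<one>)"
      by (simp add: num_ac)
    then have "p \<otimes> (n \<otimes> x \<otimes> (l \<oplus> \<one>)) \<oplus> n = n \<otimes> q \<otimes> ((i \<oplus> \<one>) \<otimes> x) \<oplus> n \<otimes> p"
      by (simp only: p)
    moreover have "p divides n \<otimes> q \<otimes> ((i \<oplus> \<one>) \<otimes> x) \<oplus> n \<otimes> p"
      using dvd unfolding p_def q_def by (simp add: nums.dvd_add nums.dvd_mult2)
    ultimately show ?thesis
      unfolding p_def by (metis nums.dvd_add_right_iff nums.dvd_triv_left)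
  qed
qed

text \<open>\<open>code_bound k b\<close> makes \<open>b\<close> a bound for the codes of all subsets of \<open>{i. i \<prec> k}\<close>: replacing \<open>n\<close>
  by its remainder modulo \<open>P\<close> does not change the set coded by \<open>\<langle>k, \<langle>m, n\<rangle>\<rangle>\<close>.\<close>

definition code_bound :: "'m \<Rightarrow> 'm \<Rightarrow> bool" where
  "code_bound k b \<longleftrightarrow> (\<exists>m. m \<prec> b \<oplus> \<one> \<and> (\<exists>P. P \<prec> b \<oplus> \<one> \<and> b = \<langle>k, \<langle>m, P\<rangle>\<rangle> \<and> m \<noteq> \<zero> \<and> P \<noteq> \<zero> \<and>
     (\<forall>i. i \<prec> k \<longrightarrow> i \<oplus> \<one> divides m) \<and> (\<forall>i. i \<prec> k \<longrightarrow> modulus m i divides P)))"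

lemma Delta1_code_bound [definable]:
  "def_fun s \<Longrightarrow> def_fun t \<Longrightarrow> Delta1 (\<lambda>e. code_bound (s e) (t e))"
  by (rule Delta1_subst2[where P = code_bound]) (unfold code_bound_def, intro definable)

lemma ex_code_bound: "\<exists>b. code_bound k b"
proof -
  obtain m where m: "m \<noteq> \<zero>" "\<forall>i. i \<prec> k \<longrightarrow> i \<oplus> \<one> divides m"
    using ex_common_multiple by blast
  have "\<exists>P. P \<noteq> \<zero> \<and> (\<forall>i. i \<prec> k \<longrightarrow> modulus m i divides P)"
  proof (rule Sigma1_induct[where P = "\<lambda>k. \<exists>P. P \<noteq> \<zero> \<and> (\<forall>i. i \<prec> k \<longrightarrow> modulus m i divides P)"])
    show "Sigma1 (\<lambda>e. \<exists>P. P \<noteq> \<zero> \<and> (\<forall>i. i \<prec> e 0 \<longrightarrow> modulus m i divides P))"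
      by (intro Sigma1_ex Delta1_Sigma1 definable)
    show "\<exists>P. P \<noteq> \<zero> \<and> (\<forall>i. i \<prec> \<zero> \<longrightarrow> modulus m i divides P)"
      by (rule exI[of _ \<one>]) simp
    fix k assume "\<exists>P. P \<noteq> \<zero> \<and> (\<forall>i. i \<prec> k \<longrightarrow> modulus m i divides P)"
    then obtain P where "P \<noteq> \<zero>" "\<forall>i. i \<prec> k \<longrightarrow> modulus m i divides P" by blast
    then show "\<exists>P. P \<noteq> \<zero> \<and> (\<forall>i. i \<prec> k \<oplus> \<one> \<longrightarrow> modulus m i divides P)"
      by (intro exI[of _ "P \<otimes> modulus m k"])
        (auto simp: less_succ intro: nums.dvd_mult nums.dvd_mult2, simp add: modulus_def)
  qed
  then obtain P where P: "P \<noteq> \<zero>" "\<forall>i. i \<prec> k \<longrightarrow> modulus m i divides P" by blast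
  have "m \<preceq>\<preceq> \<langle>k, \<langle>m, P\<rangle>\<rangle>" "P \<preceq>\<preceq> \<langle>k, \<langle>m, P\<rangle>\<rangle>"
    using le_pair1 le_pair2 nums.order_trans by blast+
  then show ?thesis
    unfolding code_bound_def less_succ_iff_le using m P by blast
qed

lemma ex_div_mod:
  assumes "P \<noteq> \<zero>"
  shows "\<exists>q r. n = P \<otimes> q \<oplus> r \<and> r \<prec> P"
proof (rule Sigma1_induct[where P = "\<lambda>n. \<exists>q r. n = P \<otimes> q \<oplus> r \<and> r \<prec> P"])
  show "Sigma1 (\<lambda>e. \<exists>q r. e 0 = P \<otimes> q \<oplus> r \<and> r \<prec> P)"
    by (intro Sigma1_ex Delta1_Sigma1 definable)
  show "\<exists>q r. \<zero> = P \<otimes> q \<oplus> r \<and> r \<prec> P"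
    using assms by (intro exI[of _ \<zero>]) (simp add: num_neq_zero_iff)
  fix n assume "\<exists>q r. n = P \<otimes> q \<oplus> r \<and> r \<prec> P"
  then obtain q r where qr: "n = P \<otimes> q \<oplus> r" "r \<prec> P" by blast
  show "\<exists>q r. n \<oplus> \<one> = P \<otimes> q \<oplus> r \<and> r \<prec> P"
  proof (cases "r \<oplus> \<one> = P")
    case True
    then have "n \<oplus> \<one> = P \<otimes> (q \<oplus> \<one>) \<oplus> \<zero>"
      using qr by (auto simp: num_ac)
    then show ?thesis
      using assms num_neq_zero_iff by blast
  next
    case False
    then have "r \<oplus> \<one> \<prec> P"
      using qr by (metis succ_le_iff nums.le_less)
    then show ?thesis
      using qr nums.add.assoc by blast
  qed
qed

lemma pair_mono:
  assumes "i \<preceq>\<preceq> k" "j \<preceq>\<preceq> l"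
  shows "\<langle>i, j\<rangle> \<preceq>\<preceq> \<langle>k, l\<rangle>"
  unfolding pair_def by (intro nums.add_mono nums.mult_mono assms) simp_all

text \<open>The number \<open>n\<close> is built by induction on \<open>j\<close> as the product of
  the moduli of the elements below \<open>j\<close>. A new factor does not affect divisibility by
  the other moduli, by coprimality. Reduction modulo \<open>P\<close> finally brings the code below
  the bound.\<close>

lemma code_bound_code:
  assumes b: "code_bound k b" and A: "Delta1 (\<lambda>e. A (e 0))"
  shows "\<exists>c. c \<preceq>\<preceq> b \<and> (\<forall>i. elt i c \<longleftrightarrow> i \<prec> k \<and> A i)"
proof -
  obtain m P where m: "b = \<langle>k, \<langle>m, P\<rangle>\<rangle>" "m \<noteq> \<zero>" "P \<noteq> \<zero>" "\<forall>i. i \<prec> k \<longrightarrow> i \<oplus> \<one> divides m"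
    "\<forall>i. i \<prec> k \<longrightarrow> modulus m i divides P"
    using b unfolding code_bound_def by blast
  have "k \<prec> j \<or> (\<exists>n. \<forall>i. i \<prec> k \<longrightarrow> (modulus m i divides n \<longleftrightarrow> i \<prec> j \<and> A i))" for j
  proof (rule Sigma1_induct[where P = "\<lambda>j. k \<prec> j \<or>
      (\<exists>n. \<forall>i. i \<prec> k \<longrightarrow> (modulus m i divides n \<longleftrightarrow> i \<prec> j \<and> A i))"])
    show "Sigma1 (\<lambda>e. k \<prec> e 0 \<or> (\<exists>n. \<forall>i. i \<prec> k \<longrightarrow> (modulus m i divides n \<longleftrightarrow> i \<prec> e 0 \<and> A i)))"
      by (intro Sigma1_or Sigma1_ex; intro Delta1_Sigma1 definable; rule A)
    \<comment> \<open>The empty product must have no elements. This holds since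
      \<open>m \<noteq> \<zero>\<close> makes every modulus greater than one.\<close>
    have "\<not> modulus m i divides \<one>" for i
    proof
      assume "modulus m i divides \<one>"
      then obtain q where "(m \<otimes> (i \<oplus> \<one>) \<oplus> \<one>) \<otimes> q = \<one>"
        unfolding divides_def modulus_def by metis
      moreover obtain m' where "m = m' \<oplus> \<one>"
        using m num_cases by blast
      moreover have "q \<noteq> \<zero>"
        using calculation(1) by auto
      then obtain q' where "q = q' \<oplus> \<one>"
        using num_cases by blast
      ultimately have "(m' \<otimes> (i \<oplus> \<one>) \<oplus> i \<oplus> \<one> \<oplus> \<one>) \<otimes> q' \<oplus> m' \<otimes> (i \<oplus> \<one>) \<oplus> i \<oplus> \<one> \<oplus> \<one> = \<zero> \<oplus> \<one>"
        by (simp add: num_ac)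
      then show False
        using succ_inject succ_neq_zero by metis
    qed
    then show "k \<prec> \<zero> \<or> (\<exists>n. \<forall>i. i \<prec> k \<longrightarrow> (modulus m i divides n \<longleftrightarrow> i \<prec> \<zero> \<and> A i))"
      by (intro disjI2 exI[of _ \<one>]) simp
    fix j assume IH: "k \<prec> j \<or> (\<exists>n. \<forall>i. i \<prec> k \<longrightarrow> (modulus m i divides n \<longleftrightarrow> i \<prec> j \<and> A i))"
    show "k \<prec> j \<oplus> \<one> \<or> (\<exists>n. \<forall>i. i \<prec> k \<longrightarrow> (modulus m i divides n \<longleftrightarrow> i \<prec> j \<oplus> \<one> \<and> A i))"
    proof (cases "j \<prec> k")
      case True
      then obtain n where n: "i \<prec> k \<Longrightarrow> modulus m i divides n \<longleftrightarrow> i \<prec> j \<and> A i" for i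
        using IH nums.less_asym by blast
      show ?thesis
      proof (cases "A j")
        case True
        have "modulus m i divides n \<otimes> modulus m j \<longleftrightarrow> i \<prec> j \<oplus> \<one> \<and> A i" if i: "i \<prec> k" for i
        proof (cases "i = j")
          case False
          then have "modulus m i divides n \<otimes> modulus m j \<longleftrightarrow> modulus m i divides n"
            using modulus_coprime[OF m(4) i \<open>j \<prec> k\<close> False] nums.dvd_mult2 by blast
          then show ?thesis
            using n[OF i] False unfolding less_succ by blast
        qed (use True in simp)
        then show ?thesis by blast
      next
        case False
        then have "i \<prec> j \<oplus> \<one> \<and> A i \<longleftrightarrow> i \<prec> j \<and> A i" for i
          unfolding less_succ by blast
        then show ?thesis using n by blast
      qed
    next
      case False
      then show ?thesis by (metis less_succ num_less_linear)
    qed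
  qed
  from this[of k] obtain n where n: "i \<prec> k \<Longrightarrow> modulus m i divides n \<longleftrightarrow> A i" for i
    by auto
  obtain q r where r: "n = P \<otimes> q \<oplus> r" "r \<prec> P"
    using ex_div_mod[OF m(3)] by blast
  have "modulus m i divides r \<longleftrightarrow> A i" if "i \<prec> k" for i
    using n[OF that] m(5) that unfolding r(1) by (metis nums.dvd_add_right_iff nums.dvd_mult2)
  then have "elt i \<langle>k, \<langle>m, r\<rangle>\<rangle> \<longleftrightarrow> i \<prec> k \<and> A i" for i
    unfolding elt_iff by blast
  moreover have "\<langle>k, \<langle>m, r\<rangle>\<rangle> \<preceq>\<preceq> b"
    unfolding m(1) using r(2) by (intro pair_mono) (auto intro: nums.less_imp_le)
  ultimately show ?thesis by blast
qed

lemma Delta1_fin_code [definable]: "def_fun t \<Longrightarrow> Delta1 (\<lambda>e. fin_code (t e))"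
proof -
  have "fin_code c \<longleftrightarrow> (\<forall>c'. c' \<prec> c \<longrightarrow> \<not> (\<forall>i. i \<prec> c \<longrightarrow> (elt i c' \<longleftrightarrow> elt i c)))" for c
    unfolding fin_code_def using elt_less nums.less_trans by meson
  then have "Delta1 (\<lambda>e. fin_code (e 0))"
    by (simp only:) (intro definable)
  then show "def_fun t \<Longrightarrow> Delta1 (\<lambda>e. fin_code (t e))"
    by (rule Delta1_subst2[where P = "\<lambda>x y. fin_code x"])
qed

lemma fin_code_eqI: "fin_code c \<Longrightarrow> fin_code d \<Longrightarrow> (\<And>i. elt i c \<longleftrightarrow> elt i d) \<Longrightarrow> c = d"
  unfolding fin_code_def using num_less_linear by metis

text \<open>The canonical code is the least one and hence below any bound for the code found before.
  It exists because elements lie below their code, which makes having the prescribed elements a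
  \<Delta>1 property.\<close>

lemma fin_code_bound:
  assumes b: "code_bound k b" and A: "Delta1 (\<lambda>e. A (e 0))"
  shows "\<exists>c. c \<preceq>\<preceq> b \<and> fin_code c \<and> (\<forall>i. elt i c \<longleftrightarrow> i \<prec> k \<and> A i)"
proof -
  define Q where "Q c \<longleftrightarrow> (\<forall>i. elt i c \<longleftrightarrow> i \<prec> k \<and> A i)" for c
  have "Q c \<longleftrightarrow> (\<forall>i. i \<prec> c \<oplus> k \<longrightarrow> (elt i c \<longleftrightarrow> i \<prec> k \<and> A i))" for c
  proof -
    have "i \<prec> c \<oplus> k" if "i \<prec> c \<or> i \<prec> k" for i
      using that le_add[of c k] le_add[of k c] nums.less_le_trans by (auto simp: nums.add.commute)
    then show ?thesis
      unfolding Q_def using elt_less by meson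
  qed
  then have D: "Delta1 (\<lambda>e. Q (e 0))"
    by (simp only:) (intro definable A)
  obtain c0 where c0: "c0 \<preceq>\<preceq> b" "Q c0"
    using code_bound_code[of k b A] assms unfolding Q_def by blast
  then obtain c where c: "Q c" "\<And>d. d \<prec> c \<Longrightarrow> \<not> Q d"
    using ex_least[of Q, OF D] by blast
  then have "fin_code c"
    unfolding fin_code_def Q_def by blast
  moreover have "c \<preceq>\<preceq> b"
    using c c0 nums.not_less nums.order_trans by blast
  ultimately show ?thesis
    using c(1) unfolding Q_def by blast
qed

subsection \<open>Sequences\<close>

lemma Delta1_has_length [definable]: "def_fun s \<Longrightarrow> def_fun t \<Longrightarrow> Delta1 (\<lambda>e. has_length (s e) (t e))"
proof -
  have "has_length s l \<longleftrightarrow> (\<forall>i. i \<prec> s \<oplus> l \<longrightarrow> (i \<prec> l \<longleftrightarrow> (\<exists>j. j \<prec> s \<and> elt \<langle>i, j\<rangle> s)))" for s l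
  proof -
    have "i \<prec> s \<oplus> l" if "i \<prec> l" for i
      using that le_add[of l s] nums.less_le_trans by (auto simp: nums.add.commute)
    moreover have "i \<prec> s \<oplus> l" "j \<prec> s" if "elt \<langle>i, j\<rangle> s" for i j
      using elt_less[OF that] le_add[of s l] le_pair1 le_pair2 nums.less_le_trans nums.le_less_trans
      by meson+
    ultimately show ?thesis
      unfolding has_length_def by meson
  qed
  then have "Delta1 (\<lambda>e. has_length (e 0) (e (Suc 0)))"
    by (simp only:) (intro definable)
  then show "def_fun s \<Longrightarrow> def_fun t \<Longrightarrow> Delta1 (\<lambda>e. has_length (s e) (t e))"
    by (rule Delta1_subst2)
qed

lemma has_length_unique: "has_length s l \<Longrightarrow> has_length s l' \<Longrightarrow> l = l'"
  unfolding has_length_def using num_less_linear nums.less_irrefl by metis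

lemma has_length_le:
  assumes "has_length s l"
  shows "l \<preceq>\<preceq> s"
proof (rule ccontr)
  assume "\<not> l \<preceq>\<preceq> s"
  then obtain j where "elt \<langle>s, j\<rangle> s"
    using assms unfolding has_length_def nums.not_le by blast
  then show False
    using elt_less le_pair1 nums.not_le by blast
qed

lemma lh_eqI: "has_length s l \<Longrightarrow> lh s = l"
  unfolding lh_def using has_length_unique by blast

lemma def_fun_lh [definable]: "def_fun t \<Longrightarrow> def_fun (\<lambda>e. lh (t e))"
proof (erule def_fun_comp1[rotated])
  define junk :: 'm where "junk = (THE i. False)"
  have "y = lh s \<longleftrightarrow> has_length s y \<or> \<not> (\<exists>l. l \<prec> s \<oplus> \<one> \<and> has_length s l) \<and> y = junk" for y s
  proof (cases "\<exists>l. has_length s l")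
    case True
    then show ?thesis
      using lh_eqI has_length_le unfolding less_succ_iff_le by metis
  next
    case False
    then show ?thesis
      by (auto simp: lh_def junk_def)
  qed
  then show "Delta1 (\<lambda>e. e 0 = lh (e (Suc 0)))"
    by (simp only:) (intro definable)
qed

lemma Delta1_fin_seq [definable]: "def_fun t \<Longrightarrow> Delta1 (\<lambda>e. fin_seq (t e))"
proof -
  have "fin_seq s \<longleftrightarrow> fin_code s \<and> (\<forall>z. z \<prec> s \<longrightarrow> elt z s \<longrightarrow> (\<exists>i. i \<prec> s \<and> (\<exists>j. j \<prec> s \<and> z = \<langle>i, j\<rangle>))) \<and>
     (\<forall>i. i \<prec> s \<longrightarrow> (\<forall>j. j \<prec> s \<longrightarrow> (\<forall>k. k \<prec> s \<longrightarrow> elt \<langle>i, j\<rangle> s \<and> elt \<langle>i, k\<rangle> s \<longrightarrow> j = k))) \<and>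
     (\<exists>l. l \<prec> s \<oplus> \<one> \<and> has_length s l)" for s
  proof -
    have *: "i \<prec> s" "j \<prec> s" if "elt \<langle>i, j\<rangle> s" for i j
      using elt_less[OF that] le_pair1 le_pair2 nums.le_less_trans by blast+
    have "(\<forall>z. elt z s \<longrightarrow> (\<exists>i j. z = \<langle>i, j\<rangle>)) \<longleftrightarrow>
       (\<forall>z. z \<prec> s \<longrightarrow> elt z s \<longrightarrow> (\<exists>i. i \<prec> s \<and> (\<exists>j. j \<prec> s \<and> z = \<langle>i, j\<rangle>)))"
      using * elt_less by metis
    moreover have "(\<forall>i j k. elt \<langle>i, j\<rangle> s \<and> elt \<langle>i, k\<rangle> s \<longrightarrow> j = k) \<longleftrightarrow>
       (\<forall>i. i \<prec> s \<longrightarrow> (\<forall>j. j \<prec> s \<longrightarrow> (\<forall>k. k \<prec> s \<longrightarrow> elt \<langle>i, j\<rangle> s \<and> elt \<langle>i, k\<rangle> s \<longrightarrow> j = k)))"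
      using * by meson
    moreover have "(\<exists>l. has_length s l) \<longleftrightarrow> (\<exists>l. l \<prec> s \<oplus> \<one> \<and> has_length s l)"
      using has_length_le less_succ_iff_le by blast
    ultimately show ?thesis
      unfolding fin_seq_def by (simp only:)
  qed
  then have "Delta1 (\<lambda>e. fin_seq (e 0))"
    by (simp only:) (intro definable)
  then show "def_fun t \<Longrightarrow> Delta1 (\<lambda>e. fin_seq (t e))"
    by (rule Delta1_subst2[where P = "\<lambda>x y. fin_seq x"])
qed

lemma fin_seq_length: "fin_seq s \<Longrightarrow> has_length s (lh s)"
  unfolding fin_seq_def using lh_eqI by blast

lemma elt_seq_iff:
  assumes "fin_seq s"
  shows "elt \<langle>i, j\<rangle> s \<longleftrightarrow> i \<prec> lh s \<and> entry s i = j"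
proof -
  have ex1: "\<exists>!j. elt \<langle>i, j\<rangle> s" if "i \<prec> lh s"
    using fin_seq_length[OF assms] that assms unfolding has_length_def fin_seq_def by blast
  have "elt \<langle>i, entry s i\<rangle> s" if "i \<prec> lh s"
    unfolding entry_def using theI'[OF ex1[OF that]] .
  then show ?thesis
    using fin_seq_length[OF assms] assms unfolding has_length_def fin_seq_def by blast
qed

lemma elt_seq_pair: "fin_seq s \<Longrightarrow> elt z s \<Longrightarrow> \<exists>i j. z = \<langle>i, j\<rangle>"
  by (simp add: fin_seq_def)

lemma seq_eqI:
  assumes "fin_seq s" "fin_seq t" "lh s = lh t" "\<And>i. i \<prec> lh s \<Longrightarrow> entry s i = entry t i"
  shows "s = t"
proof (rule fin_code_eqI)
  fix z
  show "elt z s \<longleftrightarrow> elt z t"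
  proof (cases "\<exists>i j. z = \<langle>i, j\<rangle>")
    case True
    then show ?thesis
      using assms by (auto simp: elt_seq_iff)
  next
    case False
    then have "\<not> elt z s" "\<not> elt z t"
      using elt_seq_pair assms(1,2) by blast+
    then show ?thesis by simp
  qed
qed (use assms in \<open>auto simp: fin_seq_def\<close>)

text \<open>Unlike \<open>entry\<close>, this is definable for all arguments.\<close>

definition ent :: "'m \<Rightarrow> 'm \<Rightarrow> 'm" where "ent s i = (if fin_seq s then entry s i else \<zero>)"

lemma def_fun_ent [definable]: "def_fun s \<Longrightarrow> def_fun t \<Longrightarrow> def_fun (\<lambda>e. ent (s e) (t e))"
proof (erule (1) def_fun_comp2[rotated])
  define junk :: 'm where "junk = (THE i. False)"
  have "y = ent s i \<longleftrightarrow> (if fin_seq s then if i \<prec> lh s then elt \<langle>i, y\<rangle> s else y = junk else y = \<zero>)" for y s i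
  proof (cases "fin_seq s")
    case True
    have "elt \<langle>i, j\<rangle> s \<longleftrightarrow> False" if "\<not> i \<prec> lh s" for j
      using that elt_seq_iff[OF True] by blast
    then have "entry s i = junk" if "\<not> i \<prec> lh s"
      unfolding entry_def junk_def using that by (simp only: simp_thms)
    then show ?thesis
      using True by (auto simp: ent_def elt_seq_iff)
  qed (simp add: ent_def)
  then show "Delta1 (\<lambda>e. e 0 = ent (e (Suc 0)) (e (Suc (Suc 0))))"
    by (simp only:) (intro definable)
qed

lemma ent_eq: "fin_seq s \<Longrightarrow> ent s i = entry s i"
  by (simp add: ent_def)

lemma ex_bound:
  assumes "def_fun (\<lambda>e. g (e 0))"
  shows "\<exists>b. \<forall>i. i \<prec> n \<longrightarrow> g i \<prec> b"
proof (rule Sigma1_induct[where P = "\<lambda>n. \<exists>b. \<forall>i. i \<prec> n \<longrightarrow> g i \<prec> b"])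
  have g: "def_fun (\<lambda>e. g (t e))" if "def_fun t" for t
    by (rule def_fun_subst1[OF assms that])
  show "Sigma1 (\<lambda>e. \<exists>b. \<forall>i. i \<prec> e 0 \<longrightarrow> g i \<prec> b)"
    by (intro Sigma1_ex Delta1_Sigma1 definable g)
  fix n assume "\<exists>b. \<forall>i. i \<prec> n \<longrightarrow> g i \<prec> b"
  then obtain b where b: "\<forall>i. i \<prec> n \<longrightarrow> g i \<prec> b" by blast
  have "i \<prec> n \<oplus> \<one> \<longrightarrow> g i \<prec> b \<oplus> g n \<oplus> \<one>" for i
  proof
    assume "i \<prec> n \<oplus> \<one>"
    then have "g i \<preceq>\<preceq> b \<oplus> g n"
      using b le_add[of b "g n"] le_add[of "g n" b] nums.less_le_trans nums.less_imp_le
      unfolding less_succ by (metis nums.add.commute)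
    then show "g i \<prec> b \<oplus> g n \<oplus> \<one>"
      by (simp only: less_succ_iff_le)
  qed
  then show "\<exists>b. \<forall>i. i \<prec> n \<oplus> \<one> \<longrightarrow> g i \<prec> b" by blast
qed simp

lemma pair_less_pair: "i \<prec> k \<Longrightarrow> j \<prec> l \<Longrightarrow> \<langle>i, j\<rangle> \<prec> \<langle>k, l\<rangle>"
  by (intro pair_sum_less nums.add_strict_mono)

text \<open>The sequence is the graph of \<open>g\<close> below \<open>n\<close>, a set of pairs
  smaller than \<open>\<langle>n, a\<rangle>\<close>, so that the bound for codes of subsets of this
  segment applies.\<close>

lemma seq_code_bound:
  assumes b: "code_bound \<langle>n, a\<rangle> b" and g: "def_fun (\<lambda>e. g (e 0))" "\<And>i. i \<prec> n \<Longrightarrow> g i \<prec> a"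
  shows "\<exists>s. s \<preceq>\<preceq> b \<and> fin_seq s \<and> lh s = n \<and> (\<forall>i. i \<prec> n \<longrightarrow> entry s i = g i)"
proof -
  have g': "def_fun (\<lambda>e. g (t e))" if "def_fun t" for t
    by (rule def_fun_subst1[OF g(1) that])
  have "Delta1 (\<lambda>e. \<exists>i. i \<prec> n \<and> e 0 = \<langle>i, g i\<rangle>)"
    by (intro definable g')
  from fin_code_bound[OF b, of "\<lambda>z. \<exists>i. i \<prec> n \<and> z = \<langle>i, g i\<rangle>", OF this]
  obtain s where s: "s \<preceq>\<preceq> b" "fin_code s"
    "\<And>z. elt z s \<longleftrightarrow> z \<prec> \<langle>n, a\<rangle> \<and> (\<exists>i. i \<prec> n \<and> z = \<langle>i, g i\<rangle>)"
    by blast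
  then have elt: "elt z s \<longleftrightarrow> (\<exists>i. i \<prec> n \<and> z = \<langle>i, g i\<rangle>)" for z
    using g(2) pair_less_pair by blast
  have len: "has_length s n"
    unfolding has_length_def by (auto simp: elt)
  have seq: "fin_seq s"
    unfolding fin_seq_def using s(2) len by (auto simp: elt)
  have "entry s i = g i" if "i \<prec> n" for i
  proof -
    have "elt \<langle>i, g i\<rangle> s" using that by (auto simp: elt)
    then show ?thesis using seq by (simp add: elt_seq_iff)
  qed
  then show ?thesis
    using s(1) seq lh_eqI[OF len] by blast
qed

lemma restr_spec:
  assumes "def_fun (\<lambda>e. g (e 0))"
  shows "fin_seq (restr g n) \<and> lh (restr g n) = n \<and> (\<forall>i. i \<prec> n \<longrightarrow> entry (restr g n) i = g i)"
proof -
  obtain a where a: "\<forall>i. i \<prec> n \<longrightarrow> g i \<prec> a"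
    using ex_bound[of g n] assms by blast
  obtain b where b: "code_bound \<langle>n, a\<rangle> b"
    using ex_code_bound by blast
  obtain s where s: "fin_seq s \<and> lh s = n \<and> (\<forall>i. i \<prec> n \<longrightarrow> entry s i = g i)"
    using seq_code_bound[OF b, of g] assms a by blast
  show ?thesis
    unfolding restr_def by (rule theI[where a = s]) (use s in \<open>auto intro: seq_eqI\<close>)
qed

lemma restr_eqI:
  assumes "fin_seq s" "lh s = n" "\<And>i. i \<prec> n \<Longrightarrow> entry s i = g i"
  shows "restr g n = s"
  unfolding restr_def by (rule the_equality) (use assms in \<open>auto intro: seq_eqI\<close>)

lemma def_fun_reindex:
  assumes "def_fun t" "inj h"
  shows "def_fun (\<lambda>e. t (\<lambda>i. e (h i)))"
proof -
  have "inj (case_nat 0 (\<lambda>i. Suc (h i)))"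
    by (rule injI) (auto simp: inj_eq[OF assms(2)] split: nat.splits)
  from Sigma1_reindex[OF assms(1)[unfolded def_fun_def] this] show ?thesis
    by (simp add: def_fun_def)
qed

lemma def_fun_fix:
  assumes "def_fun (\<lambda>e. g (\<lambda>i. e (Suc i)) (e 0))"
  shows "def_fun (\<lambda>e. g d (e 0))"
proof -
  have "Sigma1 (\<lambda>e. (\<lambda>e. e 0 = g (\<lambda>i. e (Suc (Suc i))) (e (Suc 0))) (\<lambda>i. if i < 2 then e (id i) else d (i - 2)))"
    by (rule Sigma1_subst_vars) (use assms in \<open>simp_all add: def_fun_def\<close>)
  then show ?thesis
    by (simp add: def_fun_def)
qed

lemma def_fun_shift1:
  assumes "def_fun (\<lambda>e. g (\<lambda>i. e (Suc i)) (e 0))"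
  shows "def_fun (\<lambda>e. g (\<lambda>i. e (Suc (Suc i))) (e 0))"
proof -
  have "inj (case_nat 0 (\<lambda>i. Suc (Suc i)))"
    by (auto simp: inj_def split: nat.splits)
  from def_fun_reindex[OF assms this] show ?thesis
    by simp
qed

lemma def_fun_restr [definable]:
  assumes g: "def_fun (\<lambda>e. g (\<lambda>i. e (Suc i)) (e 0))" and t: "def_fun t"
  shows "def_fun (\<lambda>e. restr (g e) (t e))"
proof -
  have "s = restr (g e) n \<longleftrightarrow> fin_seq s \<and> lh s = n \<and> (\<forall>i. i \<prec> n \<longrightarrow> ent s i = g e i)" for s e n
    using restr_spec[OF def_fun_fix, OF g, of e n] restr_eqI[of s n "g e"] by (auto simp: ent_def)
  moreover have "Sigma1 (\<lambda>e. fin_seq (e 0) \<and> lh (e 0) = t (\<lambda>i. e (Suc i)) \<and>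
      (\<forall>i. i \<prec> t (\<lambda>i. e (Suc i)) \<longrightarrow> ent (e 0) i = g (\<lambda>i. e (Suc i)) i))"
    by (intro Delta1_Sigma1 definable def_fun_shift t def_fun_shift1 g)
  ultimately show ?thesis
    unfolding def_fun_def by (simp only:)
qed

subsection \<open>Primitive recursion\<close>

definition rec_seq :: "'m \<Rightarrow> ('m \<Rightarrow> 'm \<Rightarrow> 'm) \<Rightarrow> 'm \<Rightarrow> 'm \<Rightarrow> bool" where
  "rec_seq a g n s \<longleftrightarrow> fin_seq s \<and> lh s = n \<oplus> \<one> \<and> ent s \<zero> = a \<and>
     (\<forall>i. i \<prec> n \<longrightarrow> ent s (i \<oplus> \<one>) = g i (ent s i))"

definition prim_rec :: "'m \<Rightarrow> ('m \<Rightarrow> 'm \<Rightarrow> 'm) \<Rightarrow> 'm \<Rightarrow> 'm" where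
  "prim_rec a g n = (THE y. \<exists>s. rec_seq a g n s \<and> y = ent s n)"


lemma rec_seq_unique:
  assumes s: "rec_seq a g n s" and t: "rec_seq a g m t"
  shows "i \<preceq>\<preceq> n \<Longrightarrow> i \<preceq>\<preceq> m \<Longrightarrow> ent s i = ent t i"
proof -
  have "i \<preceq>\<preceq> n \<longrightarrow> i \<preceq>\<preceq> m \<longrightarrow> ent s i = ent t i"
  proof (rule Delta1_induct[where P = "\<lambda>i. i \<preceq>\<preceq> n \<longrightarrow> i \<preceq>\<preceq> m \<longrightarrow> ent s i = ent t i"])
    show "i \<oplus> \<one> \<preceq>\<preceq> n \<longrightarrow> i \<oplus> \<one> \<preceq>\<preceq> m \<longrightarrow> ent s (i \<oplus> \<one>) = ent t (i \<oplus> \<one>)"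
      if "i \<preceq>\<preceq> n \<longrightarrow> i \<preceq>\<preceq> m \<longrightarrow> ent s i = ent t i" for i
      using s t that nums.less_imp_le by (simp add: rec_seq_def succ_le_iff)
  qed (intro definable, use s t in \<open>simp add: rec_seq_def\<close>)
  then show "i \<preceq>\<preceq> n \<Longrightarrow> i \<preceq>\<preceq> m \<Longrightarrow> ent s i = ent t i" by blast
qed

text \<open>That a coded computation of length \<open>n\<close> exists is \<Sigma>1, and a
  computation can be extended by one entry. So \<Sigma>1 induction provides all values of the
  recursion without a given set of them.\<close>

lemma ex_rec_seq:
  assumes g: "def_fun (\<lambda>e. g (e (Suc 0)) (e 0))"
  shows "\<exists>s. rec_seq a g n s"
proof (rule Sigma1_induct[where P = "\<lambda>n. \<exists>s. rec_seq a g n s"])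
  have g': "def_fun (\<lambda>e. g (s e) (t e))" if "def_fun s" "def_fun t" for s t
    using def_fun_subst2[of "\<lambda>x y. g y x", OF g that(2,1)] .
  show "Sigma1 (\<lambda>e. \<exists>s. rec_seq a g (e 0) s)"
    unfolding rec_seq_def by (intro Sigma1_ex Delta1_Sigma1 definable g')
  have "def_fun (\<lambda>e. a)" by (rule def_fun_const)
  from restr_spec[OF this, of "\<one>"] show "\<exists>s. rec_seq a g \<zero> s"
    by (intro exI[of _ "restr (\<lambda>_. a) \<one>"]) (simp add: rec_seq_def ent_eq)
  fix n assume "\<exists>s. rec_seq a g n s"
  then obtain s where s: "rec_seq a g n s" by blast
  define h where "h i = (if i \<prec> n \<oplus> \<one> then ent s i else g n (ent s n))" for i
  have "def_fun (\<lambda>e. h (e 0))"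
    unfolding h_def by (intro definable)
  note h = restr_spec[OF this, of "n \<oplus> \<one> \<oplus> \<one>"]
  have ent: "ent (restr h (n \<oplus> \<one> \<oplus> \<one>)) i = h i" if "i \<prec> n \<oplus> \<one> \<oplus> \<one>" for i
    using h that by (simp add: ent_eq)
  have "i \<prec> n \<oplus> \<one> \<longrightarrow> h (i \<oplus> \<one>) = g i (h i)" for i
  proof
    assume i: "i \<prec> n \<oplus> \<one>"
    show "h (i \<oplus> \<one>) = g i (h i)"
    proof (cases "i = n")
      case False
      then have "i \<prec> n" using i by (simp add: less_succ)
      then show ?thesis
        using s i succ_less_succ by (simp add: h_def rec_seq_def)
    qed (simp add: h_def)
  qed
  moreover have "h \<zero> = a"
    using s by (simp add: h_def rec_seq_def less_succ_iff_le)
  ultimately have "rec_seq a g (n \<oplus> \<one>) (restr h (n \<oplus> \<one> \<oplus> \<one>))"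
    unfolding rec_seq_def using h by (simp add: ent succ_less_succ less_succ_iff_le nums.add_increasing2)
  then show "\<exists>s. rec_seq a g (n \<oplus> \<one>) s" by blast
qed

lemma prim_rec_eqI:
  assumes "def_fun (\<lambda>e. g (e (Suc 0)) (e 0))" "rec_seq a g n s"
  shows "prim_rec a g n = ent s n"
  unfolding prim_rec_def using assms rec_seq_unique
  by (intro the_equality) (blast intro: nums.order_refl)+

lemma
  assumes g: "def_fun (\<lambda>e. g (e (Suc 0)) (e 0))"
  shows prim_rec_zero: "prim_rec a g \<zero> = a"
    and prim_rec_succ: "prim_rec a g (n \<oplus> \<one>) = g n (prim_rec a g n)"
proof -
  obtain s where "rec_seq a g \<zero> s"
    using ex_rec_seq[OF g] by blast
  from prim_rec_eqI[OF g this] this show "prim_rec a g \<zero> = a"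
    by (simp add: rec_seq_def)
  obtain s t where s: "rec_seq a g n s" and t: "rec_seq a g (n \<oplus> \<one>) t"
    using ex_rec_seq[OF g] by metis
  have "ent t n = ent s n"
    by (rule rec_seq_unique[OF t s]) (simp_all add: nums.less_imp_le)
  then show "prim_rec a g (n \<oplus> \<one>) = g n (prim_rec a g n)"
    using prim_rec_eqI[OF g s] prim_rec_eqI[OF g t] t by (simp add: rec_seq_def)
qed

lemma def_fun_fix2:
  assumes "def_fun (\<lambda>e. g (\<lambda>i. e (Suc (Suc i))) (e (Suc 0)) (e 0))"
  shows "def_fun (\<lambda>e. g d (e (Suc 0)) (e 0))"
proof -
  have "Sigma1 (\<lambda>e. (\<lambda>e. e 0 = g (\<lambda>i. e (Suc (Suc (Suc i)))) (e (Suc (Suc 0))) (e (Suc 0))) (\<lambda>i. if i < 3 then e (id i) else d (i - 3)))"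
    by (rule Sigma1_subst_vars) (use assms in \<open>simp_all add: def_fun_def\<close>)
  then show ?thesis
    by (simp add: def_fun_def)
qed

lemma def_fun_subst2':
  assumes g: "def_fun (\<lambda>e. g (\<lambda>i. e (Suc (Suc i))) (e (Suc 0)) (e 0))" and h: "inj h"
    and s: "def_fun s" and t: "def_fun t"
  shows "def_fun (\<lambda>e. g (\<lambda>i. e (h i)) (s e) (t e))"
proof -
  define k where "k i = (case i of 0 \<Rightarrow> Suc (Suc 0) | Suc 0 \<Rightarrow> Suc 0 | Suc (Suc 0) \<Rightarrow> 0
    | Suc (Suc (Suc j)) \<Rightarrow> Suc (Suc (Suc (h j))))" for i
  have "inj k"
    by (rule injI) (auto simp: k_def inj_eq[OF h] split: nat.splits)
  from Sigma1_reindex[OF g[unfolded def_fun_def] this]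
  have *: "Sigma1 (\<lambda>e. e (Suc (Suc 0)) = g (\<lambda>i. e (Suc (Suc (Suc (h i))))) (e 0) (e (Suc 0)))"
    by (simp add: k_def)
  have "Sigma1 (\<lambda>e. e 0 = g (\<lambda>i. e (Suc (h i))) (s (\<lambda>i. e (Suc i))) (t (\<lambda>i. e (Suc i))))"
    apply (rule Sigma1_subst[where P = "\<lambda>e x. e 0 = g (\<lambda>i. e (Suc (h i))) (s (\<lambda>i. e (Suc i))) x", OF _ def_fun_shift[OF t]])
    apply (rule Sigma1_subst[where P = "\<lambda>e x. e (Suc 0) = g (\<lambda>i. e (Suc (Suc (h i)))) x (e 0)", OF _ def_fun_shift[OF def_fun_shift[OF s]]])
    by (rule *)
  then show ?thesis
    by (simp add: def_fun_def)
qed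

lemma def_fun_prim_rec [definable]:
  assumes a: "def_fun a" and g: "def_fun (\<lambda>e. g (\<lambda>i. e (Suc (Suc i))) (e (Suc 0)) (e 0))" and t: "def_fun t"
  shows "def_fun (\<lambda>e. prim_rec (a e) (g e) (t e))"
proof -
  have gd: "def_fun (\<lambda>e. g d (e (Suc 0)) (e 0))" for d
    using g by (rule def_fun_fix2)
  have "y = prim_rec a (g d) n \<longleftrightarrow> (\<exists>s. rec_seq a (g d) n s \<and> y = ent s n)" for y a d n
    using ex_rec_seq[OF gd] prim_rec_eqI[OF gd] by metis
  moreover have "Sigma1 (\<lambda>e. \<exists>s. rec_seq (a (\<lambda>i. e (Suc i))) (g (\<lambda>i. e (Suc i))) (t (\<lambda>i. e (Suc i))) s \<and>
      e 0 = ent s (t (\<lambda>i. e (Suc i))))"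
  proof -
    have "inj (\<lambda>i. Suc (Suc (Suc i)))"
      by (simp add: inj_def)
    from def_fun_subst2'[OF g this, of "\<lambda>e. e 0" "\<lambda>e. ent (e (Suc 0)) (e 0)"]
    have "def_fun (\<lambda>e. g (\<lambda>i. e (Suc (Suc (Suc i)))) (e 0) (ent (e (Suc 0)) (e 0)))"
      using def_fun_ent def_fun_var by simp
    then show ?thesis
      unfolding rec_seq_def
      by (intro Sigma1_ex Delta1_Sigma1 definable def_fun_shift[OF a] def_fun_shift[OF t]
          def_fun_shift[OF def_fun_shift[OF a]] def_fun_shift[OF def_fun_shift[OF t]])
  qed
  ultimately show ?thesis
    unfolding def_fun_def by (simp only:)
qed

section \<open>The empty sequence, appending, bounds for binary sequences, powers of two\<close>

lemma less_one_iff [simp]: "x \<prec> \<one> \<longleftrightarrow> x = \<zero>"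
  using less_succ[of x \<zero>] by simp

lemma nil_eq: "nil = restr g \<zero>" if "def_fun (\<lambda>e. g (e 0))"
proof -
  have "lh s = \<zero> \<Longrightarrow> fin_seq s \<Longrightarrow> s = restr g \<zero>" for s
    using restr_spec[OF that, of \<zero>] by - (rule seq_eqI, auto)
  then show ?thesis
    unfolding nil_def using restr_spec[OF that, of \<zero>] by (intro the_equality) auto
qed

lemma fin_seq_nil [simp]: "fin_seq nil" and lh_nil [simp]: "lh nil = \<zero>"
  using restr_spec[of "\<lambda>_. \<zero>" \<zero>] nil_eq[of "\<lambda>_. \<zero>"] def_fun_const by auto

lemma lh_zero: "fin_seq s \<Longrightarrow> lh s = \<zero> \<Longrightarrow> s = nil"
  by (rule seq_eqI) auto

lemma snoc_spec:
  assumes s: "fin_seq s"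
  shows "fin_seq (snoc s n)" "lh (snoc s n) = lh s \<oplus> \<one>" "i \<prec> lh s \<Longrightarrow> entry (snoc s n) i = entry s i"
    "entry (snoc s n) (lh s) = n"
proof -
  define g where "g i = (if i \<prec> lh s then ent s i else n)" for i
  have "def_fun (\<lambda>e. g (e 0))"
    unfolding g_def by (intro definable)
  note r = restr_spec[OF this, of "lh s \<oplus> \<one>"]
  have g: "i \<prec> lh s \<Longrightarrow> g i = entry s i" "g (lh s) = n" for i
    using s by (simp_all add: g_def ent_eq)
  define P where "P t \<longleftrightarrow> fin_seq t \<and> lh t = lh s \<oplus> \<one> \<and> (\<forall>i. i \<prec> lh s \<longrightarrow> entry t i = entry s i) \<and> entry t (lh s) = n" for t
  have "P (restr g (lh s \<oplus> \<one>))"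
    using r g by (simp add: P_def less_succ)
  moreover have "t = u" if "P t" "P u" for t u
    using that by - (rule seq_eqI, auto simp: P_def less_succ)
  ultimately have "\<exists>!t. P t" by blast
  then have "P (snoc s n)"
    unfolding snoc_def P_def[symmetric] by (rule theI')
  then show "fin_seq (snoc s n)" "lh (snoc s n) = lh s \<oplus> \<one>" "i \<prec> lh s \<Longrightarrow> entry (snoc s n) i = entry s i"
    "entry (snoc s n) (lh s) = n"
    using P_def by blast+
qed

definition num_of_bool :: "bool \<Rightarrow> 'm" where "num_of_bool b = (if b then \<one> else \<zero>)"

lemma def_fun_num_of_bool [definable]: "Delta1 P \<Longrightarrow> def_fun (\<lambda>e. num_of_bool (P e))"
  unfolding num_of_bool_def by (intro definable)

lemma Delta1_binary_seq [definable]: "def_fun t \<Longrightarrow> Delta1 (\<lambda>e. binary_seq (t e))"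
proof -
  have "binary_seq s \<longleftrightarrow> fin_seq s \<and> (\<forall>i. i \<prec> lh s \<longrightarrow> ent s i = \<zero> \<or> ent s i = \<one>)" for s
    by (auto simp: binary_seq_def ent_def)
  then have "Delta1 (\<lambda>e. binary_seq (e 0))"
    by (simp only:) (intro definable)
  then show "def_fun t \<Longrightarrow> Delta1 (\<lambda>e. binary_seq (t e))"
    by (rule Delta1_subst2[where P = "\<lambda>x y. binary_seq x"])
qed

lemma lh_le: "fin_seq s \<Longrightarrow> lh s \<preceq>\<preceq> s"
  using fin_seq_length has_length_le by blast

text \<open>Binary sequences of length \<open>n\<close> are sets of pairs below
  \<open>\<langle>n, 2\<rangle>\<close>. Taking the least bound for codes of such sets gives a
  definable function, by which quantifiers over binary sequences of a given length become
  bounded.\<close>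

definition bin_bound :: "'m \<Rightarrow> 'm" where "bin_bound n = least (code_bound \<langle>n, \<one> \<oplus> \<one>\<rangle>)"

lemma def_fun_bin_bound [definable]: "def_fun t \<Longrightarrow> def_fun (\<lambda>e. bin_bound (t e))"
  unfolding bin_bound_def
  by (rule def_fun_subst1[of "\<lambda>n. least (code_bound \<langle>n, \<one> \<oplus> \<one>\<rangle>)"])
     (intro definable ex_code_bound)

lemma code_bound_bin_bound: "code_bound \<langle>n, \<one> \<oplus> \<one>\<rangle> (bin_bound n)"
proof -
  obtain b where "code_bound \<langle>n, \<one> \<oplus> \<one>\<rangle> b"
    using ex_code_bound by blast
  moreover have "Delta1 (\<lambda>e. code_bound \<langle>n, \<one> \<oplus> \<one>\<rangle> (e 0))"
    by (intro definable)
  ultimately show ?thesis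
    unfolding bin_bound_def by (rule leastI[of "code_bound \<langle>n, \<one> \<oplus> \<one>\<rangle>", rotated])
qed

text \<open>A sequence with the same entries is constructed below the bound. Codes of finite sets
  are canonical, so it is the given sequence.\<close>

lemma binary_seq_le_bound:
  assumes "binary_seq s"
  shows "s \<preceq>\<preceq> bin_bound (lh s)"
proof -
  have s: "fin_seq s" using assms by (simp add: binary_seq_def)
  define g where "g i = (if ent s i = \<one> then \<one> else \<zero>)" for i
  have "def_fun (\<lambda>e. g (e 0))"
    unfolding g_def by (intro definable)
  moreover have "g i \<prec> \<one> \<oplus> \<one>" for i
    by (simp add: g_def less_succ_iff_le)
  ultimately obtain t where t: "t \<preceq>\<preceq> bin_bound (lh s)" "fin_seq t" "lh t = lh s"
    "\<And>i. i \<prec> lh s \<Longrightarrow> entry t i = g i"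
    using seq_code_bound[OF code_bound_bin_bound, of g "lh s"] by blast
  have "t = s"
    using t s assms by - (rule seq_eqI, auto simp: g_def ent_def binary_seq_def)
  then show ?thesis using t by simp
qed

text \<open>The description of \<open>pow2\<close> admits only functions of the structure. For
  these, agreement with the recursively computed function is \<Delta>1 and follows by induction,
  which yields uniqueness.\<close>

lemma pow2_eq: "pow2 = prim_rec \<one> (\<lambda>i y. y \<oplus> y)"
proof -
  have g: "def_fun (\<lambda>e. e 0 \<oplus> e 0)" by (intro definable)
  have rec: "prim_rec \<one> (\<lambda>i y. y \<oplus> y) \<zero> = \<one>"
    "prim_rec \<one> (\<lambda>i y. y \<oplus> y) (n \<oplus> \<one>) = prim_rec \<one> (\<lambda>i y. y \<oplus> y) n \<oplus> prim_rec \<one> (\<lambda>i y. y \<oplus> y) n" for n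
    using prim_rec_zero[of "\<lambda>i y. y \<oplus> y" \<one>, OF g] prim_rec_succ[of "\<lambda>i y. y \<oplus> y" \<one>, OF g] by auto
  show ?thesis
    unfolding pow2_def
  proof (rule the_equality)
    have "fn_on UNIV (prim_rec \<one> (\<lambda>i y. y \<oplus> y))"
      by (rule fn_onI) (intro definable, simp)
    then show "fn_on UNIV (prim_rec \<one> (\<lambda>i y. y \<oplus> y)) \<and> prim_rec \<one> (\<lambda>i y. y \<oplus> y) \<zero> = \<one> \<and>
      (\<forall>n. prim_rec \<one> (\<lambda>i y. y \<oplus> y) (n \<oplus> \<one>) = prim_rec \<one> (\<lambda>i y. y \<oplus> y) n \<oplus> prim_rec \<one> (\<lambda>i y. y \<oplus> y) n)"
      using rec by blast
    fix f assume f: "fn_on UNIV f \<and> f \<zero> = \<one> \<and> (\<forall>n. f (n \<oplus> \<one>) = f n \<oplus> f n)"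
    then have fd: "def_fun (\<lambda>e. f (t e))" if "def_fun t" for t
      using def_fun_fn that by blast
    have "f n = prim_rec \<one> (\<lambda>i y. y \<oplus> y) n" for n
      by (rule Delta1_induct[where P = "\<lambda>n. f n = prim_rec \<one> (\<lambda>i y. y \<oplus> y) n"])
        (intro definable fd, use f rec in auto)
    then show "f = prim_rec \<one> (\<lambda>i y. y \<oplus> y)" by blast
  qed
qed

lemma pow2_zero [simp]: "pow2 \<zero> = \<one>" and pow2_succ: "pow2 (n \<oplus> \<one>) = pow2 n \<oplus> pow2 n"
proof -
  have "def_fun (\<lambda>e. e 0 \<oplus> e 0)" by (intro definable)
  then show "pow2 \<zero> = \<one>" "pow2 (n \<oplus> \<one>) = pow2 n \<oplus> pow2 n"
    unfolding pow2_eq using prim_rec_zero[of "\<lambda>i y. y \<oplus> y" \<one>] prim_rec_succ[of "\<lambda>i y. y \<oplus> y" \<one>] by auto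
qed

lemma def_fun_pow2 [definable]: "def_fun t \<Longrightarrow> def_fun (\<lambda>e. pow2 (t e))"
  unfolding pow2_eq by (intro definable)

lemma less_pow2: "n \<prec> pow2 n"
proof (rule Delta1_induct[where P = "\<lambda>n. n \<prec> pow2 n"])
  fix n assume "n \<prec> pow2 n"
  moreover from this have "\<zero> \<prec> pow2 n"
    using nums.le_less_trans zero_le by blast
  ultimately have "n \<oplus> \<one> \<prec> pow2 n \<oplus> pow2 n"
    using nums.add_less_le_mono[of n "pow2 n" \<one> "pow2 n"] succ_le_iff[of \<zero>] by simp
  then show "n \<oplus> \<one> \<prec> pow2 (n \<oplus> \<one>)"
    by (simp add: pow2_succ)
qed (intro definable, simp)

lemma pow2_pos [simp]: "\<zero> \<prec> pow2 n"
  using less_pow2 nums.le_less_trans zero_le by blast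

lemma pow2_neq_zero [simp]: "pow2 n \<noteq> \<zero>"
  by (simp add: num_neq_zero_iff)

section \<open>Rational numbers\<close>

lemma rat_code: "rat \<langle>\<langle>a, b\<rangle>, c\<rangle> \<longleftrightarrow> c \<noteq> \<zero>"
  by (auto simp: rat_def)

lemma ratE:
  assumes "rat q"
  obtains a b c where "q = \<langle>\<langle>a, b\<rangle>, c\<rangle>" "\<zero> \<prec> c"
  using assms unfolding rat_def num_neq_zero_iff by blast

lemma rat_le_code:
  "rat_le \<langle>\<langle>a, b\<rangle>, c\<rangle> \<langle>\<langle>a', b'\<rangle>, c'\<rangle> \<longleftrightarrow> a \<otimes> c' \<oplus> b' \<otimes> c \<preceq>\<preceq> a' \<otimes> c \<oplus> b \<otimes> c'"
  by (simp add: rat_le_def num_le_def)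

lemma rat_add_code:
  "rat_add \<langle>\<langle>a, b\<rangle>, c\<rangle> \<langle>\<langle>a', b'\<rangle>, c'\<rangle> = \<langle>\<langle>a \<otimes> c' \<oplus> a' \<otimes> c, b \<otimes> c' \<oplus> b' \<otimes> c\<rangle>, c \<otimes> c'\<rangle>"
  by (simp add: rat_add_def)

lemma rat_minus_code: "rat_minus \<langle>\<langle>a, b\<rangle>, c\<rangle> = \<langle>\<langle>b, a\<rangle>, c\<rangle>"
  by (simp add: rat_minus_def)

lemma rat_rat_add [simp]: "rat p \<Longrightarrow> rat q \<Longrightarrow> rat (rat_add p q)"
  by (elim ratE) (simp add: rat_add_code rat_code num_neq_zero_iff)

lemma rat_rat_minus [simp]: "rat p \<Longrightarrow> rat (rat_minus p)"
  by (elim ratE) (simp add: rat_minus_code rat_code num_neq_zero_iff)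

lemma rat_rat_zero [simp]: "rat rat_zero"
  by (simp add: rat_zero_def rat_code)

lemma rat_half_pow [simp]: "rat (half_pow n)"
  by (simp add: half_pow_def rat_code)

lemma rat_rat_dist [simp]: "rat p \<Longrightarrow> rat q \<Longrightarrow> rat (rat_dist p q)"
  by (simp add: rat_dist_def)

lemma num_mult_le_cancel_right: "\<zero> \<prec> c \<Longrightarrow> a \<otimes> c \<preceq>\<preceq> b \<otimes> c \<longleftrightarrow> a \<preceq>\<preceq> b"
  using num_mult_less[of b a c] nums.mult_right_mono[of a b c] nums.mult.commute
  by (metis nums.not_le zero_le)

lemma rat_le_trans:
  assumes "rat p" "rat q" "rat r" "rat_le p q" "rat_le q r"
  shows "rat_le p r"
proof -
  obtain a b c where p: "p = \<langle>\<langle>a, b\<rangle>, c\<rangle>" "\<zero> \<prec> c" using assms(1) by (rule ratE)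
  obtain a' b' c' where q: "q = \<langle>\<langle>a', b'\<rangle>, c'\<rangle>" "\<zero> \<prec> c'" using assms(2) by (rule ratE)
  obtain a'' b'' c'' where r: "r = \<langle>\<langle>a'', b''\<rangle>, c''\<rangle>" "\<zero> \<prec> c''" using assms(3) by (rule ratE)
  define K where "K = c \<otimes> c'' \<otimes> (a' \<oplus> b')"
  have "(a \<otimes> c' \<oplus> b' \<otimes> c) \<otimes> c'' \<oplus> (a' \<otimes> c'' \<oplus> b'' \<otimes> c') \<otimes> c \<preceq>\<preceq>
      (a' \<otimes> c \<oplus> b \<otimes> c') \<otimes> c'' \<oplus> (a'' \<otimes> c' \<oplus> b' \<otimes> c'') \<otimes> c"
    by (rule nums.add_mono; rule nums.mult_right_mono)
      (use assms(4,5) in \<open>simp_all add: p q r rat_le_code\<close>)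
  moreover have "(a \<otimes> c' \<oplus> b' \<otimes> c) \<otimes> c'' \<oplus> (a' \<otimes> c'' \<oplus> b'' \<otimes> c') \<otimes> c = (a \<otimes> c'' \<oplus> b'' \<otimes> c) \<otimes> c' \<oplus> K"
    "(a' \<otimes> c \<oplus> b \<otimes> c') \<otimes> c'' \<oplus> (a'' \<otimes> c' \<oplus> b' \<otimes> c'') \<otimes> c = (a'' \<otimes> c \<oplus> b \<otimes> c'') \<otimes> c' \<oplus> K"
    by (simp_all add: K_def num_ac)
  ultimately show ?thesis
    using num_mult_le_cancel_right[OF q(2)] by (simp add: p r rat_le_code)
qed

lemma rat_le_linear: "rat p \<Longrightarrow> rat q \<Longrightarrow> rat_le p q \<or> rat_le q p"
  unfolding rat_le_def num_le_def[symmetric] by (rule nums.linear)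

lemma rat_le_refl: "rat_le p p"
  by (simp add: rat_le_def)

lemma rat_le_add_cancel:
  assumes "rat p" "rat q" "rat r"
  shows "rat_le (rat_add p r) (rat_add q r) \<longleftrightarrow> rat_le p q"
proof -
  obtain a b c where p: "p = \<langle>\<langle>a, b\<rangle>, c\<rangle>" "\<zero> \<prec> c" using assms(1) by (rule ratE)
  obtain a' b' c' where q: "q = \<langle>\<langle>a', b'\<rangle>, c'\<rangle>" "\<zero> \<prec> c'" using assms(2) by (rule ratE)
  obtain x y z where r: "r = \<langle>\<langle>x, y\<rangle>, z\<rangle>" "\<zero> \<prec> z" using assms(3) by (rule ratE)
  define K where "K = z \<otimes> c \<otimes> c' \<otimes> (x \<oplus> y)"
  have "(a \<otimes> z \<oplus> x \<otimes> c) \<otimes> (c' \<otimes> z) \<oplus> (b' \<otimes> z \<oplus> y \<otimes> c') \<otimes> (c \<otimes> z) = (a \<otimes> c' \<oplus> b' \<otimes> c) \<otimes> (z \<otimes> z) \<oplus> K"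
    "(a' \<otimes> z \<oplus> x \<otimes> c') \<otimes> (c \<otimes> z) \<oplus> (b \<otimes> z \<oplus> y \<otimes> c) \<otimes> (c' \<otimes> z) = (a' \<otimes> c \<oplus> b \<otimes> c') \<otimes> (z \<otimes> z) \<oplus> K"
    by (simp_all add: K_def num_ac)
  then show ?thesis
    using num_mult_le_cancel_right[of "z \<otimes> z"] r(2) by (simp add: p q r rat_add_code rat_le_code)
qed

lemma rat_add_commute: "rat p \<Longrightarrow> rat q \<Longrightarrow> rat_add p q = rat_add q p"
  by (elim ratE) (simp add: rat_add_code num_ac)

lemma rat_add_assoc: "rat p \<Longrightarrow> rat q \<Longrightarrow> rat r \<Longrightarrow> rat_add (rat_add p q) r = rat_add p (rat_add q r)"
  by (elim ratE) (simp add: rat_add_code num_ac)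

lemma rat_add_zero: "rat p \<Longrightarrow> rat_add p rat_zero = p"
  by (elim ratE) (simp add: rat_add_code rat_zero_def)

lemma rat_add_minus: "rat p \<Longrightarrow> rat_le (rat_add p (rat_minus p)) rat_zero \<and> rat_le rat_zero (rat_add p (rat_minus p))"
  by (elim ratE) (simp add: rat_add_code rat_minus_code rat_zero_def rat_le_code num_ac)

text \<open>The rational numbers of the structure form an ordered group, which is realized on the whole
  type \<open>'m\<close>, so that the class of linearly ordered groups can be interpreted: there are as many
  rational numbers as numbers by the Schroeder--Bernstein theorem. \<open>val\<close> maps codes to values.\<close>

definition rat_eq :: "'m \<Rightarrow> 'm \<Rightarrow> bool" where "rat_eq p q \<longleftrightarrow> rat_le p q \<and> rat_le q p"

definition val :: "'m \<Rightarrow> 'm" where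
  "val = (SOME v. (\<forall>p q. rat p \<longrightarrow> rat q \<longrightarrow> (v p = v q \<longleftrightarrow> rat_eq p q)) \<and> (\<forall>x. \<exists>q. rat q \<and> v q = x))"

lemma val_spec:
  "(\<forall>p q. rat p \<longrightarrow> rat q \<longrightarrow> (val p = val q \<longleftrightarrow> rat_eq p q)) \<and> (\<forall>x. \<exists>q. rat q \<and> val q = x)"
proof -
  define canon where "canon q = (SOME p. rat p \<and> rat_eq p q)" for q
  have canon: "rat (canon q) \<and> rat_eq (canon q) q" if "rat q" for q
    unfolding canon_def by (rule someI[of _ q]) (use that in \<open>simp add: rat_eq_def rat_le_refl\<close>)
  have eq: "canon p = canon q \<longleftrightarrow> rat_eq p q" if "rat p" "rat q" for p q
  proof
    assume "canon p = canon q"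
    then show "rat_eq p q"
      using canon[OF that(1)] canon[OF that(2)] that rat_le_trans unfolding rat_eq_def by metis
  next
    assume "rat_eq p q"
    then have "(rat r \<and> rat_eq r p) = (rat r \<and> rat_eq r q)" for r
      using that rat_le_trans unfolding rat_eq_def by blast
    then show "canon p = canon q"
      by (simp add: canon_def)
  qed
  \<comment> \<open>The injection from numbers to rationals for the Schroeder--Bernstein theorem:
    \<open>n\<close> is sent to the chosen representative of \<open>n / 1\<close>.\<close>
  define emb where "emb n = canon \<langle>\<langle>n, \<zero>\<rangle>, \<one>\<rangle>" for n
  have emb: "emb n = emb m \<longleftrightarrow> n = m" for n m
  proof -
    have "rat_eq \<langle>\<langle>n, \<zero>\<rangle>, \<one>\<rangle> \<langle>\<langle>m, \<zero>\<rangle>, \<one>\<rangle> \<longleftrightarrow> n = m"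
      by (auto simp: rat_eq_def rat_le_code)
    then show ?thesis
      by (simp add: emb_def eq rat_code)
  qed
  then have "inj emb" by (simp add: inj_def)
  moreover have "range emb \<subseteq> canon ` {q. rat q}"
    by (auto simp: emb_def rat_code)
  ultimately have "\<exists>h. bij_betw h (canon ` {q. rat q}) (UNIV :: 'm set)"
    using Schroeder_Bernstein[of id "canon ` {q. rat q}" UNIV emb] by simp
  then obtain h where h: "bij_betw h (canon ` {q. rat q}) (UNIV :: 'm set)" ..
  have "(\<forall>p q. rat p \<longrightarrow> rat q \<longrightarrow> (h (canon p) = h (canon q) \<longleftrightarrow> rat_eq p q)) \<and> (\<forall>x. \<exists>q. rat q \<and> h (canon q) = x)"
  proof (intro conjI allI impI)
    fix p q assume "rat p" "rat q"
    then show "h (canon p) = h (canon q) \<longleftrightarrow> rat_eq p q"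
      using h eq by (auto simp: bij_betw_def inj_on_eq_iff[of h "canon ` {q. rat q}"])
  next
    fix x
    have "x \<in> h ` canon ` {q. rat q}"
      using h by (simp add: bij_betw_def)
    then show "\<exists>q. rat q \<and> h (canon q) = x" by auto
  qed
  then have "\<exists>v :: 'm \<Rightarrow> 'm. (\<forall>p q. rat p \<longrightarrow> rat q \<longrightarrow> (v p = v q \<longleftrightarrow> rat_eq p q)) \<and> (\<forall>x. \<exists>q. rat q \<and> v q = x)"
    by (rule exI[of _ "\<lambda>q. h (canon q)"])
  from someI_ex[OF this] show ?thesis
    unfolding val_def .
qed

lemma val_eq_iff: "rat p \<Longrightarrow> rat q \<Longrightarrow> val p = val q \<longleftrightarrow> rat_eq p q"
  using val_spec by blast

definition rep :: "'m \<Rightarrow> 'm" where "rep x = (SOME q. rat q \<and> val q = x)"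

lemma rat_rep [simp]: "rat (rep x)" and val_rep [simp]: "val (rep x) = x"
  unfolding rep_def using someI_ex[of "\<lambda>q. rat q \<and> val q = x"] val_spec by blast+

lemma rep_val: "rat q \<Longrightarrow> rat_eq (rep (val q)) q"
  using val_eq_iff[of "rep (val q)" q] by simp

definition val_add (infixl "\<boxplus>" 65) where "x \<boxplus> y = val (rat_add (rep x) (rep y))"
definition val_uminus where "val_uminus x = val (rat_minus (rep x))"
definition val_minus (infixl "\<boxminus>" 65) where "x \<boxminus> y = x \<boxplus> val_uminus y"
definition val_le (infix "\<sqsubseteq>" 50) where "x \<sqsubseteq> y \<longleftrightarrow> rat_le (rep x) (rep y)"
definition val_less (infix "\<sqsubset>" 50) where "x \<sqsubset> y \<longleftrightarrow> x \<sqsubseteq> y \<and> \<not> y \<sqsubseteq> x"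
definition val_zero ("\<zero>\<^sub>v") where "\<zero>\<^sub>v = val rat_zero"

lemma val_le_iff: "rat p \<Longrightarrow> rat q \<Longrightarrow> val p \<sqsubseteq> val q \<longleftrightarrow> rat_le p q"
  unfolding val_le_def using rep_val[of p] rep_val[of q] rat_le_trans unfolding rat_eq_def
  by (meson rat_rep)

lemma val_rat_add:
  assumes "rat p" "rat q"
  shows "val (rat_add p q) = val p \<boxplus> val q"
proof -
  have "rat_eq (rat_add p' q') (rat_add p q')" if "rat_eq p' p" "rat p" "rat p'" "rat q'" for p p' q'
    using that rat_le_add_cancel unfolding rat_eq_def by blast
  note * = this
  have "val (rat_add (rep (val p)) (rep (val q))) = val (rat_add p (rep (val q)))"
    using * assms rep_val by (simp add: val_eq_iff)
  also have "\<dots> = val (rat_add (rep (val q)) p)"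
    using assms by (simp add: rat_add_commute)
  also have "\<dots> = val (rat_add q p)"
    using * assms rep_val by (simp add: val_eq_iff)
  finally show ?thesis
    using assms by (simp add: val_add_def rat_add_commute)
qed

lemma val_cases: obtains q where "rat q" "x = val q"
  using val_rep rat_rep by metis

lemma val_add_uminus: "x \<boxplus> val_uminus x = \<zero>\<^sub>v"
proof -
  have "x \<boxplus> val_uminus x = val (rat_add (rep x) (rat_minus (rep x)))"
    using val_rat_add[of "rep x" "rat_minus (rep x)"] by (simp add: val_uminus_def)
  then show ?thesis
    using rat_add_minus[of "rep x"] by (simp add: val_zero_def val_eq_iff rat_eq_def)
qed

lemma val_add_commute: "x \<boxplus> y = y \<boxplus> x"
  by (simp add: val_add_def rat_add_commute)

lemma val_add_zero: "x \<boxplus> \<zero>\<^sub>v = x"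
  using val_rat_add[of "rep x" rat_zero] by (simp add: val_zero_def rat_add_zero)

sublocale vals: linordered_ab_group_add "(\<boxplus>)" "\<zero>\<^sub>v" "(\<boxminus>)" val_uminus "(\<sqsubseteq>)" "(\<sqsubset>)"
proof unfold_locales
  show "a \<boxplus> b \<boxplus> c = a \<boxplus> (b \<boxplus> c)" for a b c
  proof -
    obtain p q r where "rat p" "rat q" "rat r" "a = val p" "b = val q" "c = val r"
      by (metis val_cases)
    then show ?thesis
      using rat_add_assoc[of p q r] by (simp flip: val_rat_add)
  qed
  show "a \<boxplus> b = b \<boxplus> a" for a b by (rule val_add_commute)
  show "\<zero>\<^sub>v \<boxplus> a = a" for a
    by (metis val_add_commute val_add_zero)
  show "val_uminus a \<boxplus> a = \<zero>\<^sub>v" for a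
    by (metis val_add_commute val_add_uminus)
  show "a \<boxminus> b = a \<boxplus> val_uminus b" for a b
    by (simp add: val_minus_def)
  show "(a \<sqsubset> b) = (a \<sqsubseteq> b \<and> \<not> b \<sqsubseteq> a)" for a b by (simp add: val_less_def)
  show "a \<sqsubseteq> a" for a by (simp add: val_le_def rat_le_refl)
  show "a \<sqsubseteq> c" if "a \<sqsubseteq> b" "b \<sqsubseteq> c" for a b c
    using that rat_le_trans unfolding val_le_def by (meson rat_rep)
  show "a = b" if "a \<sqsubseteq> b" "b \<sqsubseteq> a" for a b
    using that val_eq_iff[of "rep a" "rep b"] unfolding val_le_def rat_eq_def by simp
  show "a \<sqsubseteq> b \<or> b \<sqsubseteq> a" for a b
    unfolding val_le_def by (rule rat_le_linear) simp_all
  show "c \<boxplus> a \<sqsubseteq> c \<boxplus> b" if "a \<sqsubseteq> b" for a b c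
  proof -
    have "rat_le (rat_add (rep a) (rep c)) (rat_add (rep b) (rep c))"
      using that by (simp add: rat_le_add_cancel val_le_def)
    then show ?thesis
      by (simp add: val_add_def val_le_iff rat_add_commute[of "rep c"])
  qed
qed

lemma val_rat_minus: "rat p \<Longrightarrow> val (rat_minus p) = val_uminus (val p)"
proof -
  assume p: "rat p"
  have "val p \<boxplus> val (rat_minus p) = \<zero>\<^sub>v"
    using rat_add_minus[OF p] p by (simp add: val_zero_def val_eq_iff rat_eq_def flip: val_rat_add)
  then show ?thesis
    by (metis vals.add.inverse_unique)
qed

lemma val_rat_zero [simp]: "val rat_zero = \<zero>\<^sub>v"
  by (simp add: val_zero_def)

lemma pos_rat_iff: "pos_rat r \<longleftrightarrow> rat r \<and> \<zero>\<^sub>v \<sqsubset> val r"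
  unfolding pos_rat_def using val_le_iff[of r rat_zero] by (auto simp: vals.not_le)

lemmas val_ac = vals.add.assoc vals.add.commute vals.add.left_commute

text \<open>A linear inequality is derived from the sum \<open>u \<le> v\<close> of its premises by an identity.\<close>

lemma val_leI:
  assumes "u \<sqsubseteq> v" "s \<boxplus> v = t \<boxplus> u"
  shows "s \<sqsubseteq> t"
proof -
  have "t \<boxplus> u \<sqsubseteq> t \<boxplus> v"
    using assms(1) by (rule vals.add_left_mono)
  then show ?thesis
    unfolding assms(2)[symmetric] by (simp only: vals.add_le_cancel_right)
qed

lemma val_lessI:
  assumes "u \<sqsubset> v" "s \<boxplus> v = t \<boxplus> u"
  shows "s \<sqsubset> t"
proof -
  have "t \<boxplus> u \<sqsubset> t \<boxplus> v"
    using assms(1) by (rule vals.add_strict_left_mono)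
  then show ?thesis
    unfolding assms(2)[symmetric] by (simp only: vals.add_less_cancel_right)
qed

lemma val_rat_dist_le_iff:
  assumes "rat p" "rat q"
  shows "val (rat_dist p q) \<sqsubseteq> e \<longleftrightarrow> val p \<sqsubseteq> val q \<boxplus> e \<and> val q \<sqsubseteq> val p \<boxplus> e"
proof -
  define x y where "x = val p" and "y = val q"
  have *: "a \<boxminus> b \<sqsubseteq> e \<longleftrightarrow> a \<sqsubseteq> b \<boxplus> e \<and> b \<sqsubseteq> a \<boxplus> e" if "b \<sqsubseteq> a" for a b
  proof
    assume "a \<boxminus> b \<sqsubseteq> e"
    then have a: "a \<sqsubseteq> b \<boxplus> e"
      unfolding vals.diff_le_eq vals.add.commute[of e] .
    then have "b \<sqsubseteq> b \<boxplus> e"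
      using that vals.order_trans by blast
    then have "\<zero>\<^sub>v \<sqsubseteq> e"
      by (simp only: vals.le_add_same_cancel1)
    then show "a \<sqsubseteq> b \<boxplus> e \<and> b \<sqsubseteq> a \<boxplus> e"
      using a that vals.add_increasing2 by blast
  qed (unfold vals.diff_le_eq vals.add.commute[of e], blast)
  have "val (rat_dist p q) = (if y \<sqsubseteq> x then x \<boxminus> y else y \<boxminus> x)"
    using assms by (simp add: rat_dist_def x_def y_def val_le_iff val_rat_add val_rat_minus)
  then show ?thesis
    using *[of x y] *[of y x] vals.linear[of x y] by (auto simp: x_def y_def)
qed

definition hp :: "'m \<Rightarrow> 'm" where "hp n = val (half_pow n)"

lemma hp_double: "hp (n \<oplus> \<one>) \<boxplus> hp (n \<oplus> \<one>) = hp n"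
  unfolding hp_def val_rat_add[OF rat_half_pow rat_half_pow, symmetric]
  by (subst val_eq_iff, simp, simp)
    (simp add: half_pow_def rat_add_code rat_eq_def rat_le_code pow2_succ num_ac)

lemma hp_pos [simp]: "\<zero>\<^sub>v \<sqsubset> hp n"
proof -
  have "\<not> rat_le (half_pow n) rat_zero"
    by (simp add: half_pow_def rat_zero_def rat_le_code nums.not_le)
  then show ?thesis
    using pos_rat_iff[of "half_pow n"] by (simp add: hp_def pos_rat_def)
qed

lemma hp_nonneg [simp]: "\<zero>\<^sub>v \<sqsubseteq> hp n"
  by (rule vals.less_imp_le) simp

lemma hp_succ_le: "hp (n \<oplus> \<one>) \<sqsubseteq> hp n"
  using vals.add_increasing[OF hp_nonneg[of "n \<oplus> \<one>"] vals.order_refl[of "hp (n \<oplus> \<one>)"]]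
  by (simp only: hp_double)

lemma def_fun_rat_add [definable]: "def_fun s \<Longrightarrow> def_fun t \<Longrightarrow> def_fun (\<lambda>e. rat_add (s e) (t e))"
  unfolding rat_add_def by (intro definable)

lemma def_fun_rat_minus [definable]: "def_fun s \<Longrightarrow> def_fun (\<lambda>e. rat_minus (s e))"
  unfolding rat_minus_def by (intro definable)

lemma def_fun_half_pow [definable]: "def_fun s \<Longrightarrow> def_fun (\<lambda>e. half_pow (s e))"
  unfolding half_pow_def by (intro definable)

lemma Delta1_rat_le [definable]: "def_fun s \<Longrightarrow> def_fun t \<Longrightarrow> Delta1 (\<lambda>e. rat_le (s e) (t e))"
  unfolding rat_le_def by (intro definable)

lemma def_fun_rat_dist [definable]: "def_fun s \<Longrightarrow> def_fun t \<Longrightarrow> def_fun (\<lambda>e. rat_dist (s e) (t e))"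
  unfolding rat_dist_def by (intro definable)

lemma Delta1_rat [definable]: "def_fun t \<Longrightarrow> Delta1 (\<lambda>e. rat (t e))"
proof -
  have "rat q \<longleftrightarrow> (\<exists>a. a \<prec> q \<oplus> \<one> \<and> (\<exists>b. b \<prec> q \<oplus> \<one> \<and> (\<exists>c. c \<prec> q \<oplus> \<one> \<and> c \<noteq> \<zero> \<and> q = \<langle>\<langle>a, b\<rangle>, c\<rangle>)))" for q
  proof
    assume "rat q"
    then obtain a b c where *: "c \<noteq> \<zero>" "q = \<langle>\<langle>a, b\<rangle>, c\<rangle>" by (auto simp: rat_def)
    moreover have "a \<preceq>\<preceq> q" "b \<preceq>\<preceq> q" "c \<preceq>\<preceq> q"
      unfolding *(2) using le_pair1 le_pair2 nums.order_trans by blast+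
    ultimately show "\<exists>a. a \<prec> q \<oplus> \<one> \<and> (\<exists>b. b \<prec> q \<oplus> \<one> \<and> (\<exists>c. c \<prec> q \<oplus> \<one> \<and> c \<noteq> \<zero> \<and> q = \<langle>\<langle>a, b\<rangle>, c\<rangle>))"
      unfolding less_succ_iff_le by blast
  qed (auto simp: rat_def)
  then have "Delta1 (\<lambda>e. rat (e 0))"
    by (simp only:) (intro definable)
  then show "def_fun t \<Longrightarrow> Delta1 (\<lambda>e. rat (t e))"
    by (rule Delta1_subst2[where P = "\<lambda>x y. rat x"])
qed

lemma Delta1_pos_rat [definable]: "def_fun t \<Longrightarrow> Delta1 (\<lambda>e. pos_rat (t e))"
  unfolding pos_rat_def by (intro definable)

lemma hp_antimono: "n \<preceq>\<preceq> m \<Longrightarrow> hp m \<sqsubseteq> hp n"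
proof -
  have "hp (n \<oplus> k) \<sqsubseteq> hp n" for k
  proof -
    have "rat_le (half_pow (n \<oplus> k)) (half_pow n)"
    proof (rule Delta1_induct[where P = "\<lambda>k. rat_le (half_pow (n \<oplus> k)) (half_pow n)"])
      show "rat_le (half_pow (n \<oplus> (k \<oplus> \<one>))) (half_pow n)" if "rat_le (half_pow (n \<oplus> k)) (half_pow n)" for k
        using that hp_succ_le[of "n \<oplus> k"] rat_le_trans by (simp add: hp_def val_le_iff add_succ) (meson rat_half_pow)
    qed (intro definable, simp add: rat_le_refl)
    then show ?thesis
      by (simp add: hp_def val_le_iff)
  qed
  then show "n \<preceq>\<preceq> m \<Longrightarrow> hp m \<sqsubseteq> hp n"
    by (auto simp: num_le_iff)
qed

text \<open>A positive rational \<open>(a - b) / c\<close> is at least \<open>1 / c\<close>, and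
  \<open>c\<close> is less than its power of two, also for nonstandard \<open>c\<close>.\<close>

lemma ex_hp_less:
  assumes "\<zero>\<^sub>v \<sqsubset> x"
  shows "\<exists>n. hp n \<sqsubset> x"
proof -
  obtain q where q: "rat q" "x = val q" by (rule val_cases)
  then obtain a b c where abc: "q = \<langle>\<langle>a, b\<rangle>, c\<rangle>" "\<zero> \<prec> c" by (elim ratE)
  have "\<not> rat_le q rat_zero"
    using assms q pos_rat_iff[of q] by (simp add: pos_rat_def)
  then have "b \<oplus> \<one> \<preceq>\<preceq> a"
    by (simp add: abc rat_zero_def rat_le_code nums.not_le succ_le_iff)
  then have "(b \<oplus> \<one>) \<otimes> pow2 c \<preceq>\<preceq> a \<otimes> pow2 c"
    by (intro nums.mult_right_mono) simp_all
  moreover have "c \<oplus> b \<otimes> pow2 c \<prec> (b \<oplus> \<one>) \<otimes> pow2 c"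
    using less_pow2[of c] by (simp add: nums.distrib_right nums.add.commute)
  ultimately have "c \<oplus> b \<otimes> pow2 c \<prec> a \<otimes> pow2 c"
    using nums.less_le_trans by blast
  then have "\<not> rat_le q (half_pow c)"
    by (simp add: abc half_pow_def rat_le_code nums.not_le)
  then have "hp c \<sqsubset> x"
    using q by (simp add: hp_def val_le_iff flip: vals.not_le)
  then show ?thesis ..
qed

section \<open>Real numbers and metric spaces\<close>

definition evt :: "('m \<Rightarrow> bool) \<Rightarrow> bool" where "evt P \<longleftrightarrow> (\<exists>N. \<forall>n. N \<preceq>\<preceq> n \<longrightarrow> P n)"

lemma evt_conj: "evt P \<Longrightarrow> evt Q \<Longrightarrow> evt (\<lambda>n. P n \<and> Q n)"
  unfolding evt_def using nums.order_trans nums.linear by metis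

lemma evt_mono: "evt P \<Longrightarrow> (\<And>n. P n \<Longrightarrow> Q n) \<Longrightarrow> evt Q"
  unfolding evt_def by blast

lemma evtI: "(\<And>n. N \<preceq>\<preceq> n \<Longrightarrow> P n) \<Longrightarrow> evt P"
  unfolding evt_def by blast

lemma evt_happens: "evt P \<Longrightarrow> \<exists>n. P n"
  unfolding evt_def by blast

lemma evt_ge: "evt (\<lambda>n. N \<preceq>\<preceq> n)"
  unfolding evt_def by blast

text \<open>The unit in which errors are counted: by \<open>four_hp\<close>, the factor four
  corresponds to the index shift by two in \<open>distance\<close>.\<close>

definition four :: "'m \<Rightarrow> 'm" where "four x = x \<boxplus> x \<boxplus> x \<boxplus> x"

lemma four_hp: "four (hp (n \<oplus> \<one> \<oplus> \<one>)) = hp n"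
  unfolding four_def by (metis hp_double vals.add.assoc)

lemma evt_hp_less:
  assumes "\<zero>\<^sub>v \<sqsubset> x"
  shows "evt (\<lambda>n. hp n \<sqsubset> x)"
proof -
  obtain n where "hp n \<sqsubset> x" using ex_hp_less[OF assms] by blast
  then show ?thesis
    using hp_antimono vals.le_less_trans unfolding evt_def by metis
qed

lemma evt_four:
  assumes "evt (\<lambda>n. P (hp n))"
  shows "evt (\<lambda>n. P (four (hp n)))"
proof -
  obtain N where N: "\<And>n. N \<preceq>\<preceq> n \<Longrightarrow> P (hp n)"
    using assms unfolding evt_def by blast
  show ?thesis
  proof (rule evtI[of "N \<oplus> \<one> \<oplus> \<one>"])
    fix n assume "N \<oplus> \<one> \<oplus> \<one> \<preceq>\<preceq> n"
    then obtain k where k: "n = N \<oplus> \<one> \<oplus> \<one> \<oplus> k" by (auto simp: num_le_iff)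
    then have "n = (N \<oplus> k) \<oplus> \<one> \<oplus> \<one>" by (simp add: num_ac)
    then show "P (four (hp n))"
      using N[OF le_add] by (simp only: four_hp)
  qed
qed

lemma evt_small: "\<zero>\<^sub>v \<sqsubset> x \<Longrightarrow> evt (\<lambda>n. four (four (hp n)) \<sqsubset> x)"
  using evt_four[of "\<lambda>y. four y \<sqsubset> x", OF evt_four[of "\<lambda>y. y \<sqsubset> x", OF evt_hp_less]] .

lemma ex_half: "\<zero>\<^sub>v \<sqsubset> x \<Longrightarrow> \<exists>y. \<zero>\<^sub>v \<sqsubset> y \<and> y \<boxplus> y \<sqsubset> x"
  by (metis ex_hp_less hp_double hp_pos)

lemma val_le_epsI:
  assumes "\<And>e. \<zero>\<^sub>v \<sqsubset> e \<Longrightarrow> a \<sqsubseteq> b \<boxplus> e"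
  shows "a \<sqsubseteq> b"
proof (rule ccontr)
  assume "\<not> a \<sqsubseteq> b"
  then have "\<zero>\<^sub>v \<sqsubset> a \<boxminus> b"
    by (simp add: vals.not_le)
  then obtain e where "\<zero>\<^sub>v \<sqsubset> e" "e \<sqsubset> a \<boxminus> b"
    using ex_hp_less hp_pos by blast
  then have "b \<boxplus> e \<sqsubset> a"
    by (metis vals.less_diff_eq vals.add.commute)
  then show False
    using assms[OF \<open>\<zero>\<^sub>v \<sqsubset> e\<close>] by (simp add: vals.not_le)
qed

lemma real_le_iff:
  assumes "\<And>k. rat (x k)" "\<And>k. rat (y k)"
  shows "real_le x y \<longleftrightarrow> (\<forall>k. val (x k) \<sqsubseteq> val (y k) \<boxplus> (hp k \<boxplus> hp k))"
  using assms by (simp add: real_le_def hp_def flip: val_le_iff val_rat_add)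

lemma real_num_regular:
  assumes x: "real_num x" and "k \<preceq>\<preceq> l"
  shows "val (x k) \<sqsubseteq> val (x l) \<boxplus> hp k" "val (x l) \<sqsubseteq> val (x k) \<boxplus> hp k"
proof -
  obtain i where l: "l = k \<oplus> i" using assms(2) by (auto simp: num_le_iff)
  have rat: "rat (x k)" "rat (x l)" "rat_le (rat_dist (x k) (x (k \<oplus> i))) (half_pow k)"
    using x by (simp_all add: real_num_def)
  then have "val (rat_dist (x k) (x l)) \<sqsubseteq> hp k"
    by (simp add: l hp_def val_le_iff)
  then show "val (x k) \<sqsubseteq> val (x l) \<boxplus> hp k" "val (x l) \<sqsubseteq> val (x k) \<boxplus> hp k"
    using rat val_rat_dist_le_iff by blast+
qed

lemma real_num_rat: "real_num x \<Longrightarrow> rat (x k)"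
  by (simp add: real_num_def)

end

locale metric = rca0 M for M :: "'m l2_structure" +
  fixes X :: "'m space"
  assumes metric_code: "metric_code X"
begin

abbreviation A where "A \<equiv> fst X"

definition dval :: "'m \<Rightarrow> 'm \<Rightarrow> 'm \<Rightarrow> 'm" where "dval a b k = val (snd X a b k)"

lemma codes_in_Sets: "A \<in> Sets" and codes_nonempty: "A \<noteq> {}"
  using metric_code by (auto simp: metric_code_def split: prod.splits)

lemma dist_graph: "{\<langle>\<langle>\<langle>a, b\<rangle>, k\<rangle>, snd X a b k\<rangle> | a b k. a \<in> A \<and> b \<in> A} \<in> Sets"
  using metric_code by (auto simp: metric_code_def split: prod.splits)

lemma dist_real: "a \<in> A \<Longrightarrow> b \<in> A \<Longrightarrow> real_num (snd X a b)"
  using metric_code by (auto simp: metric_code_def split: prod.splits)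

lemma dist_rat: "a \<in> A \<Longrightarrow> b \<in> A \<Longrightarrow> rat (snd X a b k)"
  using dist_real real_num_rat by blast

lemma dval_regular:
  assumes "a \<in> A" "b \<in> A" "k \<preceq>\<preceq> l"
  shows "dval a b k \<sqsubseteq> dval a b l \<boxplus> hp k" "dval a b l \<sqsubseteq> dval a b k \<boxplus> hp k"
  using real_num_regular[OF dist_real] assms by (simp_all add: dval_def)

lemma dval_self: "a \<in> A \<Longrightarrow> dval a a k \<sqsubseteq> hp k \<boxplus> hp k"
proof -
  assume a: "a \<in> A"
  then have "real_le (snd X a a) (real_of rat_zero)"
    using metric_code by (auto simp: metric_code_def real_eq_def split: prod.splits)
  then show ?thesis
    using a by (simp add: dval_def real_of_def real_le_iff dist_rat)
qed

lemma dval_sym: "a \<in> A \<Longrightarrow> b \<in> A \<Longrightarrow> dval a b k \<sqsubseteq> dval b a k \<boxplus> (hp k \<boxplus> hp k)"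
proof -
  assume ab: "a \<in> A" "b \<in> A"
  then have "real_le (snd X a b) (snd X b a)"
    using metric_code by (auto simp: metric_code_def real_eq_def split: prod.splits)
  then show ?thesis
    using ab by (simp add: dval_def real_le_iff dist_rat)
qed

lemma dval_nonneg: "a \<in> A \<Longrightarrow> b \<in> A \<Longrightarrow> \<zero>\<^sub>v \<sqsubseteq> dval a b k \<boxplus> (hp k \<boxplus> hp k)"
proof -
  assume ab: "a \<in> A" "b \<in> A"
  then have "real_le (real_of rat_zero) (snd X a b)"
    using metric_code by (auto simp: metric_code_def real_eq_def split: prod.splits)
  then show ?thesis
    using ab by (simp add: dval_def real_of_def real_le_iff dist_rat)
qed

lemma dval_triangle:
  assumes "a \<in> A" "b \<in> A" "c \<in> A"
  shows "dval a c k \<sqsubseteq> dval a b k \<boxplus> dval b c k \<boxplus> four (hp k)"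
proof -
  have "real_le (snd X a c) (real_add (snd X a b) (snd X b c))"
    using metric_code assms by (auto simp: metric_code_def split: prod.splits)
  then have "dval a c k \<sqsubseteq> dval a b (k \<oplus> \<one>) \<boxplus> dval b c (k \<oplus> \<one>) \<boxplus> (hp k \<boxplus> hp k)"
    using assms by (simp add: dval_def real_add_def real_le_iff dist_rat val_rat_add)
  moreover have "dval a b (k \<oplus> \<one>) \<sqsubseteq> dval a b k \<boxplus> hp k" "dval b c (k \<oplus> \<one>) \<sqsubseteq> dval b c k \<boxplus> hp k"
    using assms dval_regular by (simp_all add: nums.less_imp_le)
  ultimately show ?thesis
    unfolding four_def
    by (rule val_leI[OF vals.add_mono[OF _ vals.add_mono]]) (simp add: val_ac)
qed

lemma point_code: "point X x \<Longrightarrow> x i \<in> A"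
  by (simp add: point_def)

lemma dval_point:
  assumes x: "point X x" and "i \<preceq>\<preceq> m" "i \<preceq>\<preceq> n"
  shows "dval (x m) (x n) l \<sqsubseteq> hp i \<boxplus> four (hp l)"
proof -
  have *: "dval (x m) (x n) l \<sqsubseteq> hp m \<boxplus> (hp l \<boxplus> hp l)" if "m \<preceq>\<preceq> n" for m n
  proof -
    have "real_le (snd X (x m) (x n)) (real_of (half_pow m))"
      using x that unfolding point_def num_le_def by blast
    then show ?thesis
      using x by (simp add: dval_def real_of_def real_le_iff dist_rat point_code hp_def)
  qed
  have hp: "hp m \<sqsubseteq> hp i" "hp n \<sqsubseteq> hp i"
    using assms hp_antimono by auto
  consider "m \<preceq>\<preceq> n" | "n \<preceq>\<preceq> m" using nums.linear by blast
  then show ?thesis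
  proof cases
    case 1
    have "\<zero>\<^sub>v \<sqsubseteq> hp l \<boxplus> hp l"
      by (simp add: vals.add_nonneg_nonneg)
    from vals.add_mono[OF *[OF 1] vals.add_mono[OF hp(1) this]] show ?thesis
      by (rule val_leI) (simp add: four_def val_ac)
  next
    case 2
    from vals.add_mono[OF dval_sym[OF point_code[OF x] point_code[OF x], of m n l] vals.add_mono[OF *[OF 2] hp(2)]]
    show ?thesis
      by (rule val_leI) (simp add: four_def val_ac)
  qed
qed

text \<open>The indices \<open>m\<close> and \<open>n\<close> are compared through a common
  precision \<open>l\<close>. Moving \<open>x\<close>, moving \<open>y\<close> and the two rational
  approximations cost at most \<open>hp i\<close> each; the remaining errors depend on
  \<open>l\<close> only and fall below any \<open>e\<close>.\<close>

lemma dval_points: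
  assumes x: "point X x" and y: "point X y" and i: "i \<preceq>\<preceq> m" "i \<preceq>\<preceq> n"
  shows "dval (x m) (y m) m \<sqsubseteq> dval (x n) (y n) n \<boxplus> four (hp i)"
proof (rule val_le_epsI)
  fix e assume "\<zero>\<^sub>v \<sqsubset> e"
  from evt_happens[OF evt_conj[OF evt_small[OF this] evt_conj[OF evt_ge[of m] evt_ge[of n]]]]
  obtain l where l: "four (four (hp l)) \<sqsubset> e" "m \<preceq>\<preceq> l" "n \<preceq>\<preceq> l"
    by blast
  note A = point_code[OF x] point_code[OF y]
  have 1: "dval (x m) (y m) m \<sqsubseteq> dval (x m) (y m) l \<boxplus> hp m"
    using A l dval_regular by blast
  have 2: "dval (x m) (y m) l \<sqsubseteq> dval (x m) (x n) l \<boxplus> dval (x n) (y m) l \<boxplus> four (hp l)"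
    using A dval_triangle by blast
  have 3: "dval (x n) (y m) l \<sqsubseteq> dval (x n) (y n) l \<boxplus> dval (y n) (y m) l \<boxplus> four (hp l)"
    using A dval_triangle by blast
  have 4: "dval (x n) (y n) l \<sqsubseteq> dval (x n) (y n) n \<boxplus> hp n"
    using A l dval_regular by blast
  have 5: "dval (x m) (x n) l \<sqsubseteq> hp i \<boxplus> four (hp l)" "dval (y n) (y m) l \<sqsubseteq> hp i \<boxplus> four (hp l)"
    using dval_point x y i by auto
  have 6: "hp m \<sqsubseteq> hp i" "hp n \<sqsubseteq> hp i"
    using i hp_antimono by auto
  have "dval (x m) (y m) m \<sqsubseteq> dval (x n) (y n) n \<boxplus> four (hp i) \<boxplus> four (four (hp l))"
    by (rule val_leI[OF vals.add_mono[OF 1 vals.add_mono[OF 2 vals.add_mono[OF 3 vals.add_mono[OF 4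
        vals.add_mono[OF 5(1) vals.add_mono[OF 5(2) vals.add_mono[OF 6]]]]]]]])
      (simp add: four_def val_ac)
  also have "\<dots> \<sqsubseteq> dval (x n) (y n) n \<boxplus> four (hp i) \<boxplus> e"
    using l(1) by (simp add: vals.less_imp_le)
  finally show "dval (x m) (y m) m \<sqsubseteq> dval (x n) (y n) n \<boxplus> four (hp i) \<boxplus> e" .
qed

text \<open>\<open>dless x y q\<close> expresses \<open>d(x, y) < q\<close>.\<close>

definition dless :: "('m \<Rightarrow> 'm) \<Rightarrow> ('m \<Rightarrow> 'm) \<Rightarrow> 'm \<Rightarrow> bool" where
  "dless x y q \<longleftrightarrow> (\<exists>e. \<zero>\<^sub>v \<sqsubset> e \<and> evt (\<lambda>n. dval (x n) (y n) n \<boxplus> e \<sqsubseteq> q))"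

lemma distance_eq: "distance X x y k = snd X (x (k \<oplus> \<one> \<oplus> \<one>)) (y (k \<oplus> \<one> \<oplus> \<one>)) (k \<oplus> \<one> \<oplus> \<one>)"
  by (simp add: distance_def Let_def)

lemma distance_rat: "point X x \<Longrightarrow> point X y \<Longrightarrow> rat (distance X x y k)"
  by (simp add: distance_eq dist_rat point_code)

lemma val_distance: "val (distance X x y k) = dval (x (k \<oplus> \<one> \<oplus> \<one>)) (y (k \<oplus> \<one> \<oplus> \<one>)) (k \<oplus> \<one> \<oplus> \<one>)"
  by (simp add: distance_eq dval_def)

lemma less_distance_iff:
  assumes x: "point X x" and y: "point X y" and q: "rat q"
  shows "real_less (distance X x y) (real_of q) \<longleftrightarrow>
    (\<exists>k. dval (x (k \<oplus> \<one> \<oplus> \<one>)) (y (k \<oplus> \<one> \<oplus> \<one>)) (k \<oplus> \<one> \<oplus> \<one>) \<boxplus> (hp k \<boxplus> hp k) \<sqsubset> val q)"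
  unfolding real_less_def real_of_def
  by (subst real_le_iff) (simp_all add: distance_rat assms val_distance vals.not_le)

text \<open>Strictness at one index \<open>k\<close> leaves a slack of twice \<open>hp k\<close>:
  half of it absorbs all later changes of the approximations, the other half is the margin
  \<open>e\<close>. Conversely, the margin exceeds twice \<open>hp k\<close> at a large index. Later
  estimates need not mention indices any more.\<close>

lemma dless_iff:
  assumes x: "point X x" and y: "point X y" and q: "rat q"
  shows "real_less (distance X x y) (real_of q) \<longleftrightarrow> dless x y (val q)"
proof
  assume "real_less (distance X x y) (real_of q)"
  then obtain k where k: "dval (x (k \<oplus> \<one> \<oplus> \<one>)) (y (k \<oplus> \<one> \<oplus> \<one>)) (k \<oplus> \<one> \<oplus> \<one>) \<boxplus> (hp k \<boxplus> hp k) \<sqsubset> val q"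
    using less_distance_iff[OF assms] by blast
  define m where "m = k \<oplus> \<one> \<oplus> \<one>"
  have hk: "hp k = four (hp m)"
    by (simp add: m_def four_hp)
  have "dval (x n) (y n) n \<boxplus> hp k \<sqsubseteq> val q" if "m \<preceq>\<preceq> n" for n
  proof -
    have "dval (x n) (y n) n \<sqsubseteq> dval (x m) (y m) m \<boxplus> hp k"
      unfolding hk by (rule dval_points[OF x y]) (use that in auto)
    from vals.add_mono[OF this vals.less_imp_le[OF k[folded m_def]]] show ?thesis
      by (rule val_leI) (simp add: val_ac)
  qed
  then show "dless x y (val q)"
    unfolding dless_def evt_def using hp_pos by blast
next
  assume "dless x y (val q)"
  then obtain e where e: "\<zero>\<^sub>v \<sqsubset> e" "evt (\<lambda>n. dval (x n) (y n) n \<boxplus> e \<sqsubseteq> val q)"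
    unfolding dless_def by blast
  from evt_happens[OF evt_conj[OF e(2) evt_conj[OF evt_small[OF e(1)] evt_ge[of "\<one> \<oplus> \<one>"]]]]
  obtain n where n: "dval (x n) (y n) n \<boxplus> e \<sqsubseteq> val q" "four (four (hp n)) \<sqsubset> e" "\<one> \<oplus> \<one> \<preceq>\<preceq> n"
    by blast
  then obtain k where k: "n = k \<oplus> \<one> \<oplus> \<one>"
    by (auto simp: num_le_iff num_ac)
  have "hp k \<boxplus> hp k \<sqsubseteq> four (four (hp n))"
    unfolding k four_hp by (simp add: four_def vals.add_increasing2 vals.add_nonneg_nonneg)
  then have "hp k \<boxplus> hp k \<sqsubset> e"
    using n(2) vals.le_less_trans by blast
  from vals.add_less_le_mono[OF this n(1)]
  have "dval (x n) (y n) n \<boxplus> (hp k \<boxplus> hp k) \<sqsubset> val q"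
    by (rule val_lessI) (simp add: val_ac)
  then show "real_less (distance X x y) (real_of q)"
    using less_distance_iff[OF assms] k by blast
qed

lemma dless_mono: "dless x y p \<Longrightarrow> p \<sqsubseteq> q \<Longrightarrow> dless x y q"
  unfolding dless_def using evt_mono vals.order_trans by (metis (no_types, lifting))

lemma dless_sym:
  assumes x: "point X x" and y: "point X y" and "dless x y q"
  shows "dless y x q"
proof -
  obtain e where e: "\<zero>\<^sub>v \<sqsubset> e" "evt (\<lambda>n. dval (x n) (y n) n \<boxplus> e \<sqsubseteq> q)"
    using assms(3) unfolding dless_def by blast
  obtain e' where e': "\<zero>\<^sub>v \<sqsubset> e'" "e' \<boxplus> e' \<sqsubset> e"
    using ex_half[OF e(1)] by blast
  have "evt (\<lambda>n. dval (y n) (x n) n \<boxplus> e' \<sqsubseteq> q)"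
    using evt_conj[OF e(2) evt_small[OF e'(1)]]
  proof (rule evt_mono)
    fix n assume *: "dval (x n) (y n) n \<boxplus> e \<sqsubseteq> q \<and> four (four (hp n)) \<sqsubset> e'"
    have "hp n \<boxplus> hp n \<sqsubseteq> four (four (hp n))"
      by (simp add: four_def vals.add_increasing2 vals.add_nonneg_nonneg val_ac)
    then have hp: "hp n \<boxplus> hp n \<sqsubseteq> e'" using * by auto
    show "dval (y n) (x n) n \<boxplus> e' \<sqsubseteq> q"
      by (rule val_leI[OF vals.add_mono[OF dval_sym[of "y n" "x n" n] vals.add_mono[OF conjunct1[OF *]
          vals.add_mono[OF hp vals.less_imp_le[OF e'(2)]]]]])
        (simp_all add: val_ac point_code x y)
  qed
  then show ?thesis
    unfolding dless_def using e'(1) by blast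
qed

lemma dless_triangle:
  assumes x: "point X x" and y: "point X y" and z: "point X z" and "dless x y p" "dless y z q"
  shows "dless x z (p \<boxplus> q)"
proof -
  obtain e where e: "\<zero>\<^sub>v \<sqsubset> e" "evt (\<lambda>n. dval (x n) (y n) n \<boxplus> e \<sqsubseteq> p)"
    using assms(4) unfolding dless_def by blast
  obtain e' where e': "\<zero>\<^sub>v \<sqsubset> e'" "evt (\<lambda>n. dval (y n) (z n) n \<boxplus> e' \<sqsubseteq> q)"
    using assms(5) unfolding dless_def by blast
  have "evt (\<lambda>n. dval (x n) (z n) n \<boxplus> e \<sqsubseteq> p \<boxplus> q)"
    using evt_conj[OF e(2) evt_conj[OF e'(2) evt_small[OF e'(1)]]]
  proof (rule evt_mono)
    fix n assume *: "dval (x n) (y n) n \<boxplus> e \<sqsubseteq> p \<and> dval (y n) (z n) n \<boxplus> e' \<sqsubseteq> q \<and> four (four (hp n)) \<sqsubset> e'"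
    have "four (hp n) \<sqsubseteq> four (four (hp n))"
      by (simp add: four_def vals.add_increasing2 vals.add_nonneg_nonneg val_ac)
    then have hp: "four (hp n) \<sqsubseteq> e'" using * by auto
    show "dval (x n) (z n) n \<boxplus> e \<sqsubseteq> p \<boxplus> q"
      by (rule val_leI[OF vals.add_mono[OF dval_triangle[of "x n" "y n" "z n" n] vals.add_mono[OF conjunct1[OF *]
          vals.add_mono[OF hp conjunct1[OF conjunct2[OF *]]]]]])
        (simp_all add: val_ac point_code x y z)
  qed
  then show ?thesis
    unfolding dless_def using e(1) by blast
qed

lemma dless_self:
  assumes x: "point X x" and q: "\<zero>\<^sub>v \<sqsubset> q"
  shows "dless x x q"
proof -
  obtain e where e: "\<zero>\<^sub>v \<sqsubset> e" "e \<boxplus> e \<sqsubset> q"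
    using ex_half[OF q] by blast
  have "evt (\<lambda>n. dval (x n) (x n) n \<boxplus> e \<sqsubseteq> q)"
    using evt_small[OF e(1)]
  proof (rule evt_mono)
    fix n assume *: "four (four (hp n)) \<sqsubset> e"
    have "hp n \<boxplus> hp n \<sqsubseteq> four (four (hp n))"
      by (simp add: four_def vals.add_increasing2 vals.add_nonneg_nonneg val_ac)
    then have hp: "hp n \<boxplus> hp n \<sqsubseteq> e" using * by auto
    show "dval (x n) (x n) n \<boxplus> e \<sqsubseteq> q"
      by (rule val_leI[OF vals.add_mono[OF dval_self[of "x n" n] vals.add_mono[OF hp vals.less_imp_le[OF e(2)]]]])
        (simp_all add: val_ac point_code x)
  qed
  then show ?thesis
    unfolding dless_def using e(1) by blast
qed

text \<open>Half of the margin in \<open>dless\<close> is given away and half is kept. This is the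
  openness of balls in quantitative form.\<close>

lemma dless_dense:
  assumes "dless x y q"
  shows "\<exists>e. \<zero>\<^sub>v \<sqsubset> e \<and> (\<forall>p. q \<sqsubseteq> p \<boxplus> e \<longrightarrow> dless x y p)"
proof -
  obtain e where e: "\<zero>\<^sub>v \<sqsubset> e" "evt (\<lambda>n. dval (x n) (y n) n \<boxplus> e \<sqsubseteq> q)"
    using assms unfolding dless_def by blast
  obtain e' where e': "\<zero>\<^sub>v \<sqsubset> e'" "e' \<boxplus> e' \<sqsubset> e"
    using ex_half[OF e(1)] by blast
  have "dless x y p" if p: "q \<sqsubseteq> p \<boxplus> e'" for p
  proof -
    have "evt (\<lambda>n. dval (x n) (y n) n \<boxplus> e' \<sqsubseteq> p)"
      using e(2)
    proof (rule evt_mono)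
      fix n assume *: "dval (x n) (y n) n \<boxplus> e \<sqsubseteq> q"
      show "dval (x n) (y n) n \<boxplus> e' \<sqsubseteq> p"
        by (rule val_leI[OF vals.add_mono[OF * vals.add_mono[OF p vals.less_imp_le[OF e'(2)]]]])
          (simp add: val_ac)
    qed
    then show ?thesis
      unfolding dless_def using e'(1) by blast
  qed
  then show ?thesis using e'(1) by blast
qed

lemma const_point: "a \<in> A \<Longrightarrow> point X (\<lambda>_. a)"
proof -
  assume a: "a \<in> A"
  have "fn_on UNIV (\<lambda>_. a)"
    by (rule fn_onI) (intro definable, simp)
  moreover have "real_le (snd X a a) (real_of (half_pow i))" for i
  proof -
    have "dval a a k \<sqsubseteq> hp i \<boxplus> (hp k \<boxplus> hp k)" for k
      using dval_self[OF a, of k] by (rule vals.add_increasing[OF hp_nonneg])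
    then show ?thesis
      using a by (simp add: real_of_def real_le_iff dist_rat dval_def hp_def)
  qed
  ultimately show ?thesis
    using a by (simp add: point_def)
qed

lemma dless_approx:
  assumes x: "point X x" and q: "hp i \<sqsubset> q"
  shows "dless x (\<lambda>_. x i) q"
proof -
  have "\<zero>\<^sub>v \<sqsubset> q \<boxminus> hp i" using q by simp
  then obtain e where e: "\<zero>\<^sub>v \<sqsubset> e" "e \<boxplus> e \<sqsubset> q \<boxminus> hp i"
    using ex_half by blast
  have e2: "e \<boxplus> e \<boxplus> hp i \<sqsubseteq> q"
    using e(2) by (simp only: vals.less_diff_eq vals.less_imp_le)
  have "evt (\<lambda>n. dval (x n) (x i) n \<boxplus> e \<sqsubseteq> q)"
    using evt_conj[OF evt_small[OF e(1)] evt_ge[of i]]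
  proof (rule evt_mono)
    fix n assume *: "four (four (hp n)) \<sqsubset> e \<and> i \<preceq>\<preceq> n"
    have "four (hp n) \<sqsubseteq> four (four (hp n))"
      by (simp add: four_def vals.add_increasing2 vals.add_nonneg_nonneg val_ac)
    then have hp: "four (hp n) \<sqsubseteq> e" using * by auto
    have "dval (x n) (x i) n \<sqsubseteq> hp i \<boxplus> four (hp n)"
      using * by (intro dval_point x) auto
    from vals.add_mono[OF this vals.add_mono[OF hp e2]] show "dval (x n) (x i) n \<boxplus> e \<sqsubseteq> q"
      by (rule val_leI) (simp add: val_ac)
  qed
  then show ?thesis
    unfolding dless_def using e(1) by blast
qed

lemma same_point_iff:
  assumes x: "point X x" and y: "point X y"
  shows "same_point X x y \<longleftrightarrow> (\<forall>q. \<zero>\<^sub>v \<sqsubset> q \<longrightarrow> dless x y q)"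
proof
  assume "same_point X x y"
  then have *: "dval (x (k \<oplus> \<one> \<oplus> \<one>)) (y (k \<oplus> \<one> \<oplus> \<one>)) (k \<oplus> \<one> \<oplus> \<one>) \<sqsubseteq> hp k \<boxplus> hp k" for k
    unfolding same_point_def real_eq_def real_of_def
    using assms by (simp add: real_le_iff distance_rat val_distance)
  show "\<forall>q. \<zero>\<^sub>v \<sqsubset> q \<longrightarrow> dless x y q"
  proof (intro allI impI)
    fix q assume "\<zero>\<^sub>v \<sqsubset> q"
    then obtain e where e: "\<zero>\<^sub>v \<sqsubset> e" "e \<boxplus> e \<sqsubset> q"
      using ex_half by blast
    have "evt (\<lambda>n. dval (x n) (y n) n \<boxplus> e \<sqsubseteq> q)"
      using evt_conj[OF evt_small[OF e(1)] evt_ge[of "\<one> \<oplus> \<one>"]]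
    proof (rule evt_mono)
      fix n assume n: "four (four (hp n)) \<sqsubset> e \<and> \<one> \<oplus> \<one> \<preceq>\<preceq> n"
      then obtain k where k: "n = k \<oplus> \<one> \<oplus> \<one>"
        by (auto simp: num_le_iff num_ac)
      have "hp k \<boxplus> hp k \<sqsubseteq> four (four (hp n))"
        unfolding k four_hp by (simp add: four_def vals.add_increasing2 vals.add_nonneg_nonneg)
      then have hp: "hp k \<boxplus> hp k \<sqsubseteq> e" using n by auto
      show "dval (x n) (y n) n \<boxplus> e \<sqsubseteq> q"
        by (rule val_leI[OF vals.add_mono[OF *[of k, folded k] vals.add_mono[OF hp vals.less_imp_le[OF e(2)]]]])
          (simp add: val_ac)
    qed
    then show "dless x y q"
      unfolding dless_def using e(1) by blast
  qed
next
  assume *: "\<forall>q. \<zero>\<^sub>v \<sqsubset> q \<longrightarrow> dless x y q"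
  have "dval (x (k \<oplus> \<one> \<oplus> \<one>)) (y (k \<oplus> \<one> \<oplus> \<one>)) (k \<oplus> \<one> \<oplus> \<one>) \<sqsubseteq> hp k \<boxplus> hp k" for k
  proof -
    define m where "m = k \<oplus> \<one> \<oplus> \<one>"
    obtain e where e: "\<zero>\<^sub>v \<sqsubset> e" "evt (\<lambda>n. dval (x n) (y n) n \<boxplus> e \<sqsubseteq> hp k)"
      using * hp_pos unfolding dless_def by blast
    from evt_happens[OF evt_conj[OF e(2) evt_ge[of m]]]
    obtain n where n: "dval (x n) (y n) n \<boxplus> e \<sqsubseteq> hp k" "m \<preceq>\<preceq> n" by blast
    have "dval (x m) (y m) m \<sqsubseteq> dval (x n) (y n) n \<boxplus> four (hp m)"
      using dval_points[OF x y, of m m n] n by simp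
    moreover have "four (hp m) = hp k"
      by (simp add: m_def four_hp)
    ultimately have 1: "dval (x m) (y m) m \<sqsubseteq> dval (x n) (y n) n \<boxplus> hp k" by simp
    have "dval (x m) (y m) m \<sqsubseteq> hp k \<boxplus> hp k"
      by (rule val_leI[OF vals.add_mono[OF 1 vals.add_mono[OF n(1) vals.less_imp_le[OF e(1)]]]])
        (simp add: val_ac)
    then show ?thesis by (simp add: m_def)
  qed
  moreover have "\<zero>\<^sub>v \<sqsubseteq> dval (x (k \<oplus> \<one> \<oplus> \<one>)) (y (k \<oplus> \<one> \<oplus> \<one>)) (k \<oplus> \<one> \<oplus> \<one>) \<boxplus> (hp k \<boxplus> hp k)" for k
  proof -
    define m where "m = k \<oplus> \<one> \<oplus> \<one>"
    have "hp m \<sqsubseteq> hp k"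
      unfolding m_def using hp_succ_le vals.order_trans by blast
    from vals.add_mono[OF dval_nonneg[OF point_code[OF x] point_code[OF y], of m m m] vals.add_mono[OF this this]]
    have "\<zero>\<^sub>v \<sqsubseteq> dval (x m) (y m) m \<boxplus> (hp k \<boxplus> hp k)"
      by (rule val_leI) (simp add: val_ac)
    then show ?thesis by (simp add: m_def)
  qed
  ultimately show "same_point X x y"
    unfolding same_point_def real_eq_def real_of_def
    using assms by (simp add: real_le_iff distance_rat val_distance)
qed

lemma same_point_refl: "point X x \<Longrightarrow> same_point X x x"
  using same_point_iff dless_self by blast

lemma same_point_sym: "point X x \<Longrightarrow> point X y \<Longrightarrow> same_point X x y \<Longrightarrow> same_point X y x"
  using same_point_iff dless_sym by blast

lemma same_point_trans:
  assumes "point X x" "point X y" "point X z" "same_point X x y" "same_point X y z"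
  shows "same_point X x z"
proof -
  have "dless x z q" if q: "\<zero>\<^sub>v \<sqsubset> q" for q
  proof -
    obtain e where e: "\<zero>\<^sub>v \<sqsubset> e" "e \<boxplus> e \<sqsubset> q"
      using ex_half[OF q] by blast
    then have "dless x z (e \<boxplus> e)"
      using assms by (intro dless_triangle[of x y z]) (simp_all add: same_point_iff)
    then show ?thesis
      using e(2) dless_mono vals.less_imp_le by blast
  qed
  then show ?thesis
    using assms same_point_iff by blast
qed

lemma ball_iff: "a \<in> A \<Longrightarrow> rat r \<Longrightarrow> x \<in> ball X a r \<longleftrightarrow> point X x \<and> dless x (\<lambda>_. a) (val r)"
  using dless_iff const_point by (auto simp: ball_def)

lemma dless_same_point:
  assumes "point X x" "point X y" "point X z" "same_point X x y" "dless x z q"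
  shows "dless y z q"
proof -
  obtain e where e: "\<zero>\<^sub>v \<sqsubset> e" "\<forall>p. q \<sqsubseteq> p \<boxplus> e \<longrightarrow> dless x z p"
    using dless_dense[OF assms(5)] by blast
  have "dless x z (q \<boxminus> e)"
    using e(2) by simp
  moreover have "dless y x e"
    using e(1) assms(1,2,4) same_point_iff dless_sym by blast
  ultimately have "dless y z (e \<boxplus> (q \<boxminus> e))"
    using dless_triangle assms(1-3) by blast
  then show ?thesis
    by (simp only: vals.add.commute[of e] vals.diff_add_cancel)
qed

lemma same_point_ball:
  assumes "point X x" "point X y" "same_point X x y" "a \<in> A" "rat r"
  shows "x \<in> ball X a r \<longleftrightarrow> y \<in> ball X a r"
  using assms dless_same_point[of x y "\<lambda>_. a"] dless_same_point[of y x "\<lambda>_. a"]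
    same_point_sym[of x y] const_point[of a] by (auto simp: ball_iff)

end

context rca0
begin

section \<open>Weak Koenig's lemma and separation\<close>

text \<open>A set of pairs stands for the \<Sigma>1 class of its first components, the second
  components being witnesses. Thus \<Sigma>1 separation becomes a statement about sets of the
  structure.\<close>

definition separation :: bool where
  "separation \<longleftrightarrow> (\<forall>\<Theta>\<^sub>0\<in>Sets. \<forall>\<Theta>\<^sub>1\<in>Sets. (\<forall>i w w'. \<not> (\<langle>i, w\<rangle> \<in> \<Theta>\<^sub>0 \<and> \<langle>i, w'\<rangle> \<in> \<Theta>\<^sub>1)) \<longrightarrow>
     (\<exists>Z\<in>Sets. \<forall>i w. (\<langle>i, w\<rangle> \<in> \<Theta>\<^sub>1 \<longrightarrow> i \<in> Z) \<and> (\<langle>i, w\<rangle> \<in> \<Theta>\<^sub>0 \<longrightarrow> i \<notin> Z)))"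

lemma restr_fn:
  assumes "fn_on UNIV g"
  shows "fin_seq (restr g n)" "lh (restr g n) = n" "i \<prec> n \<Longrightarrow> ent (restr g n) i = g i"
proof -
  have "def_fun (\<lambda>e. g (e 0))"
    by (rule def_fun_fn[OF assms def_fun_var])
  from restr_spec[OF this, of n]
  show "fin_seq (restr g n)" "lh (restr g n) = n" "i \<prec> n \<Longrightarrow> ent (restr g n) i = g i"
    by (auto simp: ent_eq)
qed

lemma def_fun_fn_on: "def_fun (\<lambda>e. g (e 0)) \<Longrightarrow> fn_on UNIV g"
  by (rule fn_onI[OF _ UNIV_in_Sets])

lemma binary_seq_iff: "binary_seq s \<longleftrightarrow> fin_seq s \<and> (\<forall>i. i \<prec> lh s \<longrightarrow> ent s i = \<zero> \<or> ent s i = \<one>)"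
  by (auto simp: binary_seq_def ent_def)

lemma initial_segment_iff:
  "fin_seq s \<Longrightarrow> fin_seq t \<Longrightarrow> initial_segment t s \<longleftrightarrow> lh t \<preceq>\<preceq> lh s \<and> (\<forall>i. i \<prec> lh t \<longrightarrow> ent t i = ent s i)"
  by (simp add: initial_segment_def ent_def num_le_def)

text \<open>The tree keeps a binary sequence as long as no witness below its length shows it to be
  wrong about a number below its length. Since each witness is below some length, a path is wrong
  nowhere.\<close>

lemma WKL_imp_separation:
  assumes WKL
  shows separation
  unfolding separation_def
proof (intro ballI impI)
  fix \<Theta>0 \<Theta>1 assume \<Theta>: "\<Theta>0 \<in> Sets" "\<Theta>1 \<in> Sets"
    and disj: "\<forall>i w w'. \<not> (\<langle>i, w\<rangle> \<in> \<Theta>0 \<and> \<langle>i, w'\<rangle> \<in> \<Theta>1)"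
  define T where "T = {s. binary_seq s \<and> (\<forall>i. i \<prec> lh s \<longrightarrow> (\<forall>w. w \<prec> lh s \<longrightarrow>
     (\<langle>i, w\<rangle> \<in> \<Theta>1 \<longrightarrow> ent s i = \<one>) \<and> (\<langle>i, w\<rangle> \<in> \<Theta>0 \<longrightarrow> ent s i = \<zero>)))}"
  have "T \<in> Sets"
    unfolding T_def by (intro comprehension definable \<Theta>)
  moreover have "t \<in> T" if "s \<in> T" "fin_seq t" "initial_segment t s" for s t
  proof -
    have s: "fin_seq s" using that(1) by (simp add: T_def binary_seq_def)
    have "lh t \<preceq>\<preceq> lh s" and e: "\<And>i. i \<prec> lh t \<Longrightarrow> ent t i = ent s i"
      using that initial_segment_iff[OF s] by auto
    then have less: "i \<prec> lh s" if "i \<prec> lh t" for i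
      using that nums.less_le_trans by blast
    have "binary_seq t"
    proof -
      have "binary_seq s" using that(1) unfolding T_def by blast
      then show ?thesis
        using that(2) e less unfolding binary_seq_iff by simp
    qed
    moreover have "(\<langle>i, w\<rangle> \<in> \<Theta>1 \<longrightarrow> ent t i = \<one>) \<and> (\<langle>i, w\<rangle> \<in> \<Theta>0 \<longrightarrow> ent t i = \<zero>)"
      if "i \<prec> lh t" "w \<prec> lh t" for i w
    proof -
      have "(\<langle>i, w\<rangle> \<in> \<Theta>1 \<longrightarrow> ent s i = \<one>) \<and> (\<langle>i, w\<rangle> \<in> \<Theta>0 \<longrightarrow> ent s i = \<zero>)"
        using \<open>s \<in> T\<close> less[OF that(1)] less[OF that(2)] unfolding T_def by blast
      then show ?thesis
        unfolding e[OF that(1)] .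
    qed
    ultimately show ?thesis
      unfolding T_def by blast
  qed
  moreover have Tbin: "\<forall>s\<in>T. binary_seq s"
    unfolding T_def by blast
  ultimately have "tree T"
    unfolding tree_def binary_seq_def by blast
  moreover have "\<exists>s\<in>T. \<not> s \<prec> k" for k
  proof -
    \<comment> \<open>Answering by the witnesses up to \<open>k\<close> gives a member of length
      \<open>k \<oplus> \<one>\<close>. Its code is at least its length, which refutes the bound
      \<open>k\<close>.\<close>
    define g where "g i = num_of_bool (\<exists>w. w \<prec> k \<oplus> \<one> \<and> \<langle>i, w\<rangle> \<in> \<Theta>1)" for i
    have "fn_on UNIV g"
      unfolding g_def by (intro def_fun_fn_on definable \<Theta>)
    note r = restr_fn[OF this, where n = "k \<oplus> \<one>"]
    have "binary_seq (restr g (k \<oplus> \<one>))"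
      using r by (simp add: binary_seq_iff g_def num_of_bool_def)
    moreover have "(\<langle>i, w\<rangle> \<in> \<Theta>1 \<longrightarrow> g i = \<one>) \<and> (\<langle>i, w\<rangle> \<in> \<Theta>0 \<longrightarrow> g i = \<zero>)" if "w \<prec> k \<oplus> \<one>" for i w
      using disj that unfolding g_def num_of_bool_def by metis
    ultimately have "restr g (k \<oplus> \<one>) \<in> T"
      unfolding T_def mem_Collect_eq using r by simp
    moreover have "k \<oplus> \<one> \<preceq>\<preceq> restr g (k \<oplus> \<one>)"
      using lh_le[OF r(1)] r(2) by simp
    ultimately show ?thesis
      using nums.not_less nums.order_trans nums.less_imp_le[OF less_succ_self] by blast
  qed
  ultimately obtain g where g: "fn_on UNIV g" "\<And>n. restr g n \<in> T"
    using assms Tbin unfolding WKL_def has_path_def by blast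
  have gd: "def_fun (\<lambda>e. g (e 0))"
    by (rule def_fun_fn[OF g(1) def_fun_var])
  have Z: "(\<langle>i, w\<rangle> \<in> \<Theta>1 \<longrightarrow> g i = \<one>) \<and> (\<langle>i, w\<rangle> \<in> \<Theta>0 \<longrightarrow> g i = \<zero>)" for i w
  proof -
    have "i \<prec> i \<oplus> w \<oplus> \<one>" "w \<prec> i \<oplus> w \<oplus> \<one>"
      unfolding less_succ_iff_le using le_add[of i w] le_add[of w i] by (simp_all add: nums.add.commute)
    then show ?thesis
      using g(2)[of "i \<oplus> w \<oplus> \<one>"] restr_fn[OF g(1), where n = "i \<oplus> w \<oplus> \<one>"]
      unfolding T_def mem_Collect_eq by metis
  qed
  have "{i. g i = \<one>} \<in> Sets"
    by (intro comprehension definable gd)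
  moreover have "\<zero> \<noteq> \<one>"
    by simp
  ultimately show "\<exists>Z\<in>Sets. \<forall>i w. (\<langle>i, w\<rangle> \<in> \<Theta>1 \<longrightarrow> i \<in> Z) \<and> (\<langle>i, w\<rangle> \<in> \<Theta>0 \<longrightarrow> i \<notin> Z)"
    using Z by (intro bexI[of _ "{i. g i = \<one>}"]) auto
qed

text \<open>Without disjointness: keep only the witnesses that come before all those of the other set.\<close>

lemma separation_nondisjoint:
  assumes separation and \<Theta>: "\<Theta>0 \<in> Sets" "\<Theta>1 \<in> Sets"
  shows "\<exists>Z\<in>Sets. \<forall>i. ((\<exists>w. \<langle>i, w\<rangle> \<in> \<Theta>1) \<and> (\<forall>w. \<langle>i, w\<rangle> \<notin> \<Theta>0) \<longrightarrow> i \<in> Z) \<and>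
                       ((\<exists>w. \<langle>i, w\<rangle> \<in> \<Theta>0) \<and> (\<forall>w. \<langle>i, w\<rangle> \<notin> \<Theta>1) \<longrightarrow> i \<notin> Z)"
proof -
  define \<Theta>1' where "\<Theta>1' = {z. z \<in> \<Theta>1 \<and> (\<forall>w. w \<prec> p2 z \<oplus> \<one> \<longrightarrow> \<langle>p1 z, w\<rangle> \<notin> \<Theta>0)}"
  define \<Theta>0' where "\<Theta>0' = {z. z \<in> \<Theta>0 \<and> (\<forall>w. w \<prec> p2 z \<longrightarrow> \<langle>p1 z, w\<rangle> \<notin> \<Theta>1)}"
  have "\<Theta>0' \<in> Sets" "\<Theta>1' \<in> Sets"
    unfolding \<Theta>0'_def \<Theta>1'_def by (intro comprehension definable \<Theta>)+
  moreover have "\<not> (\<langle>i, w\<rangle> \<in> \<Theta>0' \<and> \<langle>i, w'\<rangle> \<in> \<Theta>1')" for i w w'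
  proof
    assume *: "\<langle>i, w\<rangle> \<in> \<Theta>0' \<and> \<langle>i, w'\<rangle> \<in> \<Theta>1'"
    then have "\<not> w \<preceq>\<preceq> w'" "\<not> w' \<prec> w"
      unfolding \<Theta>0'_def \<Theta>1'_def by (auto simp: less_succ_iff_le)
    then show False
      by (simp add: nums.not_less)
  qed
  ultimately obtain Z where "Z \<in> Sets" "\<And>i w. (\<langle>i, w\<rangle> \<in> \<Theta>1' \<longrightarrow> i \<in> Z) \<and> (\<langle>i, w\<rangle> \<in> \<Theta>0' \<longrightarrow> i \<notin> Z)"
    using assms(1) unfolding separation_def by metis
  then show ?thesis
    by (intro bexI[of _ Z]) (auto simp: \<Theta>0'_def \<Theta>1'_def)
qed

lemma Sigma1_witnesses:
  assumes "Sigma1 (\<lambda>e. P (e 0))"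
  obtains R where "R \<in> Sets" "\<And>x. P x \<longleftrightarrow> (\<exists>w. \<langle>x, w\<rangle> \<in> R)"
proof -
  obtain Q where Q: "Delta0 Q" "\<And>e. P (e 0) \<longleftrightarrow> (\<exists>m. Q (case_nat m e))"
    using assms unfolding Sigma1_def by blast
  define S where "S x w \<longleftrightarrow> Q (case_nat w (case_nat x (\<lambda>_. \<zero>)))" for x w
  have "Delta0 (\<lambda>e. S (e (Suc 0)) (e 0))"
  proof -
    have "Delta0 (\<lambda>e'. Q (\<lambda>i. if i < 2 then e' (id i) else \<zero>))"
      by (rule Delta0_subst_vars) (auto simp: Q)
    then show ?thesis
      unfolding S_def by (rule back_subst[of Delta0])
        (auto intro!: ext arg_cong[of _ _ Q] split: nat.split)
  qed
  then have "{v. \<exists>x. x \<prec> v \<oplus> \<one> \<and> (\<exists>w. w \<prec> v \<oplus> \<one> \<and> v = \<langle>x, w\<rangle> \<and> S x w)} \<in> Sets"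
    by (intro comprehension definable) (rule Delta0_Delta1)
  moreover have "P x \<longleftrightarrow> (\<exists>w. S x w)" for x
    using Q(2)[of "case_nat x (\<lambda>_. \<zero>)"] by (simp add: S_def)
  ultimately show ?thesis
    using le_pair1 le_pair2
    by (intro that[of "{v. \<exists>x. x \<prec> v \<oplus> \<one> \<and> (\<exists>w. w \<prec> v \<oplus> \<one> \<and> v = \<langle>x, w\<rangle> \<and> S x w)}"])
      (auto simp: less_succ_iff_le)
qed

text \<open>A separating set decides, for each pair of alternatives, which of them to prefer, so that a
  \<open>\<Pi>\<^sup>0\<^sub>1\<close> alternative survives a knockout tournament.\<close>

lemma separation_choice:
  assumes separation and C: "Sigma1 (\<lambda>e. C (e 0))" and b: "def_fun (\<lambda>e. b (e 0))"
  obtains g where "def_fun (\<lambda>e. g (e 0))"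
    "\<And>z i. i \<preceq>\<preceq> b z \<Longrightarrow> \<not> C \<langle>z, i\<rangle> \<Longrightarrow> g z \<preceq>\<preceq> b z \<and> \<not> C \<langle>z, g z\<rangle>"
proof -
  obtain R where R: "R \<in> Sets" "\<And>x. C x \<longleftrightarrow> (\<exists>w. \<langle>x, w\<rangle> \<in> R)"
    using Sigma1_witnesses[OF C] by blast
  \<comment> \<open>The numbers to be separated have the form
    \<open>\<langle>z, \<langle>i, j\<rangle>\<rangle>\<close>. \<open>\<Theta>0\<close> collects
    the refutations of \<open>i\<close> and \<open>\<Theta>1\<close> those of \<open>j\<close>, so
    that membership in \<open>Z\<close> advises to prefer \<open>i\<close> to
    \<open>j\<close>.\<close>
  define \<Theta>0 where "\<Theta>0 = {v. \<langle>\<langle>p1 (p1 v), p1 (p2 (p1 v))\<rangle>, p2 v\<rangle> \<in> R}"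
  define \<Theta>1 where "\<Theta>1 = {v. \<langle>\<langle>p1 (p1 v), p2 (p2 (p1 v))\<rangle>, p2 v\<rangle> \<in> R}"
  have "\<Theta>0 \<in> Sets" "\<Theta>1 \<in> Sets"
    unfolding \<Theta>0_def \<Theta>1_def by (intro comprehension definable R)+
  from separation_nondisjoint[OF assms(1) this] obtain Z where Z: "Z \<in> Sets"
    "\<And>z i j. C \<langle>z, j\<rangle> \<Longrightarrow> \<not> C \<langle>z, i\<rangle> \<Longrightarrow> \<langle>z, \<langle>i, j\<rangle>\<rangle> \<in> Z"
    "\<And>z i j. C \<langle>z, i\<rangle> \<Longrightarrow> \<not> C \<langle>z, j\<rangle> \<Longrightarrow> \<langle>z, \<langle>i, j\<rangle>\<rangle> \<notin> Z"
    unfolding \<Theta>0_def \<Theta>1_def R(2) by auto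
  define cur where "cur z = prim_rec \<zero> (\<lambda>l c. if \<langle>z, \<langle>c, l \<oplus> \<one>\<rangle>\<rangle> \<in> Z then c else l \<oplus> \<one>)" for z
  have cur0: "cur z \<zero> = \<zero>" and cur_succ:
    "cur z (l \<oplus> \<one>) = (if \<langle>z, \<langle>cur z l, l \<oplus> \<one>\<rangle>\<rangle> \<in> Z then cur z l else l \<oplus> \<one>)" for z l
    unfolding cur_def by (rule prim_rec_zero prim_rec_succ, intro definable Z(1))+
  have cur_def_fun: "def_fun (\<lambda>e. cur (s e) (t e))" if "def_fun s" "def_fun t" for s t
    by (rule def_fun_subst2[OF _ that]) (unfold cur_def, intro definable Z(1))
  have le: "cur z l \<preceq>\<preceq> l" for z l
  proof (rule Delta1_induct[where P = "\<lambda>l. cur z l \<preceq>\<preceq> l"])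
    show "cur z (l \<oplus> \<one>) \<preceq>\<preceq> l \<oplus> \<one>" if "cur z l \<preceq>\<preceq> l" for l
      using that nums.order_trans[OF that] by (simp add: cur_succ nums.less_imp_le)
  qed (intro definable cur_def_fun, simp add: cur0)
  have C': "Sigma1 (\<lambda>e. C \<langle>s e, t e\<rangle>)" if "def_fun s" "def_fun t" for s t
  proof -
    have "Sigma1 (\<lambda>e. C \<langle>e 0, e (Suc 0)\<rangle>)"
      unfolding R(2) by (intro Sigma1_ex Delta1_Sigma1 definable R(1))
    from Sigma1_subst2[OF this that] show ?thesis .
  qed
  \<comment> \<open>\<open>Z\<close> never prefers a refuted alternative to an unrefuted one. Hence
    from the round on in which the unrefuted \<open>i\<close> enters, the current winner is
    unrefuted. This is a \<Pi>1 statement about the round, whence \<open>Pi1_induct\<close>.\<close>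
  have survive: "l \<prec> i \<or> \<not> C \<langle>z, cur z l\<rangle>" if i: "\<not> C \<langle>z, i\<rangle>" for z i l
  proof (rule Pi1_induct[where P = "\<lambda>l. l \<prec> i \<or> \<not> C \<langle>z, cur z l\<rangle>"])
    show "Sigma1 (\<lambda>e. \<not> (e 0 \<prec> i \<or> \<not> C \<langle>z, cur z (e 0)\<rangle>))"
      unfolding de_Morgan_disj not_not
      by (intro Sigma1_and C' cur_def_fun Delta1_Sigma1[OF Delta1_not[OF Delta1_less]] definable)
    show "\<zero> \<prec> i \<or> \<not> C \<langle>z, cur z \<zero>\<rangle>"
      using i zero_or_pos[of i] by (auto simp: cur0)
    fix l assume IH: "l \<prec> i \<or> \<not> C \<langle>z, cur z l\<rangle>"
    show "l \<oplus> \<one> \<prec> i \<or> \<not> C \<langle>z, cur z (l \<oplus> \<one>)\<rangle>"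
    proof (cases "l \<oplus> \<one> \<prec> i")
      case False
      then consider "l \<oplus> \<one> = i" | "\<not> l \<prec> i"
        by (metis less_succ nums.not_less nums.le_less succ_le_iff)
      then show ?thesis
      proof cases
        case 1
        then show ?thesis using i Z(3)[of z "cur z l" i] unfolding cur_succ by (auto split: if_splits)
      next
        case 2
        then have "\<not> C \<langle>z, cur z l\<rangle>" using IH by blast
        then show ?thesis using Z(2)[of z "l \<oplus> \<one>" "cur z l"] unfolding cur_succ by (auto split: if_splits)
      qed
    qed simp
  qed
  show ?thesis
  proof (rule that[of "\<lambda>z. cur z (b z)"])
    show "def_fun (\<lambda>e. cur (e 0) (b (e 0)))"
      by (intro cur_def_fun def_fun_var b)
    fix z i assume "i \<preceq>\<preceq> b z" "\<not> C \<langle>z, i\<rangle>"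
    then show "cur z (b z) \<preceq>\<preceq> b z \<and> \<not> C \<langle>z, cur z (b z)\<rangle>"
      using le survive[of z i "b z"] by (auto simp: nums.not_less)
  qed
qed

section \<open>From separation back to weak Koenig's lemma\<close>

definition app :: "'m \<Rightarrow> 'm \<Rightarrow> 'm" where
  "app s n = restr (\<lambda>i. if i \<prec> lh s then ent s i else n) (lh s \<oplus> \<one>)"

lemma def_fun_app [definable]: "def_fun s \<Longrightarrow> def_fun t \<Longrightarrow> def_fun (\<lambda>e. app (s e) (t e))"
  by (rule def_fun_subst2[of app]) (unfold app_def, intro definable)

text \<open>The counterpart of \<open>snoc\<close> reads \<open>s\<close> through \<open>ent\<close>
  and is thereby definable for all arguments, as is required for the recursion that builds a
  path.\<close>

lemma app_spec:
  "fin_seq (app s n)" "lh (app s n) = lh s \<oplus> \<one>" "i \<prec> lh s \<Longrightarrow> ent (app s n) i = ent s i"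
  "ent (app s n) (lh s) = n"
proof -
  have "fn_on UNIV (\<lambda>i. if i \<prec> lh s then ent s i else n)"
    by (intro def_fun_fn_on definable)
  note r = restr_fn[OF this, where n = "lh s \<oplus> \<one>"]
  show "fin_seq (app s n)" "lh (app s n) = lh s \<oplus> \<one>" "i \<prec> lh s \<Longrightarrow> ent (app s n) i = ent s i"
    "ent (app s n) (lh s) = n"
    unfolding app_def using r by (simp_all add: less_succ)
qed

lemma truncate:
  assumes "fin_seq s" "n \<preceq>\<preceq> lh s"
  obtains t where "fin_seq t" "lh t = n" "initial_segment t s" "\<And>i. i \<prec> n \<Longrightarrow> ent t i = ent s i"
proof -
  have "fn_on UNIV (ent s)"
    by (rule def_fun_fn_on) (intro definable)
  note r = restr_fn[OF this, where n = n]
  show ?thesis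
    using assms r by (intro that[of "restr (ent s) n"]) (auto simp: initial_segment_iff)
qed

text \<open>Nodes with extensions at all levels form a \<Pi>1 class, and each of them has a
  successor in the class. Separation selects such successors uniformly, so that a path arises by
  primitive recursion.\<close>

lemma separation_imp_WKL:
  assumes separation
  shows WKL
  unfolding WKL_def
proof (intro allI impI)
  fix T assume "tree T \<and> (\<forall>s\<in>T. binary_seq s) \<and> \<not> (\<exists>k. \<forall>s\<in>T. s \<prec> k)"
  then have T: "T \<in> Sets" "\<And>s. s \<in> T \<Longrightarrow> binary_seq s" "\<And>s. s \<in> T \<Longrightarrow> fin_seq s"
    "\<And>s t. s \<in> T \<Longrightarrow> fin_seq t \<Longrightarrow> initial_segment t s \<Longrightarrow> t \<in> T" "\<And>k. \<exists>s\<in>T. \<not> s \<prec> k"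
    unfolding tree_def by blast+
  define ext where "ext \<sigma> n s \<longleftrightarrow> s \<in> T \<and> lh s = n \<and> (\<forall>i. i \<prec> lh \<sigma> \<longrightarrow> ent s i = ent \<sigma> i)" for \<sigma> n s
  \<comment> \<open>The bound on the codes of binary sequences of length \<open>n\<close> makes the
    inner search bounded, so that being dead is \<Sigma>1.\<close>
  define dead where "dead \<sigma> \<longleftrightarrow> (\<exists>n. lh \<sigma> \<preceq>\<preceq> n \<and> \<not> (\<exists>s. s \<prec> bin_bound n \<oplus> \<one> \<and> ext \<sigma> n s))" for \<sigma>
  have dead_iff: "dead \<sigma> \<longleftrightarrow> (\<exists>n. lh \<sigma> \<preceq>\<preceq> n \<and> \<not> (\<exists>s. ext \<sigma> n s))" for \<sigma>
    unfolding dead_def less_succ_iff_le using binary_seq_le_bound T(2) ext_def by metis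
  have deadS: "Sigma1 (\<lambda>e. dead (t e))" if "def_fun t" for t
  proof -
    have "Sigma1 (\<lambda>e. dead (e 0))"
      unfolding dead_def ext_def by (intro Sigma1_ex Delta1_Sigma1 definable T(1))
    from Sigma1_subst2[of "\<lambda>x y. dead x", OF this that that] show ?thesis .
  qed
  have "Sigma1 (\<lambda>e. dead (app (p1 (e 0)) (p2 (e 0))))"
    by (intro deadS definable)
  moreover have "def_fun (\<lambda>e. \<one>)" by (rule def_fun_const)
  ultimately obtain g where g: "def_fun (\<lambda>e. g (e 0))"
    "\<And>\<sigma> i. i \<preceq>\<preceq> \<one> \<Longrightarrow> \<not> dead (app \<sigma> i) \<Longrightarrow> g \<sigma> \<preceq>\<preceq> \<one> \<and> \<not> dead (app \<sigma> (g \<sigma>))"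
    by (rule separation_choice[OF assms, of "\<lambda>v. dead (app (p1 v) (p2 v))" "\<lambda>_. \<one>"]) auto
  \<comment> \<open>If both successors died, at levels \<open>n0\<close> and \<open>n1\<close>, then
    an extension of \<open>\<sigma>\<close> of length \<open>n0 \<oplus> n1\<close> could be
    truncated to the level at which the successor through which it passes is dead.\<close>
  have step: "\<not> dead (app \<sigma> (g \<sigma>))" if \<sigma>: "\<not> dead \<sigma>" for \<sigma>
  proof (rule ccontr)
    assume "\<not> \<not> dead (app \<sigma> (g \<sigma>))"
    then have "dead (app \<sigma> \<zero>)" "dead (app \<sigma> \<one>)"
      using g(2)[of \<zero> \<sigma>] g(2)[of \<one> \<sigma>] by auto
    then obtain n0 n1 where n: "lh \<sigma> \<oplus> \<one> \<preceq>\<preceq> n0" "lh \<sigma> \<oplus> \<one> \<preceq>\<preceq> n1"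
      "\<And>s. \<not> ext (app \<sigma> \<zero>) n0 s" "\<And>s. \<not> ext (app \<sigma> \<one>) n1 s"
      unfolding dead_iff app_spec by blast
    have N: "n0 \<preceq>\<preceq> n0 \<oplus> n1" "n1 \<preceq>\<preceq> n0 \<oplus> n1"
      using le_add[of n0 n1] le_add[of n1 n0] by (simp_all add: nums.add.commute)
    then have lt: "lh \<sigma> \<prec> n0 \<oplus> n1"
      using n(1) succ_le_iff nums.order_trans by blast
    then obtain s where s: "s \<in> T" "lh s = n0 \<oplus> n1" "\<And>i. i \<prec> lh \<sigma> \<Longrightarrow> ent s i = ent \<sigma> i"
      using \<sigma> nums.less_imp_le unfolding dead_iff ext_def by metis
    have "\<exists>t. ext (app \<sigma> (ent s (lh \<sigma>))) n t" if nn: "n \<preceq>\<preceq> n0 \<oplus> n1" "lh \<sigma> \<oplus> \<one> \<preceq>\<preceq> n" for n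
    proof -
      obtain t where t: "fin_seq t" "lh t = n" "initial_segment t s" "\<And>i. i \<prec> n \<Longrightarrow> ent t i = ent s i"
        by (rule truncate[of s n]) (use s T(3) nn in auto)
      have lt: "i \<prec> n" if "i \<prec> lh \<sigma> \<oplus> \<one>" for i
        using that nn(2) nums.less_le_trans by blast
      have "t \<in> T"
        using T(4) s(1) t by blast
      moreover have "ent t i = ent (app \<sigma> (ent s (lh \<sigma>))) i" if "i \<prec> lh \<sigma> \<oplus> \<one>" for i
        using t(4)[OF lt[OF that]] that s(3) unfolding less_succ by (auto simp: app_spec)
      ultimately show ?thesis
        using t(2) unfolding ext_def app_spec by blast
    qed
    moreover have "ent s (lh \<sigma>) = \<zero> \<or> ent s (lh \<sigma>) = \<one>"
      using T(2)[OF s(1)] lt s(2) unfolding binary_seq_iff by metis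
    ultimately show False
      using n N by metis
  qed
  have "\<not> dead nil"
  proof -
    \<comment> \<open>Only the codes of members of \<open>T\<close> are known to be unbounded.
      Binary sequences shorter than \<open>n\<close> have codes below a common bound
      \<open>k\<close>, so a member with a code beyond \<open>k\<close> has length at least
      \<open>n\<close>.\<close>
    have "\<exists>s. ext nil n s" for n
    proof -
      have "def_fun (\<lambda>e. bin_bound (e 0))" by (intro definable)
      then obtain k where k: "\<forall>l. l \<prec> n \<longrightarrow> bin_bound l \<prec> k"
        using ex_bound[of bin_bound n] by blast
      obtain s where s: "s \<in> T" "\<not> s \<prec> k" using T(5) by blast
      then have "n \<preceq>\<preceq> lh s"
        using k binary_seq_le_bound[OF T(2)] nums.le_less_trans nums.not_less by metis
      then obtain t where "fin_seq t" "lh t = n" "initial_segment t s"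
        using truncate T(3)[OF s(1)] by metis
      then show ?thesis
        using T(4)[OF s(1)] unfolding ext_def by auto
    qed
    then show ?thesis
      unfolding dead_iff by blast
  qed
  define \<sigma> where "\<sigma> = prim_rec nil (\<lambda>n s. app s (g s))"
  have gd: "def_fun (\<lambda>e. g (t e))" if "def_fun t" for t
    by (rule def_fun_subst1[OF g(1) that])
  have \<sigma>0: "\<sigma> \<zero> = nil" and \<sigma>_succ: "\<sigma> (n \<oplus> \<one>) = app (\<sigma> n) (g (\<sigma> n))" for n
    unfolding \<sigma>_def by (rule prim_rec_zero prim_rec_succ, intro definable gd)+
  have \<sigma>_def_fun: "def_fun (\<lambda>e. \<sigma> (t e))" if "def_fun t" for t
    unfolding \<sigma>_def by (intro definable gd that)
  have len: "fin_seq (\<sigma> n) \<and> lh (\<sigma> n) = n" for n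
    by (rule Delta1_induct[where P = "\<lambda>n. fin_seq (\<sigma> n) \<and> lh (\<sigma> n) = n"])
      (intro definable \<sigma>_def_fun, simp_all add: \<sigma>0 \<sigma>_succ app_spec)
  \<comment> \<open>Being alive is \<Pi>1, so \<open>Pi1_induct\<close> carries it along the
    recursively chosen nodes.\<close>
  have alive: "\<not> dead (\<sigma> n)" for n
    by (rule Pi1_induct[where P = "\<lambda>n. \<not> dead (\<sigma> n)"])
      (simp_all only: not_not \<sigma>0 \<sigma>_succ, intro deadS \<sigma>_def_fun definable, rule \<open>\<not> dead nil\<close>, rule step)
  have inT: "\<sigma> n \<in> T" for n
  proof -
    have "lh (\<sigma> n) \<preceq>\<preceq> n" using len by simp
    then obtain s where s: "s \<in> T" "lh s = n" "\<And>i. i \<prec> n \<Longrightarrow> ent s i = ent (\<sigma> n) i"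
      using alive[of n] len[of n] unfolding dead_iff ext_def by metis
    have "s = \<sigma> n"
      by (rule seq_eqI) (use s T(3) len[of n] in \<open>auto simp: ent_def\<close>)
    then show ?thesis using s by simp
  qed
  define h where "h i = ent (\<sigma> (i \<oplus> \<one>)) i" for i
  have h: "fn_on UNIV h"
    unfolding h_def by (intro def_fun_fn_on definable \<sigma>_def_fun)
  have ent: "\<forall>i. i \<prec> n \<longrightarrow> ent (\<sigma> n) i = h i" for n
  proof (rule Delta1_induct[where P = "\<lambda>n. \<forall>i. i \<prec> n \<longrightarrow> ent (\<sigma> n) i = h i"])
    fix n assume IH: "\<forall>i. i \<prec> n \<longrightarrow> ent (\<sigma> n) i = h i"
    show "\<forall>i. i \<prec> n \<oplus> \<one> \<longrightarrow> ent (\<sigma> (n \<oplus> \<one>)) i = h i"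
    proof (intro allI impI)
      fix i assume "i \<prec> n \<oplus> \<one>"
      then consider "i = n" | "i \<prec> n" by (auto simp: less_succ)
      then show "ent (\<sigma> (n \<oplus> \<one>)) i = h i"
      proof cases
        case 2
        then show ?thesis
          using IH app_spec(3)[of i "\<sigma> n"] len[of n] by (simp add: \<sigma>_succ)
      qed (simp add: h_def)
    qed
  qed (unfold h_def, intro definable \<sigma>_def_fun, simp)
  have "restr h n = \<sigma> n" for n
    by (rule restr_eqI) (use len[of n] ent[of n] in \<open>auto simp: ent_def\<close>)
  then show "has_path T"
    unfolding has_path_def using h inT by (intro exI[of _ h]) auto
qed

definition two :: "'m \<Rightarrow> 'm" where "two k = rat_add (half_pow k) (half_pow k)"

lemma rat_two [simp]: "rat (two k)" and val_two [simp]: "val (two k) = hp k \<boxplus> hp k"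
  by (simp_all add: two_def val_rat_add hp_def)

lemma def_fun_two [definable]: "def_fun t \<Longrightarrow> def_fun (\<lambda>e. two (t e))"
  unfolding two_def by (intro definable)

lemma four_pos: "\<zero>\<^sub>v \<sqsubset> x \<Longrightarrow> \<zero>\<^sub>v \<sqsubset> four x"
  by (simp add: four_def vals.add_pos_pos)

lemma four_double: "\<zero>\<^sub>v \<sqsubseteq> x \<Longrightarrow> x \<boxplus> x \<sqsubseteq> four x"
  by (simp add: four_def vals.add_nonneg_nonneg val_ac)

lemma four_ge: "\<zero>\<^sub>v \<sqsubseteq> x \<Longrightarrow> x \<sqsubseteq> four x"
  by (simp add: four_def vals.add_nonneg_nonneg val_ac)

text \<open>Collection for \<Sigma>1 relations. With \<Sigma>1 closed under bounded quantification,
  the induction of \<open>Delta0_bounding\<close> can be repeated for a \<Sigma>1 matrix.\<close>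

lemma Sigma1_bounding:
  assumes P: "Sigma1 (\<lambda>e. P (e 0) (e (Suc 0)))" and ex: "\<And>i. i \<prec> a \<Longrightarrow> \<exists>J. P i J"
  shows "\<exists>b. \<forall>i. i \<prec> a \<longrightarrow> (\<exists>J. J \<prec> b \<and> P i J)"
proof -
  have P': "Sigma1 (\<lambda>e. P (s e) (t e))" if "def_fun s" "def_fun t" for s t
    using Sigma1_subst2[OF P that] .
  have "a \<prec> n \<or> (\<exists>b. \<forall>i. i \<prec> n \<longrightarrow> (\<exists>J. J \<prec> b \<and> P i J))" for n
  proof (rule Sigma1_induct[where P = "\<lambda>n. a \<prec> n \<or> (\<exists>b. \<forall>i. i \<prec> n \<longrightarrow> (\<exists>J. J \<prec> b \<and> P i J))"])
    show "Sigma1 (\<lambda>e. a \<prec> e 0 \<or> (\<exists>b. \<forall>i. i \<prec> e 0 \<longrightarrow> (\<exists>J. J \<prec> b \<and> P i J)))"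
      by (intro Sigma1_or Sigma1_ex Sigma1_ball Sigma1_and P' Delta1_Sigma1[OF Delta1_less] definable)
    fix n assume IH: "a \<prec> n \<or> (\<exists>b. \<forall>i. i \<prec> n \<longrightarrow> (\<exists>J. J \<prec> b \<and> P i J))"
    show "a \<prec> n \<oplus> \<one> \<or> (\<exists>b. \<forall>i. i \<prec> n \<oplus> \<one> \<longrightarrow> (\<exists>J. J \<prec> b \<and> P i J))"
    proof (cases "a \<prec> n \<oplus> \<one>")
      case False
      then have "n \<prec> a"
        by (metis less_succ num_less_linear)
      then obtain b J where b: "\<forall>i. i \<prec> n \<longrightarrow> (\<exists>J. J \<prec> b \<and> P i J)" and J: "P n J"
        using IH ex nums.less_asym by blast
      have "b \<preceq>\<preceq> b \<oplus> (J \<oplus> \<one>)" "J \<prec> b \<oplus> (J \<oplus> \<one>)"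
        by (auto simp: nums.add_increasing2 nums.add_strict_increasing2 intro: le_add)
      then have "\<exists>J'. J' \<prec> b \<oplus> (J \<oplus> \<one>) \<and> P i J'" if "i \<prec> n \<oplus> \<one>" for i
        using that b J nums.less_le_trans unfolding less_succ by blast
      then show ?thesis by blast
    qed simp
  qed simp
  from this[of a] show ?thesis
    using nums.less_irrefl by blast
qed

end

section \<open>Distances as definable relations\<close>

context metric
begin

text \<open>A set of the structure gives the distance function on \<open>A\<close> only. The default
  value elsewhere makes it definable for all arguments.\<close>

definition dd :: "'m \<Rightarrow> 'm \<Rightarrow> 'm \<Rightarrow> 'm" where
  "dd a b k = (if a \<in> A \<and> b \<in> A then snd X a b k else \<zero>)"

lemma def_fun_dd [definable]:
  "def_fun r \<Longrightarrow> def_fun s \<Longrightarrow> def_fun t \<Longrightarrow> def_fun (\<lambda>e. dd (r e) (s e) (t e))"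
proof (erule (2) def_fun_comp3[rotated])
  define G where "G = {\<langle>\<langle>\<langle>a, b\<rangle>, k\<rangle>, snd X a b k\<rangle> | a b k. a \<in> A \<and> b \<in> A}"
  have G: "G \<in> Sets" using dist_graph by (simp add: G_def)
  have "y = dd a b k \<longleftrightarrow> (if a \<in> A \<and> b \<in> A then \<langle>\<langle>\<langle>a, b\<rangle>, k\<rangle>, y\<rangle> \<in> G else y = \<zero>)" for y a b k
    by (auto simp: dd_def G_def)
  then show "Delta1 (\<lambda>e. e 0 = dd (e (Suc 0)) (e (Suc (Suc 0))) (e (Suc (Suc (Suc 0)))))"
    by (simp only:) (intro definable G codes_in_Sets)
qed

text \<open>This is the failure at index \<open>k\<close> of the inequality
  \<open>q \<le> d(x, y)\<close> of reals. It is decidable, and \<open>k\<close> is the witness that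
  turns \<open>dless\<close> into a \<Sigma>1 relation.\<close>

abbreviation near_at :: "('m \<Rightarrow> 'm) \<Rightarrow> ('m \<Rightarrow> 'm) \<Rightarrow> 'm \<Rightarrow> 'm \<Rightarrow> bool" where
  "near_at x y q k \<equiv> \<not> rat_le q (rat_add (dd (x (k \<oplus> \<one> \<oplus> \<one>)) (y (k \<oplus> \<one> \<oplus> \<one>)) (k \<oplus> \<one> \<oplus> \<one>)) (two k))"

lemma dless_code:
  assumes x: "point X x" and y: "point X y" and q: "rat q"
  shows "dless x y (val q) \<longleftrightarrow> (\<exists>k. near_at x y q k)"
  unfolding dless_iff[OF assms, symmetric] real_less_def real_le_def real_of_def two_def
  using x y by (simp add: distance_eq dd_def point_code)

text \<open>\<open>far x y q\<close> expresses \<open>d(x, y) > q\<close>.\<close>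

definition far :: "('m \<Rightarrow> 'm) \<Rightarrow> ('m \<Rightarrow> 'm) \<Rightarrow> 'm \<Rightarrow> bool" where
  "far x y q \<longleftrightarrow> (\<exists>k. \<not> rat_le (dd (x (k \<oplus> \<one> \<oplus> \<one>)) (y (k \<oplus> \<one> \<oplus> \<one>)) (k \<oplus> \<one> \<oplus> \<one>)) (rat_add q (two k)))"

lemma far_iff:
  assumes "point X x" "point X y" "rat q"
  shows "far x y q \<longleftrightarrow> (\<exists>k. \<not> dval (x (k \<oplus> \<one> \<oplus> \<one>)) (y (k \<oplus> \<one> \<oplus> \<one>)) (k \<oplus> \<one> \<oplus> \<one>) \<sqsubseteq> val q \<boxplus> (hp k \<boxplus> hp k))"
  using assms by (simp add: far_def dd_def point_code dval_def val_rat_add dist_rat flip: val_le_iff)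

lemma dless_not_far:
  assumes x: "point X x" and y: "point X y" and q: "rat q" and "dless x y (val q)"
  shows "\<not> far x y q"
proof -
  have "dval (x (k \<oplus> \<one> \<oplus> \<one>)) (y (k \<oplus> \<one> \<oplus> \<one>)) (k \<oplus> \<one> \<oplus> \<one>) \<sqsubseteq> val q \<boxplus> (hp k \<boxplus> hp k)" for k
  proof -
    define m where "m = k \<oplus> \<one> \<oplus> \<one>"
    obtain e where e: "\<zero>\<^sub>v \<sqsubset> e" "evt (\<lambda>n. dval (x n) (y n) n \<boxplus> e \<sqsubseteq> val q)"
      using assms(4) unfolding dless_def by blast
    from evt_happens[OF evt_conj[OF e(2) evt_ge[of m]]]
    obtain n where n: "dval (x n) (y n) n \<boxplus> e \<sqsubseteq> val q" "m \<preceq>\<preceq> n" by blast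
    have "dval (x m) (y m) m \<sqsubseteq> dval (x n) (y n) n \<boxplus> four (hp m)"
      using dval_points[OF x y, of m m n] n by simp
    then have 1: "dval (x m) (y m) m \<sqsubseteq> dval (x n) (y n) n \<boxplus> hp k"
      by (simp only: m_def four_hp)
    have "dval (x m) (y m) m \<sqsubseteq> val q \<boxplus> (hp k \<boxplus> hp k)"
      by (rule val_leI[OF vals.add_mono[OF 1 vals.add_mono[OF n(1) vals.add_mono[OF
          vals.less_imp_le[OF e(1)] hp_nonneg[of k]]]]]) (simp add: val_ac)
    then show ?thesis by (simp add: m_def)
  qed
  then show ?thesis
    using assms by (simp add: far_iff)
qed

text \<open>\<open>far\<close> and \<open>dless\<close> are both \<Sigma>1, and the failure of the
  former means only \<open>d(x, y) \<le> q\<close>. The price for returning to a strict inequality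
  is a larger bound \<open>p\<close>.\<close>

lemma not_far_dless:
  assumes x: "point X x" and y: "point X y" and q: "rat q" and "\<not> far x y q" and p: "val q \<sqsubset> p"
  shows "dless x y p"
proof -
  have "\<zero>\<^sub>v \<sqsubset> p \<boxminus> val q" using p by simp
  then obtain e where e: "\<zero>\<^sub>v \<sqsubset> e" "e \<boxplus> e \<sqsubset> p \<boxminus> val q"
    using ex_half by blast
  have e2: "e \<boxplus> e \<boxplus> val q \<sqsubseteq> p"
    using e(2) by (simp only: vals.less_diff_eq vals.less_imp_le)
  have "evt (\<lambda>n. dval (x n) (y n) n \<boxplus> e \<sqsubseteq> p)"
    using evt_conj[OF evt_small[OF e(1)] evt_ge[of "\<one> \<oplus> \<one>"]]
  proof (rule evt_mono)
    fix n assume n: "four (four (hp n)) \<sqsubset> e \<and> \<one> \<oplus> \<one> \<preceq>\<preceq> n"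
    then obtain k where k: "n = k \<oplus> \<one> \<oplus> \<one>"
      by (auto simp: num_le_iff num_ac)
    have "hp k \<boxplus> hp k \<sqsubseteq> four (four (hp n))"
      unfolding k four_hp by (simp add: four_double)
    then have hp: "hp k \<boxplus> hp k \<sqsubseteq> e" using n by auto
    have *: "dval (x n) (y n) n \<sqsubseteq> val q \<boxplus> (hp k \<boxplus> hp k)"
      using assms(4) far_iff[OF x y q] by (simp add: k)
    show "dval (x n) (y n) n \<boxplus> e \<sqsubseteq> p"
      by (rule val_leI[OF vals.add_mono[OF * vals.add_mono[OF hp e2]]]) (simp add: val_ac)
  qed
  then show ?thesis
    unfolding dless_def using e(1) by blast
qed

lemma dless_codes_le:
  assumes "a \<in> A" "b \<in> A" "dless (\<lambda>_. a) (\<lambda>_. b) q"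
  shows "dval a b k \<sqsubseteq> q \<boxplus> hp k"
proof -
  obtain e where e: "\<zero>\<^sub>v \<sqsubset> e" "evt (\<lambda>n. dval a b n \<boxplus> e \<sqsubseteq> q)"
    using assms(3) unfolding dless_def by blast
  from evt_happens[OF evt_conj[OF e(2) evt_ge[of k]]]
  obtain n where n: "dval a b n \<boxplus> e \<sqsubseteq> q" "k \<preceq>\<preceq> n" by blast
  from vals.add_mono[OF dval_regular(1)[OF assms(1,2) n(2)] vals.add_mono[OF n(1) vals.less_imp_le[OF e(1)]]]
  show ?thesis
    by (rule val_leI) (simp add: val_ac)
qed

end

section \<open>Compactness\<close>

locale compact_metric = metric M X for M :: "'m l2_structure" and X :: "'m space" +
  fixes n :: "'m \<Rightarrow> 'm" and x :: "'m \<Rightarrow> 'm \<Rightarrow> 'm \<Rightarrow> 'm"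
  assumes n_fn: "fn_on UNIV n"
    and x_graph: "{\<langle>\<langle>\<langle>i, j\<rangle>, k\<rangle>, x i j k\<rangle> | i j k. i \<preceq> n j} \<in> Sets"
    and x_point: "\<And>i j. i \<preceq>\<preceq> n j \<Longrightarrow> point X (x i j)"
    and x_net: "\<And>z j. point X z \<Longrightarrow> \<exists>i. i \<preceq>\<preceq> n j \<and> dless (x i j) z (hp j)"
begin

definition xx :: "'m \<Rightarrow> 'm \<Rightarrow> 'm \<Rightarrow> 'm" where "xx i j k = (if i \<preceq>\<preceq> n j then x i j k else \<zero>)"

lemma def_fun_n [definable]: "def_fun t \<Longrightarrow> def_fun (\<lambda>e. n (t e))"
  by (rule def_fun_fn[OF n_fn])

lemma def_fun_xx [definable]:
  "def_fun r \<Longrightarrow> def_fun s \<Longrightarrow> def_fun t \<Longrightarrow> def_fun (\<lambda>e. xx (r e) (s e) (t e))"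
proof (erule (2) def_fun_comp3[rotated])
  define G where "G = {\<langle>\<langle>\<langle>i, j\<rangle>, k\<rangle>, x i j k\<rangle> | i j k. i \<preceq> n j}"
  have G: "G \<in> Sets" using x_graph by (simp add: G_def)
  have "y = xx i j k \<longleftrightarrow> (if i \<preceq>\<preceq> n j then \<langle>\<langle>\<langle>i, j\<rangle>, k\<rangle>, y\<rangle> \<in> G else y = \<zero>)" for y i j k
    by (auto simp: xx_def G_def num_le_def)
  then show "Delta1 (\<lambda>e. e 0 = xx (e (Suc 0)) (e (Suc (Suc 0))) (e (Suc (Suc (Suc 0)))))"
    by (simp only:) (intro definable G)
qed

lemma xx_eq: "i \<preceq>\<preceq> n j \<Longrightarrow> xx i j = x i j"
  by (simp add: xx_def fun_eq_iff)

lemma xx_point: "i \<preceq>\<preceq> n j \<Longrightarrow> point X (xx i j)"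
  by (simp add: xx_eq x_point)

lemma xx_net:
  assumes "point X z"
  obtains i where "i \<preceq>\<preceq> n j" "dless (xx i j) z (hp j)"
  using x_net[OF assms] xx_eq by metis

end

text \<open>In a compact space, a \<open>\<Sigma>\<^sup>0\<^sub>1\<close> family of balls none of whose finite parts covers the space does not
  cover the space. \<open>caught i j\<close> says that the ball of radius \<open>2\<^sup>-\<^sup>j\<close> around \<open>x\<^sub>i\<^sub>j\<close> is contained, with some
  room, in a single ball of the family, and \<open>covered i j\<close> that the points of some finer net
  that lie near \<open>x\<^sub>i\<^sub>j\<close> are caught.\<close>

locale noncovering = compact_metric M X n x for M :: "'m l2_structure" and X n x +
  fixes Bad :: "'m \<Rightarrow> 'm \<Rightarrow> bool"
  assumes Bad_def: "Sigma1 (\<lambda>e. Bad (e 0) (e (Suc 0)))"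
    and Bad_ball: "\<And>c t. Bad c t \<Longrightarrow> c \<in> A \<and> rat t"
begin

definition caught :: "'m \<Rightarrow> 'm \<Rightarrow> bool" where
  "caught i j \<longleftrightarrow> (\<exists>c t k. Bad c t \<and> near_at (xx i j) (\<lambda>_. c) (rat_add t (rat_minus (two j))) k)"

definition covered :: "'m \<Rightarrow> 'm \<Rightarrow> bool" where
  "covered i j \<longleftrightarrow> (\<exists>J. j \<prec> J \<and> (\<forall>i'. i' \<prec> n J \<oplus> \<one> \<longrightarrow> caught i' J \<or> far (xx i j) (xx i' J) (two j)))"

lemma caught_iff:
  assumes "i \<preceq>\<preceq> n j"
  shows "caught i j \<longleftrightarrow> (\<exists>c t. Bad c t \<and> dless (xx i j) (\<lambda>_. c) (val t \<boxminus> (hp j \<boxplus> hp j)))"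
proof -
  have "dless (xx i j) (\<lambda>_. c) (val t \<boxminus> (hp j \<boxplus> hp j)) \<longleftrightarrow> (\<exists>k. near_at (xx i j) (\<lambda>_. c) (rat_add t (rat_minus (two j))) k)"
    if bad: "Bad c t" for c t
  proof -
    have t: "c \<in> A" "rat t"
      using Bad_ball[OF bad] by auto
    have "val (rat_add t (rat_minus (two j))) = val t \<boxminus> (hp j \<boxplus> hp j)"
      using t by (simp only: val_rat_add val_rat_minus rat_rat_minus rat_two val_two val_minus_def)
    then show ?thesis
      using dless_code[of "xx i j" "\<lambda>_. c" "rat_add t (rat_minus (two j))"] t const_point xx_point[OF assms]
      by (simp only: rat_rat_add rat_rat_minus rat_two)
  qed
  then show ?thesis
    unfolding caught_def by blast
qed

lemma Sigma1_Bad: "def_fun s \<Longrightarrow> def_fun t \<Longrightarrow> Sigma1 (\<lambda>e. Bad (s e) (t e))"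
  by (rule Sigma1_subst2[OF Bad_def])

lemma Sigma1_caught: "def_fun s \<Longrightarrow> def_fun t \<Longrightarrow> Sigma1 (\<lambda>e. caught (s e) (t e))"
  by (rule Sigma1_subst2[where P = caught])
    (unfold caught_def, intro Sigma1_ex Sigma1_and Sigma1_Bad definable, intro Delta1_Sigma1 definable)

lemma Sigma1_far:
  "def_fun i \<Longrightarrow> def_fun j \<Longrightarrow> def_fun i' \<Longrightarrow> def_fun j' \<Longrightarrow> def_fun q \<Longrightarrow>
    Sigma1 (\<lambda>e. far (xx (i e) (j e)) (xx (i' e) (j' e)) (q e))"
proof -
  assume *: "def_fun i" "def_fun j" "def_fun i'" "def_fun j'" "def_fun q"
  have "Sigma1 (\<lambda>e. far (xx (p1 (e 0)) (p2 (e 0))) (xx (p1 (e (Suc 0))) (p1 (p2 (e (Suc 0))))) (p2 (p2 (e (Suc 0)))))"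
    unfolding far_def by (intro Sigma1_ex Delta1_Sigma1 definable)
  from Sigma1_subst2[of "\<lambda>u v. far (xx (p1 u) (p2 u)) (xx (p1 v) (p1 (p2 v))) (p2 (p2 v))", OF this,
      of "\<lambda>e. \<langle>i e, j e\<rangle>" "\<lambda>e. \<langle>i' e, \<langle>j' e, q e\<rangle>\<rangle>"] show ?thesis
    using * by (simp add: definable)
qed

lemma Sigma1_covered: "def_fun s \<Longrightarrow> def_fun t \<Longrightarrow> Sigma1 (\<lambda>e. covered (s e) (t e))"
  by (rule Sigma1_subst2[where P = covered])
    (unfold covered_def, intro Sigma1_ex Sigma1_and Sigma1_ball Sigma1_or Sigma1_caught Sigma1_far
      Delta1_Sigma1[OF Delta1_less] definable)

text \<open>The room of twice \<open>hp j\<close> pays for everything: \<open>hp j\<close> for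
  moving the centre, and another \<open>hp j\<close> for the new room, as twice \<open>hp J\<close>
  is at most \<open>hp j\<close> for \<open>j \<prec> J\<close>.\<close>

lemma caught_mono:
  assumes i: "i \<preceq>\<preceq> n j" and i': "i' \<preceq>\<preceq> n J" and "j \<prec> J" and near: "dless (xx i j) (xx i' J) (hp j)"
    and "caught i j"
  shows "caught i' J"
proof -
  obtain c t where c: "Bad c t" "dless (xx i j) (\<lambda>_. c) (val t \<boxminus> (hp j \<boxplus> hp j))"
    using assms(5) caught_iff[OF i] by blast
  have J: "hp J \<boxplus> hp J \<sqsubseteq> hp j"
  proof -
    have "hp J \<sqsubseteq> hp (j \<oplus> \<one>)"
      using \<open>j \<prec> J\<close> by (intro hp_antimono) (simp add: succ_le_iff)
    from vals.add_mono[OF this this] show ?thesis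
      by (simp only: hp_double)
  qed
  have "dless (xx i' J) (\<lambda>_. c) (hp j \<boxplus> (val t \<boxminus> (hp j \<boxplus> hp j)))"
    using dless_triangle[OF xx_point[OF i'] xx_point[OF i] const_point] near c(2) Bad_ball[OF c(1)]
      dless_sym[OF xx_point[OF i] xx_point[OF i']] by blast
  moreover have "hp j \<boxplus> (val t \<boxminus> (hp j \<boxplus> hp j)) \<sqsubseteq> val t \<boxminus> (hp J \<boxplus> hp J)"
  proof -
    define d where "d = val t \<boxminus> (hp j \<boxplus> hp j)"
    have t: "val t = d \<boxplus> (hp j \<boxplus> hp j)"
      unfolding d_def vals.diff_add_cancel ..
    show ?thesis
      unfolding vals.le_diff_eq d_def[symmetric] unfolding t
      by (rule val_leI[OF J]) (simp add: val_ac)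
  qed
  ultimately show ?thesis
    using c(1) dless_mono caught_iff[OF i'] by blast
qed

text \<open>By collection the levels that show the single \<open>i\<close> to be covered lie below
  one \<open>b\<close>. An uncaught point of a level from \<open>b\<close> on has an uncaught net
  point close to it on each of these levels, by \<open>caught_mono\<close>; if it were near a
  covered \<open>i\<close>, that net point would violate \<open>covered\<close>. The predicate
  \<open>N\<close> exempts some indices.\<close>

lemma covered_level:
  assumes N: "Sigma1 (\<lambda>e. N (e 0))" and cov: "\<And>i. i \<preceq>\<preceq> n j \<Longrightarrow> N i \<or> covered i j"
  shows "\<exists>b. \<forall>J i i'. b \<preceq>\<preceq> J \<longrightarrow> i' \<preceq>\<preceq> n J \<longrightarrow> \<not> caught i' J \<longrightarrow> i \<preceq>\<preceq> n j \<longrightarrow>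
    dless (xx i j) (xx i' J) (hp j) \<longrightarrow> N i"
proof -
  have N': "Sigma1 (\<lambda>e. N (t e))" if "def_fun t" for t
    using Sigma1_subst2[of "\<lambda>x y. N x", OF N that that] .
  define P where "P i J \<longleftrightarrow> N i \<or> j \<prec> J \<and> (\<forall>i'. i' \<prec> n J \<oplus> \<one> \<longrightarrow> caught i' J \<or> far (xx i j) (xx i' J) (two j))" for i J
  have "Sigma1 (\<lambda>e. P (e 0) (e (Suc 0)))"
    unfolding P_def by (intro Sigma1_or N' Sigma1_and Sigma1_ball Sigma1_caught Sigma1_far
      Delta1_Sigma1[OF Delta1_less] definable)
  moreover have "\<exists>J. P i J" if "i \<prec> n j \<oplus> \<one>" for i
    using cov that unfolding P_def covered_def less_succ_iff_le by blast
  ultimately obtain b where b: "\<forall>i. i \<prec> n j \<oplus> \<one> \<longrightarrow> (\<exists>J. J \<prec> b \<and> P i J)"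
    using Sigma1_bounding[of P] by blast
  show ?thesis
  proof (intro exI[of _ b] allI impI, rule ccontr)
    fix J i i' assume J: "b \<preceq>\<preceq> J" and i': "i' \<preceq>\<preceq> n J" "\<not> caught i' J" and i: "i \<preceq>\<preceq> n j"
      and near: "dless (xx i j) (xx i' J) (hp j)" and "\<not> N i"
    then obtain J1 where J1: "J1 \<prec> b" "j \<prec> J1"
      "\<And>k. k \<preceq>\<preceq> n J1 \<Longrightarrow> caught k J1 \<or> far (xx i j) (xx k J1) (two j)"
      using b unfolding P_def less_succ_iff_le by blast
    obtain k where k: "k \<preceq>\<preceq> n J1" "dless (xx k J1) (xx i' J) (hp J1)"
      using xx_net[OF xx_point[OF i'(1)]] by blast
    have "J1 \<prec> J" using J J1(1) nums.less_le_trans by blast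
    then have "\<not> caught k J1"
      using caught_mono[OF k(1) i'(1)] k(2) i'(2) by blast
    moreover have "dless (xx i j) (xx k J1) (hp j \<boxplus> hp J1)"
      using dless_triangle[OF xx_point[OF i] xx_point[OF i'(1)] xx_point[OF k(1)] near]
        dless_sym[OF xx_point[OF k(1)] xx_point[OF i'(1)] k(2)] by blast
    moreover have "hp j \<boxplus> hp J1 \<sqsubseteq> val (two j)"
      using J1(2) hp_antimono by (simp add: nums.less_imp_le)
    ultimately show False
      using J1(3)[OF k(1)] dless_not_far[OF xx_point[OF i] xx_point[OF k(1)] rat_two] dless_mono by blast
  qed
qed

text \<open>This is the heredity for which \<open>covered\<close> is designed. If all points of the
  next level near \<open>xx i j\<close> were covered, then by \<open>covered_level\<close> no
  uncaught point near \<open>xx i j\<close> could exist on late levels, whereas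
  \<open>\<not> covered i j\<close> provides one on each level beyond \<open>j\<close>.\<close>

lemma uncovered_succ:
  assumes i: "i \<preceq>\<preceq> n j" and "\<not> covered i j"
  shows "\<exists>i'. i' \<preceq>\<preceq> n (j \<oplus> \<one>) \<and> \<not> covered i' (j \<oplus> \<one>) \<and> \<not> far (xx i j) (xx i' (j \<oplus> \<one>)) (rat_add (two j) (two j))"
proof (rule ccontr)
  assume "\<not> ?thesis"
  then have "far (xx i j) (xx i' (j \<oplus> \<one>)) (rat_add (two j) (two j)) \<or> covered i' (j \<oplus> \<one>)"
    if "i' \<preceq>\<preceq> n (j \<oplus> \<one>)" for i'
    using that by blast
  moreover have "Sigma1 (\<lambda>e. far (xx i j) (xx (e 0) (j \<oplus> \<one>)) (rat_add (two j) (two j)))"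
    by (intro Sigma1_far definable)
  ultimately obtain b where b: "\<forall>J i1 i'. b \<preceq>\<preceq> J \<longrightarrow> i' \<preceq>\<preceq> n J \<longrightarrow> \<not> caught i' J \<longrightarrow> i1 \<preceq>\<preceq> n (j \<oplus> \<one>) \<longrightarrow>
    dless (xx i1 (j \<oplus> \<one>)) (xx i' J) (hp (j \<oplus> \<one>)) \<longrightarrow> far (xx i j) (xx i1 (j \<oplus> \<one>)) (rat_add (two j) (two j))"
    using covered_level[of "\<lambda>i'. far (xx i j) (xx i' (j \<oplus> \<one>)) (rat_add (two j) (two j))" "j \<oplus> \<one>"] by metis
  define J where "J = b \<oplus> (j \<oplus> \<one>)"
  have J: "b \<preceq>\<preceq> J" "j \<prec> J"
    unfolding J_def by (auto simp: nums.add_increasing2 nums.add_strict_increasing2 intro: le_add)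
  obtain i' where i': "i' \<preceq>\<preceq> n J" "\<not> caught i' J" "\<not> far (xx i j) (xx i' J) (two j)"
    using assms(2) J(2) unfolding covered_def less_succ_iff_le by blast
  obtain i1 where i1: "i1 \<preceq>\<preceq> n (j \<oplus> \<one>)" "dless (xx i1 (j \<oplus> \<one>)) (xx i' J) (hp (j \<oplus> \<one>))"
    using xx_net[OF xx_point[OF i'(1)]] by blast
  \<comment> \<open>Origin of the constant four: twice \<open>hp j\<close> because \<open>i'\<close>
    is not far, once more to make the inequality strict, and
    \<open>hp (j \<oplus> \<one>) \<sqsubseteq> hp j\<close> to reach the net point
    \<open>i1\<close>.\<close>
  have "dless (xx i j) (xx i' J) (hp j \<boxplus> hp j \<boxplus> hp j)"
    using not_far_dless[OF xx_point[OF i] xx_point[OF i'(1)] rat_two i'(3)] by simp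
  then have "dless (xx i j) (xx i1 (j \<oplus> \<one>)) (hp j \<boxplus> hp j \<boxplus> hp j \<boxplus> hp (j \<oplus> \<one>))"
    using dless_triangle[OF xx_point[OF i] xx_point[OF i'(1)] xx_point[OF i1(1)]]
      dless_sym[OF xx_point[OF i1(1)] xx_point[OF i'(1)] i1(2)] by blast
  then have "dless (xx i j) (xx i1 (j \<oplus> \<one>)) (val (rat_add (two j) (two j)))"
    by (rule dless_mono) (simp add: val_rat_add val_ac hp_succ_le)
  then show False
    using b J(1) i'(1,2) i1 dless_not_far[OF xx_point[OF i] xx_point[OF i1(1)]] rat_rat_add rat_two by blast
qed

lemma ex_uncaught_point:
  assumes separation and unc: "\<And>J. \<exists>i. i \<preceq>\<preceq> n J \<and> \<not> caught i J"
  shows "\<exists>z. point X z \<and> (\<forall>c t. Bad c t \<longrightarrow> \<not> dless z (\<lambda>_. c) (val t))"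
proof -
  \<comment> \<open>The argument is \<open>\<langle>\<langle>i, j\<rangle>, i'\<rangle>\<close>: the
    index \<open>i'\<close> is refuted as a successor of \<open>i\<close> on level
    \<open>j \<oplus> \<one>\<close> if it is covered or is seen to be farther away than four times
    \<open>hp j\<close>. By \<open>uncovered_succ\<close> an uncovered \<open>i\<close> leaves an
    unrefuted alternative.\<close>
  define C where "C v \<longleftrightarrow> covered (p2 v) (p2 (p1 v) \<oplus> \<one>) \<or>
    far (xx (p1 (p1 v)) (p2 (p1 v))) (xx (p2 v) (p2 (p1 v) \<oplus> \<one>)) (rat_add (two (p2 (p1 v))) (two (p2 (p1 v))))" for v
  have "Sigma1 (\<lambda>e. C (e 0))"
    unfolding C_def by (intro Sigma1_or Sigma1_covered Sigma1_far definable)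
  moreover have "def_fun (\<lambda>e. n (p2 (e 0) \<oplus> \<one>))" by (intro definable)
  ultimately obtain g where g: "def_fun (\<lambda>e. g (e 0))"
    "\<And>z i. i \<preceq>\<preceq> n (p2 z \<oplus> \<one>) \<Longrightarrow> \<not> C \<langle>z, i\<rangle> \<Longrightarrow> g z \<preceq>\<preceq> n (p2 z \<oplus> \<one>) \<and> \<not> C \<langle>z, g z\<rangle>"
    using separation_choice[OF assms(1), of C "\<lambda>z. n (p2 z \<oplus> \<one>)"] by metis
  have g': "g \<langle>i, j\<rangle> \<preceq>\<preceq> n (j \<oplus> \<one>) \<and> \<not> covered (g \<langle>i, j\<rangle>) (j \<oplus> \<one>) \<and>
      \<not> far (xx i j) (xx (g \<langle>i, j\<rangle>) (j \<oplus> \<one>)) (rat_add (two j) (two j))"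
    if ij: "i \<preceq>\<preceq> n j" "\<not> covered i j" for i j
  proof -
    obtain i' where "i' \<preceq>\<preceq> n (j \<oplus> \<one>)" "\<not> C \<langle>\<langle>i, j\<rangle>, i'\<rangle>"
      using uncovered_succ[OF ij] unfolding C_def p1_pair p2_pair by blast
    from g(2)[of i' "\<langle>i, j\<rangle>", unfolded p2_pair, OF this] show ?thesis
      unfolding C_def p1_pair p2_pair by blast
  qed
  \<comment> \<open>If all of level zero were covered, \<open>covered_level\<close> with empty
    \<open>N\<close> would exclude uncaught points from some level on, contrary to the hypothesis on
    finite parts.\<close>
  have "\<exists>i. i \<preceq>\<preceq> n \<zero> \<and> \<not> covered i \<zero>"
  proof (rule ccontr)
    assume "\<not> ?thesis"
    then have cov: "False \<or> covered i \<zero>" if "i \<preceq>\<preceq> n \<zero>" for i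
      using that by blast
    have S: "Sigma1 (\<lambda>e. False)" by (intro Delta1_Sigma1 definable)
    obtain b where b: "\<forall>J i i'. b \<preceq>\<preceq> J \<longrightarrow> i' \<preceq>\<preceq> n J \<longrightarrow> \<not> caught i' J \<longrightarrow> i \<preceq>\<preceq> n \<zero> \<longrightarrow>
      dless (xx i \<zero>) (xx i' J) (hp \<zero>) \<longrightarrow> False"
      using covered_level[of "\<lambda>_. False" \<zero>, OF S cov] ..
    obtain i' where i': "i' \<preceq>\<preceq> n b" "\<not> caught i' b" using unc by blast
    moreover obtain i where "i \<preceq>\<preceq> n \<zero>" "dless (xx i \<zero>) (xx i' b) (hp \<zero>)"
      using xx_net[OF xx_point[OF i'(1)]] by blast
    ultimately show False
      using b nums.order_refl by blast
  qed
  then obtain i0 where i0: "i0 \<preceq>\<preceq> n \<zero>" "\<not> covered i0 \<zero>" by blast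
  define s where "s = prim_rec i0 (\<lambda>j i. g \<langle>i, j\<rangle>)"
  have gd: "def_fun (\<lambda>e. g (t e))" if "def_fun t" for t
    by (rule def_fun_subst1[OF g(1) that])
  have s0: "s \<zero> = i0" and s_succ: "s (j \<oplus> \<one>) = g \<langle>s j, j\<rangle>" for j
    unfolding s_def by (rule prim_rec_zero prim_rec_succ, intro definable gd)+
  have sd: "def_fun (\<lambda>e. s (t e))" if "def_fun t" for t
    unfolding s_def by (intro definable gd that)
  have s: "s j \<preceq>\<preceq> n j \<and> \<not> covered (s j) j" for j
  proof (rule Pi1_induct[where P = "\<lambda>j. s j \<preceq>\<preceq> n j \<and> \<not> covered (s j) j"])
    show "Sigma1 (\<lambda>e. \<not> (s (e 0) \<preceq>\<preceq> n (e 0) \<and> \<not> covered (s (e 0)) (e 0)))"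
      unfolding de_Morgan_conj not_not
      by (intro Sigma1_or Sigma1_covered Delta1_Sigma1[OF Delta1_not[OF Delta1_le]] definable sd)
    show "s \<zero> \<preceq>\<preceq> n \<zero> \<and> \<not> covered (s \<zero>) \<zero>"
      unfolding s0 using i0 by blast
    show "s (j \<oplus> \<one>) \<preceq>\<preceq> n (j \<oplus> \<one>) \<and> \<not> covered (s (j \<oplus> \<one>)) (j \<oplus> \<one>)"
      if "s j \<preceq>\<preceq> n j \<and> \<not> covered (s j) j" for j
      using g'[of "s j" j] that unfolding s_succ by blast
  qed
  define z where "z j = xx (s j) j" for j
  have z: "point X (z j)" for j
    using xx_point s by (simp add: z_def)
  have z_step: "dless (z j) (z (j \<oplus> \<one>)) (four (hp j) \<boxplus> four (hp j))" for j
  proof -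
    have "\<not> far (z j) (z (j \<oplus> \<one>)) (rat_add (two j) (two j))"
      using g' s by (simp add: z_def s_succ)
    moreover have "val (rat_add (two j) (two j)) \<sqsubset> four (hp j) \<boxplus> four (hp j)"
      by (simp add: val_rat_add four_def vals.add_pos_pos val_ac)
    ultimately show ?thesis
      using not_far_dless[OF z z] rat_rat_add rat_two by blast
  qed
  \<comment> \<open>Consecutive points are less than eight times \<open>hp j\<close>, that is
    \<open>u (j \<oplus> \<one>)\<close>, apart. As \<open>u\<close> halves from level to level,
    these distances form a geometric series.\<close>
  define u where "u j = four (four (hp j))" for j
  have u_nonneg: "\<zero>\<^sub>v \<sqsubset> u j" for j
    by (simp add: u_def four_pos)
  have u_double: "u (j \<oplus> \<one>) \<boxplus> u (j \<oplus> \<one>) = u j" for j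
    unfolding u_def hp_double[of j, symmetric] by (simp add: four_def val_ac)
  have u8: "(four (hp j) \<boxplus> four (hp j)) \<boxplus> (four (hp j) \<boxplus> four (hp j)) = u j" for j
    by (simp add: u_def four_def val_ac)
  \<comment> \<open>The partial sums of the series are
    \<open>u j \<boxminus> u (j \<oplus> m)\<close>; the surplus \<open>u j\<close> makes the
    inequality strict already for \<open>m = \<zero>\<close>.\<close>
  have near: "dless (z j) (z (j \<oplus> m)) (u j \<boxplus> u j \<boxminus> u (j \<oplus> m))" for j m
  proof -
    \<comment> \<open>Values of rationals are no objects of the structure. For a \<Sigma>1 induction
      the bound is therefore expressed by the codes \<open>r m\<close> and the inequality by
      \<open>near_at\<close>.\<close>
    define q where "q k = rat_add (rat_add (two k) (two k)) (rat_add (two k) (two k))" for k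
    define r where "r m = rat_add (rat_add (rat_add (q j) (q j)) (rat_add (q j) (q j))) (rat_minus (rat_add (q (j \<oplus> m)) (q (j \<oplus> m))))" for m
    have q: "rat (q k)" "val (q k) = four (hp k) \<boxplus> four (hp k)" for k
      by (simp_all add: q_def val_rat_add four_def val_ac)
    have r: "rat (r m)" "val (r m) = u j \<boxplus> u j \<boxminus> u (j \<oplus> m)" for m
      by (simp_all add: r_def q val_rat_add val_rat_minus u8)
    have "\<exists>k. near_at (z j) (z (j \<oplus> m)) (r m) k" for m
    proof (rule Sigma1_induct[where P = "\<lambda>m. \<exists>k. near_at (z j) (z (j \<oplus> m)) (r m) k"])
      show "Sigma1 (\<lambda>e. \<exists>k. near_at (z j) (z (j \<oplus> e 0)) (r (e 0)) k)"
        unfolding r_def q_def z_def by (intro Sigma1_ex Delta1_Sigma1 definable sd)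
      show "\<exists>k. near_at (z j) (z (j \<oplus> \<zero>)) (r \<zero>) k"
        unfolding dless_code[OF z z r(1), symmetric] r(2) by (simp add: dless_self z u_nonneg)
      fix m assume "\<exists>k. near_at (z j) (z (j \<oplus> m)) (r m) k"
      then have "dless (z j) (z (j \<oplus> m)) (u j \<boxplus> u j \<boxminus> u (j \<oplus> m))"
        unfolding dless_code[OF z z r(1), symmetric] r(2) .
      from dless_triangle[OF z z z this z_step]
      have "dless (z j) (z (j \<oplus> m \<oplus> \<one>)) (u j \<boxplus> u j \<boxminus> u (j \<oplus> m) \<boxplus> (four (hp (j \<oplus> m)) \<boxplus> four (hp (j \<oplus> m))))" .
      moreover have "u j \<boxplus> u j \<boxminus> u (j \<oplus> m) \<boxplus> (four (hp (j \<oplus> m)) \<boxplus> four (hp (j \<oplus> m))) = u j \<boxplus> u j \<boxminus> u (j \<oplus> m \<oplus> \<one>)"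
      proof -
        have "four (hp (j \<oplus> m)) \<boxplus> four (hp (j \<oplus> m)) = u (j \<oplus> m \<oplus> \<one>)"
          unfolding u_def hp_double[of "j \<oplus> m", symmetric] by (simp add: four_def val_ac)
        then show ?thesis
          unfolding u_double[of "j \<oplus> m", symmetric]
          by (simp only: vals.diff_add_eq vals.diff_diff_add[symmetric] vals.add_diff_cancel_right' vals.diff_add_cancel)
      qed
      ultimately show "\<exists>k. near_at (z j) (z (j \<oplus> (m \<oplus> \<one>))) (r (m \<oplus> \<one>)) k"
        unfolding dless_code[OF z z r(1), symmetric] r(2) by (simp only: add_succ)
    qed
    from this[of m] show ?thesis
      unfolding dless_code[OF z z r(1), symmetric] r(2) .
  qed
  have near: "dless (z j) (z l) (u j \<boxplus> u j)" if jl: "j \<preceq>\<preceq> l" for j l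
  proof -
    obtain m where m: "l = j \<oplus> m" using jl by (auto simp: num_le_iff)
    have "u j \<boxplus> u j \<boxminus> u (j \<oplus> m) \<sqsubseteq> u j \<boxplus> u j"
      using u_nonneg[of "j \<oplus> m"] by (simp add: vals.diff_le_eq vals.less_imp_le)
    then show ?thesis
      using near[of j m] dless_mono unfolding m by blast
  qed
  \<comment> \<open>A shift by six levels, because four times \<open>u\<close> is 64 times
    \<open>hp\<close>.\<close>
  define sh where "sh k = k \<oplus> \<one> \<oplus> \<one> \<oplus> \<one> \<oplus> \<one> \<oplus> \<one> \<oplus> \<one>" for k
  have u_sh: "four (u (sh k)) = hp k" for k
    by (simp only: u_def sh_def four_hp)
  have sh_mono: "k \<preceq>\<preceq> l \<Longrightarrow> sh k \<preceq>\<preceq> sh l" for k l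
    by (simp add: sh_def)
  have k_sh: "k \<preceq>\<preceq> sh k" for k
    unfolding sh_def by (simp only: nums.add.assoc le_add)
  have u_mono: "u l \<sqsubseteq> u k" if "k \<preceq>\<preceq> l" for k l
    using hp_antimono[OF that] unfolding u_def four_def by (intro vals.add_mono)
  have hp_u: "hp k \<boxplus> hp k \<sqsubseteq> u k" for k
    by (metis u_def four_double four_ge hp_nonneg vals.order_trans vals.less_imp_le four_pos hp_pos)
  \<comment> \<open>The limit as a diagonal sequence. From \<open>y k\<close> to
    \<open>z (sh k)\<close>, on to \<open>z (sh l)\<close> and back to \<open>y l\<close> the errors
    are at most one, two and one times \<open>u (sh k)\<close>, which is \<open>hp k\<close> in
    total: the rate demanded of a point.\<close>
  define y where "y k = z (sh k) (sh k)" for k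
  have yA: "y k \<in> A" for k
    using z point_code by (simp add: y_def)
  have y_z: "dless (\<lambda>_. y k) (z (sh k)) (u (sh k))" for k
  proof -
    have "hp (sh k) \<sqsubset> u (sh k)"
      using hp_u[of "sh k"] hp_pos vals.less_le_trans
      by (metis vals.less_add_same_cancel1)
    then have "dless (z (sh k)) (\<lambda>_. y k) (u (sh k))"
      unfolding y_def by (rule dless_approx[OF z])
    then show ?thesis
      by (rule dless_sym[OF z const_point[OF yA]])
  qed
  have yy: "dless (\<lambda>_. y k) (\<lambda>_. y l) (hp k)" if "k \<preceq>\<preceq> l" for k l
  proof -
    have "dless (\<lambda>_. y k) (z (sh l)) (u (sh k) \<boxplus> (u (sh k) \<boxplus> u (sh k)))"
      using dless_triangle[OF const_point[OF yA] z z y_z near[OF sh_mono[OF that]]] .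
    from dless_triangle[OF const_point[OF yA] z const_point[OF yA] this dless_sym[OF const_point[OF yA] z y_z]]
    have "dless (\<lambda>_. y k) (\<lambda>_. y l) (u (sh k) \<boxplus> (u (sh k) \<boxplus> u (sh k)) \<boxplus> u (sh l))" .
    then show ?thesis
      by (rule dless_mono) (use u_mono[OF sh_mono[OF that]] in \<open>simp add: u_sh[symmetric] four_def val_ac\<close>)
  qed
  have "point X y"
  proof -
    have "fn_on UNIV y"
      unfolding y_def z_def sh_def by (intro def_fun_fn_on definable sd)
    moreover have "real_le (snd X (y i) (y j)) (real_of (half_pow i))" if "i \<preceq> j" for i j
    proof -
      have "dval (y i) (y j) k \<sqsubseteq> hp i \<boxplus> (hp k \<boxplus> hp k)" for k
      proof -
        have "dval (y i) (y j) k \<sqsubseteq> hp i \<boxplus> hp k"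
          using that yy[of i j] dless_codes_le[OF yA yA] by (simp add: num_le_def)
        then show ?thesis
          by (metis vals.order_trans vals.add.assoc vals.le_add_same_cancel1 hp_nonneg)
      qed
      then show ?thesis
        by (simp add: real_of_def real_le_iff dist_rat yA dval_def hp_def)
    qed
    ultimately show ?thesis
      using yA unfolding point_def by blast
  qed
  have zy: "dless (z j) y (four (u j))" for j
  proof -
    have 1: "dless (z j) (z (sh j)) (u j \<boxplus> u j)"
      by (rule near[OF k_sh])
    have "dless (z j) (\<lambda>_. y j) (u j \<boxplus> u j \<boxplus> u (sh j))"
      using dless_triangle[OF z z const_point[OF yA] 1 dless_sym[OF const_point[OF yA] z y_z]] .
    moreover have "dless (\<lambda>_. y j) y (u j)"
    proof -
      have "hp j \<sqsubset> u j"
        using hp_u[of j] hp_pos vals.less_le_trans by (metis vals.less_add_same_cancel1)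
      then show ?thesis
        by (intro dless_sym[OF \<open>point X y\<close> const_point[OF yA]] dless_approx[OF \<open>point X y\<close>])
    qed
    ultimately have "dless (z j) y (u j \<boxplus> u j \<boxplus> u (sh j) \<boxplus> u j)"
      using dless_triangle[OF z const_point[OF yA] \<open>point X y\<close>] by blast
    then show ?thesis
      by (rule dless_mono) (use u_mono[OF k_sh[of j]] in \<open>simp add: four_def val_ac\<close>)
  qed
  have "\<not> dless y (\<lambda>_. c) (val t)" if bad: "Bad c t" for c t
  proof
    assume "dless y (\<lambda>_. c) (val t)"
    then obtain e where e: "\<zero>\<^sub>v \<sqsubset> e" "\<And>p. val t \<sqsubseteq> p \<boxplus> e \<Longrightarrow> dless y (\<lambda>_. c) p"
      using dless_dense by blast
    then have yc: "dless y (\<lambda>_. c) (val t \<boxminus> e)"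
      by simp
    have c: "point X (\<lambda>_. c)"
      using Bad_ball[OF bad] const_point by blast
    \<comment> \<open>At a late level the margin \<open>e\<close> exceeds the distance from an
      uncaught net point near \<open>z j\<close> to the limit, at most six times \<open>u j\<close>,
      together with the room required by \<open>caught\<close>, at most \<open>u j\<close>. So this
      net point would be caught.\<close>
    have "evt (\<lambda>j. four (four (u j)) \<sqsubset> e)"
      unfolding u_def using evt_four[of "\<lambda>v. four (four (four v)) \<sqsubset> e"] evt_four[of "\<lambda>v. four (four v) \<sqsubset> e"]
        evt_small[OF e(1)] by blast
    then obtain j where j: "four (four (u j)) \<sqsubset> e"
      using evt_happens by blast
    define J where "J = j \<oplus> \<one>"
    obtain i where i: "i \<preceq>\<preceq> n J" "\<not> caught i J" "\<not> far (z j) (xx i J) (two j)"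
      using s[of j] unfolding covered_def z_def J_def less_succ_iff_le by (meson less_succ_self)
    have "val (two j) \<sqsubset> u j \<boxplus> u j"
      using hp_u[of j] u_nonneg vals.le_less_trans by (metis val_two vals.less_add_same_cancel1)
    then have "dless (z j) (xx i J) (u j \<boxplus> u j)"
      using not_far_dless[OF z xx_point[OF i(1)] rat_two i(3)] by blast
    from dless_triangle[OF xx_point[OF i(1)] z \<open>point X y\<close> dless_sym[OF z xx_point[OF i(1)] this] zy]
    have "dless (xx i J) (\<lambda>_. c) (u j \<boxplus> u j \<boxplus> four (u j) \<boxplus> (val t \<boxminus> e))"
      using dless_triangle[OF xx_point[OF i(1)] \<open>point X y\<close> c _ yc] by blast
    moreover have "u j \<boxplus> u j \<boxplus> four (u j) \<boxplus> (val t \<boxminus> e) \<sqsubseteq> val t \<boxminus> (hp J \<boxplus> hp J)"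
    proof -
      have 1: "hp J \<boxplus> hp J \<sqsubseteq> u j"
        using hp_u[of J] u_mono[of j J] vals.order_trans by (simp add: J_def nums.less_imp_le)
      have 2: "\<zero>\<^sub>v \<sqsubseteq> u j" using u_nonneg vals.less_imp_le by blast
      have 3: "\<zero>\<^sub>v \<sqsubseteq> four (u j)" using u_nonneg four_pos vals.less_imp_le by blast
      define d where "d = val t \<boxminus> e"
      have t: "val t = d \<boxplus> e"
        unfolding d_def vals.diff_add_cancel ..
      show ?thesis
        unfolding vals.le_diff_eq d_def[symmetric] unfolding t
        by (rule val_leI[OF vals.add_mono[OF 1 vals.add_mono[OF vals.less_imp_le[OF j] vals.add_mono[OF 2 vals.add_mono[OF 3 3]]]]])
          (simp add: four_def val_ac)
    qed
    ultimately have "caught i J"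
      using caught_iff[OF i(1)] bad dless_mono by blast
    then show False using i(2) by blast
  qed
  then show ?thesis
    using \<open>point X y\<close> by blast
qed

end

section \<open>The half line as a metric space\<close>

context rca0
begin

lemma real_of_real_num: "rat q \<Longrightarrow> real_num (real_of q)"
proof -
  assume q: "rat q"
  have "fn_on UNIV (\<lambda>_. q)"
    by (intro def_fun_fn_on definable)
  moreover have "val (rat_dist q q) \<sqsubseteq> hp k" for k
    using q by (simp add: val_rat_dist_le_iff)
  then have "rat_le (rat_dist q q) (half_pow k)" for k
    using q by (simp add: hp_def val_le_iff)
  ultimately show ?thesis
    using q by (simp add: real_num_def real_of_def)
qed

lemma real_le_real_of: "rat p \<Longrightarrow> rat q \<Longrightarrow> val p \<sqsubseteq> val q \<Longrightarrow> real_le (real_of p) (real_of q)"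
  by (simp add: real_of_def real_le_iff vals.add_increasing2 vals.add_nonneg_nonneg)

lemma val_rat_dist_nonneg: "rat p \<Longrightarrow> rat q \<Longrightarrow> \<zero>\<^sub>v \<sqsubseteq> val (rat_dist p q)"
proof -
  assume "rat p" "rat q"
  then have "val p \<sqsubseteq> val q \<boxplus> val (rat_dist p q)" "val q \<sqsubseteq> val p \<boxplus> val (rat_dist p q)"
    using val_rat_dist_le_iff vals.order_refl by blast+
  from vals.add_mono[OF this] have "\<zero>\<^sub>v \<sqsubseteq> val (rat_dist p q) \<boxplus> val (rat_dist p q)"
    by (rule val_leI) (simp add: val_ac)
  then show ?thesis
    by (simp only: vals.zero_le_double_add_iff_zero_le_single_add)
qed

lemma nonneg_code_iff: "q \<in> fst nonneg_reals \<longleftrightarrow> rat q \<and> \<zero>\<^sub>v \<sqsubseteq> val q"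
  using val_le_iff[of rat_zero q] by (auto simp: nonneg_reals_def)

lemma snd_nonneg_reals: "snd nonneg_reals p q = real_of (rat_dist p q)"
  by (simp add: nonneg_reals_def)

lemma dist_graph_eq: "{\<langle>\<langle>\<langle>a, b\<rangle>, k\<rangle>, d a b k\<rangle> | a b k. a \<in> A \<and> b \<in> A} =
  {z. z = \<langle>\<langle>\<langle>p1 (p1 (p1 z)), p2 (p1 (p1 z))\<rangle>, p2 (p1 z)\<rangle>, d (p1 (p1 (p1 z))) (p2 (p1 (p1 z))) (p2 (p1 z))\<rangle> \<and>
      p1 (p1 (p1 z)) \<in> A \<and> p2 (p1 (p1 z)) \<in> A}"
  by (rule set_eqI, unfold mem_Collect_eq) (metis p1_pair p2_pair)

lemma metric_code_nonneg_reals: "metric_code nonneg_reals"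
proof -
  define A d where "A = fst nonneg_reals" and "d = snd nonneg_reals"
  have A: "A \<in> Sets"
    unfolding A_def nonneg_reals_def fst_conv by (intro comprehension definable)
  have d: "d = (\<lambda>p q k. rat_dist p q)"
    by (simp add: d_def nonneg_reals_def real_of_def)
  have rat: "rat p" if "p \<in> A" for p
    using that by (simp add: A_def nonneg_code_iff)
  have "{\<langle>\<langle>\<langle>a, b\<rangle>, k\<rangle>, d a b k\<rangle> | a b k. a \<in> A \<and> b \<in> A} \<in> Sets"
    unfolding dist_graph_eq d by (intro comprehension definable A)
  moreover have "rat_zero \<in> A"
    by (simp add: A_def nonneg_code_iff)
  moreover have "real_num (d a b)" if "a \<in> A" "b \<in> A" for a b
    using real_of_real_num[of "rat_dist a b"] rat that by (simp add: d real_of_def)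
  moreover have le: "real_le (d a b) (real_of p)" if "val (rat_dist a b) \<sqsubseteq> val p" "a \<in> A" "b \<in> A" "rat p" for a b p
    using real_le_real_of[of "rat_dist a b" p] that rat by (simp add: d real_of_def)
  moreover have ge: "real_le (real_of p) (d a b)" if "val p \<sqsubseteq> val (rat_dist a b)" "a \<in> A" "b \<in> A" "rat p" for a b p
    using real_le_real_of[of p "rat_dist a b"] that rat by (simp add: d real_of_def)
  have zero: "real_eq (d a a) (real_of rat_zero)" if "a \<in> A" for a
  proof -
    have "val (rat_dist a a) \<sqsubseteq> val rat_zero"
      using rat[OF that] by (simp add: val_rat_dist_le_iff)
    moreover have "val rat_zero \<sqsubseteq> val (rat_dist a a)"
      using rat[OF that] by (simp add: val_rat_dist_nonneg)
    ultimately show ?thesis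
      unfolding real_eq_def using le ge that by simp
  qed
  have sym: "real_eq (d a b) (d b a) \<and> real_le (real_of rat_zero) (d a b)" if ab: "a \<in> A" "b \<in> A" for a b
  proof -
    have "val (rat_dist p q) \<sqsubseteq> val (rat_dist q p)" if "rat p" "rat q" for p q
      using that val_rat_dist_le_iff[of p q] val_rat_dist_le_iff[of q p] vals.order_refl by blast
    then have "real_le (d a b) (d b a)" "real_le (d b a) (d a b)"
      using le[of a b "rat_dist b a"] le[of b a "rat_dist a b"] ab rat by (simp_all add: d real_of_def)
    moreover have "real_le (real_of rat_zero) (d a b)"
      using ab rat by (intro ge) (simp_all add: val_rat_dist_nonneg)
    ultimately show ?thesis
      by (simp add: real_eq_def)
  qed
  have triangle: "real_le (d a c) (real_add (d a b) (d b c))" if abc: "a \<in> A" "b \<in> A" "c \<in> A" for a b c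
  proof -
    note r = rat[OF abc(1)] rat[OF abc(2)] rat[OF abc(3)]
    have 1: "val a \<sqsubseteq> val b \<boxplus> val (rat_dist a b)" "val b \<sqsubseteq> val a \<boxplus> val (rat_dist a b)"
      "val b \<sqsubseteq> val c \<boxplus> val (rat_dist b c)" "val c \<sqsubseteq> val b \<boxplus> val (rat_dist b c)"
      using val_rat_dist_le_iff r vals.order_refl by blast+
    have "val (rat_dist a c) \<sqsubseteq> val (rat_dist a b) \<boxplus> val (rat_dist b c)"
      unfolding val_rat_dist_le_iff[OF r(1,3)]
    proof
      show "val a \<sqsubseteq> val c \<boxplus> (val (rat_dist a b) \<boxplus> val (rat_dist b c))"
        by (rule val_leI[OF vals.add_mono[OF 1(1) 1(3)]]) (simp add: val_ac)
      show "val c \<sqsubseteq> val a \<boxplus> (val (rat_dist a b) \<boxplus> val (rat_dist b c))"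
        by (rule val_leI[OF vals.add_mono[OF 1(2) 1(4)]]) (simp add: val_ac)
    qed
    then have "real_le (d a c) (real_of (rat_add (rat_dist a b) (rat_dist b c)))"
      using abc r by (intro le) (simp_all add: val_rat_add)
    then show ?thesis
      by (simp add: d real_of_def real_add_def)
  qed
  have "metric_code (A, d)"
    unfolding metric_code_def using A calculation zero sym triangle by auto
  then show ?thesis
    by (simp add: A_def d_def)
qed

sublocale nonneg: metric M nonneg_reals
  by unfold_locales (rule metric_code_nonneg_reals)

lemma nonneg_dval: "nonneg.dval p q k = val (rat_dist p q)"
  by (simp add: nonneg.dval_def snd_nonneg_reals real_of_def)

lemma nonneg_balls_disjoint:
  assumes b: "b \<in> fst nonneg_reals" "b' \<in> fst nonneg_reals" and s: "rat s" "rat s'"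
    and le: "val b \<boxplus> val s \<boxplus> val s' \<sqsubseteq> val b'"
  shows "ball nonneg_reals b s \<inter> ball nonneg_reals b' s' = {}"
proof -
  have False if "v \<in> ball nonneg_reals b s" "v \<in> ball nonneg_reals b' s'" for v
  proof -
    have v: "point nonneg_reals v" "nonneg.dless v (\<lambda>_. b) (val s)" "nonneg.dless v (\<lambda>_. b') (val s')"
      using that nonneg.ball_iff b s by auto
    then obtain e e' where e: "\<zero>\<^sub>v \<sqsubset> e" "evt (\<lambda>n. val (rat_dist (v n) b) \<boxplus> e \<sqsubseteq> val s)"
      and e': "\<zero>\<^sub>v \<sqsubset> e'" "evt (\<lambda>n. val (rat_dist (v n) b') \<boxplus> e' \<sqsubseteq> val s')"
      unfolding nonneg.dless_def nonneg_dval by blast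
    from evt_happens[OF evt_conj[OF e(2) e'(2)]]
    obtain n where n: "val (rat_dist (v n) b) \<boxplus> e \<sqsubseteq> val s" "val (rat_dist (v n) b') \<boxplus> e' \<sqsubseteq> val s'"
      by blast
    have r: "rat (v n)" "rat b" "rat b'"
      using nonneg.point_code[OF v(1)] b by (auto simp: nonneg_code_iff)
    have 1: "val (v n) \<sqsubseteq> val b \<boxplus> val (rat_dist (v n) b)"
      using val_rat_dist_le_iff r vals.order_refl by blast
    have 2: "val b' \<sqsubseteq> val (v n) \<boxplus> val (rat_dist (v n) b')"
      using val_rat_dist_le_iff r vals.order_refl by blast
    have "e \<boxplus> e' \<sqsubseteq> \<zero>\<^sub>v"
      by (rule val_leI[OF vals.add_mono[OF 1 vals.add_mono[OF 2 vals.add_mono[OF n(1) vals.add_mono[OF n(2) le]]]]])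
        (simp add: val_ac)
    then show False
      using vals.add_pos_pos[OF e(1) e'(1)] by (simp add: vals.not_le[symmetric])
  qed
  then show ?thesis by blast
qed

text \<open>The last condition places the second ball above the first one. Unlike disjointness of
  the balls, which speaks about all points, it is decidable in the codes and can be used in a
  \<Sigma>1 definition.\<close>

lemma nonneg_separating_balls:
  assumes v: "point nonneg_reals v" and w: "point nonneg_reals w" and "\<not> real_le v w"
  obtains b s b' s' where "b \<in> fst nonneg_reals" "pos_rat s" "w \<in> ball nonneg_reals b s"
    "b' \<in> fst nonneg_reals" "pos_rat s'" "v \<in> ball nonneg_reals b' s'"
    "\<not> rat_le b' (rat_add (rat_add b s) s')"
proof -
  have r: "rat (v k)" "rat (w k)" for k
    using nonneg.point_code v w by (auto simp: nonneg_code_iff)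
  obtain k where k: "val (w k) \<boxplus> (hp k \<boxplus> hp k) \<sqsubset> val (v k)"
    using assms(3) r by (auto simp: real_le_iff vals.not_le)
  then have "\<zero>\<^sub>v \<sqsubset> val (v k) \<boxminus> (val (w k) \<boxplus> (hp k \<boxplus> hp k))"
    by (simp only: vals.diff_gt_0_iff_gt)
  then obtain e where e: "\<zero>\<^sub>v \<sqsubset> e" "e \<boxplus> e \<sqsubset> val (v k) \<boxminus> (val (w k) \<boxplus> (hp k \<boxplus> hp k))"
    using ex_half by blast
  then have less: "e \<boxplus> e \<boxplus> (val (w k) \<boxplus> (hp k \<boxplus> hp k)) \<sqsubset> val (v k)"
    by (simp only: vals.less_diff_eq)
  obtain q where q: "rat q" "e = val q" by (rule val_cases)
  \<comment> \<open>A radius beyond \<open>hp k\<close> suffices for the balls around the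
    \<open>k\<close>-th approximations to contain the reals; the excess \<open>e\<close> is so small
    that a gap between the balls remains.\<close>
  define s where "s = rat_add (half_pow k) q"
  have s: "rat s" "val s = hp k \<boxplus> e"
    using q by (simp_all add: s_def val_rat_add hp_def)
  have sp: "pos_rat s"
    using s e(1) by (simp add: pos_rat_iff vals.add_pos_pos)
  have hs: "hp k \<sqsubset> val s"
    using e(1) by (simp add: s)
  have "v \<in> ball nonneg_reals (v k) s" "w \<in> ball nonneg_reals (w k) s"
    using v w s(1) nonneg.point_code nonneg.dless_approx[OF _ hs] by (auto simp: nonneg.ball_iff)
  moreover have "\<not> rat_le (v k) (rat_add (rat_add (w k) s) s)"
  proof -
    have "val (rat_add (rat_add (w k) s) s) \<sqsubset> val (v k)"
      using r s less by (simp add: val_rat_add val_ac)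
    then show ?thesis
      using r s by (simp add: vals.not_le[symmetric] val_le_iff)
  qed
  ultimately show ?thesis
    using that[of "w k" s "v k" s] sp nonneg.point_code v w by blast
qed

text \<open>Restricting to numbers below \<open>B\<close> keeps the induction formula \<Delta>1. The
  minimum is compared with the one new candidate in each step.\<close>

lemma ex_minimal:
  assumes P: "Delta1 (\<lambda>e. P (e 0))" and K: "def_fun (\<lambda>e. K (e 0))" and rat: "\<And>v. P v \<Longrightarrow> rat (K v)"
    and "u \<prec> B" "P u"
  shows "\<exists>v. v \<prec> B \<and> P v \<and> (\<forall>w. w \<prec> B \<longrightarrow> P w \<longrightarrow> rat_le (K v) (K w))"
proof -
  have P': "Delta1 (\<lambda>e. P (t e))" if "def_fun t" for t
    using Delta1_subst2[of "\<lambda>x y. P x", OF P that that] .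
  have K': "def_fun (\<lambda>e. K (t e))" if "def_fun t" for t
    using def_fun_subst1[OF K that] .
  have "(\<exists>u. u \<prec> B \<and> P u) \<longrightarrow> (\<exists>v. v \<prec> B \<and> P v \<and> (\<forall>w. w \<prec> B \<longrightarrow> P w \<longrightarrow> rat_le (K v) (K w)))" for B
  proof (rule Delta1_induct[where P = "\<lambda>B. (\<exists>u. u \<prec> B \<and> P u) \<longrightarrow>
      (\<exists>v. v \<prec> B \<and> P v \<and> (\<forall>w. w \<prec> B \<longrightarrow> P w \<longrightarrow> rat_le (K v) (K w)))"])
    fix B assume IH: "(\<exists>u. u \<prec> B \<and> P u) \<longrightarrow> (\<exists>v. v \<prec> B \<and> P v \<and> (\<forall>w. w \<prec> B \<longrightarrow> P w \<longrightarrow> rat_le (K v) (K w)))"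
    show "(\<exists>u. u \<prec> B \<oplus> \<one> \<and> P u) \<longrightarrow>
      (\<exists>v. v \<prec> B \<oplus> \<one> \<and> P v \<and> (\<forall>w. w \<prec> B \<oplus> \<one> \<longrightarrow> P w \<longrightarrow> rat_le (K v) (K w)))"
    proof
      assume ex: "\<exists>u. u \<prec> B \<oplus> \<one> \<and> P u"
      consider "P B" "\<not> (\<exists>u. u \<prec> B \<and> P u)" | "\<not> P B" "\<exists>u. u \<prec> B \<and> P u" | "P B" "\<exists>u. u \<prec> B \<and> P u"
        using ex unfolding less_succ by blast
      then show "\<exists>v. v \<prec> B \<oplus> \<one> \<and> P v \<and> (\<forall>w. w \<prec> B \<oplus> \<one> \<longrightarrow> P w \<longrightarrow> rat_le (K v) (K w))"
      proof cases
        case 1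
        then show ?thesis
          unfolding less_succ using rat_le_refl by blast
      next
        case 2
        then show ?thesis
          unfolding less_succ using IH by blast
      next
        case 3
        then obtain v where v: "v \<prec> B" "P v" "\<forall>w. w \<prec> B \<longrightarrow> P w \<longrightarrow> rat_le (K v) (K w)"
          using IH by blast
        show ?thesis
        proof (cases "rat_le (K v) (K B)")
          case True
          then show ?thesis
            unfolding less_succ using v by blast
        next
          case False
          then have "rat_le (K B) (K v)"
            using rat_le_linear rat v(2) 3(1) by blast
          then have "rat_le (K B) (K w)" if "w \<prec> B" "P w" for w
            using rat_le_trans[OF rat[OF 3(1)] rat[OF v(2)] rat[OF that(2)]] v(3) that by blast
          then show ?thesis
            unfolding less_succ using 3(1) rat_le_refl by blast
        qed
      qed
    qed
  qed (intro definable P' K', simp)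
  then show ?thesis using assms(4,5) by blast
qed

end

section \<open>Minima of continuous functions and fixed points\<close>

context metric
begin

lemma same_pointI:
  assumes x: "point X x" and y: "point X y"
    and le: "\<And>k. dval (x (k \<oplus> \<one> \<oplus> \<one>)) (y (k \<oplus> \<one> \<oplus> \<one>)) (k \<oplus> \<one> \<oplus> \<one>) \<sqsubseteq> four (hp k)"
  shows "same_point X x y"
  unfolding same_point_iff[OF x y]
proof (intro allI impI)
  fix q assume "\<zero>\<^sub>v \<sqsubset> q"
  then obtain e where e: "\<zero>\<^sub>v \<sqsubset> e" "e \<boxplus> e \<sqsubset> q"
    using ex_half by blast
  have "evt (\<lambda>n. dval (x n) (y n) n \<boxplus> e \<sqsubseteq> q)"
    using evt_conj[OF evt_small[OF e(1)] evt_ge[of "\<one> \<oplus> \<one>"]]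
  proof (rule evt_mono)
    fix n assume n: "four (four (hp n)) \<sqsubset> e \<and> \<one> \<oplus> \<one> \<preceq>\<preceq> n"
    then obtain k where k: "n = k \<oplus> \<one> \<oplus> \<one>"
      by (auto simp: num_le_iff num_ac)
    have 1: "dval (x n) (y n) n \<sqsubseteq> four (four (hp n))"
      using le[of k] unfolding k four_hp .
    show "dval (x n) (y n) n \<boxplus> e \<sqsubseteq> q"
      by (rule val_leI[OF vals.add_mono[OF 1 vals.add_mono[OF vals.less_imp_le[OF conjunct1[OF n]] vals.less_imp_le[OF e(2)]]]])
        (simp add: val_ac)
  qed
  then show "dless x y q"
    unfolding dless_def using e(1) by blast
qed

lemma compactE:
  assumes "compact_space X"
  obtains n x where "compact_metric M X n x"
proof -
  obtain n x where nx: "fn_on UNIV n" "{\<langle>\<langle>\<langle>i, j\<rangle>, k\<rangle>, x i j k\<rangle> | i j k. i \<preceq> n j} \<in> Sets"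
    "\<And>i j. i \<preceq> n j \<Longrightarrow> point X (x i j)"
    "\<And>z j. point X z \<Longrightarrow> \<exists>i. i \<preceq> n j \<and> real_less (distance X (x i j) z) (real_of (half_pow j))"
    using assms unfolding compact_space_def by blast
  have "compact_metric M X n x"
  proof unfold_locales
    show "\<exists>i. i \<preceq>\<preceq> n j \<and> dless (x i j) z (hp j)" if z: "point X z" for z j
    proof -
      obtain i where i: "i \<preceq> n j" "real_less (distance X (x i j) z) (real_of (half_pow j))"
        using nx(4)[OF z] by blast
      then have "dless (x i j) z (val (half_pow j))"
        using dless_iff[OF nx(3) z] rat_half_pow by blast
      then show ?thesis
        using i(1) unfolding hp_def num_le_def by blast
    qed
  qed (use nx in \<open>auto simp: num_le_def\<close>)
  then show ?thesis by (rule that)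
qed

text \<open>Minima: if every point had a neighbourhood on which \<open>V\<close> exceeds some value \<open>V(a)\<close>, \<open>a \<in> A\<close>,
  then finitely many such values would do, and \<open>V\<close> would exceed the least of them at that very \<open>a\<close>.\<close>

lemma continuous_minimum:
  assumes separation and compact: "compact_space X" and code: "continuous_code X nonneg_reals \<Phi>"
  obtains z where "point X z" "\<And>y v w. continuous_value X nonneg_reals \<Phi> z v \<Longrightarrow>
    continuous_value X nonneg_reals \<Phi> y w \<Longrightarrow> real_le v w"
proof -
  obtain n x where "compact_metric M X n x"
    using compactE[OF compact] .
  then interpret compact_metric M X n x .
  define P where "P b s = open_set X (sect \<Phi> \<langle>b, s\<rangle>)" for b s
  have \<Phi>: "\<Phi> \<in> Sets" and disjoint: "\<And>b s b' s'. b \<in> fst nonneg_reals \<Longrightarrow> pos_rat s \<Longrightarrow>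
      b' \<in> fst nonneg_reals \<Longrightarrow> pos_rat s' \<Longrightarrow> ball nonneg_reals b s \<inter> ball nonneg_reals b' s' = {} \<Longrightarrow> P b s \<inter> P b' s' = {}"
    and open_code: "\<And>b s. b \<in> fst nonneg_reals \<Longrightarrow> pos_rat s \<Longrightarrow> open_code X (sect \<Phi> \<langle>b, s\<rangle>)"
    using code unfolding continuous_code_def preimage_conditions_def P_def by blast+
  have code_ball: "c \<in> A \<and> pos_rat t" if "b \<in> fst nonneg_reals" "pos_rat s" "\<langle>\<langle>b, s\<rangle>, \<langle>m, \<langle>c, t\<rangle>\<rangle>\<rangle> \<in> \<Phi>" for b s m c t
    using open_code[OF that(1,2)] that(3) unfolding open_code_def sect_def by fastforce
  have P_iff: "y \<in> P b s \<longleftrightarrow> (\<exists>m c t. \<langle>\<langle>b, s\<rangle>, \<langle>m, \<langle>c, t\<rangle>\<rangle>\<rangle> \<in> \<Phi> \<and> y \<in> ball X c t)" for y b s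
    unfolding P_def open_set_def sect_def by simp
  \<comment> \<open>The number \<open>w\<close> codes balls \<open>(c, t)\<close>,
    \<open>(b, s)\<close>, \<open>(b', s')\<close> and an element \<open>a\<close>. The ball
    \<open>(c, t)\<close> is listed in the preimage of \<open>(b', s')\<close>, the interval
    \<open>(b', s')\<close> lies above \<open>(b, s)\<close>, and \<open>a\<close> belongs to the
    preimage of \<open>(b, s)\<close>. So \<open>V\<close> exceeds \<open>V(a)\<close> on
    \<open>(c, t)\<close>.\<close>
  define T where "T w \<longleftrightarrow> (\<exists>m m' c' t' k.
      p1 (p1 (p2 w)) \<in> fst nonneg_reals \<and> pos_rat (p2 (p1 (p2 w))) \<and>
      p1 (p1 (p2 (p2 w))) \<in> fst nonneg_reals \<and> pos_rat (p2 (p1 (p2 (p2 w)))) \<and>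
      \<not> rat_le (p1 (p1 (p2 (p2 w)))) (rat_add (rat_add (p1 (p1 (p2 w))) (p2 (p1 (p2 w)))) (p2 (p1 (p2 (p2 w))))) \<and>
      \<langle>\<langle>p1 (p1 (p2 (p2 w))), p2 (p1 (p2 (p2 w)))\<rangle>, \<langle>m, p1 w\<rangle>\<rangle> \<in> \<Phi> \<and>
      p2 (p2 (p2 w)) \<in> A \<and> \<langle>\<langle>p1 (p1 (p2 w)), p2 (p1 (p2 w))\<rangle>, \<langle>m', \<langle>c', t'\<rangle>\<rangle>\<rangle> \<in> \<Phi> \<and>
      near_at (\<lambda>_. p2 (p2 (p2 w))) (\<lambda>_. c') t' k)" for w
  have T_iff: "T \<langle>\<langle>c, t\<rangle>, \<langle>\<langle>b, s\<rangle>, \<langle>\<langle>b', s'\<rangle>, a\<rangle>\<rangle>\<rangle> \<longleftrightarrow>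
    b \<in> fst nonneg_reals \<and> pos_rat s \<and> b' \<in> fst nonneg_reals \<and> pos_rat s' \<and> \<not> rat_le b' (rat_add (rat_add b s) s') \<and>
    (\<exists>m. \<langle>\<langle>b', s'\<rangle>, \<langle>m, \<langle>c, t\<rangle>\<rangle>\<rangle> \<in> \<Phi>) \<and> a \<in> A \<and> (\<lambda>_. a) \<in> P b s" for c t b s b' s' a
  proof -
    have "(\<lambda>_. a) \<in> ball X c' t' \<longleftrightarrow> (\<exists>k. near_at (\<lambda>_. a) (\<lambda>_. c') t' k)"
      if "b \<in> fst nonneg_reals" "pos_rat s" "\<langle>\<langle>b, s\<rangle>, \<langle>m', \<langle>c', t'\<rangle>\<rangle>\<rangle> \<in> \<Phi>" "a \<in> A" for m' c' t'
      using code_ball[OF that(1-3)] that(4) const_point dless_code[of "\<lambda>_. a" "\<lambda>_. c'" t'] ball_iff[of c' t' "\<lambda>_. a"]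
      by (simp add: pos_rat_def)
    then show ?thesis
      unfolding T_def p1_pair p2_pair P_iff by blast
  qed
  have TS: "Sigma1 (\<lambda>e. T (e 0))"
    unfolding T_def by (intro Sigma1_ex Delta1_Sigma1 definable \<Phi> codes_in_Sets nonneg.codes_in_Sets)
  obtain R where R: "R \<in> Sets" "\<And>w. T w \<longleftrightarrow> (\<exists>m. \<langle>w, m\<rangle> \<in> R)"
    using Sigma1_witnesses[OF TS] by blast
  \<comment> \<open>Passing from \<open>T\<close> to its witnesses in \<open>R\<close> makes the
    family decidable in the numbers \<open>\<langle>w, m\<rangle>\<close>, among which a minimum can
    be sought below a bound.\<close>
  define Bad where "Bad c t \<longleftrightarrow> (\<exists>r m. \<langle>\<langle>\<langle>c, t\<rangle>, \<langle>\<langle>p1 (p1 r), p2 (p1 r)\<rangle>, \<langle>\<langle>p1 (p1 (p2 r)), p2 (p1 (p2 r))\<rangle>, p2 (p2 r)\<rangle>\<rangle>\<rangle>, m\<rangle> \<in> R)" for c t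
  have Bad_iff: "Bad c t \<longleftrightarrow> (\<exists>b s b' s' a. T \<langle>\<langle>c, t\<rangle>, \<langle>\<langle>b, s\<rangle>, \<langle>\<langle>b', s'\<rangle>, a\<rangle>\<rangle>\<rangle>)" for c t
    unfolding Bad_def R(2) by (metis p1_pair p2_pair)
  interpret noncovering M X n x Bad
  proof unfold_locales
    show "Sigma1 (\<lambda>e. Bad (e 0) (e (Suc 0)))"
      unfolding Bad_def by (intro Sigma1_ex Delta1_Sigma1 definable R)
    show "c \<in> A \<and> rat t" if "Bad c t" for c t
      using that code_ball unfolding Bad_iff T_iff pos_rat_def by blast
  qed
  have "\<exists>i. i \<preceq>\<preceq> n J \<and> \<not> caught i J" for J
  proof (rule ccontr)
    assume "\<not> ?thesis"
    then have all: "caught i J" if "i \<preceq>\<preceq> n J" for i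
      using that by blast
    define Q where "Q v \<longleftrightarrow> (\<exists>c t b s b' s' a m. v = \<langle>\<langle>\<langle>c, t\<rangle>, \<langle>\<langle>b, s\<rangle>, \<langle>\<langle>b', s'\<rangle>, a\<rangle>\<rangle>\<rangle>, m\<rangle> \<and> v \<in> R)" for v
    have Q_iff: "Q v \<longleftrightarrow> v \<in> R \<and> v = \<langle>\<langle>\<langle>p1 (p1 (p1 v)), p2 (p1 (p1 v))\<rangle>, \<langle>\<langle>p1 (p1 (p2 (p1 v))), p2 (p1 (p2 (p1 v)))\<rangle>,
        \<langle>\<langle>p1 (p1 (p2 (p2 (p1 v)))), p2 (p1 (p2 (p2 (p1 v))))\<rangle>, p2 (p2 (p2 (p1 v)))\<rangle>\<rangle>\<rangle>, p2 v\<rangle>" for v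
      unfolding Q_def by (metis p1_pair p2_pair)
    have QD: "Delta1 (\<lambda>e. Q (e 0))"
      unfolding Q_iff by (intro definable R)
    \<comment> \<open>The upper end of the interval \<open>(b, s)\<close>, which exceeds
      \<open>V(a)\<close>; rational numbers replace the values \<open>V(a)\<close> in the search for
      the least one.\<close>
    define K where "K v = rat_add (p1 (p1 (p2 (p1 v)))) (p2 (p1 (p2 (p1 v))))" for v
    have KD: "def_fun (\<lambda>e. K (e 0))"
      unfolding K_def by (intro definable)
    define S where "S i v \<longleftrightarrow> (\<exists>k. Q v \<and> near_at (xx i J) (\<lambda>_. p1 (p1 (p1 v)))
        (rat_add (p2 (p1 (p1 v))) (rat_minus (two J))) k)" for i v
    have "Sigma1 (\<lambda>e. S (e 0) (e (Suc 0)))"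
      unfolding S_def Q_iff by (intro Sigma1_ex Delta1_Sigma1 definable R)
    moreover have "\<exists>v. S i v" if i: "i \<prec> n J \<oplus> \<one>" for i
    proof -
      obtain c t k where ct: "Bad c t" "near_at (xx i J) (\<lambda>_. c) (rat_add t (rat_minus (two J))) k"
        using all i unfolding caught_def less_succ_iff_le by blast
      then obtain b s b' s' a m where "\<langle>\<langle>\<langle>c, t\<rangle>, \<langle>\<langle>b, s\<rangle>, \<langle>\<langle>b', s'\<rangle>, a\<rangle>\<rangle>\<rangle>, m\<rangle> \<in> R"
        unfolding Bad_iff R(2) by blast
      then have "S i \<langle>\<langle>\<langle>c, t\<rangle>, \<langle>\<langle>b, s\<rangle>, \<langle>\<langle>b', s'\<rangle>, a\<rangle>\<rangle>\<rangle>, m\<rangle>"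
        unfolding S_def Q_def p1_pair p2_pair using ct(2) by blast
      then show ?thesis ..
    qed
    ultimately obtain B where B: "\<forall>i. i \<prec> n J \<oplus> \<one> \<longrightarrow> (\<exists>v. v \<prec> B \<and> S i v)"
      using Sigma1_bounding[of S] by blast
    have ratK: "rat (K v)" if "Q v" for v
    proof -
      from that obtain c t b s b' s' a m where v: "v = \<langle>\<langle>\<langle>c, t\<rangle>, \<langle>\<langle>b, s\<rangle>, \<langle>\<langle>b', s'\<rangle>, a\<rangle>\<rangle>\<rangle>, m\<rangle>" "v \<in> R"
        unfolding Q_def by blast
      then have "T \<langle>\<langle>c, t\<rangle>, \<langle>\<langle>b, s\<rangle>, \<langle>\<langle>b', s'\<rangle>, a\<rangle>\<rangle>\<rangle>"
        using R(2) by blast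
      then show ?thesis
        unfolding T_iff by (simp add: K_def v(1) nonneg_code_iff pos_rat_def)
    qed
    have "\<zero> \<prec> n J \<oplus> \<one>"
      by (simp add: less_succ_iff_le)
    then obtain u where "u \<prec> B" "Q u"
      using B unfolding S_def by blast
    from ex_minimal[of Q K, OF QD KD ratK this] obtain v where v: "v \<prec> B" "Q v"
      "\<And>w. w \<prec> B \<Longrightarrow> Q w \<Longrightarrow> rat_le (K v) (K w)" by blast
    obtain c t b s b' s' a m where v_eq: "v = \<langle>\<langle>\<langle>c, t\<rangle>, \<langle>\<langle>b, s\<rangle>, \<langle>\<langle>b', s'\<rangle>, a\<rangle>\<rangle>\<rangle>, m\<rangle>" "v \<in> R"
      using v(2) unfolding Q_def by blast
    then have "T \<langle>\<langle>c, t\<rangle>, \<langle>\<langle>b, s\<rangle>, \<langle>\<langle>b', s'\<rangle>, a\<rangle>\<rangle>\<rangle>"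
      using R(2) by blast
    then have b: "b \<in> fst nonneg_reals" "pos_rat s" and a: "a \<in> A" "(\<lambda>_. a) \<in> P b s"
      unfolding T_iff by auto
    \<comment> \<open>The element \<open>a\<close> that belongs to the least upper end is close to a
      net point, which is caught through some \<open>w\<close> below \<open>B\<close>. The room in
      \<open>caught\<close> puts \<open>a\<close> itself into the ball of \<open>w\<close>, where
      \<open>V\<close> lies above \<open>K w\<close> and hence above \<open>K v\<close>; but
      \<open>V(a)\<close> lies below \<open>K v\<close>.\<close>
    obtain i where i: "i \<preceq>\<preceq> n J" "dless (xx i J) (\<lambda>_. a) (hp J)"
      using xx_net[OF const_point[OF a(1)]] by blast
    then obtain w k where w: "w \<prec> B" "Q w" "near_at (xx i J) (\<lambda>_. p1 (p1 (p1 w)))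
        (rat_add (p2 (p1 (p1 w))) (rat_minus (two J))) k"
      using B unfolding less_succ_iff_le S_def by blast
    obtain c1 t1 b1 s1 b1' s1' a1 m1 where w_eq: "w = \<langle>\<langle>\<langle>c1, t1\<rangle>, \<langle>\<langle>b1, s1\<rangle>, \<langle>\<langle>b1', s1'\<rangle>, a1\<rangle>\<rangle>\<rangle>, m1\<rangle>" "w \<in> R"
      using w(2) unfolding Q_def by blast
    then have "T \<langle>\<langle>c1, t1\<rangle>, \<langle>\<langle>b1, s1\<rangle>, \<langle>\<langle>b1', s1'\<rangle>, a1\<rangle>\<rangle>\<rangle>"
      using R(2) by blast
    then obtain m' where b1: "b1 \<in> fst nonneg_reals" "pos_rat s1" "b1' \<in> fst nonneg_reals" "pos_rat s1'"
      "\<not> rat_le b1' (rat_add (rat_add b1 s1) s1')" "\<langle>\<langle>b1', s1'\<rangle>, \<langle>m', \<langle>c1, t1\<rangle>\<rangle>\<rangle> \<in> \<Phi>"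
      unfolding T_iff by blast
    have c1: "c1 \<in> A" "pos_rat t1"
      using code_ball[OF b1(3,4,6)] by auto
    have "dless (xx i J) (\<lambda>_. c1) (val (rat_add t1 (rat_minus (two J))))"
      using w(3) c1 dless_code[OF xx_point[OF i(1)] const_point[OF c1(1)], of "rat_add t1 (rat_minus (two J))"]
      unfolding w_eq(1) p1_pair p2_pair by (auto simp: pos_rat_def)
    from dless_triangle[OF const_point[OF a(1)] xx_point[OF i(1)] const_point[OF c1(1)]
        dless_sym[OF xx_point[OF i(1)] const_point[OF a(1)] i(2)] this]
    have "dless (\<lambda>_. a) (\<lambda>_. c1) (hp J \<boxplus> val (rat_add t1 (rat_minus (two J))))" .
    moreover have "hp J \<boxplus> val (rat_add t1 (rat_minus (two J))) \<sqsubseteq> val t1"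
    proof -
      define d where "d = val (rat_add t1 (rat_minus (two J)))"
      have "d = val t1 \<boxminus> (hp J \<boxplus> hp J)"
        using c1(2) unfolding d_def pos_rat_def
        by (simp only: val_rat_add val_rat_minus rat_rat_minus rat_two val_two val_minus_def)
      then have t1: "val t1 = d \<boxplus> (hp J \<boxplus> hp J)"
        by (simp only: vals.diff_add_cancel)
      show ?thesis
        unfolding d_def[symmetric] unfolding t1 by (rule val_leI[OF hp_nonneg[of J]]) (simp add: val_ac)
    qed
    ultimately have "(\<lambda>_. a) \<in> ball X c1 t1"
      using c1 a(1) const_point dless_mono by (auto simp: ball_iff pos_rat_def)
    then have "(\<lambda>_. a) \<in> P b1' s1'"
      unfolding P_iff using b1(6) by blast
    moreover have "ball nonneg_reals b s \<inter> ball nonneg_reals b1' s1' = {}"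
    proof (rule nonneg_balls_disjoint)
      have r: "rat b" "rat s" "rat b1" "rat s1" "rat s1'" "rat b1'"
        using b b1 by (auto simp: nonneg_code_iff pos_rat_def)
      have 1: "val b \<boxplus> val s \<sqsubseteq> val b1 \<boxplus> val s1"
        using v(3)[OF w(1,2)] r unfolding K_def v_eq w_eq p1_pair p2_pair
        by (simp flip: val_le_iff val_rat_add)
      have "val b1 \<boxplus> val s1 \<boxplus> val s1' \<sqsubset> val b1'"
        using b1(5) r val_le_iff[of b1' "rat_add (rat_add b1 s1) s1'"]
        by (simp add: val_rat_add vals.not_le)
      from vals.add_mono[OF 1 vals.less_imp_le[OF this]]
      show "val b \<boxplus> val s \<boxplus> val s1' \<sqsubseteq> val b1'"
        by (rule val_leI) (simp add: val_ac)
    qed (use b b1 in \<open>auto simp: pos_rat_def\<close>)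
    ultimately show False
      using disjoint[OF b b1(3,4)] a(2) by blast
  qed
  then obtain z where z: "point X z" "\<And>c t. Bad c t \<Longrightarrow> \<not> dless z (\<lambda>_. c) (val t)"
    using ex_uncaught_point[OF assms(1)] by blast
  show ?thesis
  proof (rule that[OF z(1)], rule ccontr)
    fix y v w assume zv: "continuous_value X nonneg_reals \<Phi> z v" and yw: "continuous_value X nonneg_reals \<Phi> y w"
      and nle: "\<not> real_le v w"
    have v: "point nonneg_reals v" "\<And>b s. b \<in> fst nonneg_reals \<Longrightarrow> pos_rat s \<Longrightarrow> v \<in> ball nonneg_reals b s \<Longrightarrow> z \<in> P b s"
      and w: "point X y" "point nonneg_reals w" "\<And>b s. b \<in> fst nonneg_reals \<Longrightarrow> pos_rat s \<Longrightarrow> w \<in> ball nonneg_reals b s \<Longrightarrow> y \<in> P b s"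
      using zv yw unfolding continuous_value_def value_at_def P_def Let_def by blast+
    obtain b s b' s' where b: "b \<in> fst nonneg_reals" "pos_rat s" "w \<in> ball nonneg_reals b s"
      "b' \<in> fst nonneg_reals" "pos_rat s'" "v \<in> ball nonneg_reals b' s'" "\<not> rat_le b' (rat_add (rat_add b s) s')"
      using nonneg_separating_balls[OF v(1) w(2) nle] by blast
    obtain m c t where c: "\<langle>\<langle>b', s'\<rangle>, \<langle>m, \<langle>c, t\<rangle>\<rangle>\<rangle> \<in> \<Phi>" "z \<in> ball X c t"
      using v(2)[OF b(4-6)] unfolding P_iff by blast
    obtain m' c' t' where c': "\<langle>\<langle>b, s\<rangle>, \<langle>m', \<langle>c', t'\<rangle>\<rangle>\<rangle> \<in> \<Phi>" "y \<in> ball X c' t'"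
      using w(3)[OF b(1-3)] unfolding P_iff by blast
    have cA: "c \<in> A" "pos_rat t" "c' \<in> A" "pos_rat t'"
      using code_ball[OF b(1,2) c'(1)] code_ball[OF b(4,5) c(1)] by auto
    then have "dless y (\<lambda>_. c') (val t')"
      using c'(2) by (simp add: ball_iff pos_rat_def)
    then obtain e where e: "\<zero>\<^sub>v \<sqsubset> e" "\<And>p. val t' \<sqsubseteq> p \<boxplus> e \<Longrightarrow> dless y (\<lambda>_. c') p"
      using dless_dense by blast
    then obtain i where i: "hp i \<sqsubset> e"
      using ex_hp_less by blast
    \<comment> \<open>The family refers to values at elements of \<open>A\<close> only. Since the
      preimage is open, \<open>y\<close> can be replaced by its approximation
      \<open>y i\<close>.\<close>
    have "dless (\<lambda>_. y i) y e"
      using dless_sym[OF w(1) const_point[OF point_code[OF w(1)]] dless_approx[OF w(1) i]] .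
    moreover have "dless y (\<lambda>_. c') (val t' \<boxminus> e)"
      using e(2) by simp
    ultimately have "dless (\<lambda>_. y i) (\<lambda>_. c') (e \<boxplus> (val t' \<boxminus> e))"
      using dless_triangle[OF const_point[OF point_code[OF w(1)]] w(1) const_point[OF cA(3)]] by blast
    then have "dless (\<lambda>_. y i) (\<lambda>_. c') (val t')"
      by (simp only: vals.add.commute[of e] vals.diff_add_cancel)
    then have "(\<lambda>_. y i) \<in> ball X c' t'"
      using cA const_point[OF point_code[OF w(1)]] by (simp add: ball_iff pos_rat_def)
    then have "(\<lambda>_. y i) \<in> P b s"
      unfolding P_iff using c'(1) by blast
    then have "T \<langle>\<langle>c, t\<rangle>, \<langle>\<langle>b, s\<rangle>, \<langle>\<langle>b', s'\<rangle>, y i\<rangle>\<rangle>\<rangle>"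
      unfolding T_iff using b c(1) point_code[OF w(1)] by blast
    then have "\<not> dless z (\<lambda>_. c) (val t)"
      using z(2) unfolding Bad_iff by blast
    then show False
      using c(2) cA by (simp add: ball_iff pos_rat_def)
  qed
qed

text \<open>Values are unique only up to equality of points. Closure under this equality permits a
  fixed point in the literal form \<open>f x x\<close>.\<close>

lemma value_at_same_point:
  assumes f: "value_at Z X P x y" and y': "point X y'" "same_point X y y'"
  shows "value_at Z X P x y'"
proof -
  define V where "V y \<longleftrightarrow> point X y \<and> (\<forall>a r. a \<in> A \<and> pos_rat r \<and> y \<in> ball X a r \<longrightarrow> x \<in> P a r)" for y
  have *: "value_at Z X P x y \<longleftrightarrow> point Z x \<and> V y \<and> (\<forall>z. V z \<longrightarrow> same_point X y z)" for y
    by (simp add: value_at_def V_def Let_def)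
  have y: "point Z x" "V y" "\<And>z. V z \<Longrightarrow> same_point X y z" "point X y"
    using f unfolding * by (auto simp: V_def)
  have "V y'"
    using y(2) y' same_point_ball[OF y(4) y'] unfolding V_def by (auto simp: pos_rat_def)
  moreover have "same_point X y' z" if "V z" for z
    using same_point_trans[OF y'(1) y(4), of z] same_point_sym[OF y(4) y'] y(3)[OF that] that
    by (auto simp: V_def)
  ultimately show ?thesis
    unfolding * using y(1) by blast
qed

text \<open>The function \<open>f\<close> is evaluated only at the minimum \<open>z\<close> of
  \<open>V\<close>, where the Caristi inequality forces distance zero. Its code serves to show that
  the value is a point and that the graph contains every representation of it, in particular
  \<open>z\<close>.\<close>

lemma caristi_fixed_point:
  assumes separation and compact: "compact_space X" and V: "continuous_function X nonneg_reals V"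
    and sys: "caristi_system X f V"
  shows "\<exists>x. f x x"
proof -
  obtain \<Phi> where \<Phi>: "continuous_code X nonneg_reals \<Phi>" "V = continuous_value X nonneg_reals \<Phi>" "total X V"
    using V unfolding continuous_function_def by blast
  obtain z where z: "point X z" "\<And>y v w. V z v \<Longrightarrow> V y w \<Longrightarrow> real_le v w"
    using continuous_minimum[OF assms(1) compact \<Phi>(1)] unfolding \<Phi>(2) by blast
  have f: "baire_function X X f \<or> borel_function X X f"
    using sys by (simp add: caristi_system_def)
  then have "total X f"
    unfolding baire_function_def borel_function_def by blast
  then obtain y where y: "f z y"
    using z(1) unfolding total_def by blast
  have yp: "point X y"
    using f y unfolding baire_function_def borel_function_def baire_value_def value_at_def Let_def by blast
  obtain v w where v: "V z v" "V y w"
    using \<Phi>(3) z(1) yp unfolding total_def by blast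
  have "point nonneg_reals v" "point nonneg_reals w"
    using v unfolding \<Phi>(2) continuous_value_def value_at_def Let_def by auto
  then have r: "rat (v k)" "rat (w k)" for k
    using nonneg.point_code by (auto simp: nonneg_code_iff)
  have le: "real_le (distance X z y) (real_minus v w)"
    using sys y v unfolding caristi_system_def by blast
  have "same_point X z y"
  proof (rule same_pointI[OF z(1) yp])
    fix k
    define d where "d = dval (z (k \<oplus> \<one> \<oplus> \<one>)) (y (k \<oplus> \<one> \<oplus> \<one>)) (k \<oplus> \<one> \<oplus> \<one>)"
    have "real_le v w" using z(2) v by blast
    then have 1: "val (v (k \<oplus> \<one>)) \<sqsubseteq> val (w (k \<oplus> \<one>)) \<boxplus> hp k"
      using r real_le_iff[of v w] hp_double by metis
    have "d \<sqsubseteq> val (v (k \<oplus> \<one>)) \<boxplus> val_uminus (val (w (k \<oplus> \<one>))) \<boxplus> (hp k \<boxplus> hp k)"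
      using le r z(1) yp
      by (simp add: real_le_iff real_minus_def distance_rat val_distance d_def val_rat_add val_rat_minus
          del: vals.add_uminus_conv_diff)
    then have 2: "d \<boxplus> val (w (k \<oplus> \<one>)) \<sqsubseteq> val (v (k \<oplus> \<one>)) \<boxplus> (hp k \<boxplus> hp k)"
      by (rule val_leI) (simp add: val_ac, metis vals.add.commute vals.diff_add_cancel)
    show "d \<sqsubseteq> four (hp k)"
      by (rule val_leI[OF vals.add_mono[OF 1 vals.add_mono[OF 2 hp_nonneg[of k]]]])
        (simp add: four_def val_ac)
  qed
  then have yz: "same_point X y z"
    using same_point_sym z(1) yp by blast
  have "f z z"
    using f
  proof
    assume "baire_function X X f"
    then obtain T L where fT: "f = baire_value X X T L" and T: "baire_code X X T L"
      unfolding baire_function_def by blast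
    then obtain u where u: "baire_evaluation X X T L z u" "same_point X (u nil) y"
      using y unfolding baire_value_def by blast
    have "nil \<in> T"
      using T unfolding baire_code_def by blast
    then have "point X (u nil)"
      using u(1) unfolding baire_evaluation_def by blast
    then have "same_point X (u nil) z"
      using same_point_trans u(2) yz yp z(1) by blast
    then show ?thesis
      unfolding fT baire_value_def using z(1) u(1) by blast
  next
    assume "borel_function X X f"
    then show ?thesis
      using y value_at_same_point[OF _ z(1) yz] unfolding borel_function_def by blast
  qed
  then show ?thesis by blast
qed

end

context rca0
begin

section \<open>The Cantor space\<close>

lemma hp_strict_antimono: "m \<prec> n \<Longrightarrow> hp n \<sqsubset> hp m"
proof -
  assume "m \<prec> n"
  then have "hp n \<sqsubseteq> hp (m \<oplus> \<one>)"
    by (intro hp_antimono) (simp add: succ_le_iff)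
  moreover have "hp (m \<oplus> \<one>) \<sqsubset> hp m"
    using hp_double[of m] hp_pos[of "m \<oplus> \<one>"] by (metis vals.less_add_same_cancel1)
  ultimately show ?thesis
    by (rule vals.le_less_trans)
qed

definition pd :: "'m \<Rightarrow> 'm \<Rightarrow> 'm" where "pd s i = (if i \<prec> lh s then ent s i else \<zero>)"

lemma def_fun_pd [definable]: "def_fun s \<Longrightarrow> def_fun t \<Longrightarrow> def_fun (\<lambda>e. pd (s e) (t e))"
  unfolding pd_def by (intro definable)

lemma pad_eq: "fin_seq s \<Longrightarrow> pad s i = pd s i"
  by (simp add: pad_def pd_def ent_def)

lemma pd_binary: "binary_seq s \<Longrightarrow> pd s i = \<zero> \<or> pd s i = \<one>"
  by (simp add: pd_def binary_seq_iff)

definition agree :: "'m \<Rightarrow> 'm \<Rightarrow> 'm \<Rightarrow> bool" where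
  "agree s t n \<longleftrightarrow> (\<forall>i. i \<prec> n \<longrightarrow> pd s i = pd t i)"

definition cdist :: "'m \<Rightarrow> 'm \<Rightarrow> 'm" where
  "cdist s t = (if \<forall>i. pd s i = pd t i then rat_zero else half_pow (least (\<lambda>n. pd s n \<noteq> pd t n)))"

lemma least_difference:
  assumes "pd s i \<noteq> pd t i"
  shows "pd s (least (\<lambda>n. pd s n \<noteq> pd t n)) \<noteq> pd t (least (\<lambda>n. pd s n \<noteq> pd t n))"
    "j \<prec> least (\<lambda>n. pd s n \<noteq> pd t n) \<Longrightarrow> pd s j = pd t j"
proof -
  have D: "Delta1 (\<lambda>e. pd s (e 0) \<noteq> pd t (e 0))" by (intro definable)
  show "pd s (least (\<lambda>n. pd s n \<noteq> pd t n)) \<noteq> pd t (least (\<lambda>n. pd s n \<noteq> pd t n))"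
    using leastI[of "\<lambda>n. pd s n \<noteq> pd t n", OF D assms] .
  show "j \<prec> least (\<lambda>n. pd s n \<noteq> pd t n) \<Longrightarrow> pd s j = pd t j"
    using not_less_least[of "\<lambda>n. pd s n \<noteq> pd t n", OF D assms] by blast
qed

lemma snd_cantor_space:
  assumes "binary_seq s" "binary_seq t"
  shows "snd cantor_space s t = real_of (cdist s t)"
proof -
  have seq: "fin_seq s" "fin_seq t" using assms by (auto simp: binary_seq_def)
  have "(THE n. pd s n \<noteq> pd t n \<and> (\<forall>i. i \<prec> n \<longrightarrow> pd s i = pd t i)) = least (\<lambda>n. pd s n \<noteq> pd t n)"
    by (simp add: least_def)
  then show ?thesis
    using seq by (simp add: cantor_space_def cdist_def pad_eq)
qed

lemma cdist_cases:
  obtains "\<forall>i. pd s i = pd t i" "val (cdist s t) = \<zero>\<^sub>v"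
  | n where "pd s n \<noteq> pd t n" "agree s t n" "val (cdist s t) = hp n"
proof (cases "\<forall>i. pd s i = pd t i")
  case True
  then show ?thesis
    using that(1) by (simp add: cdist_def)
next
  case False
  then obtain i where "pd s i \<noteq> pd t i" by blast
  from least_difference[OF this] False show ?thesis
    by (intro that(2)[of "least (\<lambda>n. pd s n \<noteq> pd t n)"]) (auto simp: cdist_def agree_def hp_def)
qed

lemma rat_cdist [simp]: "rat (cdist s t)"
  by (simp add: cdist_def)

lemma cdist_le: "agree s t n \<Longrightarrow> val (cdist s t) \<sqsubseteq> hp n"
proof (cases s t rule: cdist_cases)
  case (2 m)
  assume "agree s t n"
  then have "n \<preceq>\<preceq> m"
    using 2(1) by (auto simp: agree_def nums.not_less[symmetric])
  then show ?thesis
    using 2 hp_antimono by simp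
qed simp

lemma cdist_le_agree: "val (cdist s t) \<sqsubseteq> hp n \<Longrightarrow> agree s t n"
proof (cases s t rule: cdist_cases)
  case (2 m)
  assume "val (cdist s t) \<sqsubseteq> hp n"
  then have "\<not> m \<prec> n"
    using 2 hp_strict_antimono[of m n] by (auto simp: vals.not_le[symmetric])
  then show ?thesis
    using 2(2) nums.less_le_trans unfolding agree_def nums.not_less by blast
qed (simp add: agree_def)

text \<open>The strict inequality gains one place over \<open>cdist_le_agree\<close>, since the next
  smaller distance is half as large.\<close>

lemma cdist_less_agree: "val (cdist s t) \<sqsubset> hp n \<Longrightarrow> agree s t (n \<oplus> \<one>)"
proof (cases s t rule: cdist_cases)
  case (2 m)
  assume "val (cdist s t) \<sqsubset> hp n"
  then have "n \<prec> m"
    using 2 hp_antimono[of m n] by (auto simp: vals.not_le[symmetric] nums.not_le[symmetric])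
  then show ?thesis
    using 2(2) nums.less_le_trans unfolding agree_def less_succ_iff_le
    by (metis nums.le_less_trans)
qed (simp add: agree_def)

lemma cdist_nonneg: "\<zero>\<^sub>v \<sqsubseteq> val (cdist s t)"
  by (cases s t rule: cdist_cases) auto

lemma cdist_sym: "val (cdist s t) \<sqsubseteq> val (cdist t s)"
proof (cases t s rule: cdist_cases)
  case 1
  then show ?thesis
    by (simp add: cdist_def)
next
  case (2 n)
  then have "agree s t n" by (auto simp: agree_def)
  then show ?thesis using 2 cdist_le by simp
qed

lemma cdist_self: "val (cdist s s) = \<zero>\<^sub>v"
  by (simp add: cdist_def)

text \<open>The metric is in fact an ultrametric: if \<open>a\<close> and \<open>c\<close> differ at
  place \<open>n\<close>, then one of them differs from \<open>b\<close> there.\<close>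

lemma cdist_triangle: "val (cdist a c) \<sqsubseteq> val (cdist a b) \<boxplus> val (cdist b c)"
proof (cases a c rule: cdist_cases)
  case 1
  then show ?thesis
    by (simp add: cdist_nonneg vals.add_nonneg_nonneg)
next
  case (2 n)
  have "hp n \<sqsubseteq> val (cdist a b) \<or> hp n \<sqsubseteq> val (cdist b c)"
  proof (rule ccontr)
    assume "\<not> ?thesis"
    then have "agree a b (n \<oplus> \<one>)" "agree b c (n \<oplus> \<one>)"
      using cdist_less_agree by (auto simp: vals.not_le)
    then show False
      using 2(1) by (simp add: agree_def)
  qed
  then show ?thesis
    unfolding 2(3) using cdist_nonneg vals.add_increasing vals.add_increasing2 by blast
qed

lemma cantor_code_iff [simp]: "s \<in> fst cantor_space \<longleftrightarrow> binary_seq s"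
  by (simp add: cantor_space_def)

lemma binary_seq_nil [simp]: "binary_seq nil"
  by (simp add: binary_seq_def)

lemma def_fun_cdist [definable]: "def_fun s \<Longrightarrow> def_fun t \<Longrightarrow> def_fun (\<lambda>e. cdist (s e) (t e))"
proof (erule (1) def_fun_comp2[rotated])
  have "y = cdist s t \<longleftrightarrow> (if \<forall>i. i \<prec> lh s \<oplus> lh t \<longrightarrow> pd s i = pd t i then y = rat_zero else
      \<exists>n. n \<prec> lh s \<oplus> lh t \<and> pd s n \<noteq> pd t n \<and> (\<forall>i. i \<prec> n \<longrightarrow> pd s i = pd t i) \<and> y = half_pow n)" for y s t
  proof -
    \<comment> \<open>Beyond both lengths the paddings vanish. This bounds the search for a
      difference and makes the distance definable.\<close>
    have less: "n \<prec> lh s \<oplus> lh t" if "pd s n \<noteq> pd t n" for n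
    proof -
      have "n \<prec> lh s \<or> n \<prec> lh t"
        using that by (auto simp: pd_def split: if_splits)
      then show ?thesis
        using le_add[of "lh s" "lh t"] le_add[of "lh t" "lh s"] nums.less_le_trans
        by (auto simp: nums.add.commute)
    qed
    show ?thesis
    proof (cases "\<forall>i. pd s i = pd t i")
      case True
      then show ?thesis by (simp add: cdist_def)
    next
      case False
      then obtain i where i: "pd s i \<noteq> pd t i" by blast
      define l where "l = least (\<lambda>n. pd s n \<noteq> pd t n)"
      have l: "pd s l \<noteq> pd t l" "\<And>j. j \<prec> l \<Longrightarrow> pd s j = pd t j"
        using least_difference[OF i] unfolding l_def by blast+
      have eq: "l = n" if "pd s n \<noteq> pd t n" "\<forall>i. i \<prec> n \<longrightarrow> pd s i = pd t i" for n
        using that l num_less_linear by blast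
      have cd: "cdist s t = half_pow l"
        unfolding cdist_def l_def using False by (rule if_not_P)
      have nall: "\<not> (\<forall>i. i \<prec> lh s \<oplus> lh t \<longrightarrow> pd s i = pd t i)"
        using l(1) less by blast
      show ?thesis
        unfolding cd if_not_P[OF nall]
      proof
        assume "y = half_pow l"
        then show "\<exists>n. n \<prec> lh s \<oplus> lh t \<and> pd s n \<noteq> pd t n \<and> (\<forall>i. i \<prec> n \<longrightarrow> pd s i = pd t i) \<and> y = half_pow n"
          using l less[OF l(1)] by blast
      qed (use eq in blast)
    qed
  qed
  moreover have "Delta1 (\<lambda>e. if \<forall>i. i \<prec> lh (e (Suc 0)) \<oplus> lh (e (Suc (Suc 0))) \<longrightarrow> pd (e (Suc 0)) i = pd (e (Suc (Suc 0))) i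
     then e 0 = rat_zero else
      \<exists>n. n \<prec> lh (e (Suc 0)) \<oplus> lh (e (Suc (Suc 0))) \<and> pd (e (Suc 0)) n \<noteq> pd (e (Suc (Suc 0))) n \<and>
       (\<forall>i. i \<prec> n \<longrightarrow> pd (e (Suc 0)) i = pd (e (Suc (Suc 0))) i) \<and> e 0 = half_pow n)"
    by (intro definable)
  ultimately show "Delta1 (\<lambda>e. e 0 = cdist (e (Suc 0)) (e (Suc (Suc 0))))"
    by (simp only:)
qed

lemma metric_code_cantor_space: "metric_code cantor_space"
proof -
  define A d where "A = fst cantor_space" and "d = snd cantor_space"
  have A_iff: "s \<in> A \<longleftrightarrow> binary_seq s" for s
    by (simp add: A_def)
  have A: "A \<in> Sets"
    unfolding A_def cantor_space_def fst_conv by (intro comprehension definable)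
  have d: "d s t = real_of (cdist s t)" if "s \<in> A" "t \<in> A" for s t
    using that snd_cantor_space by (simp add: A_iff d_def)
  have "{\<langle>\<langle>\<langle>a, b\<rangle>, k\<rangle>, d a b k\<rangle> | a b k. a \<in> A \<and> b \<in> A} = {\<langle>\<langle>\<langle>a, b\<rangle>, k\<rangle>, cdist a b\<rangle> | a b k. a \<in> A \<and> b \<in> A}"
    using d by (auto simp: real_of_def)
  also have "\<dots> \<in> Sets"
    unfolding dist_graph_eq[of "\<lambda>a b k. cdist a b"] by (intro comprehension definable A)
  finally have graph: "{\<langle>\<langle>\<langle>a, b\<rangle>, k\<rangle>, d a b k\<rangle> | a b k. a \<in> A \<and> b \<in> A} \<in> Sets" .
  have ne: "nil \<in> A"
    by (simp add: A_iff)
  have num: "real_num (d a b)" if "a \<in> A" "b \<in> A" for a b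
    using real_of_real_num that by (simp add: d)
  have zero: "real_eq (d a a) (real_of rat_zero)" if "a \<in> A" for a
    unfolding real_eq_def d[OF that that] by (intro conjI real_le_real_of) (simp_all add: cdist_self)
  have sym: "real_eq (d a b) (d b a) \<and> real_le (real_of rat_zero) (d a b)" if "a \<in> A" "b \<in> A" for a b
    unfolding real_eq_def d[OF that] d[OF that(2,1)]
    by (intro conjI real_le_real_of) (simp_all add: cdist_sym cdist_nonneg)
  have triangle: "real_le (d a c) (real_add (d a b) (d b c))" if abc: "a \<in> A" "b \<in> A" "c \<in> A" for a b c
  proof -
    have "real_le (real_of (cdist a c)) (real_of (rat_add (cdist a b) (cdist b c)))"
      by (rule real_le_real_of) (simp_all add: val_rat_add cdist_triangle)
    then show ?thesis
      using abc by (simp add: d) (simp add: real_of_def real_add_def)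
  qed
  have "metric_code (A, d)"
    unfolding metric_code_def using A graph ne num zero sym triangle by auto
  then show ?thesis
    by (simp add: A_def d_def)
qed

sublocale cantor: metric M cantor_space
  by unfold_locales (rule metric_code_cantor_space)

lemma cantor_dval: "binary_seq s \<Longrightarrow> binary_seq t \<Longrightarrow> cantor.dval s t k = val (cdist s t)"
  by (simp add: cantor.dval_def snd_cantor_space real_of_def)

text \<open>The approximations from index \<open>i \<oplus> \<one>\<close> on are at distance at
  most \<open>hp (i \<oplus> \<one>)\<close> and hence agree on the first
  \<open>i \<oplus> \<one>\<close> places, so that place \<open>i\<close> is final.\<close>

definition bit :: "('m \<Rightarrow> 'm) \<Rightarrow> 'm \<Rightarrow> 'm" where "bit x i = pd (x (i \<oplus> \<one>)) i"

lemma cantor_point_binary: "point cantor_space x \<Longrightarrow> binary_seq (x n)"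
  using cantor.point_code by simp

lemma point_bit:
  assumes x: "point cantor_space x" and "i \<prec> n"
  shows "pd (x n) i = bit x i"
proof -
  have "real_le (snd cantor_space (x (i \<oplus> \<one>)) (x n)) (real_of (half_pow (i \<oplus> \<one>)))"
    using x assms(2) unfolding point_def by (simp add: succ_le_iff flip: num_le_def)
  then have "val (cdist (x (i \<oplus> \<one>)) (x n)) \<sqsubseteq> hp (i \<oplus> \<one>) \<boxplus> (hp k \<boxplus> hp k)" for k
    using cantor_point_binary[OF x] by (simp add: snd_cantor_space real_of_def real_le_iff hp_def)
  note * = this
  have "val (cdist (x (i \<oplus> \<one>)) (x n)) \<sqsubseteq> hp (i \<oplus> \<one>)"
  proof (rule val_le_epsI)
    fix e assume "\<zero>\<^sub>v \<sqsubset> e"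
    then obtain k where "hp k \<sqsubset> e" using ex_hp_less by blast
    then have "hp (i \<oplus> \<one>) \<boxplus> hp k \<sqsubseteq> hp (i \<oplus> \<one>) \<boxplus> e"
      by (simp add: vals.less_imp_le)
    then show "val (cdist (x (i \<oplus> \<one>)) (x n)) \<sqsubseteq> hp (i \<oplus> \<one>) \<boxplus> e"
      using *[of "k \<oplus> \<one>"] vals.order_trans unfolding hp_double by blast
  qed
  then have "agree (x (i \<oplus> \<one>)) (x n) (i \<oplus> \<one>)"
    by (rule cdist_le_agree)
  then show ?thesis
    by (simp add: agree_def bit_def)
qed

lemma bit_binary: "point cantor_space x \<Longrightarrow> bit x i = \<zero> \<or> bit x i = \<one>"
  unfolding bit_def using cantor_point_binary pd_binary by blast

lemma fn_on_bit: "point cantor_space x \<Longrightarrow> fn_on UNIV (bit x)"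
proof -
  assume "point cantor_space x"
  then have x: "fn_on UNIV x" by (simp add: point_def)
  show ?thesis
    unfolding bit_def by (intro def_fun_fn_on definable def_fun_fn[OF x])
qed

lemma bit_const: "bit (\<lambda>_. s) i = pd s i"
  by (simp add: bit_def)

lemma cdist_points_le:
  assumes x: "point cantor_space x" and y: "point cantor_space y" and "\<And>i. i \<prec> d \<Longrightarrow> bit x i = bit y i"
  shows "val (cdist (x n) (y n)) \<sqsubseteq> hp d \<or> val (cdist (x n) (y n)) \<sqsubseteq> hp n"
proof (cases "d \<preceq>\<preceq> n")
  case True
  then have "agree (x n) (y n) d"
    unfolding agree_def using assms point_bit nums.less_le_trans by metis
  then show ?thesis using cdist_le by blast
next
  case False
  then have "agree (x n) (y n) n"
    unfolding agree_def using assms point_bit nums.less_trans nums.not_le by metis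
  then show ?thesis using cdist_le by blast
qed

lemma cantor_dlessI:
  assumes x: "point cantor_space x" and y: "point cantor_space y"
    and "\<And>i. i \<prec> d \<Longrightarrow> bit x i = bit y i" and q: "hp d \<sqsubset> q"
  shows "cantor.dless x y q"
proof -
  have "\<zero>\<^sub>v \<sqsubset> q \<boxminus> hp d" using q by simp
  have "evt (\<lambda>n. cantor.dval (x n) (y n) n \<boxplus> (q \<boxminus> hp d) \<sqsubseteq> q)"
  proof (rule evtI[of d])
    fix n assume "d \<preceq>\<preceq> n"
    then have "agree (x n) (y n) d"
      unfolding agree_def using assms(1-3) point_bit nums.less_le_trans by metis
    then have "val (cdist (x n) (y n)) \<sqsubseteq> hp d" by (rule cdist_le)
    from vals.add_right_mono[OF this, of "q \<boxminus> hp d"]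
    have "val (cdist (x n) (y n)) \<boxplus> (q \<boxminus> hp d) \<sqsubseteq> q"
      by (simp only: vals.add.commute[of "hp d"] vals.diff_add_cancel)
    then show "cantor.dval (x n) (y n) n \<boxplus> (q \<boxminus> hp d) \<sqsubseteq> q"
      by (simp only: cantor_dval[OF cantor_point_binary[OF x] cantor_point_binary[OF y]])
  qed
  then show ?thesis
    unfolding cantor.dless_def using \<open>\<zero>\<^sub>v \<sqsubset> q \<boxminus> hp d\<close> by blast
qed

lemma cantor_dlessD:
  assumes x: "point cantor_space x" and y: "point cantor_space y"
    and "cantor.dless x y (hp d)" and i: "i \<preceq>\<preceq> d"
  shows "bit x i = bit y i"
proof -
  obtain e where e: "\<zero>\<^sub>v \<sqsubset> e" "evt (\<lambda>n. cantor.dval (x n) (y n) n \<boxplus> e \<sqsubseteq> hp d)"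
    using assms(3) unfolding cantor.dless_def by blast
  from evt_happens[OF evt_conj[OF e(2) evt_ge[of "d \<oplus> \<one>"]]]
  obtain n where n: "cantor.dval (x n) (y n) n \<boxplus> e \<sqsubseteq> hp d" "d \<oplus> \<one> \<preceq>\<preceq> n" by blast
  have "val (cdist (x n) (y n)) \<sqsubset> val (cdist (x n) (y n)) \<boxplus> e"
    using e(1) by simp
  then have "val (cdist (x n) (y n)) \<sqsubset> hp d"
    using n(1) vals.less_le_trans
    unfolding cantor_dval[OF cantor_point_binary[OF x] cantor_point_binary[OF y]] by blast
  then have "pd (x n) i = pd (y n) i"
    using cdist_less_agree i unfolding agree_def less_succ_iff_le by blast
  moreover have "i \<prec> n"
    using i n(2) nums.le_less_trans succ_le_iff by blast
  ultimately show ?thesis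
    using point_bit x y by simp
qed

lemma cantor_same_point_bit:
  "point cantor_space x \<Longrightarrow> point cantor_space y \<Longrightarrow> same_point cantor_space x y \<Longrightarrow> bit x i = bit y i"
  using cantor_dlessD[of x y i i] cantor.same_point_iff hp_pos by simp

text \<open>Balls are open, so the radius is twice \<open>hp (lh s)\<close>: being closer than this
  means agreement on exactly the first \<open>lh s\<close> places. For length zero the radius is
  two, and the ball is the whole space.\<close>

lemma cylinder_iff:
  assumes s: "binary_seq s" and x: "point cantor_space x"
  shows "x \<in> ball cantor_space s (two (lh s)) \<longleftrightarrow> (\<forall>i. i \<prec> lh s \<longrightarrow> bit x i = ent s i)"
proof -
  have c: "point cantor_space (\<lambda>_. s)"
    using s cantor.const_point by simp
  have bits: "bit (\<lambda>_. s) i = ent s i" if "i \<prec> lh s" for i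
    using that by (simp add: bit_const pd_def)
  have "cantor.dless x (\<lambda>_. s) (hp (lh s) \<boxplus> hp (lh s)) \<longleftrightarrow> (\<forall>i. i \<prec> lh s \<longrightarrow> bit x i = ent s i)"
  proof
    assume *: "cantor.dless x (\<lambda>_. s) (hp (lh s) \<boxplus> hp (lh s))"
    show "\<forall>i. i \<prec> lh s \<longrightarrow> bit x i = ent s i"
    proof (cases "lh s" rule: num_cases)
      case (2 m)
      then have "cantor.dless x (\<lambda>_. s) (hp m)"
        using * by (simp only: hp_double)
      from cantor_dlessD[OF x c this] show ?thesis
        using bits unfolding 2 less_succ_iff_le by simp
    qed simp
  qed (use bits in \<open>auto intro!: cantor_dlessI[OF x c]\<close>)
  then show ?thesis
    using s x by (simp add: cantor.ball_iff)
qed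

lemma compact_cantor_space: "compact_space cantor_space"
proof -
  \<comment> \<open>The net consists of all binary sequences of length
    \<open>j \<oplus> \<one>\<close>, one place more than \<open>j\<close> as the distances must be
    strictly below \<open>hp j\<close>. It is indexed by all numbers up to the bound for their
    codes; an index that codes no binary sequence stands for \<open>nil\<close>.\<close>
  define n where "n j = bin_bound (j \<oplus> \<one>)" for j
  define c where "c i = (if binary_seq i then i else nil)" for i
  have "fn_on UNIV n"
    unfolding n_def by (intro def_fun_fn_on definable)
  moreover have "{\<langle>\<langle>\<langle>i, j\<rangle>, k\<rangle>, c i\<rangle> | i j k. i \<preceq> n j} \<in> Sets"
  proof -
    have "{\<langle>\<langle>\<langle>i, j\<rangle>, k\<rangle>, c i\<rangle> | i j k. i \<preceq> n j} =
      {z. z = \<langle>\<langle>\<langle>p1 (p1 (p1 z)), p2 (p1 (p1 z))\<rangle>, p2 (p1 z)\<rangle>, c (p1 (p1 (p1 z)))\<rangle> \<and> p1 (p1 (p1 z)) \<preceq> n (p2 (p1 (p1 z)))}"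
      by (rule set_eqI, unfold mem_Collect_eq) (metis p1_pair p2_pair)
    also have "\<dots> \<in> Sets"
      unfolding c_def n_def by (intro comprehension definable)
    finally show ?thesis .
  qed
  moreover have c: "point cantor_space (\<lambda>_. c i)" for i
    by (intro cantor.const_point) (simp add: c_def)
  moreover have "\<exists>i. i \<preceq> n j \<and> real_less (distance cantor_space (\<lambda>_. c i) z) (real_of (half_pow j))"
    if z: "point cantor_space z" for z j
  proof -
    define s where "s = restr (bit z) (j \<oplus> \<one>)"
    have s: "fin_seq s" "lh s = j \<oplus> \<one>" "\<And>i. i \<prec> j \<oplus> \<one> \<Longrightarrow> ent s i = bit z i"
      unfolding s_def using restr_fn[OF fn_on_bit[OF z]] by auto
    have bin: "binary_seq s"
      using s bit_binary[OF z] by (simp add: binary_seq_iff)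
    have "cantor.dless (\<lambda>_. c s) z (val (half_pow j))"
    proof (rule cantor_dlessI[OF c z])
      show "bit (\<lambda>_. c s) i = bit z i" if "i \<prec> j \<oplus> \<one>" for i
        using that s bin by (simp add: bit_const c_def pd_def)
      show "hp (j \<oplus> \<one>) \<sqsubset> val (half_pow j)"
        unfolding hp_def[symmetric] by (rule hp_strict_antimono) simp
    qed
    then have "real_less (distance cantor_space (\<lambda>_. c s) z) (real_of (half_pow j))"
      using cantor.dless_iff[OF c z] by simp
    moreover have "s \<preceq> n j"
      using binary_seq_le_bound[OF bin] s(2) by (simp add: n_def num_le_def)
    ultimately show ?thesis by blast
  qed
  ultimately show ?thesis
    unfolding compact_space_def using metric_code_cantor_space
    by (intro conjI exI[of _ n] exI[of _ "\<lambda>i j k. c i"]) auto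
qed

end

section \<open>Codes for given functions; continuous functions as Baire functions and as
  potentials\<close>

context metric
begin

text \<open>Exact preimages satisfy both conditions on codes at once. The value is determined
  because arbitrarily small balls around approximations of \<open>y\<close> contain
  \<open>y\<close>, and hence also \<open>F x\<close>.\<close>

lemma value_at_ball_preimages:
  assumes F: "\<And>x. point Z x \<Longrightarrow> point X (F x)"
    and P: "\<And>a r. a \<in> A \<Longrightarrow> pos_rat r \<Longrightarrow> P a r = {x. point Z x \<and> F x \<in> ball X a r}"
  shows "preimage_conditions Z X P"
    and "value_at Z X P x y \<longleftrightarrow> point Z x \<and> point X y \<and> same_point X (F x) y"
proof -
  show "preimage_conditions Z X P"
    unfolding preimage_conditions_def
  proof (intro allI impI conjI)
    fix a r b s assume "a \<in> A \<and> pos_rat r \<and> b \<in> A \<and> pos_rat s"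
    then have "P a r = {x. point Z x \<and> F x \<in> ball X a r}" "P b s = {x. point Z x \<and> F x \<in> ball X b s}"
      using P by blast+
    then show "ball X a r \<subseteq> ball X b s \<Longrightarrow> P a r \<subseteq> P b s"
      "ball X a r \<inter> ball X b s = {} \<Longrightarrow> P a r \<inter> P b s = {}"
      by blast+
  qed
  define V where "V y \<longleftrightarrow> point X y \<and> (\<forall>a r. a \<in> A \<and> pos_rat r \<and> y \<in> ball X a r \<longrightarrow> x \<in> P a r)" for y
  have V: "V y \<longleftrightarrow> point X y \<and> same_point X (F x) y" if x: "point Z x" for y
  proof (cases "point X y")
    case y: True
    have "V y \<longleftrightarrow> (\<forall>a r. a \<in> A \<and> pos_rat r \<and> y \<in> ball X a r \<longrightarrow> F x \<in> ball X a r)"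
      using P x y unfolding V_def by blast
    also have "\<dots> \<longleftrightarrow> same_point X (F x) y"
    proof
      assume *: "\<forall>a r. a \<in> A \<and> pos_rat r \<and> y \<in> ball X a r \<longrightarrow> F x \<in> ball X a r"
      show "same_point X (F x) y"
        unfolding same_point_iff[OF F[OF x] y]
      proof (intro allI impI)
        fix q assume "\<zero>\<^sub>v \<sqsubset> q"
        then obtain e where e: "\<zero>\<^sub>v \<sqsubset> e" "e \<boxplus> e \<sqsubset> q"
          using ex_half by blast
        obtain r where r: "rat r" "e = val r" by (rule val_cases)
        obtain i where i: "hp i \<sqsubset> e"
          using ex_hp_less e(1) by blast
        have yi: "y i \<in> A" by (rule point_code[OF y])
        have "dless y (\<lambda>_. y i) e"
          by (rule dless_approx[OF y i])
        then have "y \<in> ball X (y i) r"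
          using y yi r by (simp add: ball_iff)
        then have "F x \<in> ball X (y i) r"
          using * yi r e(1) pos_rat_iff by blast
        then have "dless (F x) (\<lambda>_. y i) e"
          using yi r by (simp add: ball_iff)
        from dless_triangle[OF F[OF x] const_point[OF yi] y this dless_sym[OF y const_point[OF yi] \<open>dless y _ e\<close>]]
        show "dless (F x) y q"
          by (rule dless_mono) (rule vals.less_imp_le[OF e(2)])
      qed
    next
      assume "same_point X (F x) y"
      then show "\<forall>a r. a \<in> A \<and> pos_rat r \<and> y \<in> ball X a r \<longrightarrow> F x \<in> ball X a r"
        using same_point_ball[OF F[OF x] y] by (auto simp: pos_rat_def)
    qed
    finally show ?thesis using y by simp
  qed (simp add: V_def)
  have "value_at Z X P x y \<longleftrightarrow> point Z x \<and> V y \<and> (\<forall>z. V z \<longrightarrow> same_point X y z)"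
    by (simp add: value_at_def V_def Let_def)
  also have "\<dots> \<longleftrightarrow> point Z x \<and> point X y \<and> same_point X (F x) y"
    using V F same_point_trans same_point_sym by metis
  finally show "value_at Z X P x y \<longleftrightarrow> point Z x \<and> point X y \<and> same_point X (F x) y" .
qed

text \<open>The tree with the root as its only node has a leaf as root, so evaluation involves no
  limit.\<close>

lemma continuous_imp_baire:
  assumes "continuous_function Z X f"
  shows "baire_function Z X f"
proof -
  obtain \<Phi> where \<Phi>: "continuous_code Z X \<Phi>" "f = continuous_value Z X \<Phi>" "total Z f"
    using assms unfolding continuous_function_def by blast
  define L where "L = {z. z = \<langle>nil, p2 z\<rangle> \<and> p2 z \<in> \<Phi>}"
  have "\<Phi> \<in> Sets" using \<Phi>(1) by (simp add: continuous_code_def)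
  then have L: "L \<in> Sets"
    unfolding L_def by (intro comprehension definable)
  have sect: "sect L nil = \<Phi>"
    by (auto simp: sect_def L_def)
  have "snoc nil k \<noteq> nil" for k
    using snoc_spec(2)[of nil k] lh_nil by (metis fin_seq_nil succ_neq_zero)
  then have leaf: "leaf {nil} nil"
    by (simp add: leaf_def)
  have "{z. z = nil} \<in> Sets"
    by (intro comprehension definable)
  then have "tree {nil}"
    unfolding tree_def using lh_zero by (auto simp: initial_segment_def)
  moreover have "\<not> has_path {nil}"
  proof
    assume "has_path {nil}"
    then obtain g where "fn_on UNIV g" "restr g \<one> = nil"
      unfolding has_path_def by blast
    then show False
      using restr_fn(2)[of g \<one>] lh_nil by simp
  qed
  ultimately have code: "baire_code Z X {nil} L"
    unfolding baire_code_def using L leaf sect \<Phi>(1) by simp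
  have eval: "baire_evaluation Z X {nil} L x v \<longleftrightarrow>
    {\<langle>\<langle>s, k\<rangle>, v s k\<rangle> | s k. s = nil} \<in> Sets \<and> point X (v nil) \<and> f x (v nil)" for x v
    unfolding baire_evaluation_def using leaf sect \<Phi>(2) by simp
  have "f x y \<longleftrightarrow> baire_value Z X {nil} L x y" for x y
  proof
    assume fxy: "f x y"
    then have xy: "point Z x" "point X y"
      unfolding \<Phi>(2) continuous_value_def value_at_def Let_def by auto
    have y: "fn_on UNIV y" using xy(2) by (simp add: point_def)
    have "{\<langle>\<langle>s, k\<rangle>, y k\<rangle> | s k. s = nil} = {z. z = \<langle>\<langle>nil, p2 (p1 z)\<rangle>, y (p2 (p1 z))\<rangle>}"
      by (rule set_eqI, unfold mem_Collect_eq) (metis p1_pair p2_pair)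
    also have "\<dots> \<in> Sets"
      by (intro comprehension definable def_fun_fn[OF y])
    finally have "baire_evaluation Z X {nil} L x (\<lambda>_. y)"
      unfolding eval using xy fxy by simp
    then show "baire_value Z X {nil} L x y"
      unfolding baire_value_def using xy same_point_refl by blast
  next
    assume "baire_value Z X {nil} L x y"
    then obtain v where "f x (v nil)" "same_point X (v nil) y" "point X y"
      unfolding baire_value_def eval by blast
    then show "f x y"
      unfolding \<Phi>(2) continuous_value_def using value_at_same_point by blast
  qed
  then have "f = baire_value Z X {nil} L" by blast
  then show ?thesis
    unfolding baire_function_def using code \<Phi>(3) by blast
qed

end

context rca0
begin

lemma continuous_imp_potential:
  assumes X: "metric M X" and V: "continuous_function X nonneg_reals V"
  shows "potential X V"
proof -
  obtain \<Phi> where \<Phi>: "continuous_code X nonneg_reals \<Phi>" "V = continuous_value X nonneg_reals \<Phi>" "total X V"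
    using V unfolding continuous_function_def by blast
  have v: "point X x" "point nonneg_reals v" if "V x v" for x v
    using that unfolding \<Phi>(2) continuous_value_def value_at_def Let_def by auto
  have same: "same_point nonneg_reals u v" if "V x u" "V x v" for x u v
    using that unfolding \<Phi>(2) continuous_value_def value_at_def Let_def by blast
  \<comment> \<open>The constant sequence of codes. Monotonicity and convergence then reduce to the
    uniqueness of values up to equality of points.\<close>
  define W where "W = {z. z = \<langle>p1 z, p2 z\<rangle> \<and> p2 z \<in> \<Phi>}"
  have "\<Phi> \<in> Sets" using \<Phi>(1) by (simp add: continuous_code_def)
  then have W: "W \<in> Sets"
    unfolding W_def by (intro comprehension definable)
  have sect: "sect W n = \<Phi>" for n
    by (auto simp: sect_def W_def)
  have mono: "real_le u w" if "V x u" "V x w" for x u w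
  proof -
    note pu = v(2)[OF that(1)] and pw = v(2)[OF that(2)]
    have r: "rat (u k)" "rat (w k)" for k
      using nonneg.point_code[OF pu, of k] nonneg.point_code[OF pw, of k] by (auto simp: nonneg_code_iff)
    have "val (u k) \<sqsubseteq> val (w k) \<boxplus> (hp k \<boxplus> hp k)" for k
    proof -
      have "same_point nonneg_reals u w" using same that by blast
      have "val (rat_dist (u k) (w k)) \<sqsubseteq> hp k \<boxplus> hp k"
      proof (rule val_le_epsI)
        fix e assume "\<zero>\<^sub>v \<sqsubset> e"
        then obtain e1 where e1: "\<zero>\<^sub>v \<sqsubset> e1" "e1 \<boxplus> e1 \<sqsubset> e"
          using ex_half by blast
        note cu = nonneg.const_point[OF nonneg.point_code[OF pu]] and cw = nonneg.const_point[OF nonneg.point_code[OF pw]]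
        have "nonneg.dless u (\<lambda>_. u k) (hp k \<boxplus> e1)" "nonneg.dless w (\<lambda>_. w k) (hp k \<boxplus> e1)"
          using e1(1) by (intro nonneg.dless_approx pu pw; simp)+
        then have "nonneg.dless u (\<lambda>_. w k) (hp k \<boxplus> e1)" "nonneg.dless (\<lambda>_. u k) u (hp k \<boxplus> e1)"
          using nonneg.dless_same_point[OF pw pu cw] nonneg.same_point_sym[OF pu pw \<open>same_point nonneg_reals u w\<close>]
            nonneg.dless_sym[OF pu cu] by blast+
        from nonneg.dless_triangle[OF cu pu cw this(2,1)]
        have "nonneg.dless (\<lambda>_. u k) (\<lambda>_. w k) (hp k \<boxplus> e1 \<boxplus> (hp k \<boxplus> e1))" .
        then obtain e' where e': "\<zero>\<^sub>v \<sqsubset> e'" "val (rat_dist (u k) (w k)) \<boxplus> e' \<sqsubseteq> hp k \<boxplus> e1 \<boxplus> (hp k \<boxplus> e1)"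
          unfolding nonneg.dless_def nonneg_dval using evt_happens by blast
        show "val (rat_dist (u k) (w k)) \<sqsubseteq> hp k \<boxplus> hp k \<boxplus> e"
          by (rule val_leI[OF vals.add_mono[OF e'(2) vals.add_mono[OF vals.less_imp_le[OF e'(1)] vals.less_imp_le[OF e1(2)]]]])
            (simp add: val_ac)
      qed
      then show ?thesis
        using val_rat_dist_le_iff r by blast
    qed
    then show ?thesis
      using r by (simp add: real_le_iff)
  qed
  have lim: "V x v \<longleftrightarrow> point X x \<and> point nonneg_reals v \<and> (\<forall>k. \<exists>N. \<forall>n u. N \<preceq> n \<and> V x u \<longrightarrow>
      real_less (distance nonneg_reals u v) (real_of (half_pow k)))" for x v
  proof
    assume xv: "V x v"
    have "real_less (distance nonneg_reals u v) (real_of (half_pow k))" if "V x u" for u k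
    proof -
      have "nonneg.dless u v (hp k)"
        using nonneg.same_point_iff[OF v(2)[OF that] v(2)[OF xv]] same[OF that xv] by simp
      then show ?thesis
        using nonneg.dless_iff[OF v(2)[OF that] v(2)[OF xv]] by (simp add: hp_def)
    qed
    then show "point X x \<and> point nonneg_reals v \<and> (\<forall>k. \<exists>N. \<forall>n u. N \<preceq> n \<and> V x u \<longrightarrow>
      real_less (distance nonneg_reals u v) (real_of (half_pow k)))"
      using v[OF xv] by blast
  next
    assume *: "point X x \<and> point nonneg_reals v \<and> (\<forall>k. \<exists>N. \<forall>n u. N \<preceq> n \<and> V x u \<longrightarrow>
      real_less (distance nonneg_reals u v) (real_of (half_pow k)))"
    then obtain u where u: "V x u"
      using \<Phi>(3) unfolding total_def by blast
    have "real_less (distance nonneg_reals u v) (real_of (half_pow k))" for k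
      using * u by blast
    then have k: "nonneg.dless u v (hp k)" for k
      using nonneg.dless_iff[OF v(2)[OF u] conjunct1[OF conjunct2[OF *]]] by (simp add: hp_def)
    have "same_point nonneg_reals u v"
      unfolding nonneg.same_point_iff[OF v(2)[OF u] conjunct1[OF conjunct2[OF *]]]
    proof (intro allI impI)
      fix q assume "\<zero>\<^sub>v \<sqsubset> q"
      then obtain k where "hp k \<sqsubset> q" using ex_hp_less by blast
      then show "nonneg.dless u v q"
        using nonneg.dless_mono[OF k vals.less_imp_le] by blast
    qed
    then show "V x v"
      using u * nonneg.value_at_same_point unfolding \<Phi>(2) continuous_value_def by blast
  qed
  show ?thesis
    unfolding potential_def Let_def
  proof (intro conjI bexI[OF _ W], unfold sect, fold \<Phi>(2))
    show "total X V" "\<forall>n. continuous_code X nonneg_reals \<Phi> \<and> total X V"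
      using \<Phi>(1,3) by blast+
    show "\<forall>n m x u w. n \<preceq> m \<and> V x u \<and> V x w \<longrightarrow> real_le u w"
      using mono by blast
    show "\<forall>x v. V x v \<longleftrightarrow> point X x \<and> point nonneg_reals v \<and> (\<forall>k. \<exists>N. \<forall>n u. N \<preceq> n \<and> V x u \<longrightarrow>
      real_less (distance nonneg_reals u v) (real_of (half_pow k)))"
      using lim by blast
  qed
qed

lemma nonneg_same_point_const:
  assumes q: "q \<in> fst nonneg_reals" and v: "point nonneg_reals v" and same: "same_point nonneg_reals (\<lambda>_. q) v"
  shows "val q \<sqsubseteq> val (v m) \<boxplus> hp m" "val (v m) \<sqsubseteq> val q \<boxplus> hp m"
proof -
  have r: "rat q" "rat (v m)" "v m \<in> fst nonneg_reals"
    using q nonneg.point_code[OF v, of m] by (auto simp: nonneg_code_iff)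
  note cq = nonneg.const_point[OF q] and cv = nonneg.const_point[OF r(3)]
  have "val (rat_dist q (v m)) \<sqsubseteq> hp m"
  proof (rule val_le_epsI)
    fix e assume e: "\<zero>\<^sub>v \<sqsubset> e"
    then have "nonneg.dless v (\<lambda>_. v m) (hp m \<boxplus> e)"
      by (intro nonneg.dless_approx[OF v]) simp
    then have "nonneg.dless (\<lambda>_. q) (\<lambda>_. v m) (hp m \<boxplus> e)"
      using nonneg.dless_same_point[OF v cq cv] nonneg.same_point_sym[OF cq v same] by blast
    then obtain e' where e': "\<zero>\<^sub>v \<sqsubset> e'" "evt (\<lambda>n. val (rat_dist q (v m)) \<boxplus> e' \<sqsubseteq> hp m \<boxplus> e)"
      unfolding nonneg.dless_def nonneg_dval by blast
    then have "val (rat_dist q (v m)) \<boxplus> e' \<sqsubseteq> hp m \<boxplus> e"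
      using evt_happens by blast
    from vals.add_mono[OF this vals.less_imp_le[OF e'(1)]]
    show "val (rat_dist q (v m)) \<sqsubseteq> hp m \<boxplus> e"
      by (rule val_leI) (simp add: val_ac)
  qed
  then show "val q \<sqsubseteq> val (v m) \<boxplus> hp m" "val (v m) \<sqsubseteq> val q \<boxplus> hp m"
    using val_rat_dist_le_iff r by blast+
qed

definition witnessed :: "'m set \<Rightarrow> 'm \<Rightarrow> 'm \<Rightarrow> bool" where
  "witnessed \<Theta> i n \<longleftrightarrow> (\<exists>w. w \<prec> n \<and> \<langle>i, w\<rangle> \<in> \<Theta>)"

lemma Delta1_witnessed [definable]:
  "\<Theta> \<in> Sets \<Longrightarrow> def_fun s \<Longrightarrow> def_fun t \<Longrightarrow> Delta1 (\<lambda>e. witnessed \<Theta> (s e) (t e))"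
  by (rule Delta1_subst2[where P = "witnessed \<Theta>"]) (unfold witnessed_def, intro definable)

lemma witnessed_mono: "witnessed \<Theta> i n \<Longrightarrow> n \<preceq>\<preceq> m \<Longrightarrow> witnessed \<Theta> i m"
  unfolding witnessed_def using nums.less_le_trans by blast

text \<open>\<open>\<tau> \<sigma> n\<close> is the binary fraction \<open>\<Sum>\<^sub>i\<^sub><\<^sub>n \<sigma>(i) 2\<^sup>-\<^sup>i\<close>.\<close>

definition \<tau> :: "'m \<Rightarrow> 'm \<Rightarrow> 'm" where
  "\<tau> \<sigma> n = prim_rec rat_zero (\<lambda>i y. if ent \<sigma> i = \<one> then rat_add y (half_pow i) else y) n"

lemma def_fun_\<tau> [definable]: "def_fun s \<Longrightarrow> def_fun t \<Longrightarrow> def_fun (\<lambda>e. \<tau> (s e) (t e))"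
  by (rule def_fun_subst2[where f = \<tau>]) (unfold \<tau>_def, intro definable)

lemma \<tau>_zero: "\<tau> \<sigma> \<zero> = rat_zero"
  and \<tau>_succ: "\<tau> \<sigma> (n \<oplus> \<one>) = (if ent \<sigma> n = \<one> then rat_add (\<tau> \<sigma> n) (half_pow n) else \<tau> \<sigma> n)"
  unfolding \<tau>_def by (rule prim_rec_zero prim_rec_succ, intro definable)+

lemma rat_\<tau> [simp]: "rat (\<tau> \<sigma> n)"
  by (rule Delta1_induct[where P = "\<lambda>n. rat (\<tau> \<sigma> n)"])
    (intro definable, simp_all add: \<tau>_zero \<tau>_succ)

lemma val_\<tau>_succ: "val (\<tau> \<sigma> (n \<oplus> \<one>)) = val (\<tau> \<sigma> n) \<boxplus> (if ent \<sigma> n = \<one> then hp n else \<zero>\<^sub>v)"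
  by (simp add: \<tau>_succ val_rat_add hp_def)

lemma \<tau>_mono: "n \<preceq>\<preceq> m \<Longrightarrow> val (\<tau> \<sigma> n) \<sqsubseteq> val (\<tau> \<sigma> m)"
proof -
  have "rat_le (\<tau> \<sigma> n) (\<tau> \<sigma> (n \<oplus> k))" for k
  proof (rule Delta1_induct[where P = "\<lambda>k. rat_le (\<tau> \<sigma> n) (\<tau> \<sigma> (n \<oplus> k))"])
    fix k assume "rat_le (\<tau> \<sigma> n) (\<tau> \<sigma> (n \<oplus> k))"
    then have "val (\<tau> \<sigma> n) \<sqsubseteq> val (\<tau> \<sigma> (n \<oplus> k))"
      by (simp add: val_le_iff)
    then have "val (\<tau> \<sigma> n) \<sqsubseteq> val (\<tau> \<sigma> (n \<oplus> k \<oplus> \<one>))"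
      unfolding val_\<tau>_succ by (rule vals.add_increasing2[rotated]) simp
    then show "rat_le (\<tau> \<sigma> n) (\<tau> \<sigma> (n \<oplus> (k \<oplus> \<one>)))"
      by (simp only: val_le_iff rat_\<tau> add_succ)
  qed (intro definable, simp add: rat_le_refl)
  then show "n \<preceq>\<preceq> m \<Longrightarrow> ?thesis"
    by (auto simp: num_le_iff val_le_iff)
qed

lemma \<tau>_nonneg: "\<zero>\<^sub>v \<sqsubseteq> val (\<tau> \<sigma> n)"
  using \<tau>_mono[of \<zero> n \<sigma>] by (simp add: \<tau>_zero)

lemma \<tau>_le: "val (\<tau> \<sigma> n) \<sqsubseteq> hp \<zero> \<boxplus> hp \<zero>"
proof -
  \<comment> \<open>The claim by itself is not inductive. It is strengthened by the tail of the
    geometric series, twice \<open>hp n\<close>.\<close>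
  have "rat_le (rat_add (\<tau> \<sigma> n) (two n)) (two \<zero>)"
  proof (rule Delta1_induct[where P = "\<lambda>n. rat_le (rat_add (\<tau> \<sigma> n) (two n)) (two \<zero>)"])
    show "rat_le (rat_add (\<tau> \<sigma> \<zero>) (two \<zero>)) (two \<zero>)"
      by (simp add: \<tau>_zero val_rat_add flip: val_le_iff)
    fix n assume "rat_le (rat_add (\<tau> \<sigma> n) (two n)) (two \<zero>)"
    then have *: "val (\<tau> \<sigma> n) \<boxplus> (hp n \<boxplus> hp n) \<sqsubseteq> hp \<zero> \<boxplus> hp \<zero>"
      by (simp add: val_rat_add flip: val_le_iff)
    have "(if ent \<sigma> n = \<one> then hp n else \<zero>\<^sub>v) \<sqsubseteq> hp n"
      by simp
    from vals.add_mono[OF * this]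
    have "val (\<tau> \<sigma> (n \<oplus> \<one>)) \<boxplus> hp n \<sqsubseteq> hp \<zero> \<boxplus> hp \<zero>"
      unfolding val_\<tau>_succ by (rule val_leI) (simp add: val_ac)
    then show "rat_le (rat_add (\<tau> \<sigma> (n \<oplus> \<one>)) (two (n \<oplus> \<one>))) (two \<zero>)"
      by (simp add: val_rat_add hp_double flip: val_le_iff)
  qed (intro definable)
  then have *: "val (\<tau> \<sigma> n) \<boxplus> (hp n \<boxplus> hp n) \<sqsubseteq> hp \<zero> \<boxplus> hp \<zero>"
    by (simp add: val_rat_add flip: val_le_iff)
  have "\<zero>\<^sub>v \<sqsubseteq> hp n \<boxplus> hp n"
    by (simp add: vals.add_nonneg_nonneg)
  from vals.add_mono[OF * this] show ?thesis
    by (rule val_leI) (simp add: val_ac)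
qed

lemma \<tau>_strict:
  assumes le: "\<And>i. i \<prec> n \<Longrightarrow> ent \<sigma> i = \<one> \<Longrightarrow> ent \<rho> i = \<one>"
    and d: "d \<prec> n" "ent \<sigma> d \<noteq> \<one>" "ent \<rho> d = \<one>"
  shows "val (\<tau> \<sigma> n) \<boxplus> hp d \<sqsubseteq> val (\<tau> \<rho> n)"
proof -
  \<comment> \<open>The gain \<open>hp d\<close> appears when the induction on \<open>m\<close>
    passes \<open>d\<close>. At all other places the terms of \<open>\<sigma>\<close> are bounded by
    those of \<open>\<rho>\<close>.\<close>
  define g where "g m = (if d \<prec> m then half_pow d else rat_zero)" for m
  have g: "rat (g m)" for m
    by (simp add: g_def)
  have "m \<preceq>\<preceq> n \<longrightarrow> rat_le (rat_add (\<tau> \<sigma> m) (g m)) (\<tau> \<rho> m)" for m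
  proof (rule Delta1_induct[where P = "\<lambda>m. m \<preceq>\<preceq> n \<longrightarrow> rat_le (rat_add (\<tau> \<sigma> m) (g m)) (\<tau> \<rho> m)"])
    show "Delta1 (\<lambda>e. e 0 \<preceq>\<preceq> n \<longrightarrow> rat_le (rat_add (\<tau> \<sigma> (e 0)) (g (e 0))) (\<tau> \<rho> (e 0)))"
      unfolding g_def by (intro definable)
    show "\<zero> \<preceq>\<preceq> n \<longrightarrow> rat_le (rat_add (\<tau> \<sigma> \<zero>) (g \<zero>)) (\<tau> \<rho> \<zero>)"
      by (simp add: \<tau>_zero g_def rat_add_zero rat_le_refl)
    fix m assume IH: "m \<preceq>\<preceq> n \<longrightarrow> rat_le (rat_add (\<tau> \<sigma> m) (g m)) (\<tau> \<rho> m)"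
    show "m \<oplus> \<one> \<preceq>\<preceq> n \<longrightarrow> rat_le (rat_add (\<tau> \<sigma> (m \<oplus> \<one>)) (g (m \<oplus> \<one>))) (\<tau> \<rho> (m \<oplus> \<one>))"
    proof
      assume "m \<oplus> \<one> \<preceq>\<preceq> n"
      then have m: "m \<prec> n" by (simp only: succ_le_iff)
      then have *: "val (\<tau> \<sigma> m) \<boxplus> val (g m) \<sqsubseteq> val (\<tau> \<rho> m)"
        using IH g by (simp add: nums.less_imp_le val_rat_add flip: val_le_iff)
      have "(if ent \<sigma> m = \<one> then hp m else \<zero>\<^sub>v) \<boxplus> val (g (m \<oplus> \<one>)) \<sqsubseteq> (if ent \<rho> m = \<one> then hp m else \<zero>\<^sub>v) \<boxplus> val (g m)"
      proof (cases "m = d")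
        case True
        then show ?thesis
          using d by (simp add: g_def hp_def)
      next
        case False
        then have "g (m \<oplus> \<one>) = g m"
          by (auto simp: g_def less_succ)
        then show ?thesis
          using le[OF m] by simp
      qed
      from vals.add_mono[OF * this]
      have "val (\<tau> \<sigma> (m \<oplus> \<one>)) \<boxplus> val (g (m \<oplus> \<one>)) \<sqsubseteq> val (\<tau> \<rho> (m \<oplus> \<one>))"
        unfolding val_\<tau>_succ by (rule val_leI) (simp add: val_ac)
      then show "rat_le (rat_add (\<tau> \<sigma> (m \<oplus> \<one>)) (g (m \<oplus> \<one>))) (\<tau> \<rho> (m \<oplus> \<one>))"
        using g by (simp only: val_rat_add rat_rat_add rat_\<tau> flip: val_le_iff)
    qed
  qed
  from this[of n] show ?thesis
    using d(1) by (simp add: g_def val_rat_add hp_def flip: val_le_iff)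
qed

end

section \<open>The reversal\<close>

text \<open>Let \<open>\<Theta>\<^sub>0\<close>, \<open>\<Theta>\<^sub>1\<close> be inseparable. Then for each \<open>x \<in> 2\<^sup>\<nat>\<close> an error of \<open>x\<close> as a separating set is
  found at some \<open>stage x\<close>, and \<open>stem x\<close> is the initial segment of this length.\<close>

locale inseparable = rca0 M for M :: "'m l2_structure" +
  fixes \<Theta>0 \<Theta>1 :: "'m set"
  assumes sets: "\<Theta>0 \<in> Sets" "\<Theta>1 \<in> Sets"
    and disjoint: "\<And>i w w'. \<langle>i, w\<rangle> \<in> \<Theta>0 \<Longrightarrow> \<langle>i, w'\<rangle> \<in> \<Theta>1 \<Longrightarrow> False"
    and inseparable: "\<And>Z. Z \<in> Sets \<Longrightarrow> \<exists>i w. \<langle>i, w\<rangle> \<in> \<Theta>1 \<and> i \<notin> Z \<or> \<langle>i, w\<rangle> \<in> \<Theta>0 \<and> i \<in> Z"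
begin

text \<open>Numbers and witnesses below \<open>n\<close> only are inspected, so that
  \<open>err b n\<close> is decided by the first \<open>n\<close> values of \<open>b\<close>. The
  continuity of the counterexample rests on this.\<close>

definition err :: "('m \<Rightarrow> 'm) \<Rightarrow> 'm \<Rightarrow> bool" where
  "err b n \<longleftrightarrow> (\<exists>i. i \<prec> n \<and> (witnessed \<Theta>0 i n \<and> b i = \<one> \<or> witnessed \<Theta>1 i n \<and> b i \<noteq> \<one>))"

text \<open>The sequences on which an error appears exactly at their length. By \<open>stem\<close>
  and \<open>stem_unique\<close>, each point extends exactly one of them: their cylinders partition
  the space.\<close>

definition bar :: "'m \<Rightarrow> bool" where
  "bar \<sigma> \<longleftrightarrow> binary_seq \<sigma> \<and> err (ent \<sigma>) (lh \<sigma>) \<and> (\<forall>n. n \<prec> lh \<sigma> \<longrightarrow> \<not> err (ent \<sigma>) n)"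

definition stage :: "('m \<Rightarrow> 'm) \<Rightarrow> 'm" where "stage x = least (err (bit x))"

definition stem :: "('m \<Rightarrow> 'm) \<Rightarrow> 'm" where "stem x = restr (bit x) (stage x)"

lemma err_cong: "(\<And>i. i \<prec> n \<Longrightarrow> b i = c i) \<Longrightarrow> err b n \<longleftrightarrow> err c n"
  unfolding err_def by (intro ex_cong1) auto

lemma Delta1_bar [definable]: "def_fun t \<Longrightarrow> Delta1 (\<lambda>e. bar (t e))"
proof -
  have "Delta1 (\<lambda>e. bar (e 0))"
    unfolding bar_def err_def by (intro definable sets)
  then show "def_fun t \<Longrightarrow> Delta1 (\<lambda>e. bar (t e))"
    by (rule Delta1_subst2[where P = "\<lambda>x y. bar x"])
qed

text \<open>The places with bit one form a set of the structure, which therefore fails to separate.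
  The error is visible at any stage beyond both the number and its witness.\<close>

lemma ex_err:
  assumes x: "point cantor_space x"
  shows "\<exists>n. err (bit x) n"
proof -
  have "{i. bit x i = \<one>} \<in> Sets"
    by (intro comprehension definable def_fun_fn[OF fn_on_bit[OF x]])
  from inseparable[OF this] obtain i w where
    *: "\<langle>i, w\<rangle> \<in> \<Theta>1 \<and> bit x i \<noteq> \<one> \<or> \<langle>i, w\<rangle> \<in> \<Theta>0 \<and> bit x i = \<one>"
    by blast
  have "i \<prec> i \<oplus> w \<oplus> \<one>" "w \<prec> i \<oplus> w \<oplus> \<one>"
    unfolding less_succ_iff_le using le_add[of i w] le_add[of w i] by (simp_all add: nums.add.commute)
  then have "err (bit x) (i \<oplus> w \<oplus> \<one>)"
    using * unfolding err_def witnessed_def by blast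
  then show ?thesis ..
qed

lemma stage:
  assumes x: "point cantor_space x"
  shows "err (bit x) (stage x)" "n \<prec> stage x \<Longrightarrow> \<not> err (bit x) n"
proof -
  have D: "Delta1 (\<lambda>e. err (bit x) (e 0))"
    unfolding err_def by (intro definable sets def_fun_fn[OF fn_on_bit[OF x]])
  obtain n where n: "err (bit x) n"
    using ex_err[OF x] by blast
  show "err (bit x) (stage x)" "n \<prec> stage x \<Longrightarrow> \<not> err (bit x) n" for n
    unfolding stage_def using leastI[of "err (bit x)", OF D n] not_less_least[of "err (bit x)", OF D n] .
qed

lemma stem:
  assumes x: "point cantor_space x"
  shows "bar (stem x)" "lh (stem x) = stage x" "i \<prec> stage x \<Longrightarrow> ent (stem x) i = bit x i"
proof -
  note r = restr_fn[OF fn_on_bit[OF x], where n = "stage x", folded stem_def]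
  show "lh (stem x) = stage x" "i \<prec> stage x \<Longrightarrow> ent (stem x) i = bit x i"
    using r by auto
  have "binary_seq (stem x)"
    using r bit_binary[OF x] by (simp add: binary_seq_iff)
  moreover have "err (ent (stem x)) n \<longleftrightarrow> err (bit x) n" if "n \<preceq>\<preceq> stage x" for n
    using that r nums.less_le_trans by (intro err_cong) blast
  ultimately show "bar (stem x)"
    unfolding bar_def r(2) using stage[OF x] nums.less_imp_le nums.order_refl by blast
qed

lemma bar_binary: "bar \<sigma> \<Longrightarrow> binary_seq \<sigma>"
  by (simp add: bar_def)

lemma stem_unique:
  assumes x: "point cantor_space x" and b: "bar \<sigma>" and bits: "\<And>i. i \<prec> lh \<sigma> \<Longrightarrow> bit x i = ent \<sigma> i"
  shows "\<sigma> = stem x"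
proof -
  have err: "err (bit x) n \<longleftrightarrow> err (ent \<sigma>) n" if "n \<preceq>\<preceq> lh \<sigma>" for n
    using that bits nums.less_le_trans by (intro err_cong) blast
  have "\<not> lh \<sigma> \<prec> stage x"
    using err[of "lh \<sigma>"] stage(2)[OF x] b unfolding bar_def by blast
  moreover have "\<not> stage x \<prec> lh \<sigma>"
    using err[of "stage x"] stage(1)[OF x] b nums.less_imp_le unfolding bar_def by blast
  ultimately have "lh \<sigma> = stage x"
    using num_less_linear by blast
  then show ?thesis
    using stem[OF x] bits bar_binary b by - (rule seq_eqI, auto simp: binary_seq_def ent_def)
qed

text \<open>A function that is constant on each of the cylinders is continuous whatever its values
  are: the preimage of a ball is the union of the cylinders whose value lies in the ball.\<close>

lemma locally_constant:
  assumes "metric M X" and t: "def_fun (\<lambda>e. t (e 0))" and tX: "\<And>\<sigma>. bar \<sigma> \<Longrightarrow> t \<sigma> \<in> fst X"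
  shows "\<exists>\<Phi>. continuous_code cantor_space X \<Phi> \<and> (\<forall>x y. continuous_value cantor_space X \<Phi> x y \<longleftrightarrow>
    point cantor_space x \<and> point X y \<and> same_point X (\<lambda>_. t (stem x)) y)"
proof -
  interpret metric M X by fact
  \<comment> \<open>That \<open>t \<sigma>\<close> lies in the ball \<open>(a, r)\<close> is only
    \<Sigma>1. The free first component of the triples in an open code takes up the witness, which
    makes the code a set.\<close>
  define \<Phi> where "\<Phi> = {z. p1 (p1 z) \<in> A \<and> pos_rat (p2 (p1 z)) \<and> bar (p1 (p2 (p2 z))) \<and>
    z = \<langle>\<langle>p1 (p1 z), p2 (p1 z)\<rangle>, \<langle>p1 (p2 z), \<langle>p1 (p2 (p2 z)), two (lh (p1 (p2 (p2 z))))\<rangle>\<rangle>\<rangle> \<and>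
    near_at (\<lambda>_. t (p1 (p2 (p2 z)))) (\<lambda>_. p1 (p1 z)) (p2 (p1 z)) (p1 (p2 z))}"
  have \<Phi>: "\<Phi> \<in> Sets"
    unfolding \<Phi>_def by (intro comprehension definable codes_in_Sets def_fun_subst1[OF t])
  have mem: "\<langle>\<langle>a, r\<rangle>, \<langle>k, \<langle>\<sigma>, s\<rangle>\<rangle>\<rangle> \<in> \<Phi> \<longleftrightarrow> a \<in> A \<and> pos_rat r \<and> bar \<sigma> \<and> s = two (lh \<sigma>) \<and>
      near_at (\<lambda>_. t \<sigma>) (\<lambda>_. a) r k" for a r k \<sigma> s
    unfolding \<Phi>_def by auto
  have form: "\<exists>k \<sigma>. bar \<sigma> \<and> z = \<langle>k, \<langle>\<sigma>, two (lh \<sigma>)\<rangle>\<rangle>" if "z \<in> sect \<Phi> \<langle>a, r\<rangle>" for z a r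
    using that unfolding sect_def \<Phi>_def mem_Collect_eq by (metis pair_eq_iff)
  have two_pos: "pos_rat (two k)" for k
    by (simp add: pos_rat_iff vals.add_pos_pos)
  have tp: "point X (\<lambda>_. t (stem x))" if "point cantor_space x" for x
    using const_point tX stem(1)[OF that] by blast
  have P: "open_set cantor_space (sect \<Phi> \<langle>a, r\<rangle>) = {x. point cantor_space x \<and> (\<lambda>_. t (stem x)) \<in> ball X a r}"
    if a: "a \<in> A" and r: "pos_rat r" for a r
  proof (rule set_eqI)
    fix x
    have "x \<in> open_set cantor_space (sect \<Phi> \<langle>a, r\<rangle>) \<longleftrightarrow>
      (\<exists>k \<sigma>. bar \<sigma> \<and> near_at (\<lambda>_. t \<sigma>) (\<lambda>_. a) r k \<and> x \<in> ball cantor_space \<sigma> (two (lh \<sigma>)))"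
      unfolding open_set_def sect_def using a r by (simp add: mem)
    also have "\<dots> \<longleftrightarrow> point cantor_space x \<and> (\<exists>k. near_at (\<lambda>_. t (stem x)) (\<lambda>_. a) r k)"
    proof (cases "point cantor_space x")
      case x: True
      have "bar \<sigma> \<and> x \<in> ball cantor_space \<sigma> (two (lh \<sigma>)) \<longleftrightarrow> \<sigma> = stem x" for \<sigma>
        using cylinder_iff[OF bar_binary x] stem_unique[OF x] stem[OF x] by metis
      then show ?thesis using x by metis
    qed (auto simp: ball_def)
    also have "\<dots> \<longleftrightarrow> point cantor_space x \<and> (\<lambda>_. t (stem x)) \<in> ball X a r"
      using dless_code[OF tp const_point[OF a]] a r tp by (auto simp: ball_iff pos_rat_def)
    finally show "x \<in> open_set cantor_space (sect \<Phi> \<langle>a, r\<rangle>) \<longleftrightarrow>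
      x \<in> {x. point cantor_space x \<and> (\<lambda>_. t (stem x)) \<in> ball X a r}" by simp
  qed
  note V = value_at_ball_preimages[where Z = cantor_space and F = "\<lambda>x _. t (stem x)" and
      P = "\<lambda>a r. open_set cantor_space (sect \<Phi> \<langle>a, r\<rangle>)", OF tp P]
  have "continuous_code cantor_space X \<Phi>"
    unfolding continuous_code_def open_code_def using \<Phi> V(1) form two_pos bar_binary
    by (metis cantor_code_iff)
  then show ?thesis
    using V(2) unfolding continuous_value_def by blast
qed

text \<open>\<open>\<sigma>\<close> is justified if all its elements are known to be in the projection of \<open>\<Theta>\<^sub>1\<close>. For justified \<open>\<sigma>\<close>
  the errors are corrected by adding elements, which increases \<open>\<tau>\<close>; otherwise start from the empty set.\<close>

definition justified :: "'m \<Rightarrow> bool" where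
  "justified \<sigma> \<longleftrightarrow> (\<forall>i. i \<prec> lh \<sigma> \<longrightarrow> ent \<sigma> i = \<one> \<longrightarrow> witnessed \<Theta>1 i (lh \<sigma>))"

definition target :: "'m \<Rightarrow> 'm" where
  "target \<sigma> = (if justified \<sigma> then restr (\<lambda>i. num_of_bool (witnessed \<Theta>1 i (lh \<sigma>))) (lh \<sigma>) else nil)"

text \<open>Two bounds all fractions \<open>\<tau>\<close> and so keeps the potential nonnegative.
  The other value, three, exceeds all potentials of justified sequences by at least one, and no two
  points are farther apart than one.\<close>

definition pot :: "'m \<Rightarrow> 'm" where
  "pot \<sigma> = (if justified \<sigma> then rat_add (two \<zero>) (rat_minus (\<tau> \<sigma> (lh \<sigma>))) else rat_add (two \<zero>) (half_pow \<zero>))"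

lemma Delta1_justified [definable]: "def_fun t \<Longrightarrow> Delta1 (\<lambda>e. justified (t e))"
proof -
  have "Delta1 (\<lambda>e. justified (e 0))"
    unfolding justified_def by (intro definable sets)
  then show "def_fun t \<Longrightarrow> Delta1 (\<lambda>e. justified (t e))"
    by (rule Delta1_subst2[where P = "\<lambda>x y. justified x"])
qed

lemma def_fun_target: "def_fun (\<lambda>e. target (e 0))"
  unfolding target_def by (intro definable sets)

lemma def_fun_pot: "def_fun (\<lambda>e. pot (e 0))"
  unfolding pot_def by (intro definable sets)

lemma target_correction:
  assumes "justified \<sigma>"
  shows "fin_seq (target \<sigma>)" "lh (target \<sigma>) = lh \<sigma>"
    "i \<prec> lh \<sigma> \<Longrightarrow> ent (target \<sigma>) i = num_of_bool (witnessed \<Theta>1 i (lh \<sigma>))"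
proof -
  have "fn_on UNIV (\<lambda>i. num_of_bool (witnessed \<Theta>1 i (lh \<sigma>)))"
    by (intro def_fun_fn_on definable sets)
  note r = restr_fn[OF this, where n = "lh \<sigma>"]
  show "fin_seq (target \<sigma>)" "lh (target \<sigma>) = lh \<sigma>"
    "i \<prec> lh \<sigma> \<Longrightarrow> ent (target \<sigma>) i = num_of_bool (witnessed \<Theta>1 i (lh \<sigma>))"
    using assms r by (simp_all add: target_def)
qed

lemma target_binary: "binary_seq (target \<sigma>)"
proof (cases "justified \<sigma>")
  case True
  then show ?thesis
    using target_correction[OF True] by (simp add: binary_seq_iff num_of_bool_def)
qed (simp add: target_def)

lemma rat_pot [simp]: "rat (pot \<sigma>)"
  by (simp add: pot_def)

lemma val_pot: "justified \<sigma> \<Longrightarrow> val (pot \<sigma>) \<boxplus> val (\<tau> \<sigma> (lh \<sigma>)) = hp \<zero> \<boxplus> hp \<zero>"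
  by (simp only: pot_def if_True val_rat_add val_rat_minus rat_rat_minus rat_\<tau> rat_two val_two
      vals.add.assoc vals.left_minus vals.add_0_right)

lemma pot_nonneg: "pot \<sigma> \<in> fst nonneg_reals"
proof (cases "justified \<sigma>")
  case True
  from \<tau>_le[of \<sigma> "lh \<sigma>"] have "\<zero>\<^sub>v \<sqsubseteq> val (pot \<sigma>)"
    by (rule val_leI) (simp add: val_pot[OF True, symmetric] val_ac)
  then show ?thesis
    by (simp add: nonneg_code_iff)
next
  case False
  then show ?thesis
    by (simp add: nonneg_code_iff pot_def val_rat_add vals.add_nonneg_nonneg hp_def[symmetric])
qed

lemma potential_decreases:
  assumes x: "point cantor_space x" and y: "point cantor_space y"
    and xy: "\<And>i. bit y i = pd (target (stem x)) i"
  shows "\<exists>d. (\<forall>i. i \<prec> d \<longrightarrow> bit x i = bit y i) \<and> bit x d \<noteq> bit y d \<and>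
    val (pot (stem y)) \<boxplus> hp d \<sqsubseteq> val (pot (stem x))"
proof -
  define n where "n = stage x"
  note sx = stem[OF x, folded n_def] and sy = stem[OF y]
  have first: "\<exists>d. (\<forall>i. i \<prec> d \<longrightarrow> bit x i = bit y i) \<and> bit x d \<noteq> bit y d" if "bit x i \<noteq> bit y i" for i
  proof -
    have "Delta1 (\<lambda>e. bit x (e 0) \<noteq> bit y (e 0))"
      by (intro definable def_fun_fn[OF fn_on_bit[OF x]] def_fun_fn[OF fn_on_bit[OF y]])
    from ex_least[of "\<lambda>i. bit x i \<noteq> bit y i", OF this that] show ?thesis by blast
  qed
  show ?thesis
  proof (cases "justified (stem x)")
    case False
    then obtain i where "i \<prec> n" "ent (stem x) i = \<one>"
      unfolding justified_def sx(2) by blast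
    then have "bit x i = \<one>" using sx(3) by simp
    have y0: "bit y j = \<zero>" for j
      using False by (simp add: xy target_def pd_def lh_nil)
    then have "bit x i \<noteq> bit y i"
      using \<open>bit x i = \<one>\<close> zero_neq_one by simp
    from first[OF this] obtain d where d: "\<forall>i. i \<prec> d \<longrightarrow> bit x i = bit y i" "bit x d \<noteq> bit y d"
      by blast
    \<comment> \<open>The image has only zeros and is justified vacuously. Its potential is at most
      two, and the drop by one suffices for any \<open>d\<close>.\<close>
    have "justified (stem y)"
      unfolding justified_def sy(2) using sy(3) y0 zero_neq_one by simp
    note py = val_pot[OF this]
    have px: "val (pot (stem x)) = hp \<zero> \<boxplus> hp \<zero> \<boxplus> hp \<zero>"
      using False by (simp add: pot_def val_rat_add hp_def[symmetric])
    have "val (pot (stem y)) \<boxplus> hp d \<sqsubseteq> val (pot (stem x))"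
      by (rule val_leI[OF vals.add_mono[OF \<tau>_nonneg[of "stem y" "lh (stem y)"] hp_antimono[of \<zero> d]]])
        (simp_all add: px py[symmetric] val_ac)
    with d show ?thesis by blast
  next
    case True
    note t = target_correction[OF True, unfolded sx(2)]
    have disj: "\<not> (witnessed \<Theta>0 i k \<and> witnessed \<Theta>1 i m)" for i k m
      unfolding witnessed_def using disjoint by blast
    have x1: "witnessed \<Theta>1 i n" if "i \<prec> n" "bit x i = \<one>" for i
      using True that sx unfolding justified_def by simp
    have y1: "bit y i = \<one> \<longleftrightarrow> i \<prec> n \<and> witnessed \<Theta>1 i n" for i
      using t zero_neq_one by (simp add: xy pd_def num_of_bool_def)
    \<comment> \<open>All elements of \<open>x\<close> below \<open>n\<close> are confirmed by
      \<open>\<Theta>1\<close>, so by disjointness the error cannot come from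
      \<open>\<Theta>0\<close>: an element is missing.\<close>
    from stage(1)[OF x, folded n_def] obtain i where i: "i \<prec> n" "witnessed \<Theta>1 i n" "bit x i \<noteq> \<one>"
      unfolding err_def using x1 disj by blast
    then have "bit x i \<noteq> bit y i"
      using y1 by metis
    from first[OF this] obtain d where d: "\<forall>i. i \<prec> d \<longrightarrow> bit x i = bit y i" "bit x d \<noteq> bit y d"
      by blast
    have "\<not> i \<prec> d"
      using d(1) \<open>bit x i \<noteq> bit y i\<close> by blast
    then have dn: "d \<prec> n"
      using i(1) nums.not_less nums.le_less_trans by blast
    \<comment> \<open>The first change adds an element: whatever \<open>x\<close> contains below
      \<open>n\<close> is confirmed and therefore also belongs to \<open>y\<close>.\<close>
    have xd: "bit x d \<noteq> \<one>" and yd: "bit y d = \<one>"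
      using d(2) x1[OF dn] y1[of d] dn bit_binary[OF x, of d] bit_binary[OF y, of d] by metis+
    \<comment> \<open>Below \<open>n\<close>, the corrected set contains exactly what
      \<open>\<Theta>1\<close> has confirmed, and by disjointness nothing that
      \<open>\<Theta>0\<close> ever rejects. Its first error thus appears later, and the longer stem
      can only enlarge the fraction.\<close>
    have "\<not> stage y \<preceq>\<preceq> n"
    proof
      assume le: "stage y \<preceq>\<preceq> n"
      from stage(1)[OF y] obtain j where j: "j \<prec> stage y"
        "witnessed \<Theta>0 j (stage y) \<and> bit y j = \<one> \<or> witnessed \<Theta>1 j (stage y) \<and> bit y j \<noteq> \<one>"
        unfolding err_def by blast
      have "j \<prec> n" by (rule nums.less_le_trans[OF j(1) le])
      then show False
        using j(2) y1 disj witnessed_mono[OF _ le] by blast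
    qed
    then have less: "n \<prec> stage y" by (simp add: nums.not_le)
    then have le: "n \<preceq>\<preceq> stage y" by (rule nums.less_imp_le)
    have "justified (stem y)"
      unfolding justified_def sy(2) using sy(3) y1 witnessed_mono[OF _ le] by metis
    note py = val_pot[OF this, unfolded sy(2)] and px = val_pot[OF True, unfolded sx(2)]
    have e: "ent (stem x) i = bit x i" "ent (stem y) i = bit y i" if "i \<prec> n" for i
      using sx(3) sy(3) that nums.less_trans[OF that less] by auto
    have "val (\<tau> (stem x) n) \<boxplus> hp d \<sqsubseteq> val (\<tau> (stem y) n)"
    proof (rule \<tau>_strict[OF _ dn])
      show "ent (stem x) d \<noteq> \<one>" "ent (stem y) d = \<one>"
        using e[OF dn] xd yd by simp_all
      show "ent (stem y) i = \<one>" if "i \<prec> n" "ent (stem x) i = \<one>" for i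
        using e[OF that(1)] that x1 y1 by simp
    qed
    from vals.order_trans[OF this \<tau>_mono[OF le]]
    have *: "val (\<tau> (stem x) n) \<boxplus> hp d \<sqsubseteq> val (\<tau> (stem y) (stage y))" .
    have "val (pot (stem y)) \<boxplus> hp d \<boxplus> val (\<tau> (stem y) (stage y)) =
      (val (pot (stem y)) \<boxplus> val (\<tau> (stem y) (stage y))) \<boxplus> hp d"
      by (simp add: val_ac)
    also have "\<dots> = val (pot (stem x)) \<boxplus> (val (\<tau> (stem x) n) \<boxplus> hp d)"
      unfolding py px[symmetric] by (simp add: val_ac)
    finally have "val (pot (stem y)) \<boxplus> hp d \<sqsubseteq> val (pot (stem x))"
      by (rule val_leI[OF *])
    with d show ?thesis by blast
  qed
qed

lemma counterexample:
  "\<exists>f V. continuous_function cantor_space cantor_space f \<and> continuous_function cantor_space nonneg_reals V \<and>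
    caristi_system cantor_space f V \<and> (\<nexists>x. f x x)"
proof -
  have t: "target \<sigma> \<in> fst cantor_space" for \<sigma>
    by (simp add: target_binary)
  note ft = cantor.const_point[OF t] and pt = nonneg.const_point[OF pot_nonneg]
  obtain \<Phi> where \<Phi>: "continuous_code cantor_space cantor_space \<Phi>"
    and f: "\<And>x y. continuous_value cantor_space cantor_space \<Phi> x y \<longleftrightarrow> point cantor_space x \<and> point cantor_space y \<and>
      same_point cantor_space (\<lambda>_. target (stem x)) y"
    using locally_constant[OF cantor.metric_axioms def_fun_target t] by blast
  obtain \<Psi> where \<Psi>: "continuous_code cantor_space nonneg_reals \<Psi>"
    and V: "\<And>x v. continuous_value cantor_space nonneg_reals \<Psi> x v \<longleftrightarrow> point cantor_space x \<and> point nonneg_reals v \<and>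
      same_point nonneg_reals (\<lambda>_. pot (stem x)) v"
    using locally_constant[OF nonneg.metric_axioms def_fun_pot pot_nonneg] by blast
  define f V where "f = continuous_value cantor_space cantor_space \<Phi>" and "V = continuous_value cantor_space nonneg_reals \<Psi>"
  have cf: "continuous_function cantor_space cantor_space f"
    unfolding continuous_function_def total_def using \<Phi> f ft cantor.same_point_refl f_def by metis
  have cV: "continuous_function cantor_space nonneg_reals V"
    unfolding continuous_function_def total_def using \<Psi> V pt nonneg.same_point_refl V_def by metis
  have bits: "bit y i = pd (target (stem x)) i" if "f x y" for x y i
    using that cantor_same_point_bit[OF ft] bit_const unfolding f_def f by metis
  have step: "\<exists>d. (\<forall>i. i \<prec> d \<longrightarrow> bit x i = bit y i) \<and> bit x d \<noteq> bit y d \<and>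
    val (pot (stem y)) \<boxplus> hp d \<sqsubseteq> val (pot (stem x))" if "f x y" for x y
  proof (rule potential_decreases)
    show "point cantor_space x" "point cantor_space y"
      using that unfolding f_def f by blast+
  qed (rule bits[OF that])
  have "real_le (distance cantor_space x y) (real_minus v w)" if "f x y" "V x v" "V y w" for x y v w
  proof -
    have x: "point cantor_space x" and y: "point cantor_space y"
      using that(1) unfolding f_def f by blast+
    have v: "point nonneg_reals v" "same_point nonneg_reals (\<lambda>_. pot (stem x)) v"
      and w: "point nonneg_reals w" "same_point nonneg_reals (\<lambda>_. pot (stem y)) w"
      using that(2,3) unfolding V_def V by blast+
    have r: "rat (v k)" "rat (w k)" for k
      using nonneg.point_code[OF v(1), of k] nonneg.point_code[OF w(1), of k] by (auto simp: nonneg_code_iff)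
    from step[OF that(1)] obtain d where d: "\<forall>i. i \<prec> d \<longrightarrow> bit x i = bit y i"
      "val (pot (stem y)) \<boxplus> hp d \<sqsubseteq> val (pot (stem x))"
      by blast
    have dist: "distance cantor_space x y k = cdist (x (k \<oplus> \<one> \<oplus> \<one>)) (y (k \<oplus> \<one> \<oplus> \<one>))" for k
      by (simp add: cantor.distance_eq snd_cantor_space cantor_point_binary[OF x] cantor_point_binary[OF y] real_of_def)
    have le: "val (cdist (x (k \<oplus> \<one> \<oplus> \<one>)) (y (k \<oplus> \<one> \<oplus> \<one>))) \<boxplus> val (w (k \<oplus> \<one>)) \<sqsubseteq> val (v (k \<oplus> \<one>)) \<boxplus> (hp k \<boxplus> hp k)" for k
    proof -
      \<comment> \<open>Comparison of reals at index \<open>k\<close> tolerates twice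
        \<open>hp k\<close>. Half of this is spent on the approximation of the distance, the rest on
        replacing the two constant potentials by \<open>v\<close> and \<open>w\<close>.\<close>
      have "val (cdist (x (k \<oplus> \<one> \<oplus> \<one>)) (y (k \<oplus> \<one> \<oplus> \<one>))) \<sqsubseteq> hp d \<boxplus> hp k"
      proof -
        have "hp (k \<oplus> \<one> \<oplus> \<one>) \<sqsubseteq> hp k"
          using vals.order_trans[OF hp_succ_le hp_succ_le] .
        then have "hp d \<sqsubseteq> hp d \<boxplus> hp k" "hp (k \<oplus> \<one> \<oplus> \<one>) \<sqsubseteq> hp d \<boxplus> hp k"
          by (simp_all add: vals.add_increasing)
        then show ?thesis
          using cdist_points_le[OF x y, of d "k \<oplus> \<one> \<oplus> \<one>"] d(1) vals.order_trans by blast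
      qed
      note 1 = vals.add_mono[OF this d(2)]
      note 2 = vals.add_mono[OF nonneg_same_point_const(1)[OF pot_nonneg v, of "k \<oplus> \<one>"]
          nonneg_same_point_const(2)[OF pot_nonneg w, of "k \<oplus> \<one>"]]
      show ?thesis
        by (rule val_leI[OF vals.add_mono[OF 1 2]]) (simp add: val_ac hp_double[of k, symmetric])
    qed
    have "val (cdist (x (k \<oplus> \<one> \<oplus> \<one>)) (y (k \<oplus> \<one> \<oplus> \<one>))) \<sqsubseteq>
      val (rat_add (v (k \<oplus> \<one>)) (rat_minus (w (k \<oplus> \<one>)))) \<boxplus> (hp k \<boxplus> hp k)" for k
    proof -
      have eq: "val (rat_add (v (k \<oplus> \<one>)) (rat_minus (w (k \<oplus> \<one>)))) \<boxplus> val (w (k \<oplus> \<one>)) = val (v (k \<oplus> \<one>))"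
        by (simp only: val_rat_add val_rat_minus rat_rat_minus r vals.add.assoc vals.left_minus vals.add_0_right)
      show ?thesis
        by (rule val_leI[OF le[of k, folded eq]]) (simp only: val_ac)
    qed
    then show ?thesis
      by (subst real_le_iff) (simp_all add: dist real_minus_def r)
  qed
  then have "caristi_system cantor_space f V"
    unfolding caristi_system_def
    using metric_code_cantor_space cantor.continuous_imp_baire[OF cf] continuous_imp_potential[OF cantor.metric_axioms cV] by blast
  moreover have "\<not> f x x" for x
    using step by blast
  ultimately show ?thesis
    using cf cV by blast
qed

end

section \<open>The equivalence\<close>

context rca0
begin

lemma CFP_cantor_imp_WKL:
  assumes CFP_continuous_f_V_cantor
  shows WKL
proof (rule separation_imp_WKL, rule ccontr)
  assume "\<not> separation"
  then obtain \<Theta>0 \<Theta>1 where "\<Theta>0 \<in> Sets" "\<Theta>1 \<in> Sets" "\<forall>i w w'. \<not> (\<langle>i, w\<rangle> \<in> \<Theta>0 \<and> \<langle>i, w'\<rangle> \<in> \<Theta>1)"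
    "\<not> (\<exists>Z\<in>Sets. \<forall>i w. (\<langle>i, w\<rangle> \<in> \<Theta>1 \<longrightarrow> i \<in> Z) \<and> (\<langle>i, w\<rangle> \<in> \<Theta>0 \<longrightarrow> i \<notin> Z))"
    unfolding separation_def by auto
  then interpret inseparable M \<Theta>0 \<Theta>1
    by unfold_locales blast+
  show False
    using counterexample assms unfolding CFP_continuous_f_V_cantor_def CFP_def by metis
qed

end

theorem theorem5p9:
  fixes M :: "'m l2_structure"
  assumes "l2.RCA0 M"
  shows "(l2.WKL0 M \<longleftrightarrow> l2.CFP_continuous_V_compact M) \<and>
         (l2.CFP_continuous_V_compact M \<longleftrightarrow> l2.CFP_continuous_f_V_cantor M)"
proof -
  interpret rca0 M
    by unfold_locales (rule assms)
  have "WKL0 \<longleftrightarrow> WKL"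
    using RCA0 by (simp add: WKL0_def)
  moreover have "CFP_continuous_V_compact" if WKL
    unfolding CFP_continuous_V_compact_def CFP_def
  proof (intro allI impI, elim conjE)
    fix X f V
    assume sys: "caristi_system X f V" and "compact_space X" "continuous_function X nonneg_reals V"
    interpret metric M X
      using sys by unfold_locales (simp add: caristi_system_def)
    show "\<exists>x. f x x"
      using caristi_fixed_point WKL_imp_separation that \<open>compact_space X\<close>
        \<open>continuous_function X nonneg_reals V\<close> sys by blast
  qed
  moreover have "CFP_continuous_f_V_cantor" if "CFP_continuous_V_compact"
    using that compact_cantor_space
    unfolding CFP_continuous_V_compact_def CFP_continuous_f_V_cantor_def CFP_def by blast
  ultimately show ?thesis
    using CFP_cantor_imp_WKL by blast
qed

end
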